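(* Let $H\in(\tfrac12,1)$ and $\theta>0$, and let $X$ be the fractional Ornstein–Uhlenbeck process of the second kind with $X_0=0$, i.e. $X_t=e^{-\theta t}\int_0^t e^{(\theta-1)s}\,\mathrm{d}B_{a_s}$, $t\ge 0$. Suppose $X$ is observed at the discrete times $t_k=k\Delta_N$, $k=0,1,\dots,N$, and let $T_N=N\Delta_N$. Assume that, as $N\to\infty$, $\Delta_N\to0$, $T_N\to\infty$ and $N\Delta_N^2\to0$. Put $$\widehat{\mu}_{2,N}=\frac1{T_N}\sum_{k=1}^N X_{t_k}^2\,\Delta t_k,\qquad \widehat{\theta}_N:=\Psi^{-1}\big(\widehat{\mu}_{2,N}\big),$$ where $\Delta t_k=t_k-t_{k-1}=\Delta_N$ and $\Psi^{-1}$ is the inverse of the function $\Psi:(0,\infty)\to(0,\infty)$, $$\Psi(\theta)=\frac{(2H-1)H^{2H}}{\theta}\,B\big((\theta-1)H+1,\,2H-1\big).$$ Then $\widehat\theta_N\to\theta$ almost surely as $N\to\infty$. Moreover, as $N\to\infty$, $$\sqrt{T_N}\,(\widehat\theta_N-\theta)\longrightarrow\mathcal N(0,\sigma_\theta^2)\quad\text{in distribution},\qquad \sigma_\theta^2=\frac{\sigma^2}{[\Psi'(\theta)]^2},$$ where, with $\alpha_H=H(2H-1)$, $$\sigma^2=\frac{2\alpha_H^2H^{4H-4}}{\theta^2}\int_{[0,\infty)^3}e^{-\theta x-\theta|y-z|}\,e^{(1-\frac1H)(x+y+z)}\big(1-e^{-\frac yH}\big)^{2H-2}\big|e^{-\frac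 xH}-e^{-\frac zH}\big|^{2H-2}\,\mathrm{d}z\,\mathrm{d}x\,\mathrm{d}y.$$
   Context: $B=\{B_t\}_{t\ge0}$ is a fractional Brownian motion with Hurst parameter $H$, i.e. a continuous centered Gaussian process with covariance $\tfrac12(s^{2H}+t^{2H}-|t-s|^{2H})$. $a_t=He^{t/H}$. The stochastic integral defining $X$ is a pathwise Riemann–Stieltjes integral (equivalently a Wiener integral). In $\Psi$, $B(x,y)$ denotes the complete Beta function. The function $\Psi$ is a bijection of $(0,\infty)$ onto itself, so $\Psi^{-1}$ is well defined. $\mathcal N(0,s^2)$ is the centered Gaussian law with variance $s^2$. *)

theory Defs
  imports "HOL-Probability.Probability"
begin

(* A Gaussian variable may be degenerate, i.e. almost surely constant; this is needed for
   a Gaussian process that vanishes at time 0. *)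
definition gaussian_rv :: "'a measure \<Rightarrow> ('a \<Rightarrow> real) \<Rightarrow> bool" where
  "gaussian_rv M Y \<longleftrightarrow> Y \<in> borel_measurable M \<and>
     ((\<exists>m s. s > 0 \<and> distributed M lborel Y (normal_density m s)) \<or>
      (\<exists>m. AE \<omega> in M. Y \<omega> = m))"

definition gaussian_process :: "'a measure \<Rightarrow> real set \<Rightarrow> (real \<Rightarrow> 'a \<Rightarrow> real) \<Rightarrow> bool" where
  "gaussian_process M I Y \<longleftrightarrow>
     (\<forall>J c. finite J \<and> J \<subseteq> I \<longrightarrow> gaussian_rv M (\<lambda>\<omega>. \<Sum>t\<in>J. c t * Y t \<omega>))"

definition fractional_brownian_motion ::
    "'a measure \<Rightarrow> real \<Rightarrow> (real \<Rightarrow> 'a \<Rightarrow> real) \<Rightarrow> bool" where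
  "fractional_brownian_motion M H B \<longleftrightarrow>
     prob_space M \<and> 0 < H \<and> H < 1 \<and>
     gaussian_process M {0..} B \<and>
     (\<forall>t\<ge>0. prob_space.expectation M (B t) = 0) \<and>
     (\<forall>s\<ge>0. \<forall>t\<ge>0. prob_space.expectation M (\<lambda>\<omega>. B s \<omega> * B t \<omega>) =
        (s powr (2 * H) + t powr (2 * H) - \<bar>t - s\<bar> powr (2 * H)) / 2) \<and>
     (\<forall>\<omega>\<in>space M. continuous_on {0..} (\<lambda>t. B t \<omega>))"

(* Riemann-Stieltjes integral of f against g over [a,b], as the limit of the tagged sums when
   the mesh tends to 0 (a constant gauge, unlike the Henstock-Kurzweil integral). *)
definition has_rs_integral ::
    "(real \<Rightarrow> real) \<Rightarrow> (real \<Rightarrow> real) \<Rightarrow> real \<Rightarrow> real \<Rightarrow> real \<Rightarrow> bool" where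
  "has_rs_integral f g a b I \<longleftrightarrow>
     (\<forall>e>0. \<exists>d>0. \<forall>p. p tagged_division_of {a..b} \<and> (\<lambda>x. ball x d) fine p \<longrightarrow>
        \<bar>(\<Sum>(x, K)\<in>p. f x * (g (Sup K) - g (Inf K))) - I\<bar> < e)"

definition rs_integral :: "(real \<Rightarrow> real) \<Rightarrow> (real \<Rightarrow> real) \<Rightarrow> real \<Rightarrow> real \<Rightarrow> real" where
  "rs_integral f g a b = (THE I. has_rs_integral f g a b I)"

definition fou_time :: "real \<Rightarrow> real \<Rightarrow> real" where
  "fou_time H t = H * exp (t / H)"

definition fou2 :: "real \<Rightarrow> real \<Rightarrow> (real \<Rightarrow> 'a \<Rightarrow> real) \<Rightarrow> real \<Rightarrow> 'a \<Rightarrow> real" where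
  "fou2 H \<theta> B t \<omega> =
     exp (- \<theta> * t) *
     rs_integral (\<lambda>s. exp ((\<theta> - 1) * s)) (\<lambda>s. B (fou_time H s) \<omega>) 0 t"

definition mu2_hat :: "(real \<Rightarrow> 'a \<Rightarrow> real) \<Rightarrow> (nat \<Rightarrow> real) \<Rightarrow> nat \<Rightarrow> 'a \<Rightarrow> real" where
  "mu2_hat X \<Delta> N \<omega> =
     1 / (real N * \<Delta> N) * (\<Sum>k = 1..N. (X (real k * \<Delta> N) \<omega>)\<^sup>2 * \<Delta> N)"

definition Psi :: "real \<Rightarrow> real \<Rightarrow> real" where
  "Psi H \<theta> =
     (2 * H - 1) * H powr (2 * H) / \<theta> * Beta ((\<theta> - 1) * H + 1) (2 * H - 1)"

(* The inverse is the one of Psi H on the open half-line; the value at a point outside the range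
   (only 0 matters, which the empirical moment can hit) is arbitrary. *)
definition theta_hat ::
    "real \<Rightarrow> (real \<Rightarrow> 'a \<Rightarrow> real) \<Rightarrow> (nat \<Rightarrow> real) \<Rightarrow> nat \<Rightarrow> 'a \<Rightarrow> real" where
  "theta_hat H X \<Delta> N \<omega> = inv_into {0<..} (Psi H) (mu2_hat X \<Delta> N \<omega>)"

definition alpha_H :: "real \<Rightarrow> real" where
  "alpha_H H = H * (2 * H - 1)"

definition sigma_sq :: "real \<Rightarrow> real \<Rightarrow> real" where
  "sigma_sq H \<theta> =
     2 * (alpha_H H)\<^sup>2 * H powr (4 * H - 4) / \<theta>\<^sup>2 *
     (LINT w:({0..} \<times> {0..} \<times> {0..})|lborel.
        (case w of (x, y, z) \<Rightarrow>
           exp (- \<theta> * x - \<theta> * \<bar>y - z\<bar>) * exp ((1 - 1 / H) * (x + y + z)) *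
           (1 - exp (- y / H)) powr (2 * H - 2) *
           \<bar>exp (- x / H) - exp (- z / H)\<bar> powr (2 * H - 2)))"

definition sigma_theta_sq :: "real \<Rightarrow> real \<Rightarrow> real" where
  "sigma_theta_sq H \<theta> = sigma_sq H \<theta> / (deriv (Psi H) \<theta>)\<^sup>2"

end

theory Submission
  imports Defs
begin

text \<open>
The process $X$ is the solution of a linear equation driven by a stationary-increment Gaussian
process whose covariance has the integrable density $c\,k(s-t)$, so $R(s,t) = E X_s X_t$ is dominated
by a stationary covariance $r(s-t)$ that decays exponentially, and the defect is
$O(e^{-\theta s}+e^{-\theta t})$. Moreover $r(0) = \Psi(\theta)$ is a Beta integral.

Gaussian integration by parts gives, for a quadratic functional $W = s\sum_k (X_{t_k}^2 - E X_{t_k}^2)$,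
a recursion for $E W^n$ whose coefficients are the traces of the powers of the covariance matrix. The
row sums of that matrix are $O(1/\Delta_N)$, hence with $s = \Delta_N/\sqrt{T_N}$ only the second
trace survives; it tends to $2\int r^2$, which a symmetry of the four-point integrand identifies with
$\sigma^2$. So the moments converge to those of a normal law, which determine it.

For the almost sure part, moments of order 32 of dyadic increments give a Hoelder bound whose constant
grows like a small power of time. It transfers the law of large numbers from a fixed sparse sequence
of grids to any grid with $N\Delta_N^2 \to 0$. Finally $\Psi$ is decreasing, so events about
$\widehat\theta_N$ are events about $\widehat\mu_{2,N}$, and the delta method reduces to the
convergence of distribution functions at moving points.
\<close>

section \<open>Gaussian integration by parts\<close>

text \<open>Almost sure convergence therefore goes through the time average of the squared path over
  [0, T], a function of real T. Along integers m it is compared with the grid of mesh 1/m, on which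
  fourth moments are summable; elsewhere the path bounds take over. They lose a growth factor
  T^(1/8) and gain Delta^(3/16); since N * Delta^2 < 1 says Delta < 1/T, what counts is 1/8 < 3/16.
  Variances of increments are bounded only linearly in the time step, and the bound must hold over
  all cells of all dyadic levels at once; a moment order as high as 32 leaves enough room for that.

  The stationary process itself is never built: its covariance \<open>stat_cov\<close> is only a
  function that dominates \<open>R\<close>. Nor is any expansion into multiple integrals used: for
  quadratic functionals, Gaussianity enters through the moments of linear combinations
  alone.\<close>

definition normal_moment :: "nat \<Rightarrow> real" where
  "normal_moment n = (if even n then fact n / (2 ^ (n div 2) * fact (n div 2)) else 0)"

lemma normal_moment_0 [simp]: "normal_moment 0 = 1"
  and normal_moment_1 [simp]: "normal_moment (Suc 0) = 0"
  by (simp_all add: normal_moment_def)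

lemma normal_moment_Suc_Suc: "normal_moment (Suc (Suc n)) = real (Suc n) * normal_moment n"
proof (cases "even n")
  case True
  then obtain k where n: "n = 2 * k" by (auto elim: evenE)
  have "real (2 * Suc k) * real (Suc (2 * k)) * fact (2 * k) = fact (2 * Suc k)"
    by (simp add: algebra_simps)
  then have "fact (2 * Suc k) / (2 ^ Suc k * fact (Suc k)) =
      (2 * real (Suc k)) * (real (Suc (2 * k)) * fact (2 * k)) / ((2 * real (Suc k)) * (2 ^ k * fact k))"
    by (simp only: power_Suc fact_Suc[of k] of_nat_mult) (simp only: mult_ac of_nat_numeral)
  also have "\<dots> = (real (Suc (2 * k)) * fact (2 * k)) / (2 ^ k * fact k)"
    by (rule mult_divide_mult_cancel_left) simp
  finally show ?thesis
    using n by (simp add: normal_moment_def)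
qed (simp add: normal_moment_def)

lemma has_real_derivative_poly_0:
  fixes c :: "nat \<Rightarrow> real"
  assumes "1 \<le> n"
  shows "((\<lambda>t. \<Sum>i\<le>n. c i * t ^ i) has_real_derivative c 1) (at 0)"
proof -
  have *: "((\<lambda>t. c i * t ^ i) has_real_derivative (if i = 1 then c 1 else 0)) (at 0)" for i
    by (rule derivative_eq_intros refl | simp)+ (cases i; simp add: power_0_left)
  have "((\<lambda>t. \<Sum>i\<le>n. c i * t ^ i) has_real_derivative (\<Sum>i\<le>n. if i = 1 then c 1 else 0)) (at 0)"
    by (intro DERIV_sum *)
  then show ?thesis using assms by simp
qed

context prob_space
begin

text \<open>These functions form an algebra, so integrability of any polynomial expression in
  Gaussian variables reduces to the closure rules below.\<close>

definition all_moments :: "('a \<Rightarrow> real) \<Rightarrow> bool" where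
  "all_moments f \<longleftrightarrow> f \<in> borel_measurable M \<and> (\<forall>n. integrable M (\<lambda>\<omega>. \<bar>f \<omega>\<bar> ^ n))"

lemma all_moments_measurable [measurable_dest]: "all_moments f \<Longrightarrow> f \<in> borel_measurable M"
  by (simp add: all_moments_def)

lemma all_moments_const [simp]: "all_moments (\<lambda>_. c)"
  by (simp add: all_moments_def)

lemma all_moments_mult:
  assumes "all_moments f" "all_moments g"
  shows "all_moments (\<lambda>\<omega>. f \<omega> * g \<omega>)"
  unfolding all_moments_def
proof safe
  note [measurable] = assms[THEN all_moments_measurable]
  show "(\<lambda>\<omega>. f \<omega> * g \<omega>) \<in> borel_measurable M" by measurable
  fix n
  show "integrable M (\<lambda>\<omega>. \<bar>f \<omega> * g \<omega>\<bar> ^ n)"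
  proof (rule Bochner_Integration.integrable_bound)
    show "integrable M (\<lambda>\<omega>. \<bar>f \<omega>\<bar> ^ (2 * n) + \<bar>g \<omega>\<bar> ^ (2 * n))"
      using assms by (simp add: all_moments_def)
    have "x * y \<le> x\<^sup>2 + y\<^sup>2" for x y :: real
      using sum_squares_bound[of x y] zero_le_power2[of x] zero_le_power2[of y] by linarith
    from this[of "\<bar>f _\<bar> ^ n" "\<bar>g _\<bar> ^ n"]
    show "AE \<omega> in M. norm (\<bar>f \<omega> * g \<omega>\<bar> ^ n) \<le> norm (\<bar>f \<omega>\<bar> ^ (2 * n) + \<bar>g \<omega>\<bar> ^ (2 * n))"
      by (intro AE_I2) (simp add: abs_mult power_mult_distrib power_even_eq)
  qed measurable
qed

lemma all_moments_add:
  assumes "all_moments f" "all_moments g"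
  shows "all_moments (\<lambda>\<omega>. f \<omega> + g \<omega>)"
  unfolding all_moments_def
proof safe
  note [measurable] = assms[THEN all_moments_measurable]
  show "(\<lambda>\<omega>. f \<omega> + g \<omega>) \<in> borel_measurable M" by measurable
  fix n
  show "integrable M (\<lambda>\<omega>. \<bar>f \<omega> + g \<omega>\<bar> ^ n)"
  proof (rule Bochner_Integration.integrable_bound)
    show "integrable M (\<lambda>\<omega>. 2 ^ n * (\<bar>f \<omega>\<bar> ^ n + \<bar>g \<omega>\<bar> ^ n))"
      using assms by (simp add: all_moments_def)
    have "\<bar>x + y\<bar> ^ n \<le> 2 ^ n * (\<bar>x\<bar> ^ n + \<bar>y\<bar> ^ n)" for x y :: real
    proof -
      have "\<bar>x + y\<bar> ^ n \<le> (2 * max \<bar>x\<bar> \<bar>y\<bar>) ^ n" by (intro power_mono) auto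
      also have "\<dots> = 2 ^ n * max \<bar>x\<bar> \<bar>y\<bar> ^ n" by (simp add: power_mult_distrib)
      also have "max \<bar>x\<bar> \<bar>y\<bar> ^ n \<le> \<bar>x\<bar> ^ n + \<bar>y\<bar> ^ n" by (cases "\<bar>x\<bar> \<le> \<bar>y\<bar>") auto
      finally show ?thesis by simp
    qed
    then show "AE \<omega> in M. norm (\<bar>f \<omega> + g \<omega>\<bar> ^ n) \<le> norm (2 ^ n * (\<bar>f \<omega>\<bar> ^ n + \<bar>g \<omega>\<bar> ^ n))"
      by (intro AE_I2) auto
  qed measurable
qed

lemma all_moments_cmult: "all_moments f \<Longrightarrow> all_moments (\<lambda>\<omega>. c * f \<omega>)"
  by (rule all_moments_mult) auto

lemma all_moments_diff: "all_moments f \<Longrightarrow> all_moments g \<Longrightarrow> all_moments (\<lambda>\<omega>. f \<omega> - g \<omega>)"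
  using all_moments_add[of f "\<lambda>\<omega>. -1 * g \<omega>"] all_moments_cmult[of g "-1"] by simp

lemma all_moments_power: "all_moments f \<Longrightarrow> all_moments (\<lambda>\<omega>. f \<omega> ^ n)"
  by (induction n) (auto intro: all_moments_mult)

lemma all_moments_sum: "(\<And>i. i \<in> I \<Longrightarrow> all_moments (f i)) \<Longrightarrow> all_moments (\<lambda>\<omega>. \<Sum>i\<in>I. f i \<omega>)"
  by (induction I rule: infinite_finite_induct) (auto intro: all_moments_add)

lemma all_moments_integrable: 
  assumes "all_moments f"
  shows "integrable M f"
proof -
  have "integrable M (\<lambda>\<omega>. \<bar>f \<omega>\<bar> ^ 1)" using assms unfolding all_moments_def by blast
  then have "integrable M (\<lambda>\<omega>. norm (f \<omega>))" by simp
  then show ?thesis by (rule integrable_norm_cancel) (use assms all_moments_measurable in auto)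
qed

lemmas all_moments_intros =
  all_moments_const all_moments_mult all_moments_add all_moments_diff all_moments_power all_moments_sum

text \<open>By the binomial theorem the expectation is a polynomial in \<open>t\<close>, and its
  derivative at 0 is the linear coefficient. No exchange of a limit with the expectation
  occurs.\<close>

lemma derivative_expectation_power:
  assumes Z: "all_moments Z" and V: "all_moments V" and U: "all_moments U"
  shows "((\<lambda>t. expectation (\<lambda>\<omega>. (Z \<omega> + t * V \<omega>) ^ Suc n * U \<omega>)) has_real_derivative
           real (Suc n) * expectation (\<lambda>\<omega>. Z \<omega> ^ n * V \<omega> * U \<omega>)) (at 0)"
proof -
  define c where "c i = real (Suc n choose i) * expectation (\<lambda>\<omega>. Z \<omega> ^ (Suc n - i) * V \<omega> ^ i * U \<omega>)" for i
  have "expectation (\<lambda>\<omega>. (Z \<omega> + t * V \<omega>) ^ Suc n * U \<omega>) = (\<Sum>i\<le>Suc n. c i * t ^ i)" for t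
  proof -
    have "(Z \<omega> + t * V \<omega>) ^ Suc n * U \<omega> =
      (\<Sum>i\<le>Suc n. (real (Suc n choose i) * t ^ i) * (Z \<omega> ^ (Suc n - i) * V \<omega> ^ i * U \<omega>))" for \<omega>
      unfolding add.commute[of "Z \<omega>"] binomial_ring[of "t * V \<omega>" "Z \<omega>" "Suc n"]
      by (simp only: sum_distrib_right power_mult_distrib) (simp only: mult_ac)
    moreover have "expectation (\<lambda>\<omega>. \<Sum>i\<le>Suc n. (real (Suc n choose i) * t ^ i) * (Z \<omega> ^ (Suc n - i) * V \<omega> ^ i * U \<omega>)) = 
       (\<Sum>i\<le>Suc n. (real (Suc n choose i) * t ^ i) * expectation (\<lambda>\<omega>. Z \<omega> ^ (Suc n - i) * V \<omega> ^ i * U \<omega>))"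
      by (subst Bochner_Integration.integral_sum)
         (auto intro!: all_moments_integrable all_moments_intros Z V U simp del: binomial_Suc_Suc)
    ultimately show ?thesis unfolding c_def by (simp only: mult_ac)
  qed
  then show ?thesis
    using has_real_derivative_poly_0[of "Suc n" c] by (simp add: c_def)
qed

end

text \<open>Only moments of single elements are prescribed. As \<open>V\<close> is a linear space,
  joint moments follow by polarization, so joint laws never have to be mentioned.\<close>

locale gaussian_space = prob_space M for M :: "'a measure" +
  fixes V :: "('a \<Rightarrow> real) set"
  assumes add_closed: "Y \<in> V \<Longrightarrow> Z \<in> V \<Longrightarrow> (\<lambda>\<omega>. Y \<omega> + Z \<omega>) \<in> V"
    and scale_closed: "Z \<in> V \<Longrightarrow> (\<lambda>\<omega>. c * Z \<omega>) \<in> V"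
    and all_moments_V: "Z \<in> V \<Longrightarrow> all_moments Z"
    and moment: "Z \<in> V \<Longrightarrow>
      expectation (\<lambda>\<omega>. Z \<omega> ^ n) = normal_moment n * expectation (\<lambda>\<omega>. (Z \<omega>)\<^sup>2) ^ (n div 2)"
begin

definition cov :: "('a \<Rightarrow> real) \<Rightarrow> ('a \<Rightarrow> real) \<Rightarrow> real" where
  "cov Y Z = expectation (\<lambda>\<omega>. Y \<omega> * Z \<omega>)"

lemma cov_commute: "cov Y Z = cov Z Y"
  by (simp add: cov_def mult.commute)

lemma cov_add_right: 
  assumes "Y \<in> V" "Z \<in> V" "Z' \<in> V"
  shows "cov Y (\<lambda>\<omega>. Z \<omega> + t * Z' \<omega>) = cov Y Z + t * cov Y Z'"
proof -
  have "cov Y (\<lambda>\<omega>. Z \<omega> + t * Z' \<omega>) = expectation (\<lambda>\<omega>. Y \<omega> * Z \<omega> + t * (Y \<omega> * Z' \<omega>))"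
    by (simp add: cov_def algebra_simps)
  then show ?thesis using assms
    by (simp add: cov_def all_moments_integrable all_moments_mult all_moments_V)
qed

text \<open>Both sides of the moment formula for $Z + tY$ are differentiated at $t = 0$.\<close>

lemma ibp_power:
  assumes Y: "Y \<in> V" and Z: "Z \<in> V"
  shows "expectation (\<lambda>\<omega>. Y \<omega> * Z \<omega> ^ n) = real n * cov Y Z * expectation (\<lambda>\<omega>. Z \<omega> ^ (n - 1))"
proof -
  have mY: "all_moments Y" and mZ: "all_moments Z" using assms all_moments_V by auto
  define q where "q = Suc n div 2"
  have ZY: "(\<lambda>\<omega>. Z \<omega> + t * Y \<omega>) \<in> V" for t
    using assms by (intro add_closed scale_closed)
  have var: "expectation (\<lambda>\<omega>. (Z \<omega> + t * Y \<omega>)\<^sup>2) = cov Z Z + 2 * t * cov Y Z + t\<^sup>2 * cov Y Y" for t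
  proof -
    have "expectation (\<lambda>\<omega>. (Z \<omega> + t * Y \<omega>)\<^sup>2) = expectation (\<lambda>\<omega>. (Z \<omega> * Z \<omega> + (2 * t) * (Y \<omega> * Z \<omega>)) + t\<^sup>2 * (Y \<omega> * Y \<omega>))"
      by (simp add: algebra_simps power2_eq_square)
    also have "\<dots> = cov Z Z + 2 * t * cov Y Z + t\<^sup>2 * cov Y Y"
      using mY mZ by (simp add: cov_def all_moments_integrable all_moments_mult)
    finally show ?thesis .
  qed
  have d1: "((\<lambda>t. expectation (\<lambda>\<omega>. (Z \<omega> + t * Y \<omega>) ^ Suc n * 1)) has_real_derivative
      real (Suc n) * expectation (\<lambda>\<omega>. Z \<omega> ^ n * Y \<omega> * 1)) (at 0)"
    by (rule derivative_expectation_power) (use mY mZ in auto)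
  have e: "(\<lambda>t. expectation (\<lambda>\<omega>. (Z \<omega> + t * Y \<omega>) ^ Suc n * 1)) =
      (\<lambda>t. normal_moment (Suc n) * (cov Z Z + 2 * t * cov Y Z + t\<^sup>2 * cov Y Y) ^ q)"
    using moment[OF ZY, of _ "Suc n"] by (simp add: var q_def)
  have d2: "((\<lambda>t. normal_moment (Suc n) * (cov Z Z + 2 * t * cov Y Z + t\<^sup>2 * cov Y Y) ^ q)
      has_real_derivative normal_moment (Suc n) * (real q * cov Z Z ^ (q - 1) * (2 * cov Y Z))) (at 0)"
    by (rule derivative_eq_intros refl | simp)+
  have eq: "real (Suc n) * expectation (\<lambda>\<omega>. Z \<omega> ^ n * Y \<omega> * 1)
      = normal_moment (Suc n) * (real q * cov Z Z ^ (q - 1) * (2 * cov Y Z))"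
    using d1 unfolding e by (rule DERIV_unique[OF _ d2])
  have "expectation (\<lambda>\<omega>. Z \<omega> ^ n * Y \<omega>) = real n * cov Y Z * expectation (\<lambda>\<omega>. Z \<omega> ^ (n - 1))"
  proof (cases n)
    case 0
    then show ?thesis using eq by simp
  next
    case (Suc m)
    have m: "expectation (\<lambda>\<omega>. Z \<omega> ^ m) = normal_moment m * cov Z Z ^ (m div 2)"
      using moment[OF Z, of m] by (simp add: cov_def power2_eq_square)
    have nm: "normal_moment (Suc n) = real n * normal_moment m"
      using Suc normal_moment_Suc_Suc[of m] by simp
    show ?thesis
    proof (cases "even m")
      case True
      then have "2 * real q = real (Suc n)" "q - 1 = m div 2"
        unfolding q_def using Suc by (auto elim!: evenE)
      moreover have "normal_moment (Suc n) * (real q * cov Z Z ^ (q - 1) * (2 * cov Y Z)) =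
         (2 * real q) * (real n * cov Y Z * (normal_moment m * cov Z Z ^ (q - 1)))"
        unfolding nm by (simp only: mult_ac)
      ultimately have "normal_moment (Suc n) * (real q * cov Z Z ^ (q - 1) * (2 * cov Y Z)) =
         real (Suc n) * (real n * cov Y Z * (normal_moment m * cov Z Z ^ (m div 2)))"
        by (simp only:)
      then have "real (Suc n) * expectation (\<lambda>\<omega>. Z \<omega> ^ n * Y \<omega>) 
         = real (Suc n) * (real n * cov Y Z * (normal_moment m * cov Z Z ^ (m div 2)))"
        using eq by simp
      then have "expectation (\<lambda>\<omega>. Z \<omega> ^ n * Y \<omega>) = real n * cov Y Z * (normal_moment m * cov Z Z ^ (m div 2))"
        by (subst (asm) mult_cancel_left) simp
      then show ?thesis using m Suc by simp
    next
      case False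
      then have "normal_moment m = 0" by (simp add: normal_moment_def)
      then show ?thesis using eq m nm Suc by simp
    qed
  qed
  then show ?thesis by (simp add: mult.commute)
qed

section \<open>The Wick formula for products of Gaussian variables\<close>

fun prod_rv :: "('a \<Rightarrow> real) list \<Rightarrow> 'a \<Rightarrow> real" where
  "prod_rv [] = (\<lambda>\<omega>. 1)"
| "prod_rv (Z # L) = (\<lambda>\<omega>. Z \<omega> * prod_rv L \<omega>)"

text \<open>The Malliavin derivative of the product in the direction \<open>Y\<close>: the Leibniz
  rule, with \<open>cov Y Z\<close> as the derivative of the factor \<open>Z\<close>.\<close>

fun deriv_prod :: "('a \<Rightarrow> real) \<Rightarrow> ('a \<Rightarrow> real) list \<Rightarrow> 'a \<Rightarrow> real" where
  "deriv_prod Y [] = (\<lambda>\<omega>. 0)"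
| "deriv_prod Y (Z # L) = (\<lambda>\<omega>. cov Y Z * prod_rv L \<omega> + Z \<omega> * deriv_prod Y L \<omega>)"

lemma all_moments_prod_rv: "set L \<subseteq> V \<Longrightarrow> all_moments (prod_rv L)"
  by (induction L) (auto intro!: all_moments_intros intro: all_moments_V)

lemma all_moments_deriv_prod: "set L \<subseteq> V \<Longrightarrow> all_moments (deriv_prod Y L)"
  by (induction L) (auto intro!: all_moments_intros all_moments_prod_rv intro: all_moments_V)

text \<open>Polarization: the case of a list $V_1, L$ is the coefficient of $t$ in the case of $L$ with
  $Z + t V_1$ in place of $Z$.\<close>

lemma ibp_power_list:
  assumes Y: "Y \<in> V" and Z: "Z \<in> V" and L: "set L \<subseteq> V"
  shows "expectation (\<lambda>\<omega>. Y \<omega> * Z \<omega> ^ n * prod_rv L \<omega>) =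
    real n * cov Y Z * expectation (\<lambda>\<omega>. Z \<omega> ^ (n - 1) * prod_rv L \<omega>) +
    expectation (\<lambda>\<omega>. Z \<omega> ^ n * deriv_prod Y L \<omega>)"
  using Z L
proof (induction L arbitrary: n Z)
  case Nil
  then show ?case using ibp_power[OF Y Nil(1), of n] by simp
next
  case (Cons U L)
  have mY: "all_moments Y" and mZ: "all_moments Z" and mU: "all_moments U" and UV: "U \<in> V"
    and mL: "all_moments (prod_rv L)" and mD: "all_moments (deriv_prod Y L)"
    using Y Cons.prems by (auto intro: all_moments_V all_moments_prod_rv all_moments_deriv_prod)
  have ZU: "(\<lambda>\<omega>. Z \<omega> + t * U \<omega>) \<in> V" for t
    using UV Cons.prems by (intro add_closed scale_closed)
  let ?f1 = "\<lambda>t. expectation (\<lambda>\<omega>. (Z \<omega> + t * U \<omega>) ^ Suc n * (Y \<omega> * prod_rv L \<omega>))"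
  let ?f2 = "\<lambda>t. expectation (\<lambda>\<omega>. (Z \<omega> + t * U \<omega>) ^ n * prod_rv L \<omega>)"
  let ?f3 = "\<lambda>t. expectation (\<lambda>\<omega>. (Z \<omega> + t * U \<omega>) ^ Suc n * deriv_prod Y L \<omega>)"
  have eq: "?f1 = (\<lambda>t. real (Suc n) * (cov Y Z + t * cov Y U) * ?f2 t + ?f3 t)"
  proof
    fix t
    show "?f1 t = real (Suc n) * (cov Y Z + t * cov Y U) * ?f2 t + ?f3 t"
      using Cons.IH[OF ZU[of t], of "Suc n"] Cons.prems cov_add_right[OF Y Cons.prems(1) UV, of t]
      by (simp add: mult_ac)
  qed
  have d1: "(?f1 has_real_derivative real (Suc n) * expectation (\<lambda>\<omega>. Z \<omega> ^ n * U \<omega> * (Y \<omega> * prod_rv L \<omega>))) (at 0)"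
    by (intro derivative_expectation_power mZ mU all_moments_mult mY mL)
  have d3: "(?f3 has_real_derivative real (Suc n) * expectation (\<lambda>\<omega>. Z \<omega> ^ n * U \<omega> * deriv_prod Y L \<omega>)) (at 0)"
    by (intro derivative_expectation_power mZ mU mD)
  have d2: "(?f2 has_real_derivative real n * expectation (\<lambda>\<omega>. Z \<omega> ^ (n - 1) * U \<omega> * prod_rv L \<omega>)) (at 0)"
  proof (cases n)
    case (Suc m)
    then show ?thesis using derivative_expectation_power[OF mZ mU mL, of m] by simp
  qed simp
  have "(?f1 has_real_derivative (real (Suc n) * cov Y U * ?f2 0 + real (Suc n) * cov Y Z * 
     (real n * expectation (\<lambda>\<omega>. Z \<omega> ^ (n - 1) * U \<omega> * prod_rv L \<omega>)) +
      real (Suc n) * expectation (\<lambda>\<omega>. Z \<omega> ^ n * U \<omega> * deriv_prod Y L \<omega>))) (at 0)"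
    unfolding eq
    by (rule derivative_eq_intros d2 d3 refl | simp)+
  then have "real (Suc n) * expectation (\<lambda>\<omega>. Z \<omega> ^ n * U \<omega> * (Y \<omega> * prod_rv L \<omega>)) =
     real (Suc n) * (cov Y U * ?f2 0 + cov Y Z * 
     (real n * expectation (\<lambda>\<omega>. Z \<omega> ^ (n - 1) * U \<omega> * prod_rv L \<omega>)) +
      expectation (\<lambda>\<omega>. Z \<omega> ^ n * U \<omega> * deriv_prod Y L \<omega>))"
    using DERIV_unique[OF d1] by (simp only: distrib_left mult.assoc)
  then have e: "expectation (\<lambda>\<omega>. Z \<omega> ^ n * U \<omega> * (Y \<omega> * prod_rv L \<omega>)) =
     cov Y U * ?f2 0 + cov Y Z * 
     (real n * expectation (\<lambda>\<omega>. Z \<omega> ^ (n - 1) * U \<omega> * prod_rv L \<omega>)) +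
      expectation (\<lambda>\<omega>. Z \<omega> ^ n * U \<omega> * deriv_prod Y L \<omega>)"
    by (subst (asm) mult_cancel_left) simp
  have "expectation (\<lambda>\<omega>. Z \<omega> ^ n * deriv_prod Y (U # L) \<omega>) = 
    expectation (\<lambda>\<omega>. cov Y U * (Z \<omega> ^ n * prod_rv L \<omega>) + Z \<omega> ^ n * U \<omega> * deriv_prod Y L \<omega>)"
    by (simp add: algebra_simps)
  also have "\<dots> = cov Y U * expectation (\<lambda>\<omega>. Z \<omega> ^ n * prod_rv L \<omega>) + expectation (\<lambda>\<omega>. Z \<omega> ^ n * U \<omega> * deriv_prod Y L \<omega>)"
    by (subst Bochner_Integration.integral_add)
       (auto intro!: all_moments_integrable all_moments_intros mZ mL mU mD)
  finally show ?case using e by (simp add: mult_ac)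
qed

text \<open>One step of the Wick (Isserlis) formula. At exponent 0 the auxiliary power disappears,
  so \<open>Y\<close> itself can stand in for \<open>Z\<close>.\<close>

lemma ibp_list:
  assumes "Y \<in> V" and "set L \<subseteq> V"
  shows "expectation (\<lambda>\<omega>. Y \<omega> * prod_rv L \<omega>) = expectation (deriv_prod Y L)"
  using ibp_power_list[OF assms(1) assms(1) assms(2), of 0] by simp

end

section \<open>Quadratic forms and the method of moments\<close>

primrec kernel_power :: "('i \<Rightarrow> 'i \<Rightarrow> real) \<Rightarrow> 'i set \<Rightarrow> nat \<Rightarrow> 'i \<Rightarrow> 'i \<Rightarrow> real" where
  "kernel_power C J 0 = (\<lambda>k j. if k = j then 1 else 0)"
| "kernel_power C J (Suc n) = (\<lambda>k j. \<Sum>l\<in>J. C k l * kernel_power C J n l j)"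

text \<open>For symmetric \<open>C\<close> this is the trace of the power \<open>n + 1\<close>. With
  this shift, index 0 gives the mean of the quadratic form and index 1 its variance.\<close>

definition kernel_trace :: "('i \<Rightarrow> 'i \<Rightarrow> real) \<Rightarrow> 'i set \<Rightarrow> nat \<Rightarrow> real" where
  "kernel_trace C J n = (\<Sum>k\<in>J. \<Sum>j\<in>J. kernel_power C J n k j * C k j)"

context gaussian_space
begin

definition quad :: "real \<Rightarrow> real \<Rightarrow> 'i set \<Rightarrow> ('i \<Rightarrow> 'a \<Rightarrow> real) \<Rightarrow> 'a \<Rightarrow> real" where
  "quad s q J X = (\<lambda>\<omega>. s * (\<Sum>k\<in>J. (X k \<omega>)\<^sup>2) - q)"

text \<open>The derivative of \<open>quad\<close> in the direction \<open>Y\<close>; the constant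
  \<open>q\<close> drops out.\<close>

definition deriv_quad :: "real \<Rightarrow> 'i set \<Rightarrow> ('i \<Rightarrow> 'a \<Rightarrow> real) \<Rightarrow> ('a \<Rightarrow> real) \<Rightarrow> 'a \<Rightarrow> real" where
  "deriv_quad s J X Y = (\<lambda>\<omega>. \<Sum>k\<in>J. (2 * s * cov Y (X k)) * X k \<omega>)"

lemma all_moments_quad: "(\<And>k. k \<in> J \<Longrightarrow> X k \<in> V) \<Longrightarrow> all_moments (quad s q J X)"
  unfolding quad_def by (intro all_moments_intros all_moments_V)

lemma all_moments_deriv_quad: "(\<And>k. k \<in> J \<Longrightarrow> X k \<in> V) \<Longrightarrow> all_moments (deriv_quad s J X Y)"
  unfolding deriv_quad_def by (intro all_moments_intros all_moments_V)

lemma expectation_mult_quad: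
  assumes "\<And>k. k \<in> J \<Longrightarrow> X k \<in> V" and U: "all_moments U"
  shows "expectation (\<lambda>\<omega>. U \<omega> * quad s q J X \<omega>) =
    s * (\<Sum>k\<in>J. expectation (\<lambda>\<omega>. U \<omega> * X k \<omega> * X k \<omega>)) - q * expectation U"
proof -
  have "expectation (\<lambda>\<omega>. U \<omega> * quad s q J X \<omega>) =
      expectation (\<lambda>\<omega>. s * (\<Sum>k\<in>J. U \<omega> * X k \<omega> * X k \<omega>) - q * U \<omega>)"
    by (simp add: quad_def algebra_simps sum_distrib_left power2_eq_square)
  also have "\<dots> = s * expectation (\<lambda>\<omega>. \<Sum>k\<in>J. U \<omega> * X k \<omega> * X k \<omega>) - q * expectation U"
    by (subst Bochner_Integration.integral_diff)
       (auto intro!: all_moments_integrable all_moments_intros U intro: all_moments_V assms(1))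
  also have "expectation (\<lambda>\<omega>. \<Sum>k\<in>J. U \<omega> * X k \<omega> * X k \<omega>) = (\<Sum>k\<in>J. expectation (\<lambda>\<omega>. U \<omega> * X k \<omega> * X k \<omega>))"
    by (rule Bochner_Integration.integral_sum)
       (auto intro!: all_moments_integrable all_moments_intros U intro: all_moments_V assms(1))
  finally show ?thesis .
qed

lemma expectation_mult_deriv_quad:
  assumes "\<And>k. k \<in> J \<Longrightarrow> X k \<in> V" and U: "all_moments U"
  shows "expectation (\<lambda>\<omega>. U \<omega> * deriv_quad s J X Y \<omega>) =
    (\<Sum>k\<in>J. (2 * s * cov Y (X k)) * expectation (\<lambda>\<omega>. U \<omega> * X k \<omega>))"
proof -
  have "expectation (\<lambda>\<omega>. U \<omega> * deriv_quad s J X Y \<omega>) =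
      expectation (\<lambda>\<omega>. \<Sum>k\<in>J. (2 * s * cov Y (X k)) * (U \<omega> * X k \<omega>))"
    by (simp add: deriv_quad_def mult_ac sum_distrib_left)
  also have "\<dots> = (\<Sum>k\<in>J. (2 * s * cov Y (X k)) * expectation (\<lambda>\<omega>. U \<omega> * X k \<omega>))"
    by (subst Bochner_Integration.integral_sum)
       (auto intro!: all_moments_integrable all_moments_intros U intro: all_moments_V assms(1))
  finally show ?thesis .
qed

text \<open>Induction on \<open>n\<close>: one factor of the power is expanded into squares
  \<open>X k * X k\<close>, which are moved into the list, and the hypothesis is applied to the
  longer list. This is why \<open>L\<close> has to be arbitrary.\<close>

lemma ibp_quad:
  fixes X :: "'i \<Rightarrow> 'a \<Rightarrow> real"
  assumes X: "\<And>k. k \<in> J \<Longrightarrow> X k \<in> V" and Y: "Y \<in> V" and L: "set L \<subseteq> V"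
  shows "expectation (\<lambda>\<omega>. Y \<omega> * prod_rv L \<omega> * quad s q J X \<omega> ^ n) =
    expectation (\<lambda>\<omega>. deriv_prod Y L \<omega> * quad s q J X \<omega> ^ n) +
    real n * expectation (\<lambda>\<omega>. prod_rv L \<omega> * quad s q J X \<omega> ^ (n - 1) * deriv_quad s J X Y \<omega>)"
  using L
proof (induction n arbitrary: L)
  case 0
  then show ?case using ibp_list[OF Y] by simp
next
  case (Suc n)
  define W where "W = quad s q J X"
  define D where "D = deriv_quad s J X Y"
  have mW: "all_moments W" and mD: "all_moments D" unfolding W_def D_def
    by (auto intro!: all_moments_quad all_moments_deriv_quad X)
  have mL: "all_moments (prod_rv L)" "all_moments (deriv_prod Y L)" "all_moments Y"
    using Suc.prems Y all_moments_prod_rv all_moments_deriv_prod all_moments_V by auto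
  have mX: "k \<in> J \<Longrightarrow> all_moments (X k)" for k using X all_moments_V by auto
  note ints = all_moments_integrable all_moments_intros mW mD mL mX
  define a where "a = (\<lambda>k. expectation (\<lambda>\<omega>. prod_rv L \<omega> * W \<omega> ^ n * X k \<omega>))"
  define b where "b = (\<lambda>k. expectation (\<lambda>\<omega>. deriv_prod Y L \<omega> * W \<omega> ^ n * X k \<omega> * X k \<omega>))"
  define d where "d = (\<lambda>k. expectation (\<lambda>\<omega>. prod_rv L \<omega> * W \<omega> ^ (n - 1) * D \<omega> * X k \<omega> * X k \<omega>))"
  define b0 where "b0 = expectation (\<lambda>\<omega>. deriv_prod Y L \<omega> * W \<omega> ^ n)"
  define d0 where "d0 = expectation (\<lambda>\<omega>. prod_rv L \<omega> * W \<omega> ^ (n - 1) * D \<omega>)"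
  have 1: "expectation (\<lambda>\<omega>. Y \<omega> * prod_rv L \<omega> * W \<omega> ^ n * X k \<omega> * X k \<omega>) =
      2 * cov Y (X k) * a k + b k + real n * d k" if k: "k \<in> J" for k
  proof -
    have "expectation (\<lambda>\<omega>. Y \<omega> * prod_rv L \<omega> * W \<omega> ^ n * X k \<omega> * X k \<omega>) =
       expectation (\<lambda>\<omega>. Y \<omega> * prod_rv (X k # X k # L) \<omega> * W \<omega> ^ n)"
      by (simp add: mult_ac)
    also have "\<dots> = expectation (\<lambda>\<omega>. deriv_prod Y (X k # X k # L) \<omega> * W \<omega> ^ n) +
       real n * expectation (\<lambda>\<omega>. prod_rv (X k # X k # L) \<omega> * W \<omega> ^ (n - 1) * D \<omega>)"
      unfolding W_def D_def by (rule Suc.IH) (use Suc.prems X k in auto)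
    also have "expectation (\<lambda>\<omega>. deriv_prod Y (X k # X k # L) \<omega> * W \<omega> ^ n) =
       expectation (\<lambda>\<omega>. (2 * cov Y (X k)) * (prod_rv L \<omega> * W \<omega> ^ n * X k \<omega>) + deriv_prod Y L \<omega> * W \<omega> ^ n * X k \<omega> * X k \<omega>)"
      by (simp add: algebra_simps)
    also have "\<dots> = 2 * cov Y (X k) * a k + b k" unfolding a_def b_def
      by (subst Bochner_Integration.integral_add) (use k in \<open>auto intro!: ints\<close>)
    also have "expectation (\<lambda>\<omega>. prod_rv (X k # X k # L) \<omega> * W \<omega> ^ (n - 1) * D \<omega>) = d k"
      by (simp add: d_def mult_ac)
    finally show ?thesis .
  qed
  have 2: "expectation (\<lambda>\<omega>. Y \<omega> * prod_rv L \<omega> * W \<omega> ^ n) = b0 + real n * d0"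
    unfolding W_def D_def b0_def d0_def by (rule Suc.IH) (use Suc.prems in auto)
  have "expectation (\<lambda>\<omega>. Y \<omega> * prod_rv L \<omega> * W \<omega> ^ Suc n) = expectation (\<lambda>\<omega>. Y \<omega> * prod_rv L \<omega> * W \<omega> ^ n * W \<omega>)"
    by (simp add: mult_ac)
  also have "\<dots> = s * (\<Sum>k\<in>J. 2 * cov Y (X k) * a k + b k + real n * d k) - q * (b0 + real n * d0)"
    unfolding 2[symmetric]
    by (subst W_def, subst expectation_mult_quad[OF X]) (auto intro!: ints simp: 1)
  \<comment> \<open>The three groups are the derivatives of the factor just expanded, of the list,
    and of the remaining power. Each is folded back into an expectation involving
    \<open>W\<close>.\<close>
  also have "\<dots> = (\<Sum>k\<in>J. 2 * s * cov Y (X k) * a k) + (s * (\<Sum>k\<in>J. b k) - q * b0) + real n * (s * (\<Sum>k\<in>J. d k) - q * d0)"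
    by (simp add: sum.distrib sum_distrib_left algebra_simps)
  also have "(\<Sum>k\<in>J. 2 * s * cov Y (X k) * a k) = expectation (\<lambda>\<omega>. prod_rv L \<omega> * W \<omega> ^ n * D \<omega>)"
    unfolding a_def D_def by (rule expectation_mult_deriv_quad[OF X, symmetric]) (auto intro!: ints)
  also have "s * (\<Sum>k\<in>J. b k) - q * b0 = expectation (\<lambda>\<omega>. deriv_prod Y L \<omega> * W \<omega> ^ n * W \<omega>)"
    unfolding b_def b0_def by (subst (3) W_def, rule expectation_mult_quad[OF X, symmetric]) (auto intro!: ints)
  also have "s * (\<Sum>k\<in>J. d k) - q * d0 = expectation (\<lambda>\<omega>. prod_rv L \<omega> * W \<omega> ^ (n - 1) * D \<omega> * W \<omega>)"
    unfolding d_def d0_def by (subst (3) W_def, rule expectation_mult_quad[OF X, symmetric]) (auto intro!: ints)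
  also have "real n * expectation (\<lambda>\<omega>. prod_rv L \<omega> * W \<omega> ^ (n - 1) * D \<omega> * W \<omega>) =
      real n * expectation (\<lambda>\<omega>. prod_rv L \<omega> * W \<omega> ^ n * D \<omega>)"
    by (cases n) (simp_all add: mult_ac)
  finally show ?case unfolding W_def[symmetric] D_def[symmetric]
    by (simp add: algebra_simps)
qed

definition qform :: "nat \<Rightarrow> 'i set \<Rightarrow> ('i \<Rightarrow> 'a \<Rightarrow> real) \<Rightarrow> 'a \<Rightarrow> real" where
  "qform i J X = (\<lambda>\<omega>. \<Sum>k\<in>J. \<Sum>j\<in>J. kernel_power (\<lambda>k j. cov (X k) (X j)) J i k j * (X k \<omega> * X j \<omega>))"

text \<open>Integration by parts with respect to \<open>X k\<close>. Differentiating
  \<open>X j\<close> closes the chain and leaves a trace; differentiating a factor of the power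
  lengthens the chain by one covariance, at the price of \<open>2 * s\<close>.\<close>

lemma expectation_quad_power_qform:
  fixes X :: "'i \<Rightarrow> 'a \<Rightarrow> real"
  assumes J: "finite J" and X: "\<And>k. k \<in> J \<Longrightarrow> X k \<in> V"
  shows "expectation (\<lambda>\<omega>. quad s q J X \<omega> ^ n * qform i J X \<omega>) =
    kernel_trace (\<lambda>k j. cov (X k) (X j)) J i * expectation (\<lambda>\<omega>. quad s q J X \<omega> ^ n) +
    2 * s * real n * expectation (\<lambda>\<omega>. quad s q J X \<omega> ^ (n - 1) * qform (Suc i) J X \<omega>)"
proof -
  define W where "W = quad s q J X"
  define C where "C = (\<lambda>k j. cov (X k) (X j))"
  define A where "A = kernel_power C J"
  have mW: "all_moments W" unfolding W_def
    by (auto intro!: all_moments_quad X)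
  have mX: "k \<in> J \<Longrightarrow> all_moments (X k)" for k using X all_moments_V by auto
  note ints = all_moments_integrable all_moments_intros mW mX
  have sumE: "expectation (\<lambda>\<omega>. W \<omega> ^ n * qform i J X \<omega>) = 
      (\<Sum>k\<in>J. \<Sum>j\<in>J. A i k j * expectation (\<lambda>\<omega>. X k \<omega> * X j \<omega> * W \<omega> ^ n))" for i n
  proof -
    have "expectation (\<lambda>\<omega>. W \<omega> ^ n * qform i J X \<omega>) =
       expectation (\<lambda>\<omega>. \<Sum>k\<in>J. \<Sum>j\<in>J. A i k j * (X k \<omega> * X j \<omega> * W \<omega> ^ n))"
      by (simp add: qform_def A_def C_def sum_distrib_left mult_ac)
    also have "\<dots> = (\<Sum>k\<in>J. expectation (\<lambda>\<omega>. \<Sum>j\<in>J. A i k j * (X k \<omega> * X j \<omega> * W \<omega> ^ n)))"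
      by (rule Bochner_Integration.integral_sum) (auto intro!: ints)
    also have "\<dots> = (\<Sum>k\<in>J. \<Sum>j\<in>J. expectation (\<lambda>\<omega>. A i k j * (X k \<omega> * X j \<omega> * W \<omega> ^ n)))"
      by (intro sum.cong refl Bochner_Integration.integral_sum) (auto intro!: ints)
    finally show ?thesis by simp
  qed
  have e: "expectation (\<lambda>\<omega>. X k \<omega> * X j \<omega> * W \<omega> ^ n) = C k j * expectation (\<lambda>\<omega>. W \<omega> ^ n) +
      2 * s * real n * (\<Sum>l\<in>J. C k l * expectation (\<lambda>\<omega>. X l \<omega> * X j \<omega> * W \<omega> ^ (n - 1)))"
    if kj: "k \<in> J" "j \<in> J" for k j
  proof -
    have "expectation (\<lambda>\<omega>. X k \<omega> * prod_rv [X j] \<omega> * quad s q J X \<omega> ^ n) =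
      expectation (\<lambda>\<omega>. deriv_prod (X k) [X j] \<omega> * quad s q J X \<omega> ^ n) +
      real n * expectation (\<lambda>\<omega>. prod_rv [X j] \<omega> * quad s q J X \<omega> ^ (n - 1) * deriv_quad s J X (X k) \<omega>)"
      by (rule ibp_quad) (use kj X in auto)
    also have "expectation (\<lambda>\<omega>. prod_rv [X j] \<omega> * quad s q J X \<omega> ^ (n - 1) * deriv_quad s J X (X k) \<omega>) = 
       (\<Sum>l\<in>J. (2 * s * C k l) * expectation (\<lambda>\<omega>. prod_rv [X j] \<omega> * W \<omega> ^ (n - 1) * X l \<omega>))"
      unfolding C_def W_def
      by (rule expectation_mult_deriv_quad[OF X]) (use kj in \<open>auto intro!: ints[unfolded W_def]\<close>)
    finally show ?thesis
      by (simp add: W_def C_def mult_ac sum_distrib_left)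
  qed
  have "expectation (\<lambda>\<omega>. W \<omega> ^ n * qform i J X \<omega>) = (\<Sum>k\<in>J. \<Sum>j\<in>J. A i k j * (C k j * expectation (\<lambda>\<omega>. W \<omega> ^ n) +
      2 * s * real n * (\<Sum>l\<in>J. C k l * expectation (\<lambda>\<omega>. X l \<omega> * X j \<omega> * W \<omega> ^ (n - 1)))))"
    unfolding sumE by (intro sum.cong refl) (simp add: e)
  also have "\<dots> = kernel_trace C J i * expectation (\<lambda>\<omega>. W \<omega> ^ n) + 2 * s * real n *
     (\<Sum>k\<in>J. \<Sum>j\<in>J. \<Sum>l\<in>J. C k l * A i k j * expectation (\<lambda>\<omega>. X l \<omega> * X j \<omega> * W \<omega> ^ (n - 1)))"
    unfolding kernel_trace_def A_def[symmetric] distrib_left sum.distrib sum_distrib_left sum_distrib_right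
    by (simp only: mult_ac)
  \<comment> \<open>Once \<open>k\<close> is innermost, the sum over \<open>k\<close> is a product
    of matrices, because the covariance is symmetric.\<close>
  also have "(\<Sum>k\<in>J. \<Sum>j\<in>J. \<Sum>l\<in>J. C k l * A i k j * expectation (\<lambda>\<omega>. X l \<omega> * X j \<omega> * W \<omega> ^ (n - 1))) =
    (\<Sum>l\<in>J. \<Sum>j\<in>J. \<Sum>k\<in>J. C k l * A i k j * expectation (\<lambda>\<omega>. X l \<omega> * X j \<omega> * W \<omega> ^ (n - 1)))"
    by (subst sum.swap, subst (2) sum.swap, subst sum.swap) simp
  also have "\<dots> = (\<Sum>l\<in>J. \<Sum>j\<in>J. A (Suc i) l j * expectation (\<lambda>\<omega>. X l \<omega> * X j \<omega> * W \<omega> ^ (n - 1)))"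
    by (simp add: A_def sum_distrib_right C_def cov_commute)
  also have "\<dots> = expectation (\<lambda>\<omega>. W \<omega> ^ (n - 1) * qform (Suc i) J X \<omega>)"
    by (simp add: sumE)
  finally show ?thesis by (simp add: W_def C_def)
qed

lemma quad_eq_qform:
  assumes "finite J"
  shows "quad s q J X \<omega> = s * qform 0 J X \<omega> - q"
  using assms by (simp add: quad_def qform_def if_distrib[of "\<lambda>x. x * _"] sum.delta power2_eq_square)

lemma all_moments_qform: "(\<And>k. k \<in> J \<Longrightarrow> X k \<in> V) \<Longrightarrow> all_moments (qform i J X)"
  unfolding qform_def by (intro all_moments_intros all_moments_V)

text \<open>The constant \<open>q\<close> is the mean, and it cancels exactly the trace term of the
  preceding recursion.\<close>

lemma expectation_centered_quad_power_Suc: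
  assumes J: "finite J" and X: "\<And>k. k \<in> J \<Longrightarrow> X k \<in> V"
    and q: "q = s * kernel_trace (\<lambda>k j. cov (X k) (X j)) J 0"
  shows "expectation (\<lambda>\<omega>. quad s q J X \<omega> ^ Suc n) =
    2 * s\<^sup>2 * real n * expectation (\<lambda>\<omega>. quad s q J X \<omega> ^ (n - 1) * qform 1 J X \<omega>)"
proof -
  have m: "all_moments (quad s q J X)" "all_moments (qform 0 J X)" 
    using X by (auto intro: all_moments_quad all_moments_qform)
  have "expectation (\<lambda>\<omega>. quad s q J X \<omega> ^ Suc n) =
      expectation (\<lambda>\<omega>. s * (quad s q J X \<omega> ^ n * qform 0 J X \<omega>) - q * quad s q J X \<omega> ^ n)"
    by (simp add: quad_eq_qform[OF J] algebra_simps)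
  also have "\<dots> = s * expectation (\<lambda>\<omega>. quad s q J X \<omega> ^ n * qform 0 J X \<omega>) - q * expectation (\<lambda>\<omega>. quad s q J X \<omega> ^ n)"
    by (subst Bochner_Integration.integral_diff)
       (auto intro!: all_moments_integrable all_moments_intros m)
  also have "\<dots> = 2 * s\<^sup>2 * real n * expectation (\<lambda>\<omega>. quad s q J X \<omega> ^ (n - 1) * qform 1 J X \<omega>)"
    by (subst expectation_quad_power_qform[OF J X]) (auto simp: q algebra_simps power2_eq_square)
  finally show ?thesis .
qed

text \<open>Weighted by \<open>s N ^ Suc i\<close>, the recursion says that the term at
  \<open>(i, n)\<close> is a scaled trace times the moment of order n, plus 2 n times the term at
  \<open>(i + 1, n - 1)\<close>. In the limit only the trace at \<open>i = 1\<close> survives, and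
  the moments satisfy \<open>m (n + 2) = (n + 1) * v * m n\<close>, which is the recursion of the
  normal moments.\<close>

lemma quad_moments_limit:
  fixes X :: "nat \<Rightarrow> 'i \<Rightarrow> 'a \<Rightarrow> real"
  assumes J: "\<And>N. finite (J N)" and X: "\<And>N k. k \<in> J N \<Longrightarrow> X N k \<in> V"
    and t_def: "\<And>N i. t N i = kernel_trace (\<lambda>k j. cov (X N k) (X N j)) (J N) i"
    and lim1: "(\<lambda>N. 2 * (s N)\<^sup>2 * t N 1) \<longlonglongrightarrow> v"
    and lim2: "\<And>i. 2 \<le> i \<Longrightarrow> (\<lambda>N. s N ^ Suc i * t N i) \<longlonglongrightarrow> 0"
  shows "(\<lambda>N. expectation (\<lambda>\<omega>. quad (s N) (s N * t N 0) (J N) (X N) \<omega> ^ n)) \<longlonglongrightarrow> normal_moment n * v ^ (n div 2)"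
proof -
  define W where "W N = quad (s N) (s N * t N 0) (J N) (X N)" for N
  define G where "G N i n = expectation (\<lambda>\<omega>. W N \<omega> ^ n * qform i (J N) (X N) \<omega>)" for N i n
  define m where "m n = normal_moment n * v ^ (n div 2)" for n
  have rec: "G N i n = t N i * expectation (\<lambda>\<omega>. W N \<omega> ^ n) + 2 * s N * real n * G N (Suc i) (n - 1)" for N i n
    unfolding G_def W_def t_def by (rule expectation_quad_power_qform[OF J X])
  have Suc_rec: "expectation (\<lambda>\<omega>. W N \<omega> ^ Suc n) = 2 * (s N)\<^sup>2 * real n * G N 1 (n - 1)" for N n
    unfolding G_def W_def by (rule expectation_centered_quad_power_Suc[OF J X]) (auto simp: t_def)
  \<comment> \<open>All \<open>i\<close> are treated at once because the term at \<open>i\<close>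
    refers to the one at \<open>i + 1\<close>.\<close>
  have step: "\<forall>i\<ge>1. (\<lambda>N. s N ^ Suc i * G N i n) \<longlonglongrightarrow> (if i = 1 then v / 2 * m n else 0)"
    if P: "(\<lambda>N. expectation (\<lambda>\<omega>. W N \<omega> ^ n)) \<longlonglongrightarrow> m n"
      and Q: "n > 0 \<Longrightarrow> \<forall>i\<ge>1. (\<lambda>N. s N ^ Suc i * G N i (n - 1)) \<longlonglongrightarrow> (if i = 1 then v / 2 * m (n - 1) else 0)" for n
  proof safe
    fix i :: nat assume i: "1 \<le> i"
    have l1: "(\<lambda>N. s N ^ Suc i * t N i) \<longlonglongrightarrow> (if i = 1 then v / 2 else 0)"
    proof (cases "i = 1")
      case True
      then show ?thesis using tendsto_divide[OF lim1 tendsto_const[of 2]] by (simp add: power2_eq_square mult_ac)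
    next
      case False
      then show ?thesis using lim2[of i] i by simp
    qed
    have l2: "(\<lambda>N. 2 * real n * (s N ^ Suc (Suc i) * G N (Suc i) (n - 1))) \<longlonglongrightarrow> 0"
    proof (cases "n = 0")
      case False
      then have "(\<lambda>N. s N ^ Suc (Suc i) * G N (Suc i) (n - 1)) \<longlonglongrightarrow> 0"
        using Q[rule_format, of "Suc i"] i by auto
      then show ?thesis by (intro tendsto_mult_right_zero)
    qed simp
    have "(\<lambda>N. s N ^ Suc i * G N i n) =
       (\<lambda>N. s N ^ Suc i * t N i * expectation (\<lambda>\<omega>. W N \<omega> ^ n) + 2 * real n * (s N ^ Suc (Suc i) * G N (Suc i) (n - 1)))"
      by (subst rec) (simp add: algebra_simps)
    moreover have "\<dots> \<longlonglongrightarrow> (if i = 1 then v / 2 else 0) * m n + 0"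
      by (intro tendsto_add tendsto_mult l1 l2 P)
    ultimately show "(\<lambda>N. s N ^ Suc i * G N i n) \<longlonglongrightarrow> (if i = 1 then v / 2 * m n else 0)"
      by (simp split: if_splits)
  qed
  \<comment> \<open>Two consecutive moments are carried along, since the recursion advances by
    two.\<close>
  have "(\<lambda>N. expectation (\<lambda>\<omega>. W N \<omega> ^ n)) \<longlonglongrightarrow> m n \<and>
    (\<lambda>N. expectation (\<lambda>\<omega>. W N \<omega> ^ Suc n)) \<longlonglongrightarrow> m (Suc n) \<and>
    (\<forall>i\<ge>1. (\<lambda>N. s N ^ Suc i * G N i n) \<longlonglongrightarrow> (if i = 1 then v / 2 * m n else 0))" for n
  proof (induction n)
    case 0
    have P0: "(\<lambda>N. expectation (\<lambda>\<omega>. W N \<omega> ^ 0)) \<longlonglongrightarrow> m 0" by (simp add: m_def prob_space)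
    then show ?case using step[OF P0] Suc_rec[of _ 0] by (simp add: m_def)
  next
    case (Suc n)
    have "(\<lambda>N. s N ^ 2 * G N 1 n) \<longlonglongrightarrow> v / 2 * m n" using Suc[THEN conjunct2, THEN conjunct2, rule_format, of 1]
      by (simp add: numeral_2_eq_2)
    from tendsto_mult[OF tendsto_const[of "2 * real (Suc n)"] this]
    have "(\<lambda>N. expectation (\<lambda>\<omega>. W N \<omega> ^ Suc (Suc n))) \<longlonglongrightarrow> real (Suc n) * v * m n"
      unfolding Suc_rec[of _ "Suc n"] by (simp del: of_nat_Suc add: mult_ac)
    also have "real (Suc n) * v * m n = m (Suc (Suc n))"
      by (simp add: m_def normal_moment_Suc_Suc)
    finally have "(\<lambda>N. expectation (\<lambda>\<omega>. W N \<omega> ^ Suc (Suc n))) \<longlonglongrightarrow> m (Suc (Suc n))" .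
    moreover have "\<forall>i\<ge>1. (\<lambda>N. s N ^ Suc i * G N i (Suc n)) \<longlonglongrightarrow> (if i = 1 then v / 2 * m (Suc n) else 0)"
    proof (rule step)
      show "(\<lambda>N. expectation (\<lambda>\<omega>. W N \<omega> ^ Suc n)) \<longlonglongrightarrow> m (Suc n)" using Suc by blast
      show "\<forall>i\<ge>1. (\<lambda>N. s N ^ Suc i * G N i (Suc n - 1)) \<longlonglongrightarrow> (if i = 1 then v / 2 * m (Suc n - 1) else 0)"
        unfolding diff_Suc_1 using Suc by blast
    qed
    ultimately show ?case using Suc by blast
  qed
  then show ?thesis unfolding W_def m_def by blast
qed

end

lemma expectation_normal_power:
  fixes v :: real
  assumes v: "0 < v" and D: "D = density lborel (normal_density 0 (sqrt v))"
  shows "integrable D (\<lambda>x. x ^ n)" "integral\<^sup>L D (\<lambda>x. x ^ n) = normal_moment n * v ^ (n div 2)"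
proof -
  have s: "0 < sqrt v" using v by simp
  have int: "integrable lborel (\<lambda>x. normal_density 0 (sqrt v) x * x ^ n)"
    using integrable_normal_moment[OF s, of 0 n] by simp
  then show "integrable D (\<lambda>x. x ^ n)" unfolding D
    by (subst integrable_density) auto
  have "integral\<^sup>L D (\<lambda>x. x ^ n) = (LINT x|lborel. normal_density 0 (sqrt v) x * x ^ n)"
    unfolding D by (subst integral_density) auto
  also have "\<dots> = normal_moment n * v ^ (n div 2)"
  proof (cases "even n")
    case True
    then obtain k where k: "n = 2 * k" by (auto elim: evenE)
    have "fact (2 * k) / ((2 / v)^k * fact k) = normal_moment n * v ^ (n div 2)"
      unfolding k normal_moment_def using v by (simp add: power_divide field_simps)
    then show ?thesis using integral_normal_moment_even[OF s, of 0 k] k v by simp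
  next
    case False
    then obtain k where k: "n = 2 * k + 1" by (auto elim: oddE)
    then show ?thesis using integral_normal_moment_odd[OF s, of 0 k] False
      by (simp add: normal_moment_def)
  qed
  finally show "integral\<^sup>L D (\<lambda>x. x ^ n) = normal_moment n * v ^ (n div 2)" .
qed

text \<open>Method of moments: both characteristic functions are within their Taylor remainders
  $O(E|W|^{2n} |t|^{2n}/(2n)!)$ of the moment sums, and for the normal moments the remainder is
  $O((t^2 v/2)^n/n!)$.\<close>

lemma (in prob_space) weak_conv_normal_of_moments:
  fixes W :: "nat \<Rightarrow> 'a \<Rightarrow> real" and v :: real
  assumes W: "\<And>N. all_moments (W N)" and v: "0 < v"
    and lim: "\<And>n. (\<lambda>N. expectation (\<lambda>\<omega>. W N \<omega> ^ n)) \<longlonglongrightarrow> normal_moment n * v ^ (n div 2)"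
  shows "weak_conv_m (\<lambda>N. distr M borel (W N)) (density lborel (normal_density 0 (sqrt v)))"
proof -
  define D where "D = density lborel (normal_density 0 (sqrt v))"
  have [measurable]: "W N \<in> borel_measurable M" for N using W all_moments_measurable by blast
  have s: "0 < sqrt v" using v by simp
  interpret D: real_distribution D
    unfolding D_def real_distribution_def real_distribution_axioms_def
    using prob_space_normal_density[OF s] by simp
  have rd: "real_distribution (distr M borel (W N))" for N
    by (rule real_distribution_distr) simp
  define m where "m n = normal_moment n * v ^ (n div 2)" for n
  have mom: "integral\<^sup>L (distr M borel (W N)) (\<lambda>x. x ^ n) = expectation (\<lambda>\<omega>. W N \<omega> ^ n)" for N n
    by (subst integral_distr) auto
  have momabs: "integral\<^sup>L (distr M borel (W N)) (\<lambda>x. \<bar>x\<bar> ^ n) = expectation (\<lambda>\<omega>. \<bar>W N \<omega>\<bar> ^ n)" for N n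
    by (subst integral_distr) auto
  have momint: "integrable (distr M borel (W N)) (\<lambda>x. x ^ n)" for N n
    by (subst integrable_distr_eq) (auto intro!: all_moments_integrable all_moments_power W)
  have char_lim: "(\<lambda>N. char (distr M borel (W N)) t) \<longlonglongrightarrow> char D t" for t
  proof (rule metric_LIMSEQ_I)
    fix e :: real assume e: "0 < e"
    have "(\<lambda>p. (t\<^sup>2 * v / 2) ^ p / fact p) \<longlonglongrightarrow> 0" 
      using summable_LIMSEQ_zero[OF summable_exp[of "t\<^sup>2 * v / 2"]] by (simp add: field_simps)
    from order_tendstoD(2)[OF this, of "e / 12"] e
    \<comment> \<open>The factor 2 in \<open>r * m n\<close> turns e / 12 into e / 6. Two remainders
      below e / 6 and the e / 3 between the moment sums stay below e.\<close>
    obtain p where p: "(t\<^sup>2 * v / 2) ^ p / fact p < e / 12"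
      by (auto simp: eventually_sequentially)
    \<comment> \<open>An even order makes the absolute moment in the remainder a plain moment, to
      which \<open>lim\<close> applies.\<close>
    define n where "n = 2 * p"
    define S :: "(nat \<Rightarrow> real) \<Rightarrow> complex" where "S f = (\<Sum>k\<le>n. ((\<i> * t) ^ k / fact k) * f k)" for f
    define r where "r = 2 * \<bar>t\<bar> ^ n / fact n"
    have "\<bar>t\<bar> ^ n = (t\<^sup>2) ^ p" by (simp add: n_def power_mult)
    then have "r * m n = 2 * ((t\<^sup>2 * v / 2) ^ p / fact p)"
      by (simp add: r_def m_def n_def normal_moment_def power_mult_distrib power_divide field_simps)
    then have rm: "r * m n < e / 6" using p by linarith
    have cD: "cmod (char D t - S m) \<le> r * m n"
    proof -
      have "cmod (char D t - (\<Sum>k\<le>n. ((\<i> * t) ^ k / fact k) * D.expectation (\<lambda>x. x ^ k))) \<le> (2 * \<bar>t\<bar> ^ n / fact n) * D.expectation (\<lambda>x. \<bar>x\<bar> ^ n)"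
        by (rule D.char_approx1) (rule expectation_normal_power[OF v D_def])
      then show ?thesis unfolding S_def r_def
        by (simp add: expectation_normal_power(2)[OF v D_def] m_def n_def power_even_abs)
    qed
    have cW: "cmod (char (distr M borel (W N)) t - S (\<lambda>k. expectation (\<lambda>\<omega>. W N \<omega> ^ k))) \<le> r * expectation (\<lambda>\<omega>. W N \<omega> ^ n)" for N
    proof -
      interpret R: real_distribution "distr M borel (W N)" by (rule rd)
      have "cmod (char (distr M borel (W N)) t - (\<Sum>k\<le>n. ((\<i> * t) ^ k / fact k) * R.expectation (\<lambda>x. x ^ k))) \<le> (2 * \<bar>t\<bar> ^ n / fact n) * R.expectation (\<lambda>x. \<bar>x\<bar> ^ n)"
        by (rule R.char_approx1) (rule momint)
      then show ?thesis unfolding S_def r_def mom momabs by (simp add: n_def power_even_abs)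
    qed
    have "(\<lambda>N. S (\<lambda>k. expectation (\<lambda>\<omega>. W N \<omega> ^ k))) \<longlonglongrightarrow> S m"
      unfolding S_def m_def by (intro tendsto_intros lim)
    then have ev1: "\<forall>\<^sub>F N in sequentially. dist (S (\<lambda>k. expectation (\<lambda>\<omega>. W N \<omega> ^ k))) (S m) < e / 3"
      using e by (intro tendstoD) auto
    have "(\<lambda>N. r * expectation (\<lambda>\<omega>. W N \<omega> ^ n)) \<longlonglongrightarrow> r * m n"
      unfolding m_def by (intro tendsto_intros lim)
    then have ev2: "\<forall>\<^sub>F N in sequentially. r * expectation (\<lambda>\<omega>. W N \<omega> ^ n) < e / 6"
      using rm by (rule order_tendstoD)
    have "\<forall>\<^sub>F N in sequentially. dist (char (distr M borel (W N)) t) (char D t) < e"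
      using ev1 ev2
    proof eventually_elim
      case (elim N)
      have "dist (char (distr M borel (W N)) t) (char D t) \<le> dist (char (distr M borel (W N)) t) (S (\<lambda>k. expectation (\<lambda>\<omega>. W N \<omega> ^ k)))
         + dist (S (\<lambda>k. expectation (\<lambda>\<omega>. W N \<omega> ^ k))) (S m) + dist (S m) (char D t)"
        by (intro order_trans[OF dist_triangle add_right_mono] dist_triangle)
      also have "dist (S m) (char D t) < e / 6" using cD rm by (simp add: dist_norm norm_minus_commute)
      also have "dist (char (distr M borel (W N)) t) (S (\<lambda>k. expectation (\<lambda>\<omega>. W N \<omega> ^ k))) < e / 6"
        using cW[of N] elim(2) by (simp add: dist_norm)
      finally show ?case using elim(1) e by simp
    qed
    then show "\<exists>no. \<forall>n\<ge>no. dist (char (distr M borel (W n)) t) (char D t) < e"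
      by (simp add: eventually_sequentially)
  qed
  show ?thesis unfolding D_def[symmetric]
    by (rule levy_continuity[OF rd D.real_distribution_axioms char_lim])
qed

section \<open>Riemann--Stieltjes integrals\<close>

text \<open>Integration by parts: for smooth \<open>f\<close> and merely continuous
  \<open>g\<close>, the increments of this function are the integral of \<open>f\<close> against
  \<open>g\<close>. Stochastic integrals thus exist path by path.\<close>

definition rs_primitive ::
    "(real \<Rightarrow> real) \<Rightarrow> (real \<Rightarrow> real) \<Rightarrow> (real \<Rightarrow> real) \<Rightarrow> real \<Rightarrow> real \<Rightarrow> real" where
  "rs_primitive f f' g a t = f t * g t - integral {a..t} (\<lambda>u. g u * f' u)"

text \<open>Splitting at the tag \<open>x\<close>, the error is the integral of
  \<open>(g - g l) * f'\<close> over \<open>{l..x}\<close> plus that of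
  \<open>(g - g r) * f'\<close> over \<open>{x..r}\<close>. The oscillation of \<open>g\<close>
  bounds both.\<close>

lemma rs_primitive_piece:
  fixes f f' g :: "real \<Rightarrow> real"
  assumes f: "\<And>x. (f has_real_derivative f' x) (at x)"
    and f': "continuous_on {a..b} f'" and g: "continuous_on {a..b} g"
    and L: "\<And>x. x \<in> {a..b} \<Longrightarrow> \<bar>f' x\<bar> \<le> L"
    and ab: "a \<le> l" "l \<le> x" "x \<le> r" "r \<le> b"
    and osc: "\<And>u v. u \<in> {l..r} \<Longrightarrow> v \<in> {l..r} \<Longrightarrow> \<bar>g u - g v\<bar> \<le> \<eta>"
  shows "\<bar>f x * (g r - g l) - (rs_primitive f f' g a r - rs_primitive f f' g a l)\<bar> \<le> \<eta> * L * (r - l)"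
proof -
  have cont: "continuous_on {a..b} (\<lambda>u. g u * f' u)" by (intro continuous_intros f' g)
  have int: "(\<lambda>u. g u * f' u) integrable_on {p..q}" if "a \<le> p" "q \<le> b" for p q
    using that by (intro integrable_continuous_interval continuous_on_subset[OF cont]) auto
  have ftc: "(f' has_integral (f q - f p)) {p..q}" if "p \<le> q" for p q
    using that f by (intro fundamental_theorem_of_calculus)
      (auto simp: has_real_derivative_iff_has_vector_derivative[symmetric] intro: has_field_derivative_at_within)
  have bound: "\<bar>integral {p..q} (\<lambda>u. g u * f' u) - c * (f q - f p)\<bar> \<le> \<eta> * L * (q - p)"
    if pq: "l \<le> p" "p \<le> q" "q \<le> r" and c: "c = g l \<or> c = g r" for p q c
  proof -
    have "((\<lambda>u. g u * f' u) has_integral integral {p..q} (\<lambda>u. g u * f' u)) {p..q}"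
      using int[of p q] pq ab by (auto intro: integrable_integral)
    from has_integral_diff[OF this has_integral_mult_right[OF ftc[OF pq(2)], of c]]
    have "((\<lambda>u. (g u - c) * f' u) has_integral (integral {p..q} (\<lambda>u. g u * f' u) - c * (f q - f p))) (cbox p q)"
      by (simp add: algebra_simps)
    then have "norm (integral {p..q} (\<lambda>u. g u * f' u) - c * (f q - f p)) \<le> (\<eta> * L) * measure lborel (cbox p q)"
    proof (rule has_integral_bound[rotated])
      have "0 \<le> \<eta>" using osc[of l l] ab by auto
      moreover have "0 \<le> L" using L[of l] ab by force
      ultimately show "0 \<le> \<eta> * L" by simp
      fix u assume u: "u \<in> cbox p q"
      have "\<bar>g u - c\<bar> \<le> \<eta>" using c osc[of u l] osc[of u r] u pq by auto
      moreover have "\<bar>f' u\<bar> \<le> L" using L u pq ab by auto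
      ultimately show "norm ((g u - c) * f' u) \<le> \<eta> * L"
        using \<open>0 \<le> \<eta>\<close> by (auto simp: abs_mult intro!: mult_mono)
    qed
    then show ?thesis using pq by simp
  qed
  have I1: "integral {a..r} (\<lambda>u. g u * f' u) = integral {a..l} (\<lambda>u. g u * f' u) + integral {l..r} (\<lambda>u. g u * f' u)"
    using ab by (intro Henstock_Kurzweil_Integration.integral_combine[symmetric] int) auto
  have I2: "integral {l..r} (\<lambda>u. g u * f' u) = integral {l..x} (\<lambda>u. g u * f' u) + integral {x..r} (\<lambda>u. g u * f' u)"
    using ab by (intro Henstock_Kurzweil_Integration.integral_combine[symmetric] int) auto
  have "f x * (g r - g l) - (rs_primitive f f' g a r - rs_primitive f f' g a l) =
     (integral {l..x} (\<lambda>u. g u * f' u) - g l * (f x - f l)) + (integral {x..r} (\<lambda>u. g u * f' u) - g r * (f r - f x))"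
    unfolding rs_primitive_def I1 I2 by (simp add: algebra_simps)
  moreover have "\<bar>integral {l..x} (\<lambda>u. g u * f' u) - g l * (f x - f l)\<bar> \<le> \<eta> * L * (x - l)"
    by (rule bound) (use ab in auto)
  moreover have "\<bar>integral {x..r} (\<lambda>u. g u * f' u) - g r * (f r - f x)\<bar> \<le> \<eta> * L * (r - x)"
    by (rule bound) (use ab in auto)
  moreover have "\<eta> * L * (x - l) + \<eta> * L * (r - x) = \<eta> * L * (r - l)" by (simp add: algebra_simps)
  ultimately show ?thesis by linarith
qed

lemma rs_sum_error:
  fixes f f' g :: "real \<Rightarrow> real"
  assumes f: "\<And>x. (f has_real_derivative f' x) (at x)"
    and f': "continuous_on {a..b} f'" and g: "continuous_on {a..b} g"
    and ab: "a \<le> b" and e: "0 < e"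
  obtains d where "0 < d"
    "\<And>l x r. a \<le> l \<Longrightarrow> l \<le> x \<Longrightarrow> x \<le> r \<Longrightarrow> r \<le> b \<Longrightarrow> r - l < d \<Longrightarrow>
      \<bar>f x * (g r - g l) - (rs_primitive f f' g a r - rs_primitive f f' g a l)\<bar> \<le> e * (r - l)"
proof -
  have "compact (f' ` {a..b})" using f' by (intro compact_continuous_image) auto
  then obtain L0 where L0: "\<And>x. x \<in> {a..b} \<Longrightarrow> \<bar>f' x\<bar> \<le> L0"
    by (metis bounded_real compact_imp_bounded imageI)
  \<comment> \<open>Adding 1 makes the bound positive, so that \<open>e / L\<close> can serve as a
    tolerance.\<close>
  define L where "L = L0 + 1"
  have L: "\<And>x. x \<in> {a..b} \<Longrightarrow> \<bar>f' x\<bar> \<le> L" using L0 by (force simp: L_def)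
  have Lpos: "0 < L" using L0[of a] ab by (force simp: L_def)
  have "uniformly_continuous_on {a..b} g" using g by (intro compact_uniformly_continuous) auto
  then obtain d where d: "0 < d" "\<And>u v. u \<in> {a..b} \<Longrightarrow> v \<in> {a..b} \<Longrightarrow> dist v u < d \<Longrightarrow> dist (g v) (g u) < e / L"
    unfolding uniformly_continuous_on_def using e Lpos by (metis divide_pos_pos)
  show thesis
  proof (rule that[OF d(1)])
    fix l x r assume as: "a \<le> l" "l \<le> x" "x \<le> r" "r \<le> b" "r - l < d"
    have "\<bar>f x * (g r - g l) - (rs_primitive f f' g a r - rs_primitive f f' g a l)\<bar> \<le> (e / L) * L * (r - l)"
    proof (rule rs_primitive_piece[OF f f' g L as(1-4)])
      fix u v assume uv: "u \<in> {l..r}" "v \<in> {l..r}"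
      then have "dist (g u) (g v) < e / L" using as by (intro d(2)) (auto simp: dist_real_def)
      then show "\<bar>g u - g v\<bar> \<le> e / L" by (simp add: dist_real_def)
    qed auto
    then show "\<bar>f x * (g r - g l) - (rs_primitive f f' g a r - rs_primitive f f' g a l)\<bar> \<le> e * (r - l)"
      using Lpos by simp
  qed
qed

lemma has_rs_integral_parts:
  fixes f f' g :: "real \<Rightarrow> real"
  assumes f: "\<And>x. (f has_real_derivative f' x) (at x)"
    and f': "continuous_on {a..b} f'" and g: "continuous_on {a..b} g"
    and ab: "a \<le> b"
  shows "has_rs_integral f g a b (rs_primitive f f' g a b - rs_primitive f f' g a a)"
  unfolding has_rs_integral_def
proof safe
  fix e :: real assume e: "0 < e"
  define e' where "e' = e / (b - a + 1)"
  have e': "0 < e'" using e ab by (simp add: e'_def)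
  have "e' * (b - a) < e' * (b - a + 1)" using e' by simp
  also have "\<dots> = e" using ab by (simp add: e'_def)
  finally have e'': "e' * (b - a) < e" .
  let ?F = "rs_primitive f f' g a"
  obtain d where d: "0 < d"
    "\<And>l x r. a \<le> l \<Longrightarrow> l \<le> x \<Longrightarrow> x \<le> r \<Longrightarrow> r \<le> b \<Longrightarrow> r - l < d \<Longrightarrow>
      \<bar>f x * (g r - g l) - (?F r - ?F l)\<bar> \<le> e' * (r - l)"
    using rs_sum_error[OF f f' g ab e'] by metis
  show "\<exists>d>0. \<forall>p. p tagged_division_of {a..b} \<and> (\<lambda>x. ball x d) fine p \<longrightarrow>
    \<bar>(\<Sum>(x, K)\<in>p. f x * (g (Sup K) - g (Inf K))) - (?F b - ?F a)\<bar> < e"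
  \<comment> \<open>Pieces that lie in a ball of radius \<open>d / 2\<close> around their tag have
    length below \<open>d\<close>.\<close>
  proof (intro exI[of _ "d / 2"] conjI allI impI)
    show "0 < d / 2" using d by simp
    fix p assume p: "p tagged_division_of {a..b} \<and> (\<lambda>x. ball x (d / 2)) fine p"
    have p': "p tagged_division_of cbox a b" using p by simp
    have piece: "\<bar>f x * (g (Sup K) - g (Inf K)) - (?F (Sup K) - ?F (Inf K))\<bar> \<le> e' * measure lborel K"
      if xK: "(x, K) \<in> p" for x K
    proof -
      obtain l r where K: "K = cbox l r" using tagged_division_ofD(4)[OF p' xK] by blast
      have x: "x \<in> K" using tagged_division_ofD(2)[OF p' xK] .
      have sub: "K \<subseteq> {a..b}" using tagged_division_ofD(3)[OF p' xK] by simp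
      have fin: "K \<subseteq> ball x (d / 2)" using p xK by (auto simp: fine_def)
      have lr: "l \<le> x" "x \<le> r" using x K by auto
      have lr': "l \<in> K" "r \<in> K" using lr K by auto
      have "dist x l < d / 2" "dist x r < d / 2" using fin lr' by (auto simp: subset_iff)
      then have "r - l < d" unfolding dist_real_def by arith
      moreover have "Sup K = r" "Inf K = l" "measure lborel K = r - l" using lr K by auto
      moreover have "a \<le> l" "r \<le> b" using sub lr' by auto
      ultimately show ?thesis using d(2)[of l x r] lr by simp
    qed
    have "(\<Sum>(x, K)\<in>p. ?F (Sup K) - ?F (Inf K)) = ?F b - ?F a"
      by (rule additive_tagged_division_1[OF ab p[THEN conjunct1]])
    then have "\<bar>(\<Sum>(x, K)\<in>p. f x * (g (Sup K) - g (Inf K))) - (?F b - ?F a)\<bar> =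
       \<bar>\<Sum>(x, K)\<in>p. f x * (g (Sup K) - g (Inf K)) - (?F (Sup K) - ?F (Inf K))\<bar>"
      by (simp add: sum_subtractf case_prod_beta)
    also have "\<dots> \<le> (\<Sum>(x, K)\<in>p. e' * measure lborel K)"
      by (rule order_trans[OF sum_abs]) (auto intro!: sum_mono piece)
    also have "\<dots> = e' * measure lborel (cbox a b)"
      using additive_content_tagged_division[OF p'] by (simp add: sum_distrib_left[symmetric] case_prod_beta)
    also have "\<dots> < e" using e'' ab by simp
    finally show "\<bar>(\<Sum>(x, K)\<in>p. f x * (g (Sup K) - g (Inf K))) - (?F b - ?F a)\<bar> < e" .
  qed
qed

lemma has_rs_integral_unique:
  assumes "has_rs_integral f g a b I" "has_rs_integral f g a b I'"
  shows "I = I'"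
proof (rule ccontr)
  assume "I \<noteq> I'"
  define e where "e = \<bar>I - I'\<bar> / 2"
  have e: "0 < e" using \<open>I \<noteq> I'\<close> by (simp add: e_def)
  from assms(1)[unfolded has_rs_integral_def, rule_format, OF e]
  obtain d where d: "0 < d" "\<forall>p. p tagged_division_of {a..b} \<and> (\<lambda>x. ball x d) fine p \<longrightarrow>
      \<bar>(\<Sum>(x, K)\<in>p. f x * (g (Sup K) - g (Inf K))) - I\<bar> < e" by (elim exE conjE)
  from assms(2)[unfolded has_rs_integral_def, rule_format, OF e]
  obtain d' where d': "0 < d'" "\<forall>p. p tagged_division_of {a..b} \<and> (\<lambda>x. ball x d') fine p \<longrightarrow>
      \<bar>(\<Sum>(x, K)\<in>p. f x * (g (Sup K) - g (Inf K))) - I'\<bar> < e" by (elim exE conjE)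
  have "gauge (\<lambda>x::real. ball x (min d d'))" using d(1) d'(1) by (simp add: gauge_def)
  then obtain p where p: "p tagged_division_of {a..b}" "(\<lambda>x. ball x (min d d')) fine p"
    using fine_division_exists_real by blast
  then have "(\<lambda>x. ball x d) fine p" "(\<lambda>x. ball x d') fine p" by (fastforce simp: fine_def)+
  with d(2) d'(2) p(1) have "\<bar>(\<Sum>(x, K)\<in>p. f x * (g (Sup K) - g (Inf K))) - I\<bar> < e"
      "\<bar>(\<Sum>(x, K)\<in>p. f x * (g (Sup K) - g (Inf K))) - I'\<bar> < e"
    by blast+
  moreover have "\<bar>I - I'\<bar> \<le> \<bar>S - I\<bar> + \<bar>S - I'\<bar>" for S by arith
  ultimately have "\<bar>I - I'\<bar> < e + e" by (meson add_strict_mono le_less_trans)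
  then show False by (simp add: e_def)
qed

lemma rs_integral_parts:
  fixes f f' g :: "real \<Rightarrow> real"
  assumes "\<And>x. (f has_real_derivative f' x) (at x)"
    and "continuous_on {a..b} f'" and "continuous_on {a..b} g"
    and "a \<le> b"
  shows "rs_integral f g a b = rs_primitive f f' g a b - rs_primitive f f' g a a"
  unfolding rs_integral_def
  using has_rs_integral_parts[OF assms] has_rs_integral_unique by blast

definition rs_sum :: "(real \<Rightarrow> real) \<Rightarrow> (real \<Rightarrow> real) \<Rightarrow> real \<Rightarrow> nat \<Rightarrow> real" where
  "rs_sum f g t n = (\<Sum>j<n. f (t * real j / real n) * (g (t * real (Suc j) / real n) - g (t * real j / real n)))"

text \<open>The partitions do not depend on the path. The integral therefore becomes a pointwise
  limit of finite linear combinations of the driving process, from which its law is obtained. The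
  index \<open>Suc n\<close> avoids the empty partition.\<close>

lemma rs_sum_tendsto:
  fixes f f' g :: "real \<Rightarrow> real"
  assumes f: "\<And>x. (f has_real_derivative f' x) (at x)"
    and f': "continuous_on {0..t} f'" and g: "continuous_on {0..t} g"
    and t: "0 \<le> t"
  shows "(\<lambda>n. rs_sum f g t (Suc n)) \<longlonglongrightarrow> rs_integral f g 0 t"
proof (rule metric_LIMSEQ_I)
  let ?F = "rs_primitive f f' g 0"
  fix e :: real assume e: "0 < e"
  define e' where "e' = e / (t + 1)"
  have e': "0 < e'" using e t by (simp add: e'_def)
  have "e' * t < e' * (t + 1)" using e' by simp
  also have "\<dots> = e" using t by (simp add: e'_def)
  finally have e'': "e' * t < e" .
  obtain d where d: "0 < d"
    "\<And>l x r. 0 \<le> l \<Longrightarrow> l \<le> x \<Longrightarrow> x \<le> r \<Longrightarrow> r \<le> t \<Longrightarrow> r - l < d \<Longrightarrow>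
      \<bar>f x * (g r - g l) - (?F r - ?F l)\<bar> \<le> e' * (r - l)"
    using rs_sum_error[OF f f' g t e'] by metis
  obtain n0 :: nat where n0: "t / d < n0" using reals_Archimedean2 by blast
  show "\<exists>no. \<forall>n\<ge>no. dist (rs_sum f g t (Suc n)) (rs_integral f g 0 t) < e"
  proof (intro exI[of _ n0] allI impI)
    fix n assume n: "n0 \<le> n"
    define m where "m = Suc n"
    define \<tau> where "\<tau> j = t * real j / real m" for j :: nat
    have m: "0 < m" "t / d < m" using n n0 by (auto simp: m_def)
    have diff: "\<tau> (Suc j) - \<tau> j = t / m" for j using m by (simp add: \<tau>_def field_simps)
    have small: "t / m < d" using m d(1) by (simp add: field_simps)
    have \<tau>0: "\<tau> 0 = 0" "\<tau> m = t" using m by (auto simp: \<tau>_def)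
    have "rs_integral f g 0 t = ?F (\<tau> m) - ?F (\<tau> 0)" unfolding \<tau>0
      by (rule rs_integral_parts[OF f f' g t])
    also have "\<dots> = (\<Sum>j<m. ?F (\<tau> (Suc j)) - ?F (\<tau> j))" by (rule sum_lessThan_telescope[symmetric])
    finally have "dist (rs_sum f g t m) (rs_integral f g 0 t) =
       \<bar>\<Sum>j<m. f (\<tau> j) * (g (\<tau> (Suc j)) - g (\<tau> j)) - (?F (\<tau> (Suc j)) - ?F (\<tau> j))\<bar>"
      by (simp add: rs_sum_def dist_real_def \<tau>_def sum_subtractf)
    also have "\<dots> \<le> (\<Sum>j<m. e' * (t / m))"
    proof (rule order_trans[OF sum_abs], rule sum_mono)
      fix j assume j: "j \<in> {..<m}"
      have "\<tau> (Suc j) \<le> t" using j m mult_left_mono[of "real (Suc j)" "real m" t] t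
        by (simp add: \<tau>_def pos_divide_le_eq mult.commute del: of_nat_Suc)
      moreover have "0 \<le> \<tau> j" using t by (simp add: \<tau>_def)
      moreover have "\<tau> j \<le> \<tau> (Suc j)" using diff[of j] t by (simp add: algebra_simps)
      ultimately show "\<bar>f (\<tau> j) * (g (\<tau> (Suc j)) - g (\<tau> j)) - (?F (\<tau> (Suc j)) - ?F (\<tau> j))\<bar> \<le> e' * (t / m)"
        using d(2)[of "\<tau> j" "\<tau> j" "\<tau> (Suc j)"] small diff[of j] by auto
    qed
    also have "\<dots> = e' * t" using m by simp
    also have "\<dots> < e" by (rule e'')
    finally show "dist (rs_sum f g t (Suc n)) (rs_integral f g 0 t) < e" by (simp add: m_def)
  qed
qed

lemma continuous_on_rs_integral:
  fixes f f' g :: "real \<Rightarrow> real"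
  assumes f: "\<And>x. (f has_real_derivative f' x) (at x)"
    and f': "continuous_on {0..T} f'" and g: "continuous_on {0..T} g"
  shows "continuous_on {0..T} (\<lambda>t. rs_integral f g 0 t)"
proof -
  have eq: "rs_integral f g 0 t = rs_primitive f f' g 0 t - rs_primitive f f' g 0 0" if "t \<in> {0..T}" for t
    using that by (intro rs_integral_parts f continuous_on_subset[OF f'] continuous_on_subset[OF g]) auto
  have "continuous_on {0..T} f" 
    by (rule DERIV_continuous_on) (rule has_field_derivative_at_within[OF f])
  then have "continuous_on {0..T} (\<lambda>t. rs_primitive f f' g 0 t - rs_primitive f f' g 0 0)"
    unfolding rs_primitive_def
    by (intro continuous_intros g indefinite_integral_continuous_1 integrable_continuous_interval f')
  then show ?thesis by (rule continuous_on_eq) (simp add: eq)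
qed

section \<open>The covariance of the time-changed fractional Brownian motion\<close>

definition fbm_cov :: "real \<Rightarrow> real \<Rightarrow> real \<Rightarrow> real" where
  "fbm_cov H s t = (s powr (2 * H) + t powr (2 * H) - \<bar>t - s\<bar> powr (2 * H)) / 2"

text \<open>The mixed derivative of the covariance of the time-changed process $B_{a_u}$.\<close>

definition cov_density :: "real \<Rightarrow> real \<Rightarrow> real \<Rightarrow> real" where
  "cov_density H u v = alpha_H H * \<bar>fou_time H u - fou_time H v\<bar> powr (2 * H - 2) * exp (u / H) * exp (v / H)"

text \<open>What remains of \<open>cov_density\<close> once \<open>exp (u + v)\<close> and the
  constant are taken out: the integrator \<open>exp (- s) dB\<close> at the changed time has
  stationary increments. At 0 it behaves like a multiple of |w|^(2H-2), which is integrable, and it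
  decays like exp (-(1/H - 1) |w|).\<close>

definition stat_kernel :: "real \<Rightarrow> real \<Rightarrow> real" where
  "stat_kernel H w = exp (- (1 / H - 1) * \<bar>w\<bar>) * (1 - exp (- \<bar>w\<bar> / H)) powr (2 * H - 2)"

definition kernel_const :: "real \<Rightarrow> real" where
  "kernel_const H = alpha_H H * H powr (2 * H - 2)"

lemma stat_kernel_nonneg [simp]: "0 \<le> stat_kernel H w"
  by (simp add: stat_kernel_def)

lemma stat_kernel_minus [simp]: "stat_kernel H (- w) = stat_kernel H w"
  by (simp add: stat_kernel_def)

lemma stat_kernel_measurable [measurable]: "stat_kernel H \<in> borel_measurable borel"
  unfolding stat_kernel_def by measurable

lemma fou_time_measurable [measurable]: "fou_time H \<in> borel_measurable borel"
  unfolding fou_time_def by measurable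

lemma cov_density_measurable [measurable]:
  "(\<lambda>p. cov_density H (fst p) (snd p)) \<in> borel_measurable (borel \<Otimes>\<^sub>M borel)"
  unfolding cov_density_def by measurable

locale hurst =
  fixes H :: real
  assumes H_half: "1 / 2 < H" and H_1: "H < 1"
begin

lemma H_pos: "0 < H" using H_half by simp

lemma kernel_const_pos: "0 < kernel_const H"
  using H_half H_pos by (simp add: kernel_const_def alpha_H_def)

lemma cov_density_nonneg: "0 \<le> cov_density H u v"
  using H_half by (simp add: cov_density_def alpha_H_def)

lemma cov_density_commute: "cov_density H u v = cov_density H v u"
  by (simp add: cov_density_def abs_minus_commute mult_ac)

text \<open>For v <= u the factor \<open>exp (u / H)\<close> is pulled out of the difference of
  times. The exponents then add up to 2 u - u/H + v/H, which is (u + v) - (1/H - 1) (u - v).\<close>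

lemma cov_density_eq_stat_kernel:
  "cov_density H u v = kernel_const H * exp (u + v) * stat_kernel H (u - v)"
proof -
  have *: "cov_density H u v = kernel_const H * exp (u + v) * stat_kernel H (u - v)" if "v \<le> u" for u v
  proof -
    have "fou_time H u - fou_time H v = H * exp (u / H) * (1 - exp (- (u - v) / H))"
      using H_pos by (simp add: fou_time_def algebra_simps exp_add[symmetric] diff_divide_distrib)
    moreover have nn: "0 \<le> 1 - exp (- (u - v) / H)" using that H_pos by (simp add: divide_nonpos_pos)
    ultimately have "\<bar>fou_time H u - fou_time H v\<bar> powr (2 * H - 2) =
       H powr (2 * H - 2) * exp (u / H) powr (2 * H - 2) * (1 - exp (- (u - v) / H)) powr (2 * H - 2)"
      using H_pos by (simp add: abs_mult powr_mult)
    moreover have "exp (u / H) powr (2 * H - 2) * exp (u / H) * exp (v / H) = exp (u + v) * exp (- (1 / H - 1) * (u - v))"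
      using H_pos by (simp add: powr_def exp_add[symmetric] field_simps)
    ultimately show ?thesis using that
      by (simp add: cov_density_def stat_kernel_def kernel_const_def mult_ac)
  qed
  show ?thesis
  proof (cases "v \<le> u")
    case False
    then show ?thesis using *[of u v] stat_kernel_minus[of H "u - v"]
      by (simp add: cov_density_commute[of u v] add.commute)
  qed (rule *)
qed

section \<open>Rectangular increments of the covariance as double integrals of its density\<close>

lemma fou_time_pos: "0 < fou_time H t" using H_pos by (simp add: fou_time_def)

lemma DERIV_fou_time: "(fou_time H has_real_derivative exp (t / H)) (at t)"
  unfolding fou_time_def using H_pos by (auto intro!: derivative_eq_intros)

lemma fou_time_eq_iff: "fou_time H s = fou_time H t \<longleftrightarrow> s = t"
  using H_pos by (simp add: fou_time_def)

text \<open>The function behind the covariance and its derivative. The second derivative blows up at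
  0, but both functions are continuous there because 2H - 1 > 0; this is what the fundamental
  theorem with exceptional points asks for.\<close>

definition half_pow :: "real \<Rightarrow> real" where "half_pow x = \<bar>x\<bar> powr (2 * H) / 2"
definition half_pow' :: "real \<Rightarrow> real" where "half_pow' x = H * sgn x * \<bar>x\<bar> powr (2 * H - 1)"

lemma DERIV_abs_powr:
  fixes x a :: real
  assumes "x \<noteq> 0"
  shows "((\<lambda>x. \<bar>x\<bar> powr a) has_real_derivative a * sgn x * \<bar>x\<bar> powr (a - 1)) (at x)"
proof -
  have "(abs has_real_derivative sgn x) (at x)"
  proof (cases "0 < x")
    case True
    have "((\<lambda>x. x) has_real_derivative 1) (at x)" by (rule DERIV_ident)
    then have "(abs has_real_derivative 1) (at x)"
      by (rule has_field_derivative_transform_within_open[where S="{0<..}"]) (use True in auto)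
    then show ?thesis using True by simp
  next
    case False
    have "((\<lambda>x. - x) has_real_derivative - 1) (at x)" by (auto intro!: derivative_eq_intros)
    then have "(abs has_real_derivative - 1) (at x)"
      by (rule has_field_derivative_transform_within_open[where S="{..<0}"]) (use False assms in auto)
    then show ?thesis using False assms by simp
  qed
  from DERIV_fun_powr[OF this, of a] show ?thesis using assms by (simp add: mult_ac)
qed

lemma DERIV_half_pow: "x \<noteq> 0 \<Longrightarrow> (half_pow has_real_derivative half_pow' x) (at x)"
  using DERIV_cdivide[OF DERIV_abs_powr[of x "2 * H"], of 2]
  by (simp add: half_pow_def[abs_def] half_pow'_def mult_ac)

lemma DERIV_half_pow': 
  assumes "x \<noteq> 0" shows "(half_pow' has_real_derivative alpha_H H * \<bar>x\<bar> powr (2 * H - 2)) (at x)"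
proof -
  have "((\<lambda>y. H * sgn x * \<bar>y\<bar> powr (2 * H - 1)) has_real_derivative H * sgn x * ((2 * H - 1) * sgn x * \<bar>x\<bar> powr (2 * H - 1 - 1))) (at x)"
    by (intro DERIV_cmult DERIV_abs_powr assms)
  moreover have "H * sgn x * ((2 * H - 1) * sgn x * \<bar>x\<bar> powr (2 * H - 1 - 1)) = alpha_H H * \<bar>x\<bar> powr (2 * H - 2)"
    using assms by (simp add: alpha_H_def sgn_if)
  ultimately have D: "((\<lambda>y. H * sgn x * \<bar>y\<bar> powr (2 * H - 1)) has_real_derivative alpha_H H * \<bar>x\<bar> powr (2 * H - 2)) (at x)"
    by (rule DERIV_cong)
  then show ?thesis
  proof (rule has_field_derivative_transform_within_open)
    \<comment> \<open>The open half-line that contains \<open>x\<close>, on which the sign is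
      constant.\<close>
    show "open {y. 0 < x * y}" by (intro open_Collect_less continuous_intros)
    show "x \<in> {y. 0 < x * y}" using assms by (auto simp: zero_less_mult_iff)
    fix y assume "y \<in> {y. 0 < x * y}"
    then have "sgn x = sgn y" by (auto simp: zero_less_mult_iff)
    then show "H * sgn x * \<bar>y\<bar> powr (2 * H - 1) = half_pow' y" by (simp add: half_pow'_def)
  qed
qed

lemma isCont_half_pow: "isCont half_pow x"
  unfolding half_pow_def[abs_def] isCont_def using H_pos by (intro tendsto_intros tendsto_powr') auto

lemma isCont_half_pow': "isCont half_pow' x"
proof (cases "x = 0")
  case True
  have "((\<lambda>x. H * \<bar>x\<bar> powr (2 * H - 1)) \<longlongrightarrow> H * \<bar>0\<bar> powr (2 * H - 1)) (at 0)"
    using H_half by (intro tendsto_intros tendsto_powr') auto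
  then have "((\<lambda>x. H * \<bar>x\<bar> powr (2 * H - 1)) \<longlongrightarrow> 0) (at (0::real))" by simp
  then have "(half_pow' \<longlongrightarrow> 0) (at 0)"
    by (rule Lim_null_comparison[rotated]) (use H_pos in \<open>auto simp: half_pow'_def abs_mult abs_sgn_eq\<close>)
  then show ?thesis using True by (simp add: isCont_def half_pow'_def)
next
  case False
  then show ?thesis using DERIV_half_pow' DERIV_isCont by blast
qed

lemma continuous_on_half_pow_comp:
  assumes "continuous_on S f"
  shows "continuous_on S (\<lambda>x. half_pow (f x))" "continuous_on S (\<lambda>x. half_pow' (f x))"
  using assms isCont_half_pow isCont_half_pow'
  by (auto intro: continuous_on_compose2[of UNIV half_pow S f] continuous_on_compose2[of UNIV half_pow' S f]
      continuous_at_imp_continuous_on)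

lemma continuous_on_fou_time: "continuous_on S (fou_time H)"
  using DERIV_isCont[OF DERIV_fou_time] by (intro continuous_at_imp_continuous_on) auto

lemma has_integral_cov_density:
  assumes "t \<le> t'"
  shows "(cov_density H u has_integral
     exp (u / H) * (half_pow' (fou_time H u - fou_time H t) - half_pow' (fou_time H u - fou_time H t'))) {t..t'}"
proof -
  let ?G = "\<lambda>v. - exp (u / H) * half_pow' (fou_time H u - fou_time H v)"
  have "(cov_density H u has_integral ?G t' - ?G t) {t..t'}"
  proof (rule fundamental_theorem_of_calculus_interior_strong[where S="{u}"])
    fix v assume v: "v \<in> {t<..<t'} - {u}"
    then have ne: "fou_time H u - fou_time H v \<noteq> 0" by (simp add: fou_time_eq_iff)
    have "((\<lambda>v. half_pow' (fou_time H u - fou_time H v)) has_real_derivative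
       (alpha_H H * \<bar>fou_time H u - fou_time H v\<bar> powr (2 * H - 2)) * (0 - exp (v / H))) (at v)"
      by (rule DERIV_chain2[where f = half_pow' and g = "\<lambda>v. fou_time H u - fou_time H v", OF DERIV_half_pow'[OF ne]]) (intro DERIV_diff DERIV_const DERIV_fou_time)
    from DERIV_cmult[OF this, of "- exp (u / H)"]
    show "(?G has_vector_derivative cov_density H u v) (at v)"
      by (simp add: has_real_derivative_iff_has_vector_derivative[symmetric] cov_density_def mult_ac)
    next
    show "continuous_on {t..t'} ?G"
      by (intro continuous_intros continuous_on_half_pow_comp continuous_on_fou_time)
  qed (use assms in auto)
  then show ?thesis by (simp add: algebra_simps)
qed

text \<open>Half-open intervals are used from here on, since the cells of a partition have to be
  disjoint.\<close>

lemma nn_integral_cov_density_inner: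
  assumes "t \<le> t'"
  shows "(\<integral>\<^sup>+v. ennreal (cov_density H u v) * indicator {t<..t'} v \<partial>lborel) =
     ennreal (exp (u / H) * (half_pow' (fou_time H u - fou_time H t) - half_pow' (fou_time H u - fou_time H t')))"
proof -
  have "(\<integral>\<^sup>+v. ennreal (cov_density H u v) * indicator {t<..t'} v \<partial>lborel) =
     (\<integral>\<^sup>+v. ennreal (cov_density H u v) * indicator {t..t'} v \<partial>lborel)"
    by (rule nn_integral_cong_AE) (use AE_lborel_singleton[of t] in eventually_elim, auto split: split_indicator)
  also have "\<dots> = ennreal (exp (u / H) * (half_pow' (fou_time H u - fou_time H t) - half_pow' (fou_time H u - fou_time H t')))"
    by (rule nn_integral_has_integral_lebesgue'[OF cov_density_nonneg has_integral_cov_density[OF assms]])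
  finally show ?thesis .
qed

lemma has_integral_cov_density_outer:
  assumes s: "s \<le> s'"
  shows "((\<lambda>u. exp (u / H) * (half_pow' (fou_time H u - fou_time H t) - half_pow' (fou_time H u - fou_time H t'))) has_integral
     fbm_cov H (fou_time H s') (fou_time H t') - fbm_cov H (fou_time H s') (fou_time H t)
            - fbm_cov H (fou_time H s) (fou_time H t') + fbm_cov H (fou_time H s) (fou_time H t)) {s..s'}"
proof -
  let ?a = "fou_time H"
  let ?h = "\<lambda>u. exp (u / H) * (half_pow' (?a u - ?a t) - half_pow' (?a u - ?a t'))"
  let ?G = "\<lambda>u. half_pow (?a u - ?a t) - half_pow (?a u - ?a t')"
  have "(?h has_integral ?G s' - ?G s) {s..s'}"
  proof (rule fundamental_theorem_of_calculus_interior_strong[where S="{t, t'}"])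
    fix u assume u: "u \<in> {s<..<s'} - {t, t'}"
    then have ne: "?a u - ?a t \<noteq> 0" "?a u - ?a t' \<noteq> 0" by (auto simp: fou_time_eq_iff)
    have "((\<lambda>u. half_pow (?a u - ?a t)) has_real_derivative half_pow' (?a u - ?a t) * (exp (u / H) - 0)) (at u)"
      by (rule DERIV_chain2[where f = half_pow and g = "\<lambda>u. ?a u - ?a t", OF DERIV_half_pow[OF ne(1)]]) (intro DERIV_diff DERIV_const DERIV_fou_time)
    moreover have "((\<lambda>u. half_pow (?a u - ?a t')) has_real_derivative half_pow' (?a u - ?a t') * (exp (u / H) - 0)) (at u)"
      by (rule DERIV_chain2[where f = half_pow and g = "\<lambda>u. ?a u - ?a t'", OF DERIV_half_pow[OF ne(2)]]) (intro DERIV_diff DERIV_const DERIV_fou_time)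
    ultimately have "(?G has_real_derivative half_pow' (?a u - ?a t) * (exp (u / H) - 0) - half_pow' (?a u - ?a t') * (exp (u / H) - 0)) (at u)"
      by (rule DERIV_diff)
    then show "(?G has_vector_derivative ?h u) (at u)"
      by (simp add: has_real_derivative_iff_has_vector_derivative[symmetric] algebra_simps)
    next
    show "continuous_on {s..s'} ?G"
      by (intro continuous_intros continuous_on_half_pow_comp continuous_on_fou_time)
  qed (use s in auto)
  moreover have "?G s' - ?G s = fbm_cov H (?a s') (?a t') - fbm_cov H (?a s') (?a t) - fbm_cov H (?a s) (?a t') + fbm_cov H (?a s) (?a t)"
    by (simp add: fbm_cov_def half_pow_def abs_minus_commute field_simps)
  ultimately show ?thesis by (simp only:)
qed

text \<open>For H > 1/2 increments over any two intervals are nonnegatively correlated. The sign is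
  what allows the return from the extended nonnegative integral to a real one.\<close>

lemma
  assumes s: "s \<le> s'" and t: "t \<le> t'"
  shows nn_integral_cov_density:
    "(\<integral>\<^sup>+u. (\<integral>\<^sup>+v. ennreal (cov_density H u v) * indicator {t<..t'} v \<partial>lborel) * indicator {s<..s'} u \<partial>lborel) =
     ennreal (fbm_cov H (fou_time H s') (fou_time H t') - fbm_cov H (fou_time H s') (fou_time H t)
            - fbm_cov H (fou_time H s) (fou_time H t') + fbm_cov H (fou_time H s) (fou_time H t))"
  and fbm_cov_rectangle_nonneg:
    "0 \<le> fbm_cov H (fou_time H s') (fou_time H t') - fbm_cov H (fou_time H s') (fou_time H t)
            - fbm_cov H (fou_time H s) (fou_time H t') + fbm_cov H (fou_time H s) (fou_time H t)"
proof -
  let ?h = "\<lambda>u. exp (u / H) * (half_pow' (fou_time H u - fou_time H t) - half_pow' (fou_time H u - fou_time H t'))"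
  have nn: "0 \<le> ?h u" for u
    using has_integral_nonneg[OF has_integral_cov_density[OF t]] cov_density_nonneg by blast
  note I = has_integral_cov_density_outer[OF s, of t t']
  have "(\<integral>\<^sup>+u. ennreal (?h u) * indicator {s<..s'} u \<partial>lborel) = (\<integral>\<^sup>+u. ennreal (?h u) * indicator {s..s'} u \<partial>lborel)"
    by (rule nn_integral_cong_AE) (use AE_lborel_singleton[of s] in eventually_elim, auto split: split_indicator)
  also note nn_integral_has_integral_lebesgue'[OF nn I]
  finally show "(\<integral>\<^sup>+u. (\<integral>\<^sup>+v. ennreal (cov_density H u v) * indicator {t<..t'} v \<partial>lborel) * indicator {s<..s'} u \<partial>lborel) =
     ennreal (fbm_cov H (fou_time H s') (fou_time H t') - fbm_cov H (fou_time H s') (fou_time H t)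
            - fbm_cov H (fou_time H s) (fou_time H t') + fbm_cov H (fou_time H s) (fou_time H t))"
    by (simp only: nn_integral_cov_density_inner[OF t])
  show "0 \<le> fbm_cov H (fou_time H s') (fou_time H t') - fbm_cov H (fou_time H s') (fou_time H t)
            - fbm_cov H (fou_time H s) (fou_time H t') + fbm_cov H (fou_time H s) (fou_time H t)"
    by (rule has_integral_nonneg[OF I]) (rule nn)
qed

end

section \<open>Centered normal variables\<close>

definition lin_span :: "'t set \<Rightarrow> ('t \<Rightarrow> 'a \<Rightarrow> real) \<Rightarrow> ('a \<Rightarrow> real) set" where
  "lin_span I Y = {(\<lambda>\<omega>. \<Sum>t\<in>J. c t * Y t \<omega>) | J c. finite J \<and> J \<subseteq> I}"

lemma lin_spanI: "finite J \<Longrightarrow> J \<subseteq> I \<Longrightarrow> (\<lambda>\<omega>. \<Sum>t\<in>J. c t * Y t \<omega>) \<in> lin_span I Y"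
  unfolding lin_span_def by blast

lemma lin_span_base: "t \<in> I \<Longrightarrow> Y t \<in> lin_span I Y"
  using lin_spanI[of "{t}" I "\<lambda>_. 1" Y] by simp

lemma lin_span_zero: "(\<lambda>\<omega>. 0) \<in> lin_span I Y"
  using lin_spanI[of "{}" I] by simp

lemma lin_span_add:
  assumes "Z \<in> lin_span I Y" "Z' \<in> lin_span I Y"
  shows "(\<lambda>\<omega>. Z \<omega> + Z' \<omega>) \<in> lin_span I Y"
proof -
  obtain J c where J: "finite J" "J \<subseteq> I" "Z = (\<lambda>\<omega>. \<Sum>t\<in>J. c t * Y t \<omega>)"
    using assms(1) unfolding lin_span_def by blast
  obtain J' c' where J': "finite J'" "J' \<subseteq> I" "Z' = (\<lambda>\<omega>. \<Sum>t\<in>J'. c' t * Y t \<omega>)"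
    using assms(2) unfolding lin_span_def by blast
  define d where "d t = (if t \<in> J then c t else 0) + (if t \<in> J' then c' t else 0)" for t
  have "Z \<omega> + Z' \<omega> = (\<Sum>t\<in>J \<union> J'. d t * Y t \<omega>)" for \<omega>
  proof -
    have "Z \<omega> = (\<Sum>t\<in>J \<union> J'. (if t \<in> J then c t else 0) * Y t \<omega>)"
      unfolding J(3) using J(1) J'(1) by (intro sum.mono_neutral_cong_left) auto
    moreover have "Z' \<omega> = (\<Sum>t\<in>J \<union> J'. (if t \<in> J' then c' t else 0) * Y t \<omega>)"
      unfolding J'(3) using J(1) J'(1) by (intro sum.mono_neutral_cong_left) auto
    ultimately show ?thesis by (simp add: d_def distrib_right sum.distrib)
  qed
  then show ?thesis using lin_spanI[of "J \<union> J'" I d Y] J J' by simp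
qed

lemma lin_span_scale:
  assumes "Z \<in> lin_span I Y"
  shows "(\<lambda>\<omega>. c * Z \<omega>) \<in> lin_span I Y"
proof -
  obtain J d where J: "finite J" "J \<subseteq> I" "Z = (\<lambda>\<omega>. \<Sum>t\<in>J. d t * Y t \<omega>)"
    using assms unfolding lin_span_def by blast
  then show ?thesis using lin_spanI[of J I "\<lambda>t. c * d t" Y] by (simp add: sum_distrib_left mult_ac)
qed

lemma lin_span_diff:
  "Z \<in> lin_span I Y \<Longrightarrow> Z' \<in> lin_span I Y \<Longrightarrow> (\<lambda>\<omega>. Z \<omega> - Z' \<omega>) \<in> lin_span I Y"
  using lin_span_add[of Z I Y "\<lambda>\<omega>. - 1 * Z' \<omega>"] lin_span_scale[of Z' I Y "-1"] by simp

lemma lin_span_sum: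
  "(\<And>i. i \<in> A \<Longrightarrow> Z i \<in> lin_span I Y) \<Longrightarrow> (\<lambda>\<omega>. \<Sum>i\<in>A. Z i \<omega>) \<in> lin_span I Y"
  by (induction A rule: infinite_finite_induct) (auto intro: lin_span_add lin_span_zero)

lemma real_distribution_normal: 
  "0 < v \<Longrightarrow> real_distribution (density lborel (normal_density 0 (sqrt v)))"
  unfolding real_distribution_def real_distribution_axioms_def
  using prob_space_normal_density[of "sqrt v"] by simp

lemma char_normal:
  assumes "0 < s"
  shows "char (density lborel (normal_density 0 s)) u = complex_of_real (exp (- (u\<^sup>2 * s\<^sup>2) / 2))"
proof -
  define D where "D = density lborel (\<lambda>x. ennreal (normal_density 0 s x))"
  interpret D: prob_space D unfolding D_def using assms by (rule prob_space_normal_density)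
  have sD: "sets D = sets borel" by (simp add: D_def)
  note [measurable_cong] = sD
  have "distr D lborel (\<lambda>x. x) = distr D D (\<lambda>x. x)" by (rule distr_cong) (auto simp: D_def)
  then have "distributed D lborel (\<lambda>x. x) (normal_density 0 s)"
    by (simp add: distributed_def D_def)
  then have "distributed D lborel (\<lambda>x. (x - 0) / s) std_normal_density"
    using D.normal_standard_normal_convert[OF assms, of "\<lambda>x. x" 0] by simp
  then have eq: "distr D lborel (\<lambda>x. x / s) = density lborel std_normal_density"
    by (simp add: distributed_def)
  have "char D u = (CLINT x|D. iexp ((s * u) * (x / s)))"
    unfolding char_def using assms by (simp add: mult_ac)
  also have "\<dots> = char (distr D lborel (\<lambda>x. x / s)) (s * u)"
    unfolding char_def by (subst integral_distr) auto
  also have "\<dots> = complex_of_real (exp (- ((s * u)\<^sup>2) / 2))"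
    unfolding eq char_std_normal_distribution ..
  finally show ?thesis by (simp add: D_def power_mult_distrib mult.commute)
qed

context prob_space
begin

text \<open>The characteristic function instead of a density: this admits variance 0 and is stable
  under pointwise limits.\<close>

definition centered_normal :: "real \<Rightarrow> ('a \<Rightarrow> real) \<Rightarrow> bool" where
  "centered_normal v Z \<longleftrightarrow> Z \<in> borel_measurable M \<and> 0 \<le> v \<and>
     (\<forall>u. char (distr M borel Z) u = complex_of_real (exp (- (u\<^sup>2 * v) / 2)))"

lemma gaussian_rv_centered:
  assumes "gaussian_rv M Y" and mean: "expectation Y = 0"
  shows "centered_normal (expectation (\<lambda>\<omega>. (Y \<omega>)\<^sup>2)) Y"
proof -
  have [measurable]: "Y \<in> borel_measurable M" using assms(1) by (simp add: gaussian_rv_def)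
  consider (normal) m s where "s > 0" "distributed M lborel Y (normal_density m s)"
    | (const) m where "AE \<omega> in M. Y \<omega> = m"
    using assms(1) by (auto simp: gaussian_rv_def)
  then show ?thesis
  proof cases
    case normal
    then have m: "m = 0" using normal_distributed_expectation[OF normal] mean by simp
    then have v: "expectation (\<lambda>\<omega>. (Y \<omega>)\<^sup>2) = s\<^sup>2"
      using normal_distributed_variance[OF normal] mean by simp
    have "distr M borel Y = distr M lborel Y" by (rule distr_cong) auto
    also have "\<dots> = density lborel (normal_density 0 s)" using normal m by (simp add: distributed_def)
    finally show ?thesis unfolding centered_normal_def v using char_normal[OF normal(1)] by simp
  next
    case const
    then have "expectation Y = expectation (\<lambda>_. m)" by (intro integral_cong_AE) auto
    then have m: "m = 0" using mean by (simp add: prob_space)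
    have "expectation (\<lambda>\<omega>. (Y \<omega>)\<^sup>2) = expectation (\<lambda>_. 0)"
      using const m by (intro integral_cong_AE) auto
    then have v: "expectation (\<lambda>\<omega>. (Y \<omega>)\<^sup>2) = 0" by simp
    have "char (distr M borel Y) u = 1" for u
    proof -
      have "char (distr M borel Y) u = (CLINT \<omega>|M. iexp (u * Y \<omega>))"
        unfolding char_def by (subst integral_distr) auto
      also have "\<dots> = (CLINT \<omega>|M. 1)" using const m by (intro integral_cong_AE) auto
      finally show ?thesis by (simp add: prob_space)
    qed
    then show ?thesis unfolding centered_normal_def v by simp
  qed
qed

text \<open>The integrands \<open>iexp (u * Z n)\<close> have modulus 1, so dominated convergence
  applies. The variance of the limit is then a consequence of its law.\<close>

lemma centered_normal_limit:
  assumes Z: "\<And>n. centered_normal (v n) (Z n)"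
    and lim: "\<And>\<omega>. \<omega> \<in> space M \<Longrightarrow> (\<lambda>n. Z n \<omega>) \<longlonglongrightarrow> Y \<omega>"
    and v: "v \<longlonglongrightarrow> w"
  shows "centered_normal w Y"
proof -
  have [measurable]: "Z n \<in> borel_measurable M" for n using Z by (simp add: centered_normal_def)
  have [measurable]: "Y \<in> borel_measurable M" by (rule borel_measurable_LIMSEQ_metric[OF _ lim]) auto
  have "char (distr M borel Y) u = complex_of_real (exp (- (u\<^sup>2 * w) / 2))" for u
  proof (rule LIMSEQ_unique)
    have c: "char (distr M borel X) u = (CLINT \<omega>|M. iexp (u * X \<omega>))" if "X \<in> borel_measurable M" for X
      unfolding char_def using that by (subst integral_distr) auto
    show "(\<lambda>n. char (distr M borel (Z n)) u) \<longlonglongrightarrow> char (distr M borel Y) u"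
      unfolding c[OF \<open>Y \<in> borel_measurable M\<close>] c[OF \<open>Z _ \<in> borel_measurable M\<close>]
    proof (rule integral_dominated_convergence[where w="\<lambda>_. 1"])
      show "AE \<omega> in M. (\<lambda>n. iexp (u * Z n \<omega>)) \<longlonglongrightarrow> iexp (u * Y \<omega>)"
        by (intro AE_I2 tendsto_intros lim)
    qed auto
    show "(\<lambda>n. char (distr M borel (Z n)) u) \<longlonglongrightarrow> complex_of_real (exp (- (u\<^sup>2 * w) / 2))"
      using Z unfolding centered_normal_def by (auto intro!: tendsto_intros v)
  qed
  moreover have "0 \<le> w" using Z by (intro LIMSEQ_le_const[OF v]) (auto simp: centered_normal_def)
  ultimately show ?thesis by (simp add: centered_normal_def)
qed

lemma centered_normal_moments:
  assumes Z: "centered_normal v Z"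
  shows "all_moments Z" "expectation (\<lambda>\<omega>. Z \<omega> ^ n) = normal_moment n * v ^ (n div 2)"
proof -
  have [measurable]: "Z \<in> borel_measurable M" using Z by (simp add: centered_normal_def)
  have rd: "real_distribution (distr M borel Z)" by (rule real_distribution_distr) simp
  have *: "integrable (distr M borel Z) (\<lambda>x. x ^ n) \<and> integral\<^sup>L (distr M borel Z) (\<lambda>x. x ^ n) = normal_moment n * v ^ (n div 2)" for n
  \<comment> \<open>At variance 0 the law is a point mass and has no density.\<close>
  proof (cases "v = 0")
    case True
    have "distr M borel Z = return borel 0"
    proof (rule Levy_uniqueness[OF rd])
      show "real_distribution (return borel (0::real))"
        unfolding real_distribution_def real_distribution_axioms_def by (simp add: prob_space_return)
      show "char (distr M borel Z) = char (return borel 0)"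
      proof
        fix u show "char (distr M borel Z) u = char (return borel 0) u"
          using Z True by (simp add: centered_normal_def char_def integral_return)
      qed
    qed
    moreover have "integrable (return borel (0::real)) (\<lambda>x. x ^ n)" 
      by (rule integrableI_bounded) (auto simp: nn_integral_return)
    moreover have "integral\<^sup>L (return borel (0::real)) (\<lambda>x. x ^ n) = normal_moment n * 0 ^ (n div 2)"
      by (subst integral_return) (auto simp: normal_moment_def power_0_left elim!: evenE)
    ultimately show ?thesis using True by simp
  next
    case False
    then have v: "0 < v" using Z by (simp add: centered_normal_def)
    have "distr M borel Z = density lborel (normal_density 0 (sqrt v))"
    proof (rule Levy_uniqueness[OF rd real_distribution_normal[OF v]], rule)
      fix u show "char (distr M borel Z) u = char (density lborel (normal_density 0 (sqrt v))) u"
        using Z v by (subst char_normal) (simp_all add: centered_normal_def)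
    qed
    then show ?thesis using expectation_normal_power[OF v refl, of n] by simp
  qed
  have i: "integrable M (\<lambda>\<omega>. Z \<omega> ^ n)" for n using *[of n] by (simp add: integrable_distr_eq)
  show "all_moments Z" unfolding all_moments_def
    using i by (auto simp: power_abs[symmetric])
  show "expectation (\<lambda>\<omega>. Z \<omega> ^ n) = normal_moment n * v ^ (n div 2)"
    using *[of n] by (simp add: integral_distr)
qed

lemma centered_normal_variance: "centered_normal v Z \<Longrightarrow> expectation (\<lambda>\<omega>. (Z \<omega>)\<^sup>2) = v"
  using centered_normal_moments(2)[of v Z 2] by (simp add: normal_moment_def)

end

lemma (in hurst) has_bochner_integral_cov_density:
  assumes s: "s \<le> s'" and t: "t \<le> t'"
  shows "has_bochner_integral (lborel \<Otimes>\<^sub>M lborel)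
     (\<lambda>p. indicator {s<..s'} (fst p) * indicator {t<..t'} (snd p) * cov_density H (fst p) (snd p))
     (fbm_cov H (fou_time H s') (fou_time H t') - fbm_cov H (fou_time H s') (fou_time H t)
            - fbm_cov H (fou_time H s) (fou_time H t') + fbm_cov H (fou_time H s) (fou_time H t))"
proof (rule has_bochner_integral_nn_integral)
  note cov_density_measurable[of H, measurable]
  show "(\<lambda>p. indicator {s<..s'} (fst p) * indicator {t<..t'} (snd p) * cov_density H (fst p) (snd p))
     \<in> borel_measurable (lborel \<Otimes>\<^sub>M lborel)" by measurable
  show "AE p in lborel \<Otimes>\<^sub>M lborel. 0 \<le> indicator {s<..s'} (fst p) * indicator {t<..t'} (snd p) * cov_density H (fst p) (snd p)"
    using cov_density_nonneg by (intro AE_I2) (auto simp: indicator_def)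
  have [measurable]: "(\<lambda>p. ennreal (indicator {s<..s'} (fst p) * indicator {t<..t'} (snd p) * cov_density H (fst p) (snd p))) \<in> borel_measurable (lborel \<Otimes>\<^sub>M lborel)"
    by measurable
  have "(\<integral>\<^sup>+p. ennreal (indicator {s<..s'} (fst p) * indicator {t<..t'} (snd p) * cov_density H (fst p) (snd p)) \<partial>(lborel \<Otimes>\<^sub>M lborel))
     = (\<integral>\<^sup>+u. \<integral>\<^sup>+v. ennreal (indicator {s<..s'} u * indicator {t<..t'} v * cov_density H u v) \<partial>lborel \<partial>lborel)"
    by (subst lborel.nn_integral_fst[symmetric]) auto
  also have "\<dots> = (\<integral>\<^sup>+u. (\<integral>\<^sup>+v. ennreal (cov_density H u v) * indicator {t<..t'} v \<partial>lborel) * indicator {s<..s'} u \<partial>lborel)"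
  proof (rule nn_integral_cong)
    fix u :: real
    show "(\<integral>\<^sup>+v. ennreal (indicator {s<..s'} u * indicator {t<..t'} v * cov_density H u v) \<partial>lborel)
      = (\<integral>\<^sup>+v. ennreal (cov_density H u v) * indicator {t<..t'} v \<partial>lborel) * indicator {s<..s'} u"
    proof (cases "u \<in> {s<..s'}")
      case True
      then show ?thesis
        by (simp, intro nn_integral_cong) (auto split: split_indicator)
    qed simp
  qed
  also note nn_integral_cov_density[OF s t]
  finally show "(\<integral>\<^sup>+p. ennreal (indicator {s<..s'} (fst p) * indicator {t<..t'} (snd p) * cov_density H (fst p) (snd p)) \<partial>(lborel \<Otimes>\<^sub>M lborel)) =
     ennreal (fbm_cov H (fou_time H s') (fou_time H t') - fbm_cov H (fou_time H s') (fou_time H t)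
            - fbm_cov H (fou_time H s) (fou_time H t') + fbm_cov H (fou_time H s) (fou_time H t))" .
  show "0 \<le> fbm_cov H (fou_time H s') (fou_time H t') - fbm_cov H (fou_time H s') (fou_time H t)
            - fbm_cov H (fou_time H s) (fou_time H t') + fbm_cov H (fou_time H s) (fou_time H t)"
    by (rule fbm_cov_rectangle_nonneg[OF s t])
qed

locale fou_param = hurst H for H :: real +
  fixes \<theta> :: real
  assumes \<theta>_pos: "0 < \<theta>"
begin

definition weight :: "real \<Rightarrow> real" where "weight s = exp ((\<theta> - 1) * s)"

lemma weight_measurable [measurable]: "weight \<in> borel_measurable borel"
  unfolding weight_def[abs_def] by measurable

text \<open>The covariance of the process, by \<open>cov_X\<close> below. Defined without the
  process, it can be analysed without probability.\<close>

definition R :: "real \<Rightarrow> real \<Rightarrow> real" where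
  "R s t = (\<integral>p. exp (- \<theta> * s) * weight (fst p) * indicator {0<..s} (fst p) *
     (exp (- \<theta> * t) * weight (snd p) * indicator {0<..t} (snd p)) *
     cov_density H (fst p) (snd p) \<partial>(lborel \<Otimes>\<^sub>M lborel))"

end

section \<open>The Gaussian space of the fractional Ornstein--Uhlenbeck process\<close>

text \<open>The cells are closed on the right, hence a ceiling minus one. An explicit index
  collapses a sum of indicators over cells to a single term.\<close>

lemma grid_cell_unique:
  fixes t u :: real
  assumes t: "0 < t" and u: "0 < u" "u \<le> t" and m: "0 < m"
  defines "j0 \<equiv> nat (\<lceil>u * real m / t\<rceil> - 1)"
  shows "j0 < m" "\<And>j. t * real j / real m < u \<and> u \<le> t * real (Suc j) / real m \<longleftrightarrow> j = j0"
proof -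
  have pos: "0 < u * real m / t" using assms by simp
  then have c: "1 \<le> \<lceil>u * real m / t\<rceil>" by linarith
  have "u * real m / t \<le> real m" using t u m by (simp add: divide_le_eq mult.commute mult_right_mono)
  then have "\<lceil>u * real m / t\<rceil> \<le> int m" by (simp add: ceiling_le_iff)
  then show "j0 < m" using c m by (simp add: j0_def nat_less_iff)
  fix j
  have "t * real j / real m < u \<and> u \<le> t * real (Suc j) / real m \<longleftrightarrow> 
      real j < u * real m / t \<and> u * real m / t \<le> real j + 1"
    using t m by (simp add: field_simps)
  also have "\<dots> \<longleftrightarrow> \<lceil>u * real m / t\<rceil> = int j + 1"
    by (subst ceiling_eq_iff) simp
  also have "\<dots> \<longleftrightarrow> j = j0" using c by (auto simp: j0_def)
  finally show "t * real j / real m < u \<and> u \<le> t * real (Suc j) / real m \<longleftrightarrow> j = j0" .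
qed

locale fou = fou_param H \<theta> + prob_space M for H \<theta> :: real and M :: "'a measure" +
  fixes B :: "real \<Rightarrow> 'a \<Rightarrow> real"
  assumes fbm: "fractional_brownian_motion M H B"
begin

definition X :: "real \<Rightarrow> 'a \<Rightarrow> real" where "X = fou2 H \<theta> B"

definition X_sum :: "nat \<Rightarrow> real \<Rightarrow> 'a \<Rightarrow> real" where
  "X_sum n t \<omega> = exp (- \<theta> * t) * rs_sum weight (\<lambda>s. B (fou_time H s) \<omega>) t (Suc n)"

text \<open>\<open>X_sum n t\<close> is the integral of this step function against the driving
  process, so its covariances are double integrals against \<open>cov_density\<close>.\<close>

definition step :: "nat \<Rightarrow> real \<Rightarrow> real \<Rightarrow> real" where
  "step n t u = exp (- \<theta> * t) * (\<Sum>j<Suc n. weight (t * real j / real (Suc n)) *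
     indicator {t * real j / real (Suc n) <.. t * real (Suc j) / real (Suc n)} u)"

lemma DERIV_weight: "(weight has_real_derivative (\<theta> - 1) * exp ((\<theta> - 1) * s)) (at s)"
  unfolding weight_def[abs_def] by (auto intro!: derivative_eq_intros)

lemma continuous_B_path:
  assumes "\<omega> \<in> space M"
  shows "continuous_on S (\<lambda>s. B (fou_time H s) \<omega>)"
proof (rule continuous_on_compose2[where t = "{0..}" and g = "\<lambda>t. B t \<omega>" and f = "fou_time H"])
  show "continuous_on {0..} (\<lambda>t. B t \<omega>)" using fbm assms by (simp add: fractional_brownian_motion_def)
qed (use fou_time_pos in \<open>auto intro: continuous_on_fou_time less_imp_le\<close>)

lemma X_sum_tendsto:
  assumes "0 \<le> t" "\<omega> \<in> space M"
  shows "(\<lambda>n. X_sum n t \<omega>) \<longlonglongrightarrow> X t \<omega>"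
  unfolding X_sum_def X_def fou2_def weight_def[abs_def, symmetric]
  by (intro tendsto_intros rs_sum_tendsto[OF DERIV_weight] continuous_B_path assms continuous_intros)

lemma continuous_on_X:
  assumes "\<omega> \<in> space M"
  shows "continuous_on {0..} (\<lambda>t. X t \<omega>)"
proof -
  have c: "continuous_on {0..T} (\<lambda>t. X t \<omega>)" for T
    unfolding X_def fou2_def weight_def[abs_def, symmetric]
    by (intro continuous_intros continuous_on_rs_integral[OF DERIV_weight] continuous_B_path assms)
  show ?thesis
    unfolding continuous_on_eq_continuous_within
  proof
    fix x :: real assume x: "x \<in> {0..}"
    have "at x within {0..} = at x within {0..x + 1}"
      by (rule at_within_nhd[of x "{..<x + 1}"]) auto
    then show "continuous (at x within {0..}) (\<lambda>t. X t \<omega>)"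
      using c[of "x + 1"] x by (simp add: continuous_on_eq_continuous_within)
  qed
qed

lemma B_span_centered:
  assumes "Z \<in> lin_span {0..} B"
  shows "centered_normal (expectation (\<lambda>\<omega>. (Z \<omega>)\<^sup>2)) Z"
proof -
  obtain J c where J: "finite J" "J \<subseteq> {0..}" "Z = (\<lambda>\<omega>. \<Sum>t\<in>J. c t * B t \<omega>)"
    using assms unfolding lin_span_def by blast
  have gp: "gaussian_process M {0..} B" using fbm by (simp add: fractional_brownian_motion_def)
  have B0: "t \<in> {0..} \<Longrightarrow> expectation (B t) = 0" for t using fbm by (auto simp: fractional_brownian_motion_def)
  have "gaussian_rv M (B t)" if "t \<in> {0..}" for t
    using gp[unfolded gaussian_process_def, rule_format, of "{t}" "\<lambda>_. 1"] that by simp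
  then have "integrable M (B t)" if "t \<in> {0..}" for t
    using that B0 gaussian_rv_centered centered_normal_moments(1) all_moments_integrable by blast
  then have "expectation Z = 0" unfolding J(3) using J(1,2) B0
    by (subst Bochner_Integration.integral_sum) (auto intro!: sum.neutral)
  moreover have "gaussian_rv M Z" unfolding J(3) using gp J by (simp add: gaussian_process_def)
  ultimately show ?thesis by (rule gaussian_rv_centered[rotated])
qed

lemma B_span_moments: "Z \<in> lin_span {0..} B \<Longrightarrow> all_moments Z"
  using B_span_centered centered_normal_moments(1) by blast

lemma B_time_span: "B (fou_time H t) \<in> lin_span {0..} B"
  using fou_time_pos[of t] by (intro lin_span_base) auto

lemma X_sum_span: "X_sum n t \<in> lin_span {0..} B"
  unfolding X_sum_def[abs_def] rs_sum_def by (intro lin_span_scale lin_span_sum lin_span_diff B_time_span)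

lemma expectation_B_B: "expectation (\<lambda>\<omega>. B (fou_time H s) \<omega> * B (fou_time H t) \<omega>) = fbm_cov H (fou_time H s) (fou_time H t)"
  using fbm fou_time_pos[of s] fou_time_pos[of t] by (auto simp: fractional_brownian_motion_def fbm_cov_def)

lemma expectation_increments:
  assumes s: "s \<le> s'" and t: "t \<le> t'"
  shows "expectation (\<lambda>\<omega>. (B (fou_time H s') \<omega> - B (fou_time H s) \<omega>) * (B (fou_time H t') \<omega> - B (fou_time H t) \<omega>)) =
    (\<integral>p. indicator {s<..s'} (fst p) * indicator {t<..t'} (snd p) * cov_density H (fst p) (snd p) \<partial>(lborel \<Otimes>\<^sub>M lborel))"
proof -
  have i: "integrable M (\<lambda>\<omega>. B (fou_time H s) \<omega> * B (fou_time H t) \<omega>)" for s t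
    by (intro all_moments_integrable all_moments_mult B_span_moments B_time_span)
  have "expectation (\<lambda>\<omega>. (B (fou_time H s') \<omega> - B (fou_time H s) \<omega>) * (B (fou_time H t') \<omega> - B (fou_time H t) \<omega>)) =
    expectation (\<lambda>\<omega>. B (fou_time H s') \<omega> * B (fou_time H t') \<omega> - B (fou_time H s') \<omega> * B (fou_time H t) \<omega>
       - B (fou_time H s) \<omega> * B (fou_time H t') \<omega> + B (fou_time H s) \<omega> * B (fou_time H t) \<omega>)"
    by (simp add: algebra_simps)
  also have "\<dots> = fbm_cov H (fou_time H s') (fou_time H t') - fbm_cov H (fou_time H s') (fou_time H t)
            - fbm_cov H (fou_time H s) (fou_time H t') + fbm_cov H (fou_time H s) (fou_time H t)"
    by (simp add: i expectation_B_B)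
  also have "\<dots> = (\<integral>p. indicator {s<..s'} (fst p) * indicator {t<..t'} (snd p) * cov_density H (fst p) (snd p) \<partial>(lborel \<Otimes>\<^sub>M lborel))"
    by (rule has_bochner_integral_integral_eq[symmetric, OF has_bochner_integral_cov_density[OF s t]])
  finally show ?thesis .
qed

lemma expectation_X_sum:
  assumes s: "0 \<le> s" and t: "0 \<le> t"
  shows "expectation (\<lambda>\<omega>. X_sum n s \<omega> * X_sum n t \<omega>) =
    (\<integral>p. step n s (fst p) * step n t (snd p) * cov_density H (fst p) (snd p) \<partial>(lborel \<Otimes>\<^sub>M lborel))"
proof -
  define g where "g t j = t * real j / real (Suc n)" for t :: real and j
  define D where "D t j \<omega> = B (fou_time H (g t (Suc j))) \<omega> - B (fou_time H (g t j)) \<omega>" for t j \<omega>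
  define c where "c t j = exp (- \<theta> * t) * weight (g t j)" for t j
  have g: "g t j \<le> g t (Suc j)" if "0 \<le> t" for t j
    unfolding g_def using that by (intro divide_right_mono mult_left_mono) auto
  have mD: "all_moments (D t j)" for t j
    unfolding D_def[abs_def] by (intro B_span_moments lin_span_diff B_time_span)
  have X: "X_sum n t \<omega> = (\<Sum>j<Suc n. c t j * D t j \<omega>)" for t \<omega>
    unfolding X_sum_def rs_sum_def c_def D_def g_def sum_distrib_left mult.assoc ..
  have S: "step n t u = (\<Sum>j<Suc n. c t j * indicator {g t j<..g t (Suc j)} u)" for t u
    unfolding step_def c_def g_def sum_distrib_left mult.assoc ..
  have "expectation (\<lambda>\<omega>. X_sum n s \<omega> * X_sum n t \<omega>) = 
     expectation (\<lambda>\<omega>. \<Sum>i<Suc n. \<Sum>j<Suc n. (c s i * c t j) * (D s i \<omega> * D t j \<omega>))"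
    unfolding X sum_product by (simp only: mult_ac)
  also have "\<dots> = (\<Sum>i<Suc n. \<Sum>j<Suc n. (c s i * c t j) * expectation (\<lambda>\<omega>. D s i \<omega> * D t j \<omega>))"
    by (subst Bochner_Integration.integral_sum, (intro all_moments_integrable all_moments_intros mD)[1],
        intro sum.cong refl, subst Bochner_Integration.integral_sum,
        (intro all_moments_integrable all_moments_intros mD)[1], simp)
  also have "\<dots> = (\<Sum>i<Suc n. \<Sum>j<Suc n. (c s i * c t j) * (\<integral>p. indicator {g s i<..g s (Suc i)} (fst p) * 
      indicator {g t j<..g t (Suc j)} (snd p) * cov_density H (fst p) (snd p) \<partial>(lborel \<Otimes>\<^sub>M lborel)))"
    unfolding D_def using g[OF s] g[OF t] by (intro sum.cong refl arg_cong2[where f="(*)"] expectation_increments)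
  also have "\<dots> = (\<integral>p. (\<Sum>i<Suc n. \<Sum>j<Suc n. (c s i * c t j) * (indicator {g s i<..g s (Suc i)} (fst p) * 
      indicator {g t j<..g t (Suc j)} (snd p) * cov_density H (fst p) (snd p))) \<partial>(lborel \<Otimes>\<^sub>M lborel))"
  proof -
    have i: "integrable (lborel \<Otimes>\<^sub>M lborel) (\<lambda>p. indicator {g s i<..g s (Suc i)} (fst p) * 
      indicator {g t j<..g t (Suc j)} (snd p) * cov_density H (fst p) (snd p))" for i j
      using has_bochner_integral_cov_density[OF g[OF s] g[OF t]] by (rule integrable.intros)
    show ?thesis
      by (subst Bochner_Integration.integral_sum, (intro Bochner_Integration.integrable_sum integrable_mult_right i)[1],
        intro sum.cong refl, subst Bochner_Integration.integral_sum,
        (intro integrable_mult_right i)[1], simp)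
  qed
  also have "\<dots> = (\<integral>p. step n s (fst p) * step n t (snd p) * cov_density H (fst p) (snd p) \<partial>(lborel \<Otimes>\<^sub>M lborel))"
    unfolding S sum_product unfolding sum_distrib_right by (simp only: mult_ac)
  finally show ?thesis .
qed

lemma step_eq:
  assumes t: "0 \<le> t"
  shows "step n t u = indicator {0<..t} u * exp (- \<theta> * t) *
     weight (t * real (nat (\<lceil>u * real (Suc n) / t\<rceil> - 1)) / real (Suc n))"
proof (cases "u \<in> {0<..t}")
  case True
  then have t': "0 < t" by simp
  define j0 where "j0 = nat (\<lceil>u * real (Suc n) / t\<rceil> - 1)"
  note cell = grid_cell_unique[OF t', of u "Suc n", folded j0_def]
  have "(\<Sum>j<Suc n. weight (t * real j / real (Suc n)) *
     indicator {t * real j / real (Suc n) <.. t * real (Suc j) / real (Suc n)} u) =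
     (\<Sum>j<Suc n. if j = j0 then weight (t * real j0 / real (Suc n)) else 0)"
    using cell(2) True by (intro sum.cong refl) (auto simp: indicator_def)
  also have "\<dots> = weight (t * real j0 / real (Suc n))"
    using cell(1) True by (simp del: sum.lessThan_Suc)
  finally show ?thesis using True by (simp add: step_def j0_def del: sum.lessThan_Suc)
next
  case False
  have "u \<notin> {t * real j / real (Suc n) <.. t * real (Suc j) / real (Suc n)}" if "j < Suc n" for j
  proof -
    have "t * real (Suc j) / real (Suc n) \<le> t" 
      using that t by (simp add: divide_le_eq mult_left_mono del: of_nat_Suc)
    moreover have "0 \<le> t * real j / real (Suc n)" using t by simp
    ultimately show ?thesis using False by auto
  qed
  then have "(\<Sum>j<Suc n. weight (t * real j / real (Suc n)) *
     indicator {t * real j / real (Suc n) <.. t * real (Suc j) / real (Suc n)} u) = 0"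
    by (intro sum.neutral) auto
  then show ?thesis using False by (simp add: step_def del: sum.lessThan_Suc)
qed

lemma step_tendsto:
  assumes t: "0 \<le> t"
  shows "(\<lambda>n. step n t u) \<longlonglongrightarrow> exp (- \<theta> * t) * weight u * indicator {0<..t} u"
proof (cases "u \<in> {0<..t}")
  case True
  then have t': "0 < t" by simp
  define j where "j n = nat (\<lceil>u * real (Suc n) / t\<rceil> - 1)" for n
  have bnd: "t * real (j n) / real (Suc n) < u \<and> u \<le> t * real (Suc (j n)) / real (Suc n)" for n
    using grid_cell_unique(2)[OF t', of u "Suc n" "j n"] True by (simp add: j_def)
  have "(\<lambda>n. t * real (j n) / real (Suc n)) \<longlonglongrightarrow> u"
  proof (rule tendsto_sandwich[of "\<lambda>n. u - t / real (Suc n)" _ _ "\<lambda>_. u"])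
    show "\<forall>\<^sub>F n in sequentially. u - t / real (Suc n) \<le> t * real (j n) / real (Suc n)"
    proof (intro always_eventually allI)
      fix n
      have "t * real (Suc (j n)) / real (Suc n) = t * real (j n) / real (Suc n) + t / real (Suc n)"
        by (simp add: add_divide_distrib[symmetric] algebra_simps)
      then show "u - t / real (Suc n) \<le> t * real (j n) / real (Suc n)" using bnd[of n] by linarith
    qed
    show "\<forall>\<^sub>F n in sequentially. t * real (j n) / real (Suc n) \<le> u"
      using bnd by (intro always_eventually allI) (simp add: less_imp_le)
    have "(\<lambda>n. u - t * inverse (real (Suc n))) \<longlonglongrightarrow> u - t * 0"
      by (intro tendsto_intros LIMSEQ_inverse_real_of_nat)
    then show "(\<lambda>n. u - t / real (Suc n)) \<longlonglongrightarrow> u" by (simp add: divide_inverse)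
  qed simp
  then have "(\<lambda>n. weight (t * real (j n) / real (Suc n))) \<longlonglongrightarrow> weight u"
    unfolding weight_def[abs_def] by (intro tendsto_intros)
  then show ?thesis unfolding step_eq[OF t] j_def[symmetric] using True
    by (auto intro!: tendsto_intros)
qed (simp add: step_eq[OF t])

text \<open>A bound independent of \<open>n\<close>, the majorant for dominated convergence. The
  absolute value covers both signs of \<open>\<theta> - 1\<close>.\<close>

lemma step_bound:
  assumes t: "0 \<le> t"
  shows "\<bar>step n t u\<bar> \<le> exp (\<bar>\<theta> - 1\<bar> * t) * indicator {0<..t} u"
proof (cases "u \<in> {0<..t}")
  case True
  then have t': "0 < t" by simp
  define j where "j = nat (\<lceil>u * real (Suc n) / t\<rceil> - 1)"
  have bnd: "t * real j / real (Suc n) < u"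
    using grid_cell_unique(2)[OF t', of u "Suc n" j] True by (simp add: j_def)
  have "(\<theta> - 1) * (t * real j / real (Suc n)) \<le> \<bar>\<theta> - 1\<bar> * t"
    using bnd True t by (intro mult_mono) auto
  moreover have "exp (- \<theta> * t) \<le> 1" using \<theta>_pos t by simp
  ultimately have "exp (- \<theta> * t) * weight (t * real j / real (Suc n)) \<le> 1 * exp (\<bar>\<theta> - 1\<bar> * t)"
    unfolding weight_def by (intro mult_mono) auto
  then show ?thesis unfolding step_eq[OF t] j_def[symmetric] using True by (simp add: weight_def abs_mult)
qed (simp add: step_eq[OF t])

lemma step_measurable [measurable]: "step n t \<in> borel_measurable borel"
  unfolding step_def[abs_def] by measurable

lemma expectation_X_sum_tendsto:
  assumes s: "0 \<le> s" and t: "0 \<le> t"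
  shows "(\<lambda>n. expectation (\<lambda>\<omega>. X_sum n s \<omega> * X_sum n t \<omega>)) \<longlonglongrightarrow> R s t"
  unfolding expectation_X_sum[OF s t] R_def
proof (rule integral_dominated_convergence[where w="\<lambda>p. exp (\<bar>\<theta> - 1\<bar> * s) * exp (\<bar>\<theta> - 1\<bar> * t) * 
   (indicator {0<..s} (fst p) * indicator {0<..t} (snd p) * cov_density H (fst p) (snd p))"])
  note cov_density_measurable[of H, measurable]
  show "(\<lambda>p. exp (- \<theta> * s) * weight (fst p) * indicator {0<..s} (fst p) *
     (exp (- \<theta> * t) * weight (snd p) * indicator {0<..t} (snd p)) *
     cov_density H (fst p) (snd p)) \<in> borel_measurable (lborel \<Otimes>\<^sub>M lborel)" by measurable
  show "(\<lambda>p. step n s (fst p) * step n t (snd p) * cov_density H (fst p) (snd p)) \<in> borel_measurable (lborel \<Otimes>\<^sub>M lborel)" for n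
    by measurable
  show "integrable (lborel \<Otimes>\<^sub>M lborel) (\<lambda>p. exp (\<bar>\<theta> - 1\<bar> * s) * exp (\<bar>\<theta> - 1\<bar> * t) * 
   (indicator {0<..s} (fst p) * indicator {0<..t} (snd p) * cov_density H (fst p) (snd p)))"
    by (intro integrable_mult_right integrable.intros[OF has_bochner_integral_cov_density[OF s t]])
  show "AE p in lborel \<Otimes>\<^sub>M lborel. (\<lambda>n. step n s (fst p) * step n t (snd p) * cov_density H (fst p) (snd p)) \<longlonglongrightarrow>
     exp (- \<theta> * s) * weight (fst p) * indicator {0<..s} (fst p) *
     (exp (- \<theta> * t) * weight (snd p) * indicator {0<..t} (snd p)) * cov_density H (fst p) (snd p)"
    by (intro AE_I2 tendsto_mult step_tendsto s t tendsto_const)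
  show "AE p in lborel \<Otimes>\<^sub>M lborel. norm (step n s (fst p) * step n t (snd p) * cov_density H (fst p) (snd p)) \<le>
     exp (\<bar>\<theta> - 1\<bar> * s) * exp (\<bar>\<theta> - 1\<bar> * t) * 
   (indicator {0<..s} (fst p) * indicator {0<..t} (snd p) * cov_density H (fst p) (snd p))" for n
  proof (rule AE_I2)
    fix p :: "real \<times> real"
    have "norm (step n s (fst p) * step n t (snd p) * cov_density H (fst p) (snd p)) =
       \<bar>step n s (fst p)\<bar> * \<bar>step n t (snd p)\<bar> * cov_density H (fst p) (snd p)"
      using cov_density_nonneg by (simp add: abs_mult)
    also have "\<dots> \<le> (exp (\<bar>\<theta> - 1\<bar> * s) * indicator {0<..s} (fst p)) * (exp (\<bar>\<theta> - 1\<bar> * t) * indicator {0<..t} (snd p)) * 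
        cov_density H (fst p) (snd p)"
      by (intro mult_mono step_bound s t cov_density_nonneg) auto
    finally show "norm (step n s (fst p) * step n t (snd p) * cov_density H (fst p) (snd p)) \<le>
     exp (\<bar>\<theta> - 1\<bar> * s) * exp (\<bar>\<theta> - 1\<bar> * t) * 
     (indicator {0<..s} (fst p) * indicator {0<..t} (snd p) * cov_density H (fst p) (snd p))"
      by (simp only: mult_ac)
  qed
qed

text \<open>Symmetry is evident for the approximating expectations and passes to the limit.\<close>

lemma R_commute: "0 \<le> s \<Longrightarrow> 0 \<le> t \<Longrightarrow> R s t = R t s"
  using LIMSEQ_unique[OF expectation_X_sum_tendsto[of s t]] expectation_X_sum_tendsto[of t s]
  by (simp add: mult.commute)

lemma X_combination_centered:
  assumes J: "finite J" "J \<subseteq> {0..}"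
  shows "centered_normal (\<Sum>s\<in>J. \<Sum>t\<in>J. c s * c t * R s t) (\<lambda>\<omega>. \<Sum>t\<in>J. c t * X t \<omega>)"
proof (rule centered_normal_limit)
  let ?Z = "\<lambda>n \<omega>. \<Sum>t\<in>J. c t * X_sum n t \<omega>"
  show "centered_normal (expectation (\<lambda>\<omega>. (?Z n \<omega>)\<^sup>2)) (?Z n)" for n
    by (intro B_span_centered lin_span_sum lin_span_scale X_sum_span)
  show "(\<lambda>n. ?Z n \<omega>) \<longlonglongrightarrow> (\<Sum>t\<in>J. c t * X t \<omega>)" if "\<omega> \<in> space M" for \<omega>
    using J that by (intro tendsto_intros X_sum_tendsto) auto
  have m: "all_moments (X_sum n t)" for n t by (intro B_span_moments X_sum_span)
  have eq: "expectation (\<lambda>\<omega>. (?Z n \<omega>)\<^sup>2) = (\<Sum>s\<in>J. \<Sum>t\<in>J. c s * c t * expectation (\<lambda>\<omega>. X_sum n s \<omega> * X_sum n t \<omega>))" for n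
  proof -
    have "expectation (\<lambda>\<omega>. (?Z n \<omega>)\<^sup>2) = expectation (\<lambda>\<omega>. \<Sum>s\<in>J. \<Sum>t\<in>J. c s * c t * (X_sum n s \<omega> * X_sum n t \<omega>))"
      unfolding power2_eq_square sum_product by (simp only: mult_ac)
    also have "\<dots> = (\<Sum>s\<in>J. \<Sum>t\<in>J. c s * c t * expectation (\<lambda>\<omega>. X_sum n s \<omega> * X_sum n t \<omega>))"
      by (subst Bochner_Integration.integral_sum, (intro all_moments_integrable all_moments_intros m)[1],
        intro sum.cong refl, subst Bochner_Integration.integral_sum,
        (intro all_moments_integrable all_moments_intros m)[1], simp)
    finally show ?thesis .
  qed
  show "(\<lambda>n. expectation (\<lambda>\<omega>. (?Z n \<omega>)\<^sup>2)) \<longlonglongrightarrow> (\<Sum>s\<in>J. \<Sum>t\<in>J. c s * c t * R s t)"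
    unfolding eq using J by (intro tendsto_sum tendsto_mult tendsto_const expectation_X_sum_tendsto) auto
qed

lemma X_span_centered:
  assumes "Z \<in> lin_span {0..} X"
  shows "centered_normal (expectation (\<lambda>\<omega>. (Z \<omega>)\<^sup>2)) Z"
proof -
  obtain J c where J: "finite J" "J \<subseteq> {0..}" "Z = (\<lambda>\<omega>. \<Sum>t\<in>J. c t * X t \<omega>)"
    using assms unfolding lin_span_def by blast
  then show ?thesis
    using X_combination_centered[OF J(1,2), of c]
      centered_normal_variance[OF X_combination_centered[OF J(1,2), of c]] by simp
qed

sublocale gaussian_space M "lin_span {0..} X"
proof
  show "Y \<in> lin_span {0..} X \<Longrightarrow> Z \<in> lin_span {0..} X \<Longrightarrow> (\<lambda>\<omega>. Y \<omega> + Z \<omega>) \<in> lin_span {0..} X" for Y Z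
    by (rule lin_span_add)
  show "Z \<in> lin_span {0..} X \<Longrightarrow> (\<lambda>\<omega>. c * Z \<omega>) \<in> lin_span {0..} X" for Z c
    by (rule lin_span_scale)
  show "Z \<in> lin_span {0..} X \<Longrightarrow> all_moments Z" for Z
    using X_span_centered centered_normal_moments(1) by blast
  show "Z \<in> lin_span {0..} X \<Longrightarrow> expectation (\<lambda>\<omega>. Z \<omega> ^ n) =
      normal_moment n * expectation (\<lambda>\<omega>. (Z \<omega>)\<^sup>2) ^ (n div 2)" for Z n
    using X_span_centered centered_normal_moments(2) by blast
qed

lemma X_span: "0 \<le> t \<Longrightarrow> X t \<in> lin_span {0..} X"
  by (rule lin_span_base) simp

lemma X_measurable: "0 \<le> t \<Longrightarrow> X t \<in> borel_measurable M"
  using X_span all_moments_V all_moments_measurable by blast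

text \<open>Polarization of the variance of \<open>X s + X t\<close>. The diagonal is separate
  because the index set \<open>{s, t}\<close> collapses there.\<close>

lemma cov_X:
  assumes s: "0 \<le> s" and t: "0 \<le> t"
  shows "cov (X s) (X t) = R s t"
proof -
  have var: "expectation (\<lambda>\<omega>. (X t \<omega>)\<^sup>2) = R t t" if "0 \<le> t" for t
    using centered_normal_variance[OF X_combination_centered[of "{t}" "\<lambda>_. 1"]] that by simp
  show ?thesis
  proof (cases "s = t")
    case True
    then show ?thesis using var[OF t] by (simp add: cov_def power2_eq_square)
  next
    case False
    have m: "all_moments (X s)" "all_moments (X t)" using s t X_span all_moments_V by auto
    have "expectation (\<lambda>\<omega>. (X s \<omega> + X t \<omega>)\<^sup>2) = R s s + R s t + (R t s + R t t)"
      using centered_normal_variance[OF X_combination_centered[of "{s, t}" "\<lambda>_. 1"]] s t False by simp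
    moreover have "expectation (\<lambda>\<omega>. (X s \<omega> + X t \<omega>)\<^sup>2) = expectation (\<lambda>\<omega>. (X s \<omega>)\<^sup>2 + 2 * (X s \<omega> * X t \<omega>) + (X t \<omega>)\<^sup>2)"
      by (simp add: power2_eq_square algebra_simps)
    moreover have "\<dots> = expectation (\<lambda>\<omega>. (X s \<omega>)\<^sup>2) + 2 * cov (X s) (X t) + expectation (\<lambda>\<omega>. (X t \<omega>)\<^sup>2)"
      using m by (simp add: cov_def all_moments_integrable all_moments_intros)
    ultimately show ?thesis using var[OF s] var[OF t] R_commute[OF s t] by simp
  qed
qed

end

section \<open>Analysis of the covariance kernel\<close>

lemma nn_integral_exp_atLeast:
  fixes q m :: real
  assumes "0 < q"
  shows "(\<integral>\<^sup>+x. ennreal (exp (- q * x)) * indicator {m..} x \<partial>lborel) = ennreal (exp (- q * m) / q)"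
  using assms by (intro nn_integral_has_integral_lebesgue' has_integral_exp_minus_to_infinity) auto

lemma integrable_Beta:
  fixes a b :: real
  assumes "0 < a" "0 < b"
  shows "set_integrable lborel {0<..<1} (\<lambda>x. (1 - x) powr (a - 1) * x powr (b - 1))"
    and "(LINT x:{0<..<1}|lborel. (1 - x) powr (a - 1) * x powr (b - 1)) = Beta a b"
proof -
  let ?f = "\<lambda>x::real. x powr (b - 1) * (1 - x) powr (a - 1)"
  have "(\<integral>\<^sup>+x. ennreal (?f x) * indicator {0..1} x \<partial>lborel) = ennreal (Beta b a)"
    by (intro nn_integral_has_integral_lebesgue' has_integral_Beta_real assms) auto
  moreover have "(\<integral>\<^sup>+x. ennreal (?f x) * indicator {0..1} x \<partial>lborel) = 
     (\<integral>\<^sup>+x. ennreal (indicator {0<..<1} x * ?f x) \<partial>lborel)"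
    by (rule nn_integral_cong_AE)
       (use AE_lborel_singleton[of 0] AE_lborel_singleton[of 1] in eventually_elim, auto split: split_indicator)
  ultimately have "(\<integral>\<^sup>+x. ennreal (indicator {0<..<1} x * ?f x) \<partial>lborel) = ennreal (Beta b a)" by simp
  moreover have "0 \<le> Beta b a" using has_integral_nonneg[OF has_integral_Beta_real[OF assms(2,1)]] by auto
  ultimately have "has_bochner_integral lborel (\<lambda>x. indicator {0<..<1} x * ?f x) (Beta b a)"
    by (intro has_bochner_integral_nn_integral) auto
  then have *: "has_bochner_integral lborel (\<lambda>x. indicator {0<..<1} x *\<^sub>R ((1 - x) powr (a - 1) * x powr (b - 1))) (Beta a b)"
    by (simp add: mult_ac Beta_commute)
  then show "set_integrable lborel {0<..<1} (\<lambda>x. (1 - x) powr (a - 1) * x powr (b - 1))"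
    unfolding set_integrable_def by (rule integrable.intros)
  show "(LINT x:{0<..<1}|lborel. (1 - x) powr (a - 1) * x powr (b - 1)) = Beta a b"
    unfolding set_lebesgue_integral_def using * by (rule has_bochner_integral_integral_eq)
qed

context hurst
begin

text \<open>The substitution $w = -H \ln(1 - y)$ turns the Laplace transform of the kernel into a Beta integral.\<close>

lemma stat_kernel_laplace:
  assumes p: "- (1 / H - 1) < p"
  shows "set_integrable lborel {0<..} (\<lambda>w. exp (- p * w) * stat_kernel H w)"
    and "(LINT w:{0<..}|lborel. exp (- p * w) * stat_kernel H w) = H * Beta ((p - 1) * H + 1) (2 * H - 1)"
proof -
  \<comment> \<open>Under the substitution \<open>exp (- w)\<close> becomes
    \<open>(1 - y) powr H\<close>. The exponents add up to p H + (1 - H) - 1 = a - 1, the last -1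
    coming from the Jacobian; the assumption on \<open>p\<close> says that \<open>a\<close> is
    positive.\<close>
  define a where "a = (p - 1) * H + 1"
  have a: "0 < a" using p H_pos by (simp add: a_def field_simps)
  have b: "0 < 2 * H - 1" using H_half by simp
  define f where "f w = exp (- p * w) * stat_kernel H w" for w
  define g where "g y = - H * ln (1 - y)" for y :: real
  define g' where "g' y = H / (1 - y)" for y :: real
  have fg: "f (g y) * g' y = H * ((1 - y) powr (a - 1) * y powr (2 * H - 1 - 1))" if y: "0 < y" "y < 1" for y
  proof -
    have gpos: "0 < g y" using y H_pos by (simp add: g_def mult_pos_neg)
    have e: "exp (- g y / H) = 1 - y" using y H_pos by (simp add: g_def)
    have "exp (- p * g y) * exp (- (1 / H - 1) * g y) * (1 / (1 - y)) = (1 - y) powr (a - 1)"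
    proof -
      have "1 / (1 - y) = exp (- ln (1 - y))" using y by (simp add: exp_minus inverse_eq_divide)
      then have "exp (- p * g y) * exp (- (1 / H - 1) * g y) * (1 / (1 - y)) = 
          exp (- p * g y + - (1 / H - 1) * g y + - ln (1 - y))" by (simp only: exp_add)
      also have "- p * g y + - (1 / H - 1) * g y + - ln (1 - y) = (a - 1) * ln (1 - y)"
        using H_pos by (simp add: g_def a_def field_simps)
      finally show ?thesis using y by (simp add: powr_def)
    qed
    then have "exp (- p * g y) * exp (- (1 / H - 1) * g y) * (1 / (1 - y)) * (H * y powr (2 * H - 2)) = (1 - y) powr (a - 1) * (H * y powr (2 * H - 2))"
      by simp
    then show ?thesis using gpos e
      by (simp add: f_def stat_kernel_def g'_def mult_ac)
  qed
  have sub: "set_integrable lborel (einterval 0 \<infinity>) f \<and> (LBINT w=0..\<infinity>. f w) = (LBINT y=0..1. f (g y) * g' y)"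
  proof (intro conjI)
    have A: "((ereal \<circ> g \<circ> real_of_ereal) \<longlongrightarrow> 0) (at_right 0)"
    proof -
      have "((\<lambda>y. ereal (- H * ln (1 - y))) \<longlongrightarrow> ereal (- H * ln (1 - 0))) (at_right 0)"
        by (intro tendsto_intros) auto
      then have "((\<lambda>x. ereal (g x)) \<longlongrightarrow> ereal 0) (at_right 0)" by (simp add: g_def)
      then show ?thesis unfolding zero_ereal_def by (subst ereal_tendsto_simps1) (simp only: comp_def)
    qed
    have B: "((ereal \<circ> g \<circ> real_of_ereal) \<longlongrightarrow> \<infinity>) (at_left 1)"
    proof -
      have "filterlim g at_top (at_left 1)" unfolding g_def using H_pos by real_asymp
      then have "((\<lambda>x. ereal (g x)) \<longlongrightarrow> \<infinity>) (at_left 1)" by (simp add: tendsto_PInfty_eq_at_top)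
      then show ?thesis unfolding one_ereal_def by (subst ereal_tendsto_simps1) (simp only: comp_def)
    qed
    have einterval01: "einterval 0 1 = {0<..<1::real}" by (auto simp: einterval_def zero_ereal_def one_ereal_def)
    have int: "set_integrable lborel (einterval 0 1) (\<lambda>y. f (g y) * g' y)"
    proof -
      have "set_integrable lborel {0<..<1} (\<lambda>y. H * ((1 - y) powr (a - 1) * y powr (2 * H - 1 - 1)))"
        by (intro set_integrable_mult_right integrable_Beta a b)
      then show ?thesis unfolding einterval01
        by (subst set_integrable_cong[OF refl refl fg]) auto
    qed
    note subst = interval_integral_substitution_nonneg[where f=f and g=g and g'=g' and a=0 and b=1 and A=0 and B=\<infinity>, OF _ _ _ _ _ _ A B int]
    have dg: "DERIV g y :> g' y" if "0 < ereal y" "ereal y < 1" for y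
      unfolding g_def g'_def using that by (auto intro!: derivative_eq_intros simp: divide_inverse one_ereal_def)
    have cf: "isCont f (g y)" if "0 < ereal y" "ereal y < 1" for y
    proof -
      have y: "0 < y" "y < 1" using that by (auto simp: zero_ereal_def one_ereal_def)
      then have "0 < g y" using H_pos by (simp add: g_def mult_pos_neg)
      then show ?thesis unfolding f_def stat_kernel_def using H_pos
        by (intro continuous_intros) auto
    qed
    have cg: "isCont g' y" if "0 < ereal y" "ereal y < 1" for y
      unfolding g'_def using that by (intro continuous_intros) (auto simp: one_ereal_def)
    have nn: "0 \<le> f (g y)" "0 \<le> g' y" if "0 \<le> ereal y" "ereal y \<le> 1" for y
      using that H_pos by (auto simp: f_def g'_def one_ereal_def)
    show "set_integrable lborel (einterval 0 \<infinity>) f" by (rule subst(1)) (use dg cf cg nn in auto)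
    show "(LBINT w=0..\<infinity>. f w) = (LBINT y=0..1. f (g y) * g' y)" by (rule subst(2)) (use dg cf cg nn in auto)
  qed
  have e: "einterval 0 \<infinity> = {0<..}" by (auto simp: einterval_def zero_ereal_def)
  show "set_integrable lborel {0<..} (\<lambda>w. exp (- p * w) * stat_kernel H w)"
    using sub unfolding e f_def[abs_def] by blast
  have "(LINT w:{0<..}|lborel. f w) = (LBINT w=0..\<infinity>. f w)"
    by (simp add: interval_lebesgue_integral_def e)
  also have "\<dots> = (LBINT y=0..1. f (g y) * g' y)" using sub by simp
  also have "\<dots> = (LINT y:{0<..<1}|lborel. f (g y) * g' y)"
    by (simp add: interval_lebesgue_integral_def einterval_def zero_ereal_def one_ereal_def greaterThanLessThan_def lessThan_def greaterThan_def Int_def)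
  also have "\<dots> = (LINT y:{0<..<1}|lborel. H * ((1 - y) powr (a - 1) * y powr (2 * H - 1 - 1)))"
    by (intro set_lebesgue_integral_cong) (auto simp: fg)
  also have "\<dots> = H * Beta a (2 * H - 1)"
    using integrable_Beta(2)[OF a b] by simp
  finally show "(LINT w:{0<..}|lborel. exp (- p * w) * stat_kernel H w) = H * Beta ((p - 1) * H + 1) (2 * H - 1)"
    by (simp add: f_def a_def)
qed

lemma Beta_pos_real: "0 < a \<Longrightarrow> 0 < b \<Longrightarrow> 0 < (Beta a b :: real)"
  by (simp add: Beta_def)

lemma nn_integral_stat_kernel_half:
  assumes p: "- (1 / H - 1) < p"
  shows "(\<integral>\<^sup>+w. ennreal (exp (- p * w) * stat_kernel H w) * indicator {0<..} w \<partial>lborel) = ennreal (H * Beta ((p - 1) * H + 1) (2 * H - 1))"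
proof -
  have "(\<integral>\<^sup>+w. ennreal (exp (- p * w) * stat_kernel H w) * indicator {0<..} w \<partial>lborel) = 
     (\<integral>\<^sup>+w. ennreal (indicator {0<..} w *\<^sub>R (exp (- p * w) * stat_kernel H w)) \<partial>lborel)"
    by (intro nn_integral_cong) (auto split: split_indicator)
  also have "\<dots> = ennreal (LINT w|lborel. indicator {0<..} w *\<^sub>R (exp (- p * w) * stat_kernel H w))"
    by (rule nn_integral_eq_integral) 
       (use stat_kernel_laplace(1)[OF p] in \<open>auto simp: set_integrable_def\<close>)
  also have "\<dots> = ennreal (H * Beta ((p - 1) * H + 1) (2 * H - 1))"
    using stat_kernel_laplace(2)[OF p] by (simp add: set_lebesgue_integral_def)
  finally show ?thesis .
qed

lemma nn_integral_stat_kernel_exp: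
  assumes p: "- (1 / H - 1) < p"
  shows "(\<integral>\<^sup>+w. ennreal (exp (- p * \<bar>w\<bar>) * stat_kernel H w) \<partial>lborel) = ennreal (2 * H * Beta ((p - 1) * H + 1) (2 * H - 1))"
proof -
  let ?h = "\<lambda>w. ennreal (exp (- p * \<bar>w\<bar>) * stat_kernel H w)"
  let ?I = "\<integral>\<^sup>+w. ennreal (exp (- p * w) * stat_kernel H w) * indicator {0<..} w \<partial>lborel"
  have pos: "0 \<le> H * Beta ((p - 1) * H + 1) (2 * H - 1)"
    using p H_half H_pos by (intro mult_nonneg_nonneg less_imp_le[OF Beta_pos_real]) (auto simp: field_simps)
  have "(\<integral>\<^sup>+w. ?h w \<partial>lborel) = (\<integral>\<^sup>+w. ?h w * indicator {0<..} w + ?h w * indicator {..<0} w \<partial>lborel)"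
    by (rule nn_integral_cong_AE) (use AE_lborel_singleton[of 0] in eventually_elim, auto split: split_indicator)
  also have "\<dots> = (\<integral>\<^sup>+w. ?h w * indicator {0<..} w \<partial>lborel) + (\<integral>\<^sup>+w. ?h w * indicator {..<0} w \<partial>lborel)"
    by (rule nn_integral_add) auto
  also have "(\<integral>\<^sup>+w. ?h w * indicator {..<0} w \<partial>lborel) = (\<integral>\<^sup>+w. ?h w * indicator {0<..} w \<partial>lborel)"
    by (subst nn_integral_real_affine[where c="-1" and t=0]) (auto intro!: nn_integral_cong split: split_indicator)
  also have "(\<integral>\<^sup>+w. ?h w * indicator {0<..} w \<partial>lborel) = ?I"
    by (intro nn_integral_cong) (auto split: split_indicator)
  also have "?I + ?I = ennreal (2 * H * Beta ((p - 1) * H + 1) (2 * H - 1))"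
    unfolding nn_integral_stat_kernel_half[OF p] ennreal_plus[OF pos pos, symmetric] by (simp add: mult.assoc)
  finally show ?thesis .
qed

end

section \<open>Covariances as integrals over regions of backward times\<close>

context fou_param
begin

abbreviation "kern \<equiv> stat_kernel H"
abbreviation "kc \<equiv> kernel_const H"

definition kernel_norm :: real where "kernel_norm = 2 * H * Beta (1 - H) (2 * H - 1)"

lemma kernel_norm_pos: "0 < kernel_norm"
  using H_pos H_half H_1 by (simp add: kernel_norm_def Beta_pos_real)

lemma nn_integral_kern: "(\<integral>\<^sup>+w. ennreal (kern w) \<partial>lborel) = ennreal kernel_norm"
  using nn_integral_stat_kernel_exp[of 0] H_1 H_pos by (simp add: kernel_norm_def)

lemma nn_integral_kern_shift: "(\<integral>\<^sup>+w. ennreal (kern (d + w)) \<partial>lborel) = ennreal kernel_norm"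
  using nn_integral_real_affine[of "\<lambda>w. ennreal (kern w)" 1 d] by (simp add: nn_integral_kern)

text \<open>In the backward times a = s - u and b = t - v the integrand depends on \<open>s\<close>
  and \<open>t\<close> only through the lag d = s - t, and the rest of the dependence sits in the
  region. Comparing covariances becomes comparing regions, and the full quadrant belongs to the
  stationary covariance. Extended nonnegative integrals make every splitting unconditional.\<close>

definition cov_region :: "real \<Rightarrow> real set \<Rightarrow> real set \<Rightarrow> ennreal" where
  "cov_region d S T = (\<integral>\<^sup>+a. (\<integral>\<^sup>+b. ennreal (exp (- \<theta> * (a + b)) * kern (d - a + b)) * indicator T b \<partial>lborel) * indicator S a \<partial>lborel)"

lemma cov_region_mono:
  "S \<subseteq> S' \<Longrightarrow> T \<subseteq> T' \<Longrightarrow> cov_region d S T \<le> cov_region d S' T'"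
  unfolding cov_region_def by (intro nn_integral_mono mult_mono) (auto split: split_indicator)

lemma cov_region_Un1:
  assumes [measurable]: "S \<in> sets borel" "S' \<in> sets borel" "T \<in> sets borel" and d: "S \<inter> S' = {}"
  shows "cov_region d (S \<union> S') T = cov_region d S T + cov_region d S' T"
proof -
  have "indicator (S \<union> S') a = indicator S a + (indicator S' a :: ennreal)" for a
    using d by (auto split: split_indicator)
  then show ?thesis
    unfolding cov_region_def by (simp add: distrib_left nn_integral_add)
qed

lemma cov_region_Un2:
  assumes [measurable]: "S \<in> sets borel" "T \<in> sets borel" "T' \<in> sets borel" and d: "T \<inter> T' = {}"
  shows "cov_region d S (T \<union> T') = cov_region d S T + cov_region d S T'"
proof -
  have "indicator (T \<union> T') a = indicator T a + (indicator T' a :: ennreal)" for a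
    using d by (auto split: split_indicator)
  then show ?thesis
    unfolding cov_region_def by (simp add: distrib_left distrib_right nn_integral_add)
qed

lemma cov_region_commute:
  assumes [measurable]: "S \<in> sets borel" "T \<in> sets borel"
  shows "cov_region d S T = cov_region (- d) T S"
proof -
  have "cov_region d S T = (\<integral>\<^sup>+a. \<integral>\<^sup>+b. ennreal (exp (- \<theta> * (a + b)) * kern (d - a + b)) * indicator T b * indicator S a \<partial>lborel \<partial>lborel)"
    unfolding cov_region_def by (simp add: nn_integral_multc)
  also have "\<dots> = (\<integral>\<^sup>+b. \<integral>\<^sup>+a. ennreal (exp (- \<theta> * (a + b)) * kern (d - a + b)) * indicator T b * indicator S a \<partial>lborel \<partial>lborel)"
    by (rule lborel_pair.Fubini') measurable
  also have "\<dots> = (\<integral>\<^sup>+b. \<integral>\<^sup>+a. ennreal (exp (- \<theta> * (b + a)) * kern (- d - b + a)) * indicator S a * indicator T b \<partial>lborel \<partial>lborel)"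
  proof (intro nn_integral_cong)
    fix a b :: real
    have "kern (d - a + b) = kern (- d - b + a)"
      using stat_kernel_minus[of H "d - a + b"] by (simp add: algebra_simps)
    then show "ennreal (exp (- \<theta> * (a + b)) * kern (d - a + b)) * indicator T b * indicator S a =
      ennreal (exp (- \<theta> * (b + a)) * kern (- d - b + a)) * indicator S a * indicator T b"
      by (simp add: mult_ac add.commute)
  qed
  also have "\<dots> = cov_region (- d) T S"
    unfolding cov_region_def by (simp add: nn_integral_multc)
  finally show ?thesis .
qed

text \<open>The exponential in \<open>b\<close> is at most 1, and the kernel is then integrated over
  the whole line. Only the integral in \<open>a\<close> remains.\<close>

lemma cov_region_le1:
  assumes [measurable]: "S \<in> sets borel" and T: "T \<subseteq> {0..}"
  shows "cov_region d S T \<le> ennreal kernel_norm * (\<integral>\<^sup>+a. ennreal (exp (- \<theta> * a)) * indicator S a \<partial>lborel)"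
proof -
  have "cov_region d S T \<le> (\<integral>\<^sup>+a. (\<integral>\<^sup>+b. ennreal (exp (- \<theta> * a)) * ennreal (kern (d - a + b)) \<partial>lborel) * indicator S a \<partial>lborel)"
    unfolding cov_region_def
  proof (intro nn_integral_mono mult_right_mono)
    fix a b :: real
    show "ennreal (exp (- \<theta> * (a + b)) * kern (d - a + b)) * indicator T b \<le> ennreal (exp (- \<theta> * a)) * ennreal (kern (d - a + b))"
    proof (cases "b \<in> T")
      case True
      then have "exp (- \<theta> * (a + b)) \<le> exp (- \<theta> * a)" using T \<theta>_pos by (auto simp: algebra_simps)
      then have "exp (- \<theta> * (a + b)) * kern (d - a + b) \<le> exp (- \<theta> * a) * kern (d - a + b)"
        by (intro mult_right_mono) auto
      then show ?thesis using True by (simp add: ennreal_mult[symmetric])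
    qed simp
  qed auto
  also have "\<dots> = (\<integral>\<^sup>+a. ennreal kernel_norm * (ennreal (exp (- \<theta> * a)) * indicator S a) \<partial>lborel)"
    by (simp add: nn_integral_cmult nn_integral_kern_shift mult_ac)
  also have "\<dots> = ennreal kernel_norm * (\<integral>\<^sup>+a. ennreal (exp (- \<theta> * a)) * indicator S a \<partial>lborel)"
    by (rule nn_integral_cmult) measurable
  finally show ?thesis .
qed

lemma cov_region_tail1:
  assumes "T \<subseteq> {0..}"
  shows "cov_region d {s..} T \<le> ennreal (kernel_norm / \<theta> * exp (- \<theta> * s))"
proof -
  have "cov_region d {s..} T \<le> ennreal kernel_norm * ennreal (exp (- \<theta> * s) / \<theta>)"
    using cov_region_le1[of "{s..}" T d] assms nn_integral_exp_atLeast[OF \<theta>_pos, of s] by simp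
  then show ?thesis using kernel_norm_pos \<theta>_pos by (simp add: ennreal_mult[symmetric])
qed

lemma cov_region_tail2:
  assumes "S \<subseteq> {0..}" "S \<in> sets borel"
  shows "cov_region d S {t..} \<le> ennreal (kernel_norm / \<theta> * exp (- \<theta> * t))"
  using cov_region_tail1[OF assms(1), of "- d" t] cov_region_commute[of S "{t..}" d] assms(2) by simp

lemma cov_region_short:
  assumes "T \<subseteq> {0..}" and h: "0 \<le> h"
  shows "cov_region d {0..<h} T \<le> ennreal (kernel_norm * h)"
proof -
  have "(\<integral>\<^sup>+a. ennreal (exp (- \<theta> * a)) * indicator {0..<h} a \<partial>lborel) \<le> (\<integral>\<^sup>+a. indicator {0..<h} a \<partial>lborel)"
    using \<theta>_pos by (intro nn_integral_mono) (auto split: split_indicator)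
  also have "\<dots> = ennreal h" using h by simp
  finally have "(\<integral>\<^sup>+a. ennreal (exp (- \<theta> * a)) * indicator {0..<h} a \<partial>lborel) \<le> ennreal h" .
  then have "ennreal kernel_norm * (\<integral>\<^sup>+a. ennreal (exp (- \<theta> * a)) * indicator {0..<h} a \<partial>lborel) \<le> ennreal kernel_norm * ennreal h"
    by (rule mult_left_mono) simp
  with cov_region_le1[of "{0..<h}" T d] assms(1) have "cov_region d {0..<h} T \<le> ennreal kernel_norm * ennreal h"
    by (auto intro: order_trans)
  then show ?thesis using kernel_norm_pos h by (simp add: ennreal_mult)
qed

text \<open>Translating \<open>a\<close> by \<open>h\<close> costs a factor
  \<open>exp (- \<theta> * h)\<close> and changes the lag; this is the semigroup property of the
  Ornstein-Uhlenbeck equation.\<close>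

lemma cov_region_shift1:
  assumes [measurable]: "T \<in> sets borel"
  shows "cov_region d {h..<t} T = ennreal (exp (- \<theta> * h)) * cov_region (d - h) {0..<t - h} T"
proof -
  have "cov_region d {h..<t} T = (\<integral>\<^sup>+a. (\<integral>\<^sup>+b. ennreal (exp (- \<theta> * ((h + 1 * a) + b)) * kern (d - (h + 1 * a) + b)) * indicator T b \<partial>lborel) * indicator {h..<t} (h + 1 * a) \<partial>lborel)"
    unfolding cov_region_def by (subst nn_integral_real_affine[where c=1 and t=h]) auto
  also have "\<dots> = (\<integral>\<^sup>+a. (\<integral>\<^sup>+b. ennreal (exp (- \<theta> * h)) * (ennreal (exp (- \<theta> * (a + b)) * kern (d - h - a + b)) * indicator T b) \<partial>lborel) * indicator {0..<t - h} a \<partial>lborel)"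
  proof (rule nn_integral_cong)
    fix a :: real
    have "ennreal (exp (- \<theta> * ((h + 1 * a) + b)) * kern (d - (h + 1 * a) + b)) * indicator T b =
      ennreal (exp (- \<theta> * h)) * (ennreal (exp (- \<theta> * (a + b)) * kern (d - h - a + b)) * indicator T b)" for b
    proof -
      have "exp (- \<theta> * ((h + 1 * a) + b)) = exp (- \<theta> * h) * exp (- \<theta> * (a + b))"
        by (simp add: exp_add[symmetric] algebra_simps)
      moreover have "d - (h + 1 * a) + b = d - h - a + b" by simp
      ultimately show ?thesis
        by (simp only: ennreal_mult mult.assoc exp_ge_zero stat_kernel_nonneg mult_nonneg_nonneg)
    qed
    then show "(\<integral>\<^sup>+b. ennreal (exp (- \<theta> * ((h + 1 * a) + b)) * kern (d - (h + 1 * a) + b)) * indicator T b \<partial>lborel) * indicator {h..<t} (h + 1 * a) =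
      (\<integral>\<^sup>+b. ennreal (exp (- \<theta> * h)) * (ennreal (exp (- \<theta> * (a + b)) * kern (d - h - a + b)) * indicator T b) \<partial>lborel) * indicator {0..<t - h} a"
      by (simp only:) (auto split: split_indicator)
  qed
  also have "\<dots> = ennreal (exp (- \<theta> * h)) * cov_region (d - h) {0..<t - h} T"
    unfolding cov_region_def by (simp add: nn_integral_cmult mult.assoc)
  finally show ?thesis .
qed

lemma cov_region_shift2:
  assumes [measurable]: "S \<in> sets borel"
  shows "cov_region d S {h..<t} = ennreal (exp (- \<theta> * h)) * cov_region (d + h) S {0..<t - h}"
  using cov_region_shift1[OF assms, of "- d" h t] 
  by (simp add: cov_region_commute[of S _ d] cov_region_commute[of S _ "d + h"])

text \<open>The covariance of the stationary solution: integrating along the diagonal of the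
  quadrant leaves a convolution with \<open>exp (- \<theta> * |x|) / (2 * \<theta>)\<close>.\<close>

definition stat_cov :: "real \<Rightarrow> real" where
  "stat_cov d = kc / (2 * \<theta>) * (LINT w|lborel. exp (- \<theta> * \<bar>d - w\<bar>) * kern w)"

lemma integrable_kern: "integrable lborel kern"
  by (rule integrableI_nn_integral_finite[OF _ _ nn_integral_kern]) auto

lemma integrable_exp_kern: "integrable lborel (\<lambda>w. exp (- \<theta> * \<bar>d - w\<bar>) * kern w)"
proof (rule Bochner_Integration.integrable_bound[OF integrable_kern])
  show "AE w in lborel. norm (exp (- \<theta> * \<bar>d - w\<bar>) * kern w) \<le> norm (kern w)"
    using \<theta>_pos by (intro AE_I2) (simp add: abs_mult mult_left_le_one_le)
qed measurable

lemma stat_cov_nonneg: "0 \<le> stat_cov d"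
  unfolding stat_cov_def using kernel_const_pos \<theta>_pos
  by (intro mult_nonneg_nonneg integral_nonneg_AE AE_I2) auto

text \<open>Replace \<open>b\<close> by w = d - a + b and integrate in \<open>a\<close> first. For
  given \<open>w\<close>, \<open>a\<close> runs from \<open>max 0 (d - w)\<close> to infinity
  against \<open>exp (- 2 * \<theta> * a)\<close>.\<close>

lemma cov_region_full: "ennreal kc * cov_region d {0..} {0..} = ennreal (stat_cov d)"
proof -
  have "cov_region d {0..} {0..} = (\<integral>\<^sup>+a. (\<integral>\<^sup>+w. ennreal (exp (- \<theta> * (2 * a + w - d)) * kern w) * indicator {0..} (a - d + w) \<partial>lborel) * indicator {0..} a \<partial>lborel)"
    unfolding cov_region_def
  proof (rule nn_integral_cong, rule arg_cong2[where f="(*)", OF _ refl])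
    fix a :: real
    show "(\<integral>\<^sup>+b. ennreal (exp (- \<theta> * (a + b)) * kern (d - a + b)) * indicator {0..} b \<partial>lborel) =
       (\<integral>\<^sup>+w. ennreal (exp (- \<theta> * (2 * a + w - d)) * kern w) * indicator {0..} (a - d + w) \<partial>lborel)"
      by (subst nn_integral_real_affine[where c=1 and t="a - d"]) (auto intro!: nn_integral_cong simp: algebra_simps)
  qed
  also have "\<dots> = (\<integral>\<^sup>+a. (\<integral>\<^sup>+w. ennreal (exp (- \<theta> * (2 * a + w - d)) * kern w) * indicator {0..} (a - d + w) * indicator {0..} a \<partial>lborel) \<partial>lborel)"
    by (intro nn_integral_cong nn_integral_multc[symmetric]) measurable
  also have "\<dots> = (\<integral>\<^sup>+w. (\<integral>\<^sup>+a. ennreal (exp (- \<theta> * (2 * a + w - d)) * kern w) * indicator {0..} (a - d + w) * indicator {0..} a \<partial>lborel) \<partial>lborel)"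
    by (rule lborel_pair.Fubini') measurable
  also have "\<dots> = (\<integral>\<^sup>+w. ennreal (1 / (2 * \<theta>)) * ennreal (exp (- \<theta> * \<bar>d - w\<bar>) * kern w) \<partial>lborel)"
  proof (rule nn_integral_cong)
    fix w :: real
    have "(\<integral>\<^sup>+a. ennreal (exp (- \<theta> * (2 * a + w - d)) * kern w) * indicator {0..} (a - d + w) * indicator {0..} a \<partial>lborel) =
      (\<integral>\<^sup>+a. ennreal (exp (\<theta> * (d - w)) * kern w) * (ennreal (exp (- (2 * \<theta>) * a)) * indicator {max 0 (d - w)..} a) \<partial>lborel)"
    proof (rule nn_integral_cong)
      fix a :: real
      have "exp (- \<theta> * (2 * a + w - d)) = exp (\<theta> * (d - w)) * exp (- (2 * \<theta>) * a)"
        by (simp add: exp_add[symmetric] algebra_simps)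
      then show "ennreal (exp (- \<theta> * (2 * a + w - d)) * kern w) * indicator {0..} (a - d + w) * indicator {0..} a =
         ennreal (exp (\<theta> * (d - w)) * kern w) * (ennreal (exp (- (2 * \<theta>) * a)) * indicator {max 0 (d - w)..} a)"
        by (auto simp: ennreal_mult[symmetric] mult_ac split: split_indicator)
    qed
    also have "\<dots> = ennreal (exp (\<theta> * (d - w)) * kern w) * ennreal (exp (- (2 * \<theta>) * max 0 (d - w)) / (2 * \<theta>))"
      using nn_integral_exp_atLeast[of "2 * \<theta>" "max 0 (d - w)"] \<theta>_pos by (subst nn_integral_cmult) auto
    also have "\<dots> = ennreal ((exp (\<theta> * (d - w)) * exp (- (2 * \<theta>) * max 0 (d - w))) * kern w / (2 * \<theta>))"
      using \<theta>_pos by (simp add: ennreal_mult[symmetric] mult_ac)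
    also have "exp (\<theta> * (d - w)) * exp (- (2 * \<theta>) * max 0 (d - w)) = exp (- \<theta> * \<bar>d - w\<bar>)"
      by (simp add: exp_add[symmetric] max_def abs_real_def algebra_simps)
    finally show "(\<integral>\<^sup>+a. ennreal (exp (- \<theta> * (2 * a + w - d)) * kern w) * indicator {0..} (a - d + w) * indicator {0..} a \<partial>lborel) =
      ennreal (1 / (2 * \<theta>)) * ennreal (exp (- \<theta> * \<bar>d - w\<bar>) * kern w)"
      using \<theta>_pos by (simp add: ennreal_mult[symmetric] mult_ac)
  qed
  also have "\<dots> = ennreal (1 / (2 * \<theta>)) * (\<integral>\<^sup>+w. ennreal (exp (- \<theta> * \<bar>d - w\<bar>) * kern w) \<partial>lborel)"
    by (rule nn_integral_cmult) measurable
  also have "(\<integral>\<^sup>+w. ennreal (exp (- \<theta> * \<bar>d - w\<bar>) * kern w) \<partial>lborel) = ennreal (LINT w|lborel. exp (- \<theta> * \<bar>d - w\<bar>) * kern w)"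
    by (rule nn_integral_eq_integral[OF integrable_exp_kern]) auto
  finally show ?thesis using \<theta>_pos kernel_const_pos
    by (simp add: stat_cov_def ennreal_mult[symmetric] mult_ac)
qed

lemma R_eq_cov_region:
  assumes s: "0 \<le> s" and t: "0 \<le> t"
  shows "ennreal (R s t) = ennreal kc * cov_region (s - t) {0..<s} {0..<t}" and "0 \<le> R s t"
proof -
  note cov_density_measurable[of H, measurable]
  let ?f = "\<lambda>p. exp (- \<theta> * s) * weight (fst p) * indicator {0<..s} (fst p) *
     (exp (- \<theta> * t) * weight (snd p) * indicator {0<..t} (snd p)) *
     cov_density H (fst p) (snd p)"
  have f: "?f (u, v) = kc * (exp (- \<theta> * ((s - u) + (t - v))) * kern (u - v)) * indicator {0<..t} v * indicator {0<..s} u" for u v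
  proof -
    have e: "exp (- \<theta> * s) * weight u * (exp (- \<theta> * t) * weight v) * exp (u + v) = exp (- \<theta> * ((s - u) + (t - v)))"
      by (simp add: weight_def exp_add[symmetric] algebra_simps)
    have "?f (u, v) = kc * (exp (- \<theta> * s) * weight u * (exp (- \<theta> * t) * weight v) * exp (u + v)) * kern (u - v) * indicator {0<..t} v * indicator {0<..s} u"
      by (simp add: cov_density_eq_stat_kernel mult_ac)
    also have "\<dots> = kc * exp (- \<theta> * ((s - u) + (t - v))) * kern (u - v) * indicator {0<..t} v * indicator {0<..s} u"
      unfolding e ..
    finally show ?thesis by (simp only: mult.assoc)
  qed
  have nn: "0 \<le> ?f p" for p using cov_density_nonneg by (simp add: weight_def)
  show "0 \<le> R s t" unfolding R_def by (intro integral_nonneg_AE AE_I2 nn)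
  have "(\<integral>\<^sup>+p. ennreal (?f p) \<partial>(lborel \<Otimes>\<^sub>M lborel)) = (\<integral>\<^sup>+u. \<integral>\<^sup>+v. ennreal (?f (u, v)) \<partial>lborel \<partial>lborel)"
    by (rule lborel.nn_integral_fst[symmetric]) measurable
  also have "\<dots> = (\<integral>\<^sup>+u. \<integral>\<^sup>+v. ennreal kc * (ennreal (exp (- \<theta> * ((s - u) + (t - v))) * kern (u - v)) * indicator {0<..t} v * indicator {0<..s} u) \<partial>lborel \<partial>lborel)"
    unfolding f using kernel_const_pos
    by (intro nn_integral_cong) (auto simp: ennreal_mult split: split_indicator)
  also have "\<dots> = ennreal kc * (\<integral>\<^sup>+u. (\<integral>\<^sup>+v. ennreal (exp (- \<theta> * ((s - u) + (t - v))) * kern (u - v)) * indicator {0<..t} v \<partial>lborel) * indicator {0<..s} u \<partial>lborel)"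
    by (simp add: nn_integral_cmult nn_integral_multc)
  also have "(\<integral>\<^sup>+u. (\<integral>\<^sup>+v. ennreal (exp (- \<theta> * ((s - u) + (t - v))) * kern (u - v)) * indicator {0<..t} v \<partial>lborel) * indicator {0<..s} u \<partial>lborel)
     = (\<integral>\<^sup>+a. (\<integral>\<^sup>+v. ennreal (exp (- \<theta> * (a + (t - v))) * kern (s - a - v)) * indicator {0<..t} v \<partial>lborel) * indicator {0..<s} a \<partial>lborel)"
    by (subst nn_integral_real_affine[where c="-1" and t=s]) (auto intro!: nn_integral_cong split: split_indicator)
  also have "\<dots> = cov_region (s - t) {0..<s} {0..<t}"
    unfolding cov_region_def
  proof (rule nn_integral_cong, rule arg_cong2[where f="(*)", OF _ refl])
    fix a :: real
    show "(\<integral>\<^sup>+v. ennreal (exp (- \<theta> * (a + (t - v))) * kern (s - a - v)) * indicator {0<..t} v \<partial>lborel) =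
       (\<integral>\<^sup>+b. ennreal (exp (- \<theta> * (a + b)) * kern (s - t - a + b)) * indicator {0..<t} b \<partial>lborel)"
      by (subst nn_integral_real_affine[where c="-1" and t=t]) (auto intro!: nn_integral_cong simp: algebra_simps split: split_indicator)
  qed
  finally have eq: "(\<integral>\<^sup>+p. ennreal (?f p) \<partial>(lborel \<Otimes>\<^sub>M lborel)) = ennreal kc * cov_region (s - t) {0..<s} {0..<t}" .
  \<comment> \<open>Comparison with the full quadrant gives finiteness, so the Bochner integral in
    \<open>R\<close> agrees with the extended one.\<close>
  have "\<dots> \<le> ennreal kc * cov_region (s - t) {0..} {0..}"
    by (intro mult_left_mono cov_region_mono) auto
  also have "\<dots> < \<infinity>" by (simp add: cov_region_full)
  finally have "integrable (lborel \<Otimes>\<^sub>M lborel) ?f"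
    using eq nn by (intro integrableI_nonneg) (auto simp: weight_def)
  then have "(\<integral>\<^sup>+p. ennreal (?f p) \<partial>(lborel \<Otimes>\<^sub>M lborel)) = ennreal (R s t)"
    unfolding R_def by (rule nn_integral_eq_integral) (rule AE_I2, rule nn)
  then show "ennreal (R s t) = ennreal kc * cov_region (s - t) {0..<s} {0..<t}" using eq by simp
qed

lemma R_le_stat_cov:
  assumes "0 \<le> s" "0 \<le> t"
  shows "R s t \<le> stat_cov (s - t)"
proof -
  have "ennreal (R s t) \<le> ennreal (stat_cov (s - t))"
    unfolding R_eq_cov_region(1)[OF assms] cov_region_full[symmetric]
    by (intro mult_left_mono cov_region_mono) auto
  then show ?thesis using stat_cov_nonneg by simp
qed

text \<open>The quadrant is the rectangle of \<open>R\<close> together with two strips, each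
  starting at distance \<open>s\<close> or \<open>t\<close> and hence exponentially small.\<close>

lemma stat_cov_le_R:
  assumes s: "0 \<le> s" and t: "0 \<le> t"
  shows "stat_cov (s - t) \<le> R s t + kc * kernel_norm / \<theta> * (exp (- \<theta> * s) + exp (- \<theta> * t))"
proof -
  have e: "{0..} = {0..<s} \<union> {s..}" "{0..} = {0..<t} \<union> {t..}" using s t by auto
  have "cov_region (s - t) {0..} {0..} = cov_region (s - t) ({0..<s} \<union> {s..}) {0..}" using e by simp
  also have "\<dots> = cov_region (s - t) {0..<s} {0..} + cov_region (s - t) {s..} {0..}"
    by (rule cov_region_Un1) auto
  also have "cov_region (s - t) {0..<s} {0..} = cov_region (s - t) {0..<s} ({0..<t} \<union> {t..})" using e by simp
  also have "\<dots> = cov_region (s - t) {0..<s} {0..<t} + cov_region (s - t) {0..<s} {t..}"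
    by (rule cov_region_Un2) auto
  also have "\<dots> + cov_region (s - t) {s..} {0..} \<le> cov_region (s - t) {0..<s} {0..<t} 
      + ennreal (kernel_norm / \<theta> * exp (- \<theta> * t)) + ennreal (kernel_norm / \<theta> * exp (- \<theta> * s))"
    by (intro add_mono order_refl cov_region_tail1 cov_region_tail2) auto
  finally have "ennreal kc * cov_region (s - t) {0..} {0..} \<le> ennreal kc * (cov_region (s - t) {0..<s} {0..<t} 
      + ennreal (kernel_norm / \<theta> * exp (- \<theta> * t)) + ennreal (kernel_norm / \<theta> * exp (- \<theta> * s)))"
    by (rule mult_left_mono) simp
  also have "\<dots> = ennreal (R s t) + ennreal (kc * (kernel_norm / \<theta> * exp (- \<theta> * t))) + ennreal (kc * (kernel_norm / \<theta> * exp (- \<theta> * s)))"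
    unfolding R_eq_cov_region(1)[OF s t] distrib_left
    using kernel_norm_pos \<theta>_pos kernel_const_pos by (simp only: ennreal_mult mult_nonneg_nonneg divide_nonneg_nonneg exp_ge_zero less_imp_le)
  also have "\<dots> = ennreal (R s t + kc * (kernel_norm / \<theta> * exp (- \<theta> * t)) + kc * (kernel_norm / \<theta> * exp (- \<theta> * s)))"
    using R_eq_cov_region(2)[OF s t] kernel_norm_pos \<theta>_pos kernel_const_pos
    by (simp only: ennreal_plus add_nonneg_nonneg mult_nonneg_nonneg divide_nonneg_nonneg exp_ge_zero less_imp_le)
  finally have "stat_cov (s - t) \<le> R s t + kc * (kernel_norm / \<theta> * exp (- \<theta> * t)) + kc * (kernel_norm / \<theta> * exp (- \<theta> * s))"
    unfolding cov_region_full using R_eq_cov_region(2)[OF s t] kernel_norm_pos \<theta>_pos kernel_const_pos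
    by (subst (asm) ennreal_le_iff) auto
  then show ?thesis by (simp add: algebra_simps)
qed

text \<open>Cutting the strip \<open>a < h\<close> off the region of \<open>R t t\<close> leaves
  \<open>exp (- \<theta> * h)\<close> times the region of \<open>R s t\<close>. Conversely, the
  region of \<open>R s t\<close> contains a translate of that of \<open>R s s\<close>. Linear order
  in the time step is all that the chaining argument uses.\<close>

lemma R_increment:
  assumes s: "0 \<le> s" and st: "s \<le> t"
  shows "R t t + R s s - 2 * R s t \<le> (kc * kernel_norm + \<theta> * stat_cov 0) * (t - s)"
proof -
  define h where "h = t - s"
  have h: "0 \<le> h" "t = s + h" "t - h = s" using st by (auto simp: h_def)
  have t: "0 \<le> t" using s st by simp
  have "cov_region 0 {0..<t} {0..<t} = cov_region 0 ({0..<h} \<union> {h..<t}) {0..<t}"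
    using h s by (intro arg_cong2[where f="cov_region 0"]) auto
  also have "\<dots> = cov_region 0 {0..<h} {0..<t} + cov_region 0 {h..<t} {0..<t}"
    by (rule cov_region_Un1) auto
  also have "\<dots> \<le> ennreal (kernel_norm * h) + cov_region 0 {h..<t} {0..<t}"
    by (intro add_mono cov_region_short order_refl h) auto
  also have "cov_region 0 {h..<t} {0..<t} = ennreal (exp (- \<theta> * h)) * cov_region (s - t) {0..<s} {0..<t}"
    by (subst cov_region_shift1) (use h in auto)
  also have "\<dots> \<le> 1 * cov_region (s - t) {0..<s} {0..<t}"
    using h \<theta>_pos by (intro mult_right_mono) auto
  finally have "ennreal kc * cov_region (t - t) {0..<t} {0..<t} \<le> ennreal kc * (ennreal (kernel_norm * h) + cov_region (s - t) {0..<s} {0..<t})"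
    by (intro mult_left_mono) (auto intro: add_left_mono)
  then have "ennreal (R t t) \<le> ennreal kc * ennreal (kernel_norm * h) + ennreal (R s t)"
    unfolding R_eq_cov_region(1)[OF s t] R_eq_cov_region(1)[OF t t] distrib_left .
  also have "\<dots> = ennreal (kc * (kernel_norm * h) + R s t)"
    using R_eq_cov_region(2)[OF s t] kernel_norm_pos kernel_const_pos h(1)
    by (simp only: ennreal_mult ennreal_plus mult_nonneg_nonneg less_imp_le)
  finally have "ennreal (R t t) \<le> ennreal (kc * (kernel_norm * h) + R s t)" .
  then have 1: "R t t \<le> kc * kernel_norm * h + R s t"
    using R_eq_cov_region(2)[OF s t] kernel_norm_pos kernel_const_pos h by (subst (asm) ennreal_le_iff) auto
  have "ennreal (exp (- \<theta> * h)) * cov_region (s - s) {0..<s} {0..<s} = cov_region (s - t) {0..<s} {h..<t}"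
    by (subst cov_region_shift2) (use h in auto)
  also have "\<dots> \<le> cov_region (s - t) {0..<s} {0..<t}"
    using h by (intro cov_region_mono) auto
  finally have "ennreal kc * (ennreal (exp (- \<theta> * h)) * cov_region (s - s) {0..<s} {0..<s}) \<le> ennreal kc * cov_region (s - t) {0..<s} {0..<t}"
    by (rule mult_left_mono) simp
  then have "ennreal (exp (- \<theta> * h)) * ennreal (R s s) \<le> ennreal (R s t)"
    unfolding R_eq_cov_region(1)[OF s t] R_eq_cov_region(1)[OF s s] by (simp only: mult_ac)
  then have 2: "exp (- \<theta> * h) * R s s \<le> R s t"
    using R_eq_cov_region(2)[OF s t] R_eq_cov_region(2)[OF s s] by (simp add: ennreal_mult[symmetric])
  have "1 - \<theta> * h \<le> exp (- \<theta> * h)" using exp_ge_add_one_self[of "- \<theta> * h"] by simp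
  then have "(1 - \<theta> * h) * R s s \<le> exp (- \<theta> * h) * R s s"
    by (intro mult_right_mono R_eq_cov_region(2) s)
  then have "R s s - R s t \<le> \<theta> * h * R s s" using 2 by (simp add: algebra_simps)
  also have "\<dots> \<le> \<theta> * h * stat_cov 0"
    using R_le_stat_cov[OF s s] h \<theta>_pos by (intro mult_left_mono) auto
  finally show ?thesis using 1 by (simp add: h_def algebra_simps)
qed

section \<open>Decay, value at zero and continuity of the stationary covariance\<close>

definition decay :: real where "decay = min \<theta> ((1 / H - 1) / 2)"

text \<open>The half in \<open>decay\<close> keeps it strictly below the rate 1/H - 1 of the kernel,
  so this integral is finite.\<close>

definition decay_const :: real where
  "decay_const = kc / (2 * \<theta>) * (LINT w|lborel. exp (decay * \<bar>w\<bar>) * kern w)"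

lemma decay_pos: "0 < decay" using \<theta>_pos H_1 H_pos by (simp add: decay_def)

lemma integrable_exp_decay_kern: "integrable lborel (\<lambda>w. exp (decay * \<bar>w\<bar>) * kern w)"
proof (rule integrableI_nn_integral_finite)
  define x where "x = 1 / H - 1"
  have "0 < x" using H_1 H_pos by (simp add: x_def)
  moreover have "decay \<le> x / 2" unfolding decay_def x_def by (rule min.cobounded2)
  ultimately have "- x < - decay" by linarith
  then have "- (1 / H - 1) < - decay" unfolding x_def .
  from nn_integral_stat_kernel_exp[OF this]
  show "(\<integral>\<^sup>+w. ennreal (exp (decay * \<bar>w\<bar>) * kern w) \<partial>lborel) = ennreal (2 * H * Beta ((- decay - 1) * H + 1) (2 * H - 1))"
    by simp
qed auto

lemma decay_const_nonneg: "0 \<le> decay_const"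
  unfolding decay_const_def using kernel_const_pos \<theta>_pos
  by (intro mult_nonneg_nonneg integral_nonneg_AE AE_I2) auto

text \<open>Since |d| <= |d - w| + |w|, a factor \<open>exp (- decay * |d|)\<close> can be taken out
  of the convolution at the price of \<open>exp (decay * |w|)\<close> on the kernel.\<close>

lemma stat_cov_decay: "stat_cov d \<le> decay_const * exp (- decay * \<bar>d\<bar>)"
proof -
  have "(LINT w|lborel. exp (- \<theta> * \<bar>d - w\<bar>) * kern w) \<le> (LINT w|lborel. exp (- decay * \<bar>d\<bar>) * (exp (decay * \<bar>w\<bar>) * kern w))"
  proof (rule integral_mono)
    fix w
    have "decay * \<bar>d\<bar> \<le> decay * (\<bar>d - w\<bar> + \<bar>w\<bar>)" using decay_pos by (intro mult_left_mono) auto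
    moreover have "decay * \<bar>d - w\<bar> \<le> \<theta> * \<bar>d - w\<bar>" by (intro mult_right_mono) (auto simp: decay_def)
    ultimately have "exp (- \<theta> * \<bar>d - w\<bar>) \<le> exp (- decay * \<bar>d\<bar> + decay * \<bar>w\<bar>)"
      by (simp add: algebra_simps)
    also have "\<dots> = exp (- decay * \<bar>d\<bar>) * exp (decay * \<bar>w\<bar>)" by (rule exp_add)
    finally have "exp (- \<theta> * \<bar>d - w\<bar>) * kern w \<le> exp (- decay * \<bar>d\<bar>) * exp (decay * \<bar>w\<bar>) * kern w"
      by (rule mult_right_mono) simp
    then show "exp (- \<theta> * \<bar>d - w\<bar>) * kern w \<le> exp (- decay * \<bar>d\<bar>) * (exp (decay * \<bar>w\<bar>) * kern w)"
      by (simp only: mult.assoc)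
  qed (intro integrable_exp_kern integrable_mult_right integrable_exp_decay_kern)+
  then have "stat_cov d \<le> kc / (2 * \<theta>) * (LINT w|lborel. exp (- decay * \<bar>d\<bar>) * (exp (decay * \<bar>w\<bar>) * kern w))"
    unfolding stat_cov_def using kernel_const_pos \<theta>_pos by (intro mult_left_mono) auto
  then show ?thesis unfolding integral_mult_right_zero decay_const_def by (simp only: mult_ac)
qed

lemma stat_cov_minus: "stat_cov (- d) = stat_cov d"
proof -
  have "(LINT w|lborel. exp (- \<theta> * \<bar>- d - w\<bar>) * kern w) = (LINT w|lborel. exp (- \<theta> * \<bar>- d - (0 + - 1 * w)\<bar>) * kern (0 + - 1 * w))"
    by (subst lborel_integral_real_affine[where c="-1" and t=0]) auto
  also have "\<dots> = (LINT w|lborel. exp (- \<theta> * \<bar>d - w\<bar>) * kern w)"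
    by (intro Bochner_Integration.integral_cong) (auto simp: abs_minus_commute)
  finally show ?thesis by (simp add: stat_cov_def)
qed

lemma stat_cov_0: "stat_cov 0 = Psi H \<theta>"
proof -
  have "1 < 1 / H" using H_1 H_pos by simp
  then have p: "- (1 / H - 1) < \<theta>" using \<theta>_pos by linarith
  let ?b = "Beta ((\<theta> - 1) * H + 1) (2 * H - 1)"
  have "0 < \<theta> * H" using \<theta>_pos H_pos by simp
  then have "0 < (\<theta> - 1) * H + 1" using H_1 by (simp add: left_diff_distrib)
  then have "0 \<le> ?b" using H_half by (intro less_imp_le[OF Beta_pos_real]) auto
  have "ennreal (LINT w|lborel. exp (- \<theta> * \<bar>0 - w\<bar>) * kern w) = (\<integral>\<^sup>+w. ennreal (exp (- \<theta> * \<bar>w\<bar>) * kern w) \<partial>lborel)"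
    using integrable_exp_kern[of 0] by (subst nn_integral_eq_integral) auto
  also have "\<dots> = ennreal (2 * H * ?b)" by (rule nn_integral_stat_kernel_exp[OF p])
  finally have "(LINT w|lborel. exp (- \<theta> * \<bar>0 - w\<bar>) * kern w) = 2 * H * ?b"
    using \<open>0 \<le> ?b\<close> H_pos by (subst (asm) ennreal_inj) (auto intro!: integral_nonneg_AE)
  then have "stat_cov 0 = H * kc * ?b / \<theta>" by (simp add: stat_cov_def)
  also have "H * kc = (2 * H - 1) * (H * H * H powr (2 * H - 2))"
    by (simp add: kernel_const_def alpha_H_def)
  also have "H * H * H powr (2 * H - 2) = H powr (2 * H)"
    using H_pos powr_add[of H 2 "2 * H - 2"] by (simp add: power2_eq_square)
  finally show ?thesis by (simp add: Psi_def)
qed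

lemma continuous_stat_cov: "continuous_on UNIV stat_cov"
proof (rule continuous_at_imp_continuous_on, rule ballI)
  fix d :: real
  have "((\<lambda>d. LINT w|lborel. exp (- \<theta> * \<bar>d - w\<bar>) * kern w) \<longlongrightarrow> (LINT w|lborel. exp (- \<theta> * \<bar>d - w\<bar>) * kern w)) (at d)"
  proof (subst tendsto_at_iff_sequentially, safe)
    fix f :: "nat \<Rightarrow> real" assume f: "f \<longlonglongrightarrow> d"
    show "((\<lambda>d. LINT w|lborel. exp (- \<theta> * \<bar>d - w\<bar>) * kern w) \<circ> f) \<longlonglongrightarrow> (LINT w|lborel. exp (- \<theta> * \<bar>d - w\<bar>) * kern w)"
      unfolding comp_def
    proof (rule integral_dominated_convergence[where w=kern])
      show "AE w in lborel. (\<lambda>i. exp (- \<theta> * \<bar>f i - w\<bar>) * kern w) \<longlonglongrightarrow> exp (- \<theta> * \<bar>d - w\<bar>) * kern w"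
        by (intro AE_I2 tendsto_intros f)
      show "AE w in lborel. norm (exp (- \<theta> * \<bar>f i - w\<bar>) * kern w) \<le> kern w" for i
        using \<theta>_pos by (intro AE_I2) (simp add: abs_mult mult_left_le_one_le)
    qed (auto intro: integrable_kern)
  qed
  then show "isCont stat_cov d"
    unfolding stat_cov_def[abs_def] isCont_def by (intro tendsto_intros)
qed

end

section \<open>Fluctuations of the empirical second moment\<close>

text \<open>By 1 + x <= exp x each term is bounded by an increment of
  \<open>exp (- p * t) / p\<close>, and the bound telescopes.\<close>

lemma sum_exp_le:
  fixes p h :: real
  assumes "0 < p" "0 \<le> h"
  shows "h * (\<Sum>k=1..N. exp (- p * (real k * h))) \<le> 1 / p"
proof -
  have step: "h * exp (- p * (real (Suc k) * h)) \<le> (exp (- p * (real k * h)) - exp (- p * (real (Suc k) * h))) / p" for k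
  proof -
    have "exp (- p * (real k * h)) = exp (p * h) * exp (- p * (real (Suc k) * h))"
      by (simp add: exp_add[symmetric] algebra_simps)
    moreover have "(1 + p * h) * exp (- p * (real (Suc k) * h)) \<le> exp (p * h) * exp (- p * (real (Suc k) * h))"
      by (intro mult_right_mono exp_ge_add_one_self) simp
    ultimately have "p * h * exp (- p * (real (Suc k) * h)) \<le> exp (- p * (real k * h)) - exp (- p * (real (Suc k) * h))"
      by (simp add: algebra_simps)
    then show ?thesis using assms by (simp add: field_simps)
  qed
  have "h * (\<Sum>k=1..N. exp (- p * (real k * h))) \<le> (1 - exp (- p * (real N * h))) / p"
  proof (induction N)
    case (Suc N)
    have "h * (\<Sum>k=1..Suc N. exp (- p * (real k * h))) = h * (\<Sum>k=1..N. exp (- p * (real k * h))) + h * exp (- p * (real (Suc N) * h))"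
      by (simp add: distrib_left)
    also have "\<dots> \<le> (1 - exp (- p * (real N * h))) / p + (exp (- p * (real N * h)) - exp (- p * (real (Suc N) * h))) / p"
      by (intro add_mono Suc step)
    also have "\<dots> = (1 - exp (- p * (real (Suc N) * h))) / p" by (simp add: diff_divide_distrib)
    finally show ?case .
  qed simp
  also have "\<dots> \<le> 1 / p" using assms by (intro divide_right_mono) auto
  finally show ?thesis .
qed

text \<open>On each side of \<open>j\<close> the distances to \<open>j\<close> are distinct, so
  either half is at most the one-sided sum. The summand \<open>h\<close> comes from distance
  0.\<close>

lemma sum_exp_abs_le:
  fixes p h :: real
  assumes p: "0 < p" and h: "0 \<le> h"
  shows "h * (\<Sum>k=1..N. exp (- p * \<bar>real j * h - real k * h\<bar>)) \<le> 2 * (h + 1 / p)"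
proof -
  define f where "f d = exp (- p * (real d * h))" for d :: nat
  define D where "D = {0..j + N}"
  have f0: "0 \<le> f d" for d by (simp add: f_def)
  have fab: "exp (- p * \<bar>real j * h - real k * h\<bar>) = f (if k \<le> j then j - k else k - j)" for k
    using h by (auto simp: f_def left_diff_distrib[symmetric] of_nat_diff abs_mult)
  have part: "sum (\<lambda>k. f (g k)) A \<le> sum f D" if "inj_on g A" "g ` A \<subseteq> D" for g A
  proof -
    have "sum (\<lambda>k. f (g k)) A = sum f (g ` A)" using that by (simp add: sum.reindex)
    also have "\<dots> \<le> sum f D" using that f0 by (intro sum_mono2) (auto simp: D_def)
    finally show ?thesis .
  qed
  have "(\<Sum>k=1..N. exp (- p * \<bar>real j * h - real k * h\<bar>)) = 
     (\<Sum>k\<in>{k\<in>{1..N}. k \<le> j}. f (j - k)) + (\<Sum>k\<in>{k\<in>{1..N}. \<not> k \<le> j}. f (k - j))"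
    unfolding fab using sum.If_cases[of "{1..N}" "\<lambda>k. k \<le> j" "\<lambda>k. f (j - k)" "\<lambda>k. f (k - j)"]
    by (simp add: if_distrib Int_def Collect_neg_eq[symmetric] cong: if_cong)
  also have "\<dots> \<le> sum f D + sum f D"
    by (intro add_mono part) (auto simp: inj_on_def D_def)
  finally have "h * (\<Sum>k=1..N. exp (- p * \<bar>real j * h - real k * h\<bar>)) \<le> h * (2 * sum f D)"
    using h by (intro mult_left_mono) auto
  also have "\<dots> = 2 * (h * sum f D)" by simp
  also have "sum f D = 1 + (\<Sum>k=1..j + N. exp (- p * (real k * h)))"
    by (simp add: D_def f_def sum.atLeast_Suc_atMost)
  also have "2 * (h * (1 + (\<Sum>k=1..j + N. exp (- p * (real k * h))))) \<le> 2 * (h + 1 / p)"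
    using sum_exp_le[OF p h, of "j + N"] by (simp add: distrib_left)
  finally show ?thesis .
qed

text \<open>One factor contributes an entry bound and the others row sums. The power 0 is excluded,
  being the identity rather than a product of entries of \<open>C\<close>.\<close>

lemma kernel_power_bound:
  assumes C0: "\<And>k j. k \<in> J \<Longrightarrow> j \<in> J \<Longrightarrow> \<bar>C k j\<bar> \<le> C0"
    and row: "\<And>k. k \<in> J \<Longrightarrow> (\<Sum>l\<in>J. \<bar>C k l\<bar>) \<le> \<rho>" and fin: "finite J"
    and kj: "k \<in> J" "j \<in> J"
  shows "\<bar>kernel_power C J (Suc i) k j\<bar> \<le> C0 * \<rho> ^ i"
  using kj
proof (induction i arbitrary: k j)
  case 0
  have "kernel_power C J (Suc 0) k j = C k j" using 0 fin by (simp add: if_distrib[of "\<lambda>x. _ * x"] cong: if_cong)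
  then show ?case using C0[OF 0] by simp
next
  case (Suc i)
  have nn: "0 \<le> C0 * \<rho> ^ i" using Suc.IH[OF Suc.prems] by linarith
  have "\<bar>kernel_power C J (Suc (Suc i)) k j\<bar> = \<bar>\<Sum>l\<in>J. C k l * kernel_power C J (Suc i) l j\<bar>" by simp
  also have "\<dots> \<le> (\<Sum>l\<in>J. \<bar>C k l\<bar> * (C0 * \<rho> ^ i))"
    by (rule order_trans[OF sum_abs], rule sum_mono)
       (simp add: abs_mult del: kernel_power.simps, intro mult_left_mono Suc.IH Suc.prems, auto)
  also have "\<dots> = (\<Sum>l\<in>J. \<bar>C k l\<bar>) * (C0 * \<rho> ^ i)" by (simp add: sum_distrib_right)
  also have "\<dots> \<le> \<rho> * (C0 * \<rho> ^ i)" by (intro mult_right_mono row Suc.prems nn)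
  finally show ?case by (simp add: mult_ac)
qed

lemma kernel_trace_bound:
  assumes C0: "\<And>k j. k \<in> J \<Longrightarrow> j \<in> J \<Longrightarrow> \<bar>C k j\<bar> \<le> C0"
    and row: "\<And>k. k \<in> J \<Longrightarrow> (\<Sum>l\<in>J. \<bar>C k l\<bar>) \<le> \<rho>" and fin: "finite J"
  shows "\<bar>kernel_trace C J (Suc i)\<bar> \<le> real (card J) * (C0 * \<rho> ^ Suc i)"
proof -
  have "\<bar>kernel_trace C J (Suc i)\<bar> \<le> (\<Sum>k\<in>J. \<Sum>j\<in>J. C0 * \<rho> ^ i * \<bar>C k j\<bar>)"
    unfolding kernel_trace_def
  proof (rule order_trans[OF sum_abs], rule sum_mono, rule order_trans[OF sum_abs], rule sum_mono)
    fix k j assume "k \<in> J" "j \<in> J"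
    then show "\<bar>kernel_power C J (Suc i) k j * C k j\<bar> \<le> C0 * \<rho> ^ i * \<bar>C k j\<bar>"
      using kernel_power_bound[of J C C0 \<rho> k j i, OF C0 row fin]
      by (simp add: abs_mult mult_right_mono del: kernel_power.simps)
  qed
  also have "\<dots> \<le> (\<Sum>k\<in>J. C0 * \<rho> ^ i * \<rho>)"
  proof (rule sum_mono)
    fix k assume k: "k \<in> J"
    have "0 \<le> C0 * \<rho> ^ i" using kernel_power_bound[of J C C0 \<rho> k k i, OF C0 row fin k k] by linarith
    then show "(\<Sum>j\<in>J. C0 * \<rho> ^ i * \<bar>C k j\<bar>) \<le> C0 * \<rho> ^ i * \<rho>"
      unfolding sum_distrib_left[symmetric] by (intro mult_left_mono row k)
  qed
  also have "\<dots> = real (card J) * (C0 * \<rho> ^ Suc i)" by (simp add: mult_ac)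
  finally show ?thesis .
qed

lemma kernel_trace_0: "finite J \<Longrightarrow> kernel_trace C J 0 = (\<Sum>k\<in>J. C k k)"
  by (simp add: kernel_trace_def if_distrib[of "\<lambda>x. x * _"] cong: if_cong)

lemma kernel_trace_1: "finite J \<Longrightarrow> kernel_trace C J 1 = (\<Sum>k\<in>J. \<Sum>j\<in>J. (C k j)\<^sup>2)"
  by (simp add: kernel_trace_def if_distrib[of "\<lambda>x. _ * x"] power2_eq_square cong: if_cong)

lemma integrable_exp_abs:
  fixes q :: real assumes q: "0 < q"
  shows "integrable lborel (\<lambda>w. exp (- q * \<bar>w\<bar>))"
proof (rule integrableI_nonneg)
  let ?h = "\<lambda>w. ennreal (exp (- q * \<bar>w\<bar>))"
  have 1: "(\<integral>\<^sup>+w. ?h w * indicator {0..} w \<partial>lborel) = ennreal (1 / q)"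
  proof -
    have "(\<integral>\<^sup>+w. ?h w * indicator {0..} w \<partial>lborel) = (\<integral>\<^sup>+w. ennreal (exp (- q * w)) * indicator {0..} w \<partial>lborel)"
      by (intro nn_integral_cong) (auto split: split_indicator)
    then show ?thesis using nn_integral_exp_atLeast[OF q, of 0] by simp
  qed
  have "(\<integral>\<^sup>+w. ?h w \<partial>lborel) \<le> (\<integral>\<^sup>+w. ?h w * indicator {0..} w + ?h w * indicator {..0} w \<partial>lborel)"
    by (intro nn_integral_mono) (auto split: split_indicator)
  also have "\<dots> = (\<integral>\<^sup>+w. ?h w * indicator {0..} w \<partial>lborel) + (\<integral>\<^sup>+w. ?h w * indicator {..0} w \<partial>lborel)"
    by (rule nn_integral_add) auto
  also have "(\<integral>\<^sup>+w. ?h w * indicator {..0} w \<partial>lborel) = (\<integral>\<^sup>+w. ?h w * indicator {0..} w \<partial>lborel)"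
    by (subst nn_integral_real_affine[where c="-1" and t=0]) (auto intro!: nn_integral_cong split: split_indicator)
  also have "(\<integral>\<^sup>+w. ?h w * indicator {0..} w \<partial>lborel) + (\<integral>\<^sup>+w. ?h w * indicator {0..} w \<partial>lborel) < \<infinity>"
    unfolding 1 by simp
  finally show "(\<integral>\<^sup>+w. ?h w \<partial>lborel) < \<infinity>" .
qed auto

lemma integrable_fst_snd_mult:
  fixes f g :: "real \<Rightarrow> real"
  assumes f: "integrable lborel f" and g: "integrable lborel g"
  shows "integrable (lborel \<Otimes>\<^sub>M lborel) (\<lambda>p. f (fst p) * g (snd p))"
proof (rule lborel_pair.Fubini_integrable)
  have [measurable]: "f \<in> borel_measurable borel" "g \<in> borel_measurable borel" using f g by auto
  show "(\<lambda>p. f (fst p) * g (snd p)) \<in> borel_measurable (lborel \<Otimes>\<^sub>M lborel)" by measurable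
  show "integrable lborel (\<lambda>x. LINT y|lborel. norm (f (fst (x, y)) * g (snd (x, y))))"
    using f g by (simp add: abs_mult integrable_abs)
  show "AE x in lborel. integrable lborel (\<lambda>y. f (fst (x, y)) * g (snd (x, y)))"
    using g by (intro AE_I2) simp
qed

section \<open>The limit of the normalised sum of squared covariances\<close>

context fou_param
begin

definition asym_var :: real where "asym_var = 2 * (LINT w|lborel. (stat_cov w)\<^sup>2)"

lemma stat_cov_measurable [measurable]: "stat_cov \<in> borel_measurable borel"
  using continuous_stat_cov by (rule borel_measurable_continuous_onI)

lemma stat_cov_sq_bound: "(stat_cov w)\<^sup>2 \<le> decay_const\<^sup>2 * exp (- (2 * decay) * \<bar>w\<bar>)"
proof -
  have "(stat_cov w)\<^sup>2 \<le> (decay_const * exp (- decay * \<bar>w\<bar>))\<^sup>2"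
    using stat_cov_decay stat_cov_nonneg by (intro power_mono) auto
  also have "\<dots> = decay_const\<^sup>2 * exp (- (2 * decay) * \<bar>w\<bar>)"
    by (simp add: power_mult_distrib power2_eq_square exp_add[symmetric])
  finally show ?thesis .
qed

lemma integrable_stat_cov_sq: "integrable lborel (\<lambda>w. (stat_cov w)\<^sup>2)"
proof (rule Bochner_Integration.integrable_bound)
  show "integrable lborel (\<lambda>w. decay_const\<^sup>2 * exp (- (2 * decay) * \<bar>w\<bar>))"
    using decay_pos by (intro integrable_mult_right integrable_exp_abs) auto
  show "AE w in lborel. norm ((stat_cov w)\<^sup>2) \<le> norm (decay_const\<^sup>2 * exp (- (2 * decay) * \<bar>w\<bar>))"
    using stat_cov_sq_bound by (intro AE_I2) auto
qed measurable

lemma stat_cov_0_pos: "0 < stat_cov 0"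
proof -
  have "0 < \<theta> * H" using \<theta>_pos H_pos by simp
  then have "0 < (\<theta> - 1) * H + 1" using H_1 by (simp add: left_diff_distrib)
  then show ?thesis unfolding stat_cov_0 Psi_def using H_half H_pos \<theta>_pos
    by (intro mult_pos_pos divide_pos_pos Beta_pos_real) auto
qed

text \<open>The limit law must have a density: the method of moments above is stated for positive
  variance.\<close>

lemma asym_var_pos: "0 < asym_var"
proof -
  have "continuous (at 0) stat_cov" using continuous_stat_cov by (simp add: continuous_on_eq_continuous_at)
  then have "stat_cov \<midarrow>0\<rightarrow> stat_cov 0" by (simp add: isCont_def)
  then have "\<forall>\<^sub>F w in at 0. stat_cov 0 / 2 < stat_cov w"
    by (rule order_tendstoD) (use stat_cov_0_pos in simp)
  then obtain d where d: "0 < d" "\<And>w. w \<noteq> 0 \<Longrightarrow> dist w 0 < d \<Longrightarrow> stat_cov 0 / 2 < stat_cov w"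
    by (auto simp: eventually_at)
  have low: "(stat_cov 0 / 2)\<^sup>2 * indicator {0..d/2} w \<le> (stat_cov w)\<^sup>2" for w
  proof (cases "w \<in> {0..d/2}")
    case True
    have "stat_cov 0 / 2 \<le> stat_cov w"
      using d(2)[of w] d(1) True stat_cov_0_pos by (cases "w = 0") (auto simp: dist_real_def)
    then have "(stat_cov 0 / 2)\<^sup>2 \<le> (stat_cov w)\<^sup>2" using stat_cov_0_pos by (intro power_mono) auto
    then show ?thesis using True by simp
  qed simp
  have "(LINT w|lborel. (stat_cov 0 / 2)\<^sup>2 * indicator {0..d/2} w) \<le> (LINT w|lborel. (stat_cov w)\<^sup>2)"
    by (rule integral_mono[OF _ integrable_stat_cov_sq low])
       (auto intro!: integrable_mult_right integrable_real_indicator simp: emeasure_lborel_Icc_eq)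
  moreover have "(LINT w|lborel. (stat_cov 0 / 2)\<^sup>2 * indicator {0..d/2} w) = (stat_cov 0 / 2)\<^sup>2 * (d / 2)"
    using d(1) by simp
  moreover have "0 < (stat_cov 0 / 2)\<^sup>2 * (d / 2)" using d(1) stat_cov_0_pos by simp
  ultimately show ?thesis unfolding asym_var_def by linarith
qed

lemma R_near_stat_cov:
  assumes "s \<longlonglongrightarrow> d" "filterlim a at_top sequentially" "filterlim b at_top sequentially"
    and s: "\<And>n. s n = a n - b n"
  shows "(\<lambda>n. R (a n) (b n)) \<longlonglongrightarrow> stat_cov d"
proof (rule tendsto_sandwich)
  have ev: "\<forall>\<^sub>F n in sequentially. 0 \<le> a n \<and> 0 \<le> b n"
    using assms(2,3) by (intro eventually_conj) (auto simp: filterlim_at_top)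
  show "\<forall>\<^sub>F n in sequentially. stat_cov (s n) - kc * kernel_norm / \<theta> * (exp (- \<theta> * a n) + exp (- \<theta> * b n)) \<le> R (a n) (b n)"
    using ev
  proof eventually_elim
    case (elim n)
    then show ?case using stat_cov_le_R[of "a n" "b n"] s[of n] by (simp only: diff_le_eq)
  qed
  show "\<forall>\<^sub>F n in sequentially. R (a n) (b n) \<le> stat_cov (s n)"
    using ev by eventually_elim (use R_le_stat_cov s in auto)
  have c: "isCont stat_cov d" using continuous_stat_cov by (simp add: continuous_on_eq_continuous_at)
  show sc: "(\<lambda>n. stat_cov (s n)) \<longlonglongrightarrow> stat_cov d"
    by (rule isCont_tendsto_compose[OF c assms(1)])
  have e: "(\<lambda>n. exp (- \<theta> * f n)) \<longlonglongrightarrow> 0" if "filterlim f at_top sequentially" for f :: "nat \<Rightarrow> real"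
  proof -
    have "filterlim (\<lambda>n. - \<theta> * f n) at_bot sequentially"
      using that \<theta>_pos by (intro filterlim_tendsto_neg_mult_at_bot[OF tendsto_const]) auto
    then show ?thesis by (rule filterlim_compose[OF exp_at_bot])
  qed
  have "(\<lambda>n. stat_cov (s n) - kc * kernel_norm / \<theta> * (exp (- \<theta> * a n) + exp (- \<theta> * b n))) \<longlonglongrightarrow>
     stat_cov d - kc * kernel_norm / \<theta> * (0 + 0)"
    by (intro tendsto_intros sc e assms)
  then show "(\<lambda>n. stat_cov (s n) - kc * kernel_norm / \<theta> * (exp (- \<theta> * a n) + exp (- \<theta> * b n))) \<longlonglongrightarrow> stat_cov d"
    by simp
qed

text \<open>The double sum is the integral of a step function in (x, w), where \<open>x\<close> is
  the first time divided by the horizon and \<open>w\<close> is the lag in real time. In these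
  coordinates the step functions converge pointwise and have an integrable majorant.\<close>

lemma sum_R_sq_limit:
  fixes h :: "nat \<Rightarrow> real"
  assumes hpos: "\<And>N. N \<ge> 1 \<Longrightarrow> 0 < h N" and h0: "h \<longlonglongrightarrow> 0"
    and T: "filterlim (\<lambda>N. real N * h N) at_top sequentially"
  shows "(\<lambda>N. (h N / real N) * (\<Sum>j<N. \<Sum>k<N. (R (real (Suc j) * h N) (real (Suc k) * h N))\<^sup>2)) \<longlonglongrightarrow> asym_var / 2"
proof -
  define I where "I N j = {real j / real N <.. real (Suc j) / real N}" for N j :: nat
  define K where "K N k = {real k * h N <.. real (Suc k) * h N}" for N k :: nat
  \<comment> \<open>The shear (x, w) -> (x, T x + w) preserves area, so each cell has area
    \<open>h N / N\<close>. The values are taken at the right endpoints, hence the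
    successors.\<close>
  define F where "F N p = (\<Sum>j<N. \<Sum>k<N. (R (real (Suc j) * h N) (real (Suc k) * h N))\<^sup>2 *
     (indicator (I N j) (fst p) * indicator (K N k) (real N * h N * fst p + snd p)))" for N and p :: "real \<times> real"
  let ?L = "lborel \<Otimes>\<^sub>M lborel :: (real \<times> real) measure"
  have IK [measurable]: "I N j \<in> sets borel" "K N k \<in> sets borel" for N j k by (auto simp: I_def K_def)
  have F_meas: "F N \<in> borel_measurable ?L" for N unfolding F_def[abs_def] by measurable
  have piece: "has_bochner_integral ?L (\<lambda>p. indicator (I N j) (fst p) * indicator (K N k) (real N * h N * fst p + snd p)) (1 / real N * h N)"
    if N: "N \<ge> 1" for N j k
  proof (rule has_bochner_integral_nn_integral)
    have hN: "0 < h N" by (rule hpos[OF N])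
    have "(\<integral>\<^sup>+p. ennreal (indicator (I N j) (fst p) * indicator (K N k) (real N * h N * fst p + snd p)) \<partial>?L) =
      (\<integral>\<^sup>+x. \<integral>\<^sup>+w. ennreal (indicator (I N j) x * indicator (K N k) (real N * h N * x + w)) \<partial>lborel \<partial>lborel)"
      by (subst lborel.nn_integral_fst[symmetric]) auto
    also have "\<dots> = (\<integral>\<^sup>+x. ennreal (h N) * indicator (I N j) x \<partial>lborel)"
    proof (rule nn_integral_cong)
      fix x :: real
      have "(\<integral>\<^sup>+w. ennreal (indicator (I N j) x * indicator (K N k) (real N * h N * x + w)) \<partial>lborel) = 
        (\<integral>\<^sup>+w. indicator (I N j) x * indicator {real k * h N - real N * h N * x <.. real (Suc k) * h N - real N * h N * x} w \<partial>lborel)"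
        by (intro nn_integral_cong) (auto simp: K_def split: split_indicator)
      also have "\<dots> = indicator (I N j) x * emeasure lborel {real k * h N - real N * h N * x <.. real (Suc k) * h N - real N * h N * x}"
        by (simp add: nn_integral_cmult)
      also have "\<dots> = ennreal (h N) * indicator (I N j) x"
        using hN by (subst emeasure_lborel_Ioc) (auto simp: algebra_simps)
      finally show "(\<integral>\<^sup>+w. ennreal (indicator (I N j) x * indicator (K N k) (real N * h N * x + w)) \<partial>lborel) = ennreal (h N) * indicator (I N j) x" .
    qed
    also have "\<dots> = ennreal (h N) * emeasure lborel (I N j)" by (simp add: nn_integral_cmult)
    also have "emeasure lborel (I N j) = ennreal (1 / real N)"
      unfolding I_def
      by (subst emeasure_lborel_Ioc) (auto simp: diff_divide_distrib[symmetric] intro: divide_right_mono)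
    also have "ennreal (h N) * ennreal (1 / real N) = ennreal (1 / real N * h N)"
      using hN by (simp add: ennreal_mult[symmetric] mult.commute)
    finally show "(\<integral>\<^sup>+p. ennreal (indicator (I N j) (fst p) * indicator (K N k) (real N * h N * fst p + snd p)) \<partial>?L) = ennreal (1 / real N * h N)" .
  qed (use hpos[OF N] in \<open>auto intro!: mult_nonneg_nonneg\<close>)
  have F_int: "integral\<^sup>L ?L (F N) = (h N / real N) * (\<Sum>j<N. \<Sum>k<N. (R (real (Suc j) * h N) (real (Suc k) * h N))\<^sup>2)" if N: "N \<ge> 1" for N
  proof -
    have "has_bochner_integral ?L (F N) (\<Sum>j<N. \<Sum>k<N. (R (real (Suc j) * h N) (real (Suc k) * h N))\<^sup>2 * (1 / real N * h N))"
      unfolding F_def[abs_def] by (intro has_bochner_integral_sum has_bochner_integral_mult_right piece N)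
    then show ?thesis by (simp add: has_bochner_integral_integral_eq sum_distrib_left mult_ac)
  qed
  \<comment> \<open>The quotient by 1 in \<open>j\<close> only serves to match
    \<open>grid_cell_unique\<close> at horizon 1.\<close>
  have F_eval: "F N (x, w) = (if 0 < real N * h N * x + w \<and> real N * h N * x + w \<le> real N * h N then (R (real (Suc j) * h N) (real (Suc k) * h N))\<^sup>2 else 0)"
    if N: "N \<ge> 1" and x: "0 < x" "x \<le> 1" and j: "j = nat (\<lceil>x * real N / 1\<rceil> - 1)" 
      and k: "k = nat (\<lceil>(real N * h N * x + w) * real N / (real N * h N)\<rceil> - 1)" for N x w j k
  proof -
    have hN: "0 < h N" by (rule hpos[OF N])
    have N0: "0 < N" using N by simp
    have TN: "0 < real N * h N" using hN N by simp
    have cx: "i < N \<Longrightarrow> indicator (I N i) x = (if i = j then 1 else 0 :: real)" "j < N" for i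
      using grid_cell_unique[of 1 x N] x N j by (auto simp: I_def indicator_def)
    show ?thesis
    proof (cases "0 < real N * h N * x + w \<and> real N * h N * x + w \<le> real N * h N")
      case True
      have e: "real N * h N * y / real N = y * h N" for y using N by simp
      note c = grid_cell_unique[OF TN True[THEN conjunct1] True[THEN conjunct2] N0, folded k, unfolded e]
      have cy: "i < N \<Longrightarrow> indicator (K N i) (real N * h N * x + w) = (if i = k then 1 else 0 :: real)" "k < N" for i
        using c by (auto simp: K_def indicator_def)
      have "F N (x, w) = (\<Sum>i<N. \<Sum>l<N. if i = j then (if l = k then (R (real (Suc i) * h N) (real (Suc l) * h N))\<^sup>2 else 0) else 0)"
        unfolding F_def fst_conv snd_conv using cx(1) cy(1) by (intro sum.cong refl) auto
      also have "\<dots> = (\<Sum>i<N. if i = j then (R (real (Suc i) * h N) (real (Suc k) * h N))\<^sup>2 else 0)"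
        using cy(2) by (intro sum.cong refl) auto
      also have "\<dots> = (R (real (Suc j) * h N) (real (Suc k) * h N))\<^sup>2" using cx(2) by simp
      finally show ?thesis using True by simp
    next
      case False
      have "real N * h N * x + w \<notin> K N i" if "i < N" for i
      proof -
        have "real (Suc i) * h N \<le> real N * h N" using that hN by (intro mult_right_mono) auto
        moreover have "0 \<le> real i * h N" using hN by simp
        ultimately show ?thesis using False by (auto simp: K_def)
      qed
      then have "F N (x, w) = 0" unfolding F_def fst_conv snd_conv by (intro sum.neutral ballI) auto
      then show ?thesis unfolding if_not_P[OF False] .
    qed
  qed
  \<comment> \<open>The right endpoint of the cell that contains \<open>y\<close> exceeds
    \<open>y\<close> by at most one cell length.\<close>
  have near: "y \<le> real (Suc (nat (\<lceil>y / b\<rceil> - 1))) * b \<and> real (Suc (nat (\<lceil>y / b\<rceil> - 1))) * b \<le> y + b" if "0 < b" "0 < y" for y b :: real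
  proof -
    have "0 < y / b" using that by simp
    then have c: "1 \<le> \<lceil>y / b\<rceil>" by linarith
    then have e: "real (Suc (nat (\<lceil>y / b\<rceil> - 1))) = of_int \<lceil>y / b\<rceil>" by simp
    have "y / b \<le> of_int \<lceil>y / b\<rceil>" by linarith
    then have "y \<le> of_int \<lceil>y / b\<rceil> * b" by (simp only: pos_divide_le_eq[OF that(1)])
    moreover have "of_int \<lceil>y / b\<rceil> * b \<le> (y / b + 1) * b" using that by (intro mult_right_mono) linarith+
    moreover have "(y / b + 1) * b = y + b" using that by (simp add: distrib_right)
    ultimately show ?thesis unfolding e by simp
  qed
  have F_zero: "F N (x, w) = 0" if "\<not> (0 < x \<and> x \<le> 1)" and N: "N \<ge> 1" for N x w
  proof -
    have "x \<notin> I N i" if "i < N" for i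
    proof -
      have "real (Suc i) / real N \<le> 1" using that by (simp add: divide_le_eq)
      moreover have "0 \<le> real i / real N" by simp
      ultimately show ?thesis using \<open>\<not> (0 < x \<and> x \<le> 1)\<close> unfolding I_def greaterThanAtMost_iff by linarith
    qed
    then show ?thesis unfolding F_def fst_conv snd_conv by (intro sum.neutral ballI) auto
  qed
  \<comment> \<open>Passing from the lag on the grid to \<open>w\<close> changes it by at most
    \<open>h N\<close>, which is at most 1 when \<open>N0 N\<close> holds; this accounts for the
    factor \<open>exp (2 * decay)\<close>.\<close>
  define G where "G p = decay_const\<^sup>2 * exp (2 * decay) * (indicator {0<..1} (fst p) * exp (- (2 * decay) * \<bar>snd p\<bar>))" for p :: "real \<times> real"
  have G_int: "integrable ?L G"
    unfolding G_def[abs_def] using decay_pos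
    by (intro integrable_mult_right integrable_fst_snd_mult integrable_exp_abs) auto
  define N0 where "N0 N \<longleftrightarrow> N \<ge> 1 \<and> h N \<le> 1" for N
  have F_bound: "norm (F N p) \<le> G p" if N: "N0 N" for N p
  proof -
    obtain x w where p: "p = (x, w)" by (cases p)
    have N1: "N \<ge> 1" and h1: "h N \<le> 1" using N by (auto simp: N0_def)
    have hN: "0 < h N" by (rule hpos[OF N1])
    show ?thesis
    proof (cases "0 < x \<and> x \<le> 1 \<and> 0 < real N * h N * x + w \<and> real N * h N * x + w \<le> real N * h N")
      case True
      define j where "j = nat (\<lceil>x * real N / 1\<rceil> - 1)"
      define k where "k = nat (\<lceil>(real N * h N * x + w) * real N / (real N * h N)\<rceil> - 1)"
      let ?s = "real (Suc j) * h N" and ?t = "real (Suc k) * h N"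
      have "0 < real N * h N * x" using True hN N1 by simp
      from near[OF hN this] have s: "real N * h N * x \<le> ?s" "?s \<le> real N * h N * x + h N"
        using hN by (simp_all add: j_def mult.commute)
      from near[OF hN, of "real N * h N * x + w"] True N1
      have t: "real N * h N * x + w \<le> ?t" "?t \<le> real N * h N * x + w + h N"
        by (simp_all add: k_def)
      have "\<bar>w\<bar> - 1 \<le> \<bar>?s - ?t\<bar>" using s t h1 by linarith
      then have "exp (- (2 * decay) * \<bar>?s - ?t\<bar>) \<le> exp (- (2 * decay) * (\<bar>w\<bar> - 1))"
        using decay_pos by simp
      also have "\<dots> = exp (2 * decay) * exp (- (2 * decay) * \<bar>w\<bar>)"
        by (simp add: exp_add[symmetric] algebra_simps)
      finally have e: "exp (- (2 * decay) * \<bar>?s - ?t\<bar>) \<le> exp (2 * decay) * exp (- (2 * decay) * \<bar>w\<bar>)" .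
      have "0 \<le> ?s" "0 \<le> ?t" using hN by auto
      then have "(R ?s ?t)\<^sup>2 \<le> (stat_cov (?s - ?t))\<^sup>2"
        using R_le_stat_cov R_eq_cov_region(2) by (intro power_mono) auto
      also have "\<dots> \<le> decay_const\<^sup>2 * exp (- (2 * decay) * \<bar>?s - ?t\<bar>)" by (rule stat_cov_sq_bound)
      also have "\<dots> \<le> decay_const\<^sup>2 * (exp (2 * decay) * exp (- (2 * decay) * \<bar>w\<bar>))"
        using e by (intro mult_left_mono) auto
      finally have b: "(R ?s ?t)\<^sup>2 \<le> decay_const\<^sup>2 * (exp (2 * decay) * exp (- (2 * decay) * \<bar>w\<bar>))" .
      have "F N p = (R ?s ?t)\<^sup>2"
        using F_eval[OF N1 _ _ j_def k_def] True p by simp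
      then show ?thesis using b True p by (simp add: G_def)
    next
      case False
      then have "F N p = 0"
        using F_zero[OF _ N1, of x w] F_eval[OF N1 _ _ refl refl, of x w] p by (cases "0 < x \<and> x \<le> 1") auto
      moreover have "0 \<le> G p" by (simp add: G_def)
      ultimately show ?thesis by simp
    qed
  qed
  \<comment> \<open>For \<open>x\<close> strictly between 0 and 1 both times lie eventually inside
    the horizon, whatever \<open>w\<close> is. The two excluded values of \<open>x\<close> form a
    null set.\<close>
  have F_lim: "(\<lambda>N. F N (x, w)) \<longlonglongrightarrow> indicator {0<..1} x * (stat_cov w)\<^sup>2" if x: "x \<noteq> 0" "x \<noteq> 1" for x w
  proof (cases "0 < x \<and> x < 1")
    case True
    define s where "s N = real (Suc (nat (\<lceil>x * real N / 1\<rceil> - 1))) * h N" for N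
    define t where "t N = real (Suc (nat (\<lceil>(real N * h N * x + w) * real N / (real N * h N)\<rceil> - 1))) * h N" for N
    have Tx: "filterlim (\<lambda>N. real N * h N * x) at_top sequentially"
      using True by (intro filterlim_at_top_mult_tendsto_pos[OF tendsto_const _ T]) auto
    have Txw: "filterlim (\<lambda>N. w + real N * h N * x) at_top sequentially"
      by (intro filterlim_tendsto_add_at_top[OF tendsto_const] Tx)
    have T1x: "filterlim (\<lambda>N. real N * h N * (1 - x)) at_top sequentially"
      using True by (intro filterlim_at_top_mult_tendsto_pos[OF tendsto_const _ T]) auto
    have ev: "\<forall>\<^sub>F N in sequentially. N \<ge> 1 \<and> 0 < w + real N * h N * x \<and> w \<le> real N * h N * (1 - x)"
    proof -
      have "\<forall>\<^sub>F N in sequentially. 0 < w + real N * h N * x" using Txw by (simp add: filterlim_at_top_dense)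
      moreover have "\<forall>\<^sub>F N in sequentially. w \<le> real N * h N * (1 - x)" using T1x by (simp add: filterlim_at_top)
      ultimately show ?thesis using eventually_ge_at_top[of 1] by eventually_elim simp
    qed
    have ev2: "\<forall>\<^sub>F N in sequentially. real N * h N * x \<le> s N \<and> s N \<le> real N * h N * x + h N \<and>
        real N * h N * x + w \<le> t N \<and> t N \<le> real N * h N * x + w + h N"
      using ev
    proof eventually_elim
      case (elim N)
      have hN: "0 < h N" using hpos elim by blast
      have "0 < real N * h N * x" using True hN elim by simp
      from near[OF hN this] near[OF hN, of "real N * h N * x + w"] elim hN
      show ?case by (simp add: s_def t_def mult.commute add.commute)
    qed
    have Fev: "\<forall>\<^sub>F N in sequentially. (R (s N) (t N))\<^sup>2 = F N (x, w)"
      using ev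
    proof eventually_elim
      case (elim N)
      have "0 < real N * h N * x + w \<and> real N * h N * x + w \<le> real N * h N"
        using elim by (simp add: algebra_simps)
      then show ?case using F_eval[of N x, OF _ _ _ refl refl, of w] elim True by (simp add: s_def t_def)
    qed
    have "(\<lambda>N. R (s N) (t N)) \<longlonglongrightarrow> stat_cov (- w)"
    proof (rule R_near_stat_cov[where s="\<lambda>N. s N - t N"])
      show "filterlim s at_top sequentially"
        by (rule filterlim_at_top_mono[OF Tx]) (use ev2 in eventually_elim, auto)
      show "filterlim t at_top sequentially"
        by (rule filterlim_at_top_mono[OF Txw]) (use ev2 in eventually_elim, auto)
      show "(\<lambda>N. s N - t N) \<longlonglongrightarrow> - w"
      proof (rule tendsto_sandwich)
        show "\<forall>\<^sub>F N in sequentially. - w - h N \<le> s N - t N" using ev2 by eventually_elim auto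
        show "\<forall>\<^sub>F N in sequentially. s N - t N \<le> - w + h N" using ev2 by eventually_elim auto
        show "(\<lambda>N. - w - h N) \<longlonglongrightarrow> - w" using tendsto_diff[OF tendsto_const h0, of "- w"] by simp
        show "(\<lambda>N. - w + h N) \<longlonglongrightarrow> - w" using tendsto_add[OF tendsto_const h0, of "- w"] by simp
      qed
    qed simp
    then have "(\<lambda>N. (R (s N) (t N))\<^sup>2) \<longlonglongrightarrow> (stat_cov w)\<^sup>2"
      unfolding stat_cov_minus by (intro tendsto_intros)
    then have "(\<lambda>N. F N (x, w)) \<longlonglongrightarrow> (stat_cov w)\<^sup>2"
      by (rule Lim_transform_eventually[OF _ Fev])
    then show ?thesis using True by simp
  next
    case False
    then have "F N (x, w) = 0" if "N \<ge> 1" for N using F_zero[of x N w] x that by auto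
    then have "\<forall>\<^sub>F N in sequentially. F N (x, w) = 0" by (auto simp: eventually_sequentially)
    then have "(\<lambda>N. F N (x, w)) \<longlonglongrightarrow> 0" by (rule tendsto_eventually)
    moreover have "x \<notin> {0<..1}" using False x by auto
    ultimately show ?thesis by simp
  qed
  have evN0: "\<forall>\<^sub>F N in sequentially. N0 N"
    unfolding N0_def using order_tendstoD(2)[OF h0, of 1] eventually_ge_at_top[of 1]
    by (auto elim!: eventually_elim2)
  \<comment> \<open>The majorant holds only when \<open>N0 N\<close> does, so the sequence is
    replaced by 0 at the finitely many other indices.\<close>
  have "(\<lambda>N. integral\<^sup>L ?L (\<lambda>p. if N0 N then F N p else 0)) \<longlonglongrightarrow> integral\<^sup>L ?L (\<lambda>p. indicator {0<..1} (fst p) * (stat_cov (snd p))\<^sup>2)"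
  proof (rule integral_dominated_convergence[where w=G])
    show "AE p in ?L. (\<lambda>N. if N0 N then F N p else 0) \<longlonglongrightarrow> indicator {0<..1} (fst p) * (stat_cov (snd p))\<^sup>2"
    proof -
      have "AE x in lborel. x \<noteq> (0::real) \<and> x \<noteq> 1"
        using AE_lborel_singleton[of "0::real"] AE_lborel_singleton[of "1::real"] by eventually_elim simp
      then have ae: "AE x in lborel. AE w in lborel. fst (x::real, w::real) \<noteq> 0 \<and> fst (x, w) \<noteq> 1"
        by eventually_elim simp
      have "{p \<in> space ?L. fst p \<noteq> 0 \<and> fst p \<noteq> 1} \<in> sets ?L" by measurable
      then have "AE p in ?L. fst p \<noteq> 0 \<and> fst p \<noteq> 1" using ae by (rule lborel_pair.AE_pair_measure)
      then show ?thesis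
      proof eventually_elim
        case (elim p)
        then have "(\<lambda>N. F N p) \<longlonglongrightarrow> indicator {0<..1} (fst p) * (stat_cov (snd p))\<^sup>2"
          using F_lim[of "fst p" "snd p"] by simp
        then show ?case
          by (rule Lim_transform_eventually) (use evN0 in eventually_elim, simp)
      qed
    qed
    show "AE p in ?L. norm (if N0 N then F N p else 0) \<le> G p" for N
    proof (rule AE_I2)
      fix p :: "real \<times> real"
      have "0 \<le> G p" by (simp add: G_def)
      then show "norm (if N0 N then F N p else 0) \<le> G p" using F_bound by simp
    qed
  qed (use F_meas G_int in auto)
  moreover have "integral\<^sup>L ?L (\<lambda>p. indicator {0<..1} (fst p) * (stat_cov (snd p))\<^sup>2) = asym_var / 2"
  proof -
    have int: "integrable ?L (\<lambda>p. indicator {0<..1} (fst p) * (stat_cov (snd p))\<^sup>2)"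
      by (intro integrable_fst_snd_mult integrable_stat_cov_sq) auto
    have "integral\<^sup>L ?L (\<lambda>p. indicator {0<..1} (fst p) * (stat_cov (snd p))\<^sup>2) =
      (LINT x|lborel. LINT w|lborel. indicator {0<..1::real} x * (stat_cov w)\<^sup>2)"
      using lborel_pair.integral_fst'[OF int] by (simp only: fst_conv snd_conv)
    also have "\<dots> = (LINT x|lborel. indicator {0<..1::real} x) * (LINT w|lborel. (stat_cov w)\<^sup>2)"
      by (simp only: integral_mult_right_zero integral_mult_left_zero)
    also have "(LINT x|lborel. indicator {0<..1::real} x) = (1::real)"
      by simp
    finally show ?thesis by (simp add: asym_var_def)
  qed
  ultimately have "(\<lambda>N. integral\<^sup>L ?L (\<lambda>p. if N0 N then F N p else 0)) \<longlonglongrightarrow> asym_var / 2" by simp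
  then show ?thesis
    by (rule Lim_transform_eventually) (use evN0 in eventually_elim, simp add: F_int N0_def)
qed

end

section \<open>Moments and bias of the empirical second moment\<close>

context fou
begin

text \<open>Centred at the exact mean, so that the moment recursion applies. The gap to the limit
  \<open>stat_cov 0\<close> is deterministic and is treated by \<open>bias_bound\<close>.\<close>

definition fluct :: "real \<Rightarrow> nat \<Rightarrow> 'a \<Rightarrow> real" where
  "fluct h N = quad (h / sqrt (real N * h)) (h / sqrt (real N * h) * (\<Sum>k=1..N. R (real k * h) (real k * h)))
     {1..N} (\<lambda>k. X (real k * h))"

lemma R_le_decay_const: "0 \<le> s \<Longrightarrow> 0 \<le> t \<Longrightarrow> R s t \<le> decay_const"
proof -
  assume "0 \<le> s" "0 \<le> t"
  then have "R s t \<le> stat_cov (s - t)" by (rule R_le_stat_cov)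
  also have "\<dots> \<le> decay_const * exp (- decay * \<bar>s - t\<bar>)" by (rule stat_cov_decay)
  also have "\<dots> \<le> decay_const * 1"
    using decay_pos decay_const_nonneg by (intro mult_left_mono) auto
  finally show ?thesis by simp
qed

lemma R_row_sum:
  assumes h: "0 < h"
  shows "(\<Sum>k=1..N. R (real j * h) (real k * h)) \<le> decay_const * (2 * (h + 1 / decay)) / h"
proof -
  have "h * (\<Sum>k=1..N. R (real j * h) (real k * h)) \<le> h * (\<Sum>k=1..N. decay_const * exp (- decay * \<bar>real j * h - real k * h\<bar>))"
    using h by (intro mult_left_mono sum_mono order_trans[OF R_le_stat_cov stat_cov_decay]) auto
  also have "\<dots> = decay_const * (h * (\<Sum>k=1..N. exp (- decay * \<bar>real j * h - real k * h\<bar>)))"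
    by (simp add: sum_distrib_left mult_ac)
  also have "\<dots> \<le> decay_const * (2 * (h + 1 / decay))"
    using sum_exp_abs_le[OF decay_pos] h decay_const_nonneg by (intro mult_left_mono) auto
  finally show ?thesis using h by (simp add: field_simps)
qed

lemma fluct_moments:
  fixes h :: "nat \<Rightarrow> real"
  assumes hpos: "\<And>N. N \<ge> 1 \<Longrightarrow> 0 < h N" and h0: "h \<longlonglongrightarrow> 0"
    and T: "filterlim (\<lambda>N. real N * h N) at_top sequentially"
  shows "(\<lambda>N. expectation (\<lambda>\<omega>. fluct (h N) N \<omega> ^ n)) \<longlonglongrightarrow> normal_moment n * asym_var ^ (n div 2)"
proof -
  define s where "s N = h N / sqrt (real N * h N)" for N
  define t where "t N i = kernel_trace (\<lambda>k j. cov (X (real k * h N)) (X (real j * h N))) {1..N} i" for N i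
  have span: "k \<in> {1..N} \<Longrightarrow> X (real k * h N) \<in> lin_span {0..} X" for N k
    using hpos[of N] by (intro X_span) auto
  have cov: "k \<in> {1..N} \<Longrightarrow> j \<in> {1..N} \<Longrightarrow> cov (X (real k * h N)) (X (real j * h N)) = R (real k * h N) (real j * h N)" for N k j
    using hpos[of N] by (intro cov_X) auto
  have pos: "0 < h N" "0 < real N * h N" "s N = h N * (1 / sqrt (real N * h N))" if "N \<ge> 1" for N
    using hpos[OF that] that by (auto simp: s_def)
  have u0: "(\<lambda>N. 1 / sqrt (real N * h N)) \<longlonglongrightarrow> 0"
  proof -
    have "filterlim (\<lambda>N. sqrt (real N * h N)) at_top sequentially"
      by (rule filterlim_compose[OF sqrt_at_top T])
    then show ?thesis by (intro tendsto_divide_0[OF tendsto_const] filterlim_at_top_imp_at_infinity)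
  qed
  have lim1: "(\<lambda>N. 2 * (s N)\<^sup>2 * t N 1) \<longlonglongrightarrow> asym_var"
  proof -
    have "(\<lambda>N. 2 * ((h N / real N) * (\<Sum>j<N. \<Sum>k<N. (R (real (Suc j) * h N) (real (Suc k) * h N))\<^sup>2))) \<longlonglongrightarrow> 2 * (asym_var / 2)"
      by (intro tendsto_intros sum_R_sq_limit hpos h0 T)
    moreover have "\<forall>\<^sub>F N in sequentially. 2 * ((h N / real N) * (\<Sum>j<N. \<Sum>k<N. (R (real (Suc j) * h N) (real (Suc k) * h N))\<^sup>2)) = 2 * (s N)\<^sup>2 * t N 1"
      using eventually_ge_at_top[of 1]
    proof eventually_elim
      case (elim N)
      have "t N 1 = (\<Sum>j\<in>{1..N}. \<Sum>k\<in>{1..N}. (R (real j * h N) (real k * h N))\<^sup>2)"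
        unfolding t_def by (subst kernel_trace_1) (auto intro!: sum.cong simp: cov)
      also have "\<dots> = (\<Sum>j<N. \<Sum>k<N. (R (real (Suc j) * h N) (real (Suc k) * h N))\<^sup>2)"
        by (simp only: One_nat_def sum.atLeast1_atMost_eq)
      finally have e: "t N 1 = \<dots>" .
      have "(s N)\<^sup>2 = h N / real N" using pos[OF elim] elim by (simp add: s_def power_divide power2_eq_square)
      then show ?case unfolding e by simp
    qed
    ultimately show ?thesis by (auto dest: Lim_transform_eventually)
  qed
  have lim2: "(\<lambda>N. s N ^ Suc i * t N i) \<longlonglongrightarrow> 0" if i: "2 \<le> i" for i
  proof -
    obtain m where m: "i = Suc m" "1 \<le> m" using i by (cases i) auto
    define \<rho>0 where "\<rho>0 = decay_const * (2 * (1 + 1 / decay))"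
    have ev: "\<forall>\<^sub>F N in sequentially. 1 \<le> N \<and> h N \<le> 1"
      using order_tendstoD(2)[OF h0, of 1] eventually_ge_at_top[of 1] by (auto elim!: eventually_elim2)
    show ?thesis
    proof (rule Lim_null_comparison)
      show "\<forall>\<^sub>F N in sequentially. norm (s N ^ Suc i * t N i) \<le> (1 / sqrt (real N * h N)) ^ m * (decay_const * \<rho>0 ^ i)"
        using ev
      proof eventually_elim
        case (elim N)
        then have N: "N \<ge> 1" and h1: "h N \<le> 1" by auto
        \<comment> \<open>With \<open>s N = h N * u\<close> and
          \<open>u * u * (real N * h N) = 1\<close>, the bound N rho^i on the trace, multiplied by
          the scaling s^(i+1), is u^(i-1) times a power of \<open>h N * \<rho>\<close>, which stays
          bounded. It vanishes as soon as \<open>i\<close> is at least 2.\<close>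
        define u where "u = 1 / sqrt (real N * h N)"
        define \<rho> where "\<rho> = decay_const * (2 * (h N + 1 / decay)) / h N"
        note p = pos[OF N]
        have u: "0 \<le> u" "u * u * (real N * h N) = 1" using p N by (auto simp: u_def)
        have \<rho>: "0 \<le> h N * \<rho>" "h N * \<rho> \<le> \<rho>0"
          using p decay_const_nonneg decay_pos h1 by (auto simp: \<rho>_def \<rho>0_def intro!: mult_nonneg_nonneg mult_left_mono)
        have "\<bar>t N i\<bar> \<le> real (card {1..N}) * (decay_const * \<rho> ^ Suc m)"
          unfolding t_def m(1)
        proof (rule kernel_trace_bound)
          fix k j assume kj: "k \<in> {1..N}" "j \<in> {1..N}"
          then show "\<bar>cov (X (real k * h N)) (X (real j * h N))\<bar> \<le> decay_const"
            unfolding cov[OF kj] using R_eq_cov_region(2)[of "real k * h N" "real j * h N"]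
              R_le_decay_const[of "real k * h N" "real j * h N"] p by simp
        next
          fix k assume k: "k \<in> {1..N}"
          have "(\<Sum>l\<in>{1..N}. \<bar>cov (X (real k * h N)) (X (real l * h N))\<bar>) = (\<Sum>l=1..N. R (real k * h N) (real l * h N))"
          proof (rule sum.cong[OF refl])
            fix l assume l: "l \<in> {1..N}"
            show "\<bar>cov (X (real k * h N)) (X (real l * h N))\<bar> = R (real k * h N) (real l * h N)"
              unfolding cov[OF k l] using R_eq_cov_region(2)[of "real k * h N" "real l * h N"] p by simp
          qed
          also have "\<dots> \<le> \<rho>" unfolding \<rho>_def by (rule R_row_sum[OF p(1)])
          finally show "(\<Sum>l\<in>{1..N}. \<bar>cov (X (real k * h N)) (X (real l * h N))\<bar>) \<le> \<rho>" .
        qed simp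
        then have "\<bar>t N i\<bar> \<le> real N * (decay_const * \<rho> ^ i)" by (simp add: m)
        then have "norm (s N ^ Suc i * t N i) \<le> (h N * u) ^ Suc i * (real N * (decay_const * \<rho> ^ i))"
          unfolding p(3) u_def[symmetric] using u p by (simp add: abs_mult del: power_Suc) (intro mult_left_mono, auto)
        also have "\<dots> = u ^ m * (u * u * (real N * h N)) * (decay_const * (h N * \<rho>) ^ i)"
          by (simp add: m power_mult_distrib mult_ac)
        also have "\<dots> \<le> u ^ m * 1 * (decay_const * \<rho>0 ^ i)"
          unfolding u(2) using \<rho> u decay_const_nonneg by (intro mult_left_mono power_mono) auto
        finally show ?case by (simp add: u_def)
      qed
      have "(\<lambda>N. (1 / sqrt (real N * h N)) ^ m * (decay_const * \<rho>0 ^ i)) \<longlonglongrightarrow> 0 ^ m * (decay_const * \<rho>0 ^ i)"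
        by (intro tendsto_intros u0)
      then show "(\<lambda>N. (1 / sqrt (real N * h N)) ^ m * (decay_const * \<rho>0 ^ i)) \<longlonglongrightarrow> 0" using m by (simp add: zero_power)
    qed
  qed
  have "(\<lambda>N. expectation (\<lambda>\<omega>. quad (s N) (s N * t N 0) {1..N} (\<lambda>k. X (real k * h N)) \<omega> ^ n)) \<longlonglongrightarrow> normal_moment n * asym_var ^ (n div 2)"
    by (rule quad_moments_limit[OF _ span t_def lim1 lim2]) auto
  moreover have "t N 0 = (\<Sum>k=1..N. R (real k * h N) (real k * h N))" for N
    unfolding t_def by (subst kernel_trace_0) (auto intro!: sum.cong simp: cov)
  ultimately show ?thesis by (simp add: fluct_def s_def)
qed

text \<open>The diagonal defects form a geometric series, so the bias of the empirical moment is of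
  order 1 / T and vanishes even after multiplication by sqrt T.\<close>

lemma bias_bound:
  assumes h: "0 < h"
  shows "h * \<bar>(\<Sum>k=1..N. R (real k * h) (real k * h)) - real N * stat_cov 0\<bar> \<le> 2 * kc * kernel_norm / \<theta>\<^sup>2"
proof -
  let ?C = "2 * kc * kernel_norm / \<theta>"
  have C: "0 \<le> ?C" using kernel_const_pos kernel_norm_pos \<theta>_pos by simp
  have each: "\<bar>R (real k * h) (real k * h) - stat_cov 0\<bar> \<le> ?C * exp (- \<theta> * (real k * h))" for k
  proof -
    have p: "0 \<le> real k * h" using h by simp
    have e: "kc * kernel_norm / \<theta> * (e + e) = ?C * e" for e by simp
    show ?thesis using R_le_stat_cov[OF p p] stat_cov_le_R[OF p p] unfolding diff_self e by linarith
  qed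
  have "h * \<bar>(\<Sum>k=1..N. R (real k * h) (real k * h)) - real N * stat_cov 0\<bar> = h * \<bar>\<Sum>k=1..N. R (real k * h) (real k * h) - stat_cov 0\<bar>"
    by (simp add: sum_subtractf)
  also have "\<dots> \<le> h * (\<Sum>k=1..N. ?C * exp (- \<theta> * (real k * h)))"
    using h by (intro mult_left_mono order_trans[OF sum_abs sum_mono] each) auto
  also have "\<dots> = ?C * (h * (\<Sum>k=1..N. exp (- \<theta> * (real k * h))))" by (simp add: sum_distrib_left mult_ac)
  also have "\<dots> \<le> ?C * (1 / \<theta>)" using sum_exp_le[OF \<theta>_pos, of h N] h C by (intro mult_left_mono) auto
  finally show ?thesis by (simp add: power2_eq_square)
qed

lemma mu2_hat_decomp:
  assumes N: "N \<ge> 1" and h: "0 < h N"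
  shows "sqrt (real N * h N) * (mu2_hat X h N \<omega> - stat_cov 0) = fluct (h N) N \<omega> +
    h N / sqrt (real N * h N) * ((\<Sum>k=1..N. R (real k * h N) (real k * h N)) - real N * stat_cov 0)"
proof -
  define S where "S = (\<Sum>k=1..N. (X (real k * h N) \<omega>)\<^sup>2)"
  define T where "T = real N * h N"
  define Q where "Q = (\<Sum>k=1..N. R (real k * h N) (real k * h N))"
  have T: "0 < T" using N h by (simp add: T_def)
  have sq: "sqrt T * x / T = x / sqrt T" for x
    using T by (metis mult.commute real_div_sqrt less_imp_le times_divide_eq_left times_divide_eq_right divide_divide_eq_right)
  have "mu2_hat X h N \<omega> = h N * S / T"
    unfolding mu2_hat_def sum_distrib_right[symmetric] S_def[symmetric] T_def[symmetric]
    by (simp add: mult.commute)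
  then have "sqrt T * (mu2_hat X h N \<omega> - stat_cov 0) = sqrt T * (h N * S - T * stat_cov 0) / T"
    using T by (simp add: right_diff_distrib diff_divide_distrib)
  also have "\<dots> = (h N * S - T * stat_cov 0) / sqrt T" by (rule sq)
  also have "\<dots> = h N / sqrt T * S - h N / sqrt T * Q + h N / sqrt T * (Q - real N * stat_cov 0)"
    by (simp add: T_def algebra_simps diff_divide_distrib)
  finally show ?thesis by (simp add: fluct_def quad_def S_def T_def Q_def)
qed

end

section \<open>The asymptotic variance\<close>

lemma nn_integral_Ioi_Ici:
  fixes g :: "real \<Rightarrow> ennreal"
  shows "(\<integral>\<^sup>+x. g x * indicator {0<..} x \<partial>lborel) = (\<integral>\<^sup>+x. g x * indicator {0..} x \<partial>lborel)"
  by (rule nn_integral_cong_AE) (use AE_lborel_singleton[of 0] in eventually_elim, auto split: split_indicator)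

lemma nn_integral_reflect:
  fixes g :: "real \<Rightarrow> ennreal"
  assumes "g \<in> borel_measurable borel"
  shows "(\<integral>\<^sup>+x. g (- x) \<partial>lborel) = (\<integral>\<^sup>+x. g x \<partial>lborel)"
  using nn_integral_real_affine[OF assms, of "-1" 0] by simp

lemma nn_integral_shift:
  fixes g :: "real \<Rightarrow> ennreal"
  assumes "g \<in> borel_measurable borel"
  shows "(\<integral>\<^sup>+x. g x \<partial>lborel) = (\<integral>\<^sup>+x. g (c + x) \<partial>lborel)"
  using nn_integral_real_affine[OF assms, of 1 c] by simp

lemma nn_integral_swap:
  fixes g :: "real \<Rightarrow> real \<Rightarrow> ennreal"
  assumes "(\<lambda>p. g (fst p) (snd p)) \<in> borel_measurable (borel \<Otimes>\<^sub>M borel)"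
  shows "(\<integral>\<^sup>+x. \<integral>\<^sup>+y. g x y \<partial>lborel \<partial>lborel) = (\<integral>\<^sup>+y. \<integral>\<^sup>+x. g x y \<partial>lborel \<partial>lborel)"
  by (rule lborel_pair.Fubini'[symmetric]) (use assms in \<open>simp add: case_prod_beta'\<close>)

text \<open>The integrand below is a function of the four points $0, x, y, z$ that depends only on their
  differences and is invariant under the double transpositions of the points. Splitting according to
  which of the four points is the least one therefore gives four equal integrals.\<close>

lemma four_point_symmetry:
  fixes f k :: "real \<Rightarrow> ennreal"
  assumes [measurable]: "f \<in> borel_measurable borel" "k \<in> borel_measurable borel"
    and f: "\<And>x. f (- x) = f x" and k: "\<And>x. k (- x) = k x"
  defines "P \<equiv> \<lambda>x y z. f x * f (y - z) * k y * k (x - z)"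
  shows "(\<integral>\<^sup>+x. \<integral>\<^sup>+y. \<integral>\<^sup>+z. P x y z \<partial>lborel \<partial>lborel \<partial>lborel) =
    4 * (\<integral>\<^sup>+x. (\<integral>\<^sup>+y. (\<integral>\<^sup>+z. P x y z * indicator {0..} z \<partial>lborel) * indicator {0..} y \<partial>lborel) * indicator {0..} x \<partial>lborel)"
    (is "_ = 4 * ?G")
proof -
  have P_meas [measurable]: "(\<lambda>w. P (a w) (b w) (c w)) \<in> borel_measurable N"
    if [measurable]: "a \<in> borel_measurable N" "b \<in> borel_measurable N" "c \<in> borel_measurable N" for a b c and N :: "'n measure"
    unfolding P_def by measurable
  have f': "f (a - b) = f (b - a)" and k': "k (a - b) = k (b - a)" for a b
    using f[of "b - a"] k[of "b - a"] by simp_all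
  let ?i = "\<lambda>A (x::real). (indicator A x :: ennreal)"
  define Q where "Q A B C = (\<integral>\<^sup>+x. \<integral>\<^sup>+y. \<integral>\<^sup>+z. P x y z * (?i A x * ?i B y * ?i C z) \<partial>lborel \<partial>lborel \<partial>lborel)" for A B C
  have Q_eq: "Q A B C = (\<integral>\<^sup>+x. (\<integral>\<^sup>+y. (\<integral>\<^sup>+z. P x y z * ?i C z \<partial>lborel) * ?i B y \<partial>lborel) * ?i A x \<partial>lborel)"
    if [measurable]: "A \<in> sets borel" "B \<in> sets borel" "C \<in> sets borel" for A B C
    unfolding Q_def by (subst nn_integral_multc[symmetric], measurable)+ (simp add: mult_ac)
  \<comment> \<open>The boundary of a half-line is a null set; breaking ties below produces both
    open and closed half-lines.\<close>
  have half: "Q A B C = ?G" if "A = {0<..} \<or> A = {0..}" "B = {0<..} \<or> B = {0..}" "C = {0<..} \<or> C = {0..}" for A B C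
  proof -
    have "A \<in> sets borel" "B \<in> sets borel" "C \<in> sets borel" using that by auto
    then show ?thesis using that by (auto simp: Q_eq nn_integral_Ioi_Ici)
  qed
  \<comment> \<open>The least of the four points is 0, x, y or z respectively. Ties go to the
    earlier one in this order, so the indicators add up to 1 everywhere.\<close>
  define S1 S2 S3 S4 :: "real \<Rightarrow> real \<Rightarrow> real \<Rightarrow> ennreal" where
    "S1 x y z = ?i {0..} x * ?i {0..} y * ?i {0..} z" and
    "S2 x y z = ?i {..<0} x * ?i {x..} y * ?i {x..} z" and
    "S3 x y z = ?i {..<0} y * ?i {y<..} x * ?i {y..} z" and
    "S4 x y z = ?i {..<0} z * ?i {z<..} x * ?i {z<..} y" for x y z
  have S_meas [measurable]:
    "(\<lambda>w. S1 (a w) (b w) (c w)) \<in> borel_measurable N" "(\<lambda>w. S2 (a w) (b w) (c w)) \<in> borel_measurable N"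
    "(\<lambda>w. S3 (a w) (b w) (c w)) \<in> borel_measurable N" "(\<lambda>w. S4 (a w) (b w) (c w)) \<in> borel_measurable N"
    if [measurable]: "a \<in> borel_measurable N" "b \<in> borel_measurable N" "c \<in> borel_measurable N" for a b c and N :: "'n measure"
    unfolding S1_def S2_def S3_def S4_def indicator_def atLeast_iff lessThan_iff greaterThan_iff by measurable
  have part: "S1 x y z + S2 x y z + S3 x y z + S4 x y z = 1" for x y z
    unfolding S1_def S2_def S3_def S4_def by (auto simp: indicator_def)
  have I1: "(\<integral>\<^sup>+x. \<integral>\<^sup>+y. \<integral>\<^sup>+z. P x y z * S1 x y z \<partial>lborel \<partial>lborel \<partial>lborel) = ?G"
    using half[of "{0..}" "{0..}" "{0..}"] by (simp add: Q_def S1_def)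
  \<comment> \<open>Translation by the least point exchanges 0 with x and y with z. In
    \<open>I3\<close> it is 0 with y and x with z, in \<open>I4\<close> it is 0 with z and x with
    y.\<close>
  have I2: "(\<integral>\<^sup>+x. \<integral>\<^sup>+y. \<integral>\<^sup>+z. P x y z * S2 x y z \<partial>lborel \<partial>lborel \<partial>lborel) = ?G"
  proof -
    have "(\<integral>\<^sup>+x. \<integral>\<^sup>+y. \<integral>\<^sup>+z. P x y z * S2 x y z \<partial>lborel \<partial>lborel \<partial>lborel) =
      (\<integral>\<^sup>+x. \<integral>\<^sup>+y. \<integral>\<^sup>+z. P (- x) y z * S2 (- x) y z \<partial>lborel \<partial>lborel \<partial>lborel)"
      by (rule nn_integral_reflect[symmetric]) measurable
    also have "\<dots> = (\<integral>\<^sup>+x. \<integral>\<^sup>+y. \<integral>\<^sup>+z. P (- x) (- x + y) (- x + z) * S2 (- x) (- x + y) (- x + z) \<partial>lborel \<partial>lborel \<partial>lborel)"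
    proof (rule nn_integral_cong)
      fix x :: real
      have "(\<integral>\<^sup>+y. \<integral>\<^sup>+z. P (- x) y z * S2 (- x) y z \<partial>lborel \<partial>lborel) = (\<integral>\<^sup>+y. \<integral>\<^sup>+z. P (- x) (- x + y) z * S2 (- x) (- x + y) z \<partial>lborel \<partial>lborel)"
        by (rule nn_integral_shift) measurable
      also have "\<dots> = (\<integral>\<^sup>+y. \<integral>\<^sup>+z. P (- x) (- x + y) (- x + z) * S2 (- x) (- x + y) (- x + z) \<partial>lborel \<partial>lborel)"
        by (intro nn_integral_cong nn_integral_shift) measurable
      finally show "(\<integral>\<^sup>+y. \<integral>\<^sup>+z. P (- x) y z * S2 (- x) y z \<partial>lborel \<partial>lborel) =
         (\<integral>\<^sup>+y. \<integral>\<^sup>+z. P (- x) (- x + y) (- x + z) * S2 (- x) (- x + y) (- x + z) \<partial>lborel \<partial>lborel)" .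
    qed
    also have "\<dots> = (\<integral>\<^sup>+x. \<integral>\<^sup>+y. \<integral>\<^sup>+z. P x z y * (?i {0<..} x * ?i {0..} z * ?i {0..} y) \<partial>lborel \<partial>lborel \<partial>lborel)"
    proof (intro nn_integral_cong arg_cong2[where f="(*)"])
      fix x y z :: real
      show "P (- x) (- x + y) (- x + z) = P x z y"
        unfolding P_def using f[of x] f'[of "- x + y" "- x + z"] k'[of "- x + y" 0] k'[of "-x" "- x + z"] f'[of y z] k'[of z 0]
        by (simp add: mult_ac)
      show "S2 (- x) (- x + y) (- x + z) = ?i {0<..} x * ?i {0..} z * ?i {0..} y"
        unfolding S2_def by (auto simp: indicator_def)
    qed
    also have "\<dots> = Q {0<..} {0..} {0..}" unfolding Q_def by (intro nn_integral_cong nn_integral_swap) measurable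
    finally show ?thesis using half by simp
  qed
  have I3: "(\<integral>\<^sup>+x. \<integral>\<^sup>+y. \<integral>\<^sup>+z. P x y z * S3 x y z \<partial>lborel \<partial>lborel \<partial>lborel) = ?G"
  proof -
    have "(\<integral>\<^sup>+x. \<integral>\<^sup>+y. \<integral>\<^sup>+z. P x y z * S3 x y z \<partial>lborel \<partial>lborel \<partial>lborel) = 
      (\<integral>\<^sup>+y. \<integral>\<^sup>+x. \<integral>\<^sup>+z. P x y z * S3 x y z \<partial>lborel \<partial>lborel \<partial>lborel)" by (rule nn_integral_swap) measurable
    also have "\<dots> = (\<integral>\<^sup>+y. \<integral>\<^sup>+x. \<integral>\<^sup>+z. P x (- y) z * S3 x (- y) z \<partial>lborel \<partial>lborel \<partial>lborel)"
      by (rule nn_integral_reflect[symmetric]) measurable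
    also have "\<dots> = (\<integral>\<^sup>+y. \<integral>\<^sup>+x. \<integral>\<^sup>+z. P (- y + x) (- y) (- y + z) * S3 (- y + x) (- y) (- y + z) \<partial>lborel \<partial>lborel \<partial>lborel)"
    proof (rule nn_integral_cong)
      fix y :: real
      have "(\<integral>\<^sup>+x. \<integral>\<^sup>+z. P x (- y) z * S3 x (- y) z \<partial>lborel \<partial>lborel) = (\<integral>\<^sup>+x. \<integral>\<^sup>+z. P (- y + x) (- y) z * S3 (- y + x) (- y) z \<partial>lborel \<partial>lborel)"
        by (rule nn_integral_shift) measurable
      also have "\<dots> = (\<integral>\<^sup>+x. \<integral>\<^sup>+z. P (- y + x) (- y) (- y + z) * S3 (- y + x) (- y) (- y + z) \<partial>lborel \<partial>lborel)"
        by (intro nn_integral_cong nn_integral_shift) measurable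
      finally show "(\<integral>\<^sup>+x. \<integral>\<^sup>+z. P x (- y) z * S3 x (- y) z \<partial>lborel \<partial>lborel) =
        (\<integral>\<^sup>+x. \<integral>\<^sup>+z. P (- y + x) (- y) (- y + z) * S3 (- y + x) (- y) (- y + z) \<partial>lborel \<partial>lborel)" .
    qed
    also have "\<dots> = (\<integral>\<^sup>+y. \<integral>\<^sup>+x. \<integral>\<^sup>+z. P z y x * (?i {0..} z * ?i {0<..} y * ?i {0<..} x) \<partial>lborel \<partial>lborel \<partial>lborel)"
    proof (intro nn_integral_cong arg_cong2[where f="(*)"])
      fix x y z :: real
      show "P (- y + x) (- y) (- y + z) = P z y x"
        unfolding P_def using f'[of "- y + x" 0] f[of z] k[of y] k'[of "- y + x" "- y + z"] f'[of y x] k'[of z x]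
        by (simp add: mult_ac)
      show "S3 (- y + x) (- y) (- y + z) = ?i {0..} z * ?i {0<..} y * ?i {0<..} x"
        unfolding S3_def by (auto simp: indicator_def)
    qed
    also have "\<dots> = (\<integral>\<^sup>+y. \<integral>\<^sup>+z. \<integral>\<^sup>+x. P z y x * (?i {0..} z * ?i {0<..} y * ?i {0<..} x) \<partial>lborel \<partial>lborel \<partial>lborel)"
      by (intro nn_integral_cong nn_integral_swap) measurable
    also have "\<dots> = Q {0..} {0<..} {0<..}" unfolding Q_def by (rule nn_integral_swap) measurable
    finally show ?thesis using half by simp
  qed
  have I4: "(\<integral>\<^sup>+x. \<integral>\<^sup>+y. \<integral>\<^sup>+z. P x y z * S4 x y z \<partial>lborel \<partial>lborel \<partial>lborel) = ?G"
  proof -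
    have "(\<integral>\<^sup>+x. \<integral>\<^sup>+y. \<integral>\<^sup>+z. P x y z * S4 x y z \<partial>lborel \<partial>lborel \<partial>lborel) = 
      (\<integral>\<^sup>+x. \<integral>\<^sup>+z. \<integral>\<^sup>+y. P x y z * S4 x y z \<partial>lborel \<partial>lborel \<partial>lborel)" by (intro nn_integral_cong nn_integral_swap) measurable
    also have "\<dots> = (\<integral>\<^sup>+z. \<integral>\<^sup>+x. \<integral>\<^sup>+y. P x y z * S4 x y z \<partial>lborel \<partial>lborel \<partial>lborel)" by (rule nn_integral_swap) measurable
    also have "\<dots> = (\<integral>\<^sup>+z. \<integral>\<^sup>+x. \<integral>\<^sup>+y. P x y (- z) * S4 x y (- z) \<partial>lborel \<partial>lborel \<partial>lborel)"
      by (rule nn_integral_reflect[symmetric]) measurable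
    also have "\<dots> = (\<integral>\<^sup>+z. \<integral>\<^sup>+x. \<integral>\<^sup>+y. P (- z + x) (- z + y) (- z) * S4 (- z + x) (- z + y) (- z) \<partial>lborel \<partial>lborel \<partial>lborel)"
    proof (rule nn_integral_cong)
      fix z :: real
      have "(\<integral>\<^sup>+x. \<integral>\<^sup>+y. P x y (- z) * S4 x y (- z) \<partial>lborel \<partial>lborel) = (\<integral>\<^sup>+x. \<integral>\<^sup>+y. P (- z + x) y (- z) * S4 (- z + x) y (- z) \<partial>lborel \<partial>lborel)"
        by (rule nn_integral_shift) measurable
      also have "\<dots> = (\<integral>\<^sup>+x. \<integral>\<^sup>+y. P (- z + x) (- z + y) (- z) * S4 (- z + x) (- z + y) (- z) \<partial>lborel \<partial>lborel)"
        by (intro nn_integral_cong nn_integral_shift) measurable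
      finally show "(\<integral>\<^sup>+x. \<integral>\<^sup>+y. P x y (- z) * S4 x y (- z) \<partial>lborel \<partial>lborel) =
        (\<integral>\<^sup>+x. \<integral>\<^sup>+y. P (- z + x) (- z + y) (- z) * S4 (- z + x) (- z + y) (- z) \<partial>lborel \<partial>lborel)" .
    qed
    also have "\<dots> = (\<integral>\<^sup>+z. \<integral>\<^sup>+x. \<integral>\<^sup>+y. P y x z * (?i {0<..} y * ?i {0<..} x * ?i {0<..} z) \<partial>lborel \<partial>lborel \<partial>lborel)"
    proof (intro nn_integral_cong arg_cong2[where f="(*)"])
      fix x y z :: real
      show "P (- z + x) (- z + y) (- z) = P y x z"
        unfolding P_def using f'[of "- z + x" 0] f[of y] k'[of "- z + y" 0] k[of x] f'[of x z] k'[of y z]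
        by (simp add: mult_ac)
      show "S4 (- z + x) (- z + y) (- z) = ?i {0<..} y * ?i {0<..} x * ?i {0<..} z"
        unfolding S4_def by (auto simp: indicator_def)
    qed
    also have "\<dots> = (\<integral>\<^sup>+z. \<integral>\<^sup>+y. \<integral>\<^sup>+x. P y x z * (?i {0<..} y * ?i {0<..} x * ?i {0<..} z) \<partial>lborel \<partial>lborel \<partial>lborel)"
      by (intro nn_integral_cong nn_integral_swap) measurable
    also have "\<dots> = (\<integral>\<^sup>+y. \<integral>\<^sup>+z. \<integral>\<^sup>+x. P y x z * (?i {0<..} y * ?i {0<..} x * ?i {0<..} z) \<partial>lborel \<partial>lborel \<partial>lborel)"
      by (rule nn_integral_swap) measurable
    also have "\<dots> = Q {0<..} {0<..} {0<..}" unfolding Q_def by (intro nn_integral_cong nn_integral_swap) measurable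
    finally show ?thesis using half by simp
  qed
  have "(\<integral>\<^sup>+x. \<integral>\<^sup>+y. \<integral>\<^sup>+z. P x y z \<partial>lborel \<partial>lborel \<partial>lborel) =
    (\<integral>\<^sup>+x. \<integral>\<^sup>+y. \<integral>\<^sup>+z. P x y z * S1 x y z + P x y z * S2 x y z + P x y z * S3 x y z + P x y z * S4 x y z \<partial>lborel \<partial>lborel \<partial>lborel)"
    unfolding distrib_left[symmetric] part by simp
  also have "\<dots> = ?G + ?G + ?G + ?G"
    by (simp add: nn_integral_add I1 I2 I3 I4)
  also have "\<dots> = (1 + 1 + 1 + 1) * ?G" by (simp only: distrib_right mult_1)
  also have "(1 + 1 + 1 + 1 :: ennreal) = 4" by simp
  finally show ?thesis .
qed


section \<open>Identification with the triple integral for the variance\<close>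

context fou_param
begin

text \<open>One factor of the square is written as the convolution of \<open>f\<close> with
  \<open>k\<close> and the other in the opposite order (\<open>r1\<close>, \<open>r2\<close>). The
  four points then form the cycle required by \<open>four_point_symmetry\<close>.\<close>

lemma nn_integral_stat_cov_sq:
  defines "f \<equiv> \<lambda>x. ennreal (exp (- \<theta> * \<bar>x\<bar>))" and "k \<equiv> \<lambda>x. ennreal (kern x)"
  shows "(\<integral>\<^sup>+t. ennreal ((stat_cov t)\<^sup>2) \<partial>lborel) = ennreal ((kc / (2 * \<theta>))\<^sup>2) *
    (\<integral>\<^sup>+x. \<integral>\<^sup>+y. \<integral>\<^sup>+z. f x * f (y - z) * k y * k (x - z) \<partial>lborel \<partial>lborel \<partial>lborel)"
proof -
  have [measurable]: "f \<in> borel_measurable borel" "k \<in> borel_measurable borel" by (auto simp: f_def k_def)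
  have kp: "k (a - b) = k (b - a)" "f (a - b) = f (b - a)" for a b
    using stat_kernel_minus[of H "b - a"] by (simp_all add: k_def f_def abs_minus_commute)
  define c where "c = kc / (2 * \<theta>)"
  have c: "0 \<le> c" using kernel_const_pos \<theta>_pos by (simp add: c_def)
  have r1: "ennreal (stat_cov t) = ennreal c * (\<integral>\<^sup>+u. f (t - u) * k u \<partial>lborel)" for t
  proof -
    have "(\<integral>\<^sup>+u. f (t - u) * k u \<partial>lborel) = (\<integral>\<^sup>+u. ennreal (exp (- \<theta> * \<bar>t - u\<bar>) * kern u) \<partial>lborel)"
      by (intro nn_integral_cong) (simp add: f_def k_def ennreal_mult)
    also have "\<dots> = ennreal (LINT u|lborel. exp (- \<theta> * \<bar>t - u\<bar>) * kern u)"
      by (rule nn_integral_eq_integral[OF integrable_exp_kern]) auto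
    finally show ?thesis using c
      by (simp add: stat_cov_def c_def[symmetric] ennreal_mult[symmetric] integral_nonneg_AE)
  qed
  have r2: "ennreal (stat_cov t) = ennreal c * (\<integral>\<^sup>+v. k (t - v) * f v \<partial>lborel)" for t
  proof -
    have "(\<integral>\<^sup>+u. f (t - u) * k u \<partial>lborel) = (\<integral>\<^sup>+u. f (t - (t + u)) * k (t + u) \<partial>lborel)"
      by (rule nn_integral_shift) measurable
    also have "\<dots> = (\<integral>\<^sup>+u. f (t - (t + - u)) * k (t + - u) \<partial>lborel)"
      by (rule nn_integral_reflect[symmetric]) measurable
    also have "\<dots> = (\<integral>\<^sup>+v. k (t - v) * f v \<partial>lborel)" by (simp add: mult.commute)
    finally show ?thesis using r1 by simp
  qed
  have "(\<integral>\<^sup>+t. ennreal ((stat_cov t)\<^sup>2) \<partial>lborel) = (\<integral>\<^sup>+t. ennreal (stat_cov t) * ennreal (stat_cov t) \<partial>lborel)"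
    by (intro nn_integral_cong) (simp add: power2_eq_square ennreal_mult stat_cov_nonneg)
  also have "\<dots> = (\<integral>\<^sup>+t. (ennreal c * (\<integral>\<^sup>+v. k (t - v) * f v \<partial>lborel)) * (ennreal c * (\<integral>\<^sup>+u. f (t - u) * k u \<partial>lborel)) \<partial>lborel)"
    by (subst r1, subst r2, rule refl)
  also have "\<dots> = (\<integral>\<^sup>+t. ennreal (c\<^sup>2) * (\<integral>\<^sup>+v. \<integral>\<^sup>+u. f v * f (u - t) * k u * k (v - t) \<partial>lborel \<partial>lborel) \<partial>lborel)"
  proof (rule nn_integral_cong)
    fix t :: real
    have "(\<integral>\<^sup>+v. k (t - v) * f v \<partial>lborel) * (\<integral>\<^sup>+u. f (t - u) * k u \<partial>lborel) =
      (\<integral>\<^sup>+v. \<integral>\<^sup>+u. (k (t - v) * f v) * (f (t - u) * k u) \<partial>lborel \<partial>lborel)"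
      by (simp add: nn_integral_multc nn_integral_cmult)
    also have "\<dots> = (\<integral>\<^sup>+v. \<integral>\<^sup>+u. f v * f (u - t) * k u * k (v - t) \<partial>lborel \<partial>lborel)"
      unfolding kp(1)[of t] kp(2)[of t] by (simp only: mult_ac)
    finally have e: "(\<integral>\<^sup>+v. k (t - v) * f v \<partial>lborel) * (\<integral>\<^sup>+u. f (t - u) * k u \<partial>lborel) = \<dots>" .
    have c2: "ennreal (c\<^sup>2) = ennreal c * ennreal c" using c by (simp add: power2_eq_square ennreal_mult)
    show "(ennreal c * (\<integral>\<^sup>+v. k (t - v) * f v \<partial>lborel)) * (ennreal c * (\<integral>\<^sup>+u. f (t - u) * k u \<partial>lborel)) =
      ennreal (c\<^sup>2) * (\<integral>\<^sup>+v. \<integral>\<^sup>+u. f v * f (u - t) * k u * k (v - t) \<partial>lborel \<partial>lborel)"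
      unfolding e[symmetric] c2 by (simp only: mult_ac)
  qed
  also have "\<dots> = ennreal (c\<^sup>2) * (\<integral>\<^sup>+t. \<integral>\<^sup>+v. \<integral>\<^sup>+u. f v * f (u - t) * k u * k (v - t) \<partial>lborel \<partial>lborel \<partial>lborel)"
    by (rule nn_integral_cmult) measurable
  also have "(\<integral>\<^sup>+t. \<integral>\<^sup>+v. \<integral>\<^sup>+u. f v * f (u - t) * k u * k (v - t) \<partial>lborel \<partial>lborel \<partial>lborel) =
     (\<integral>\<^sup>+v. \<integral>\<^sup>+t. \<integral>\<^sup>+u. f v * f (u - t) * k u * k (v - t) \<partial>lborel \<partial>lborel \<partial>lborel)"
    by (rule nn_integral_swap) measurable
  also have "\<dots> = (\<integral>\<^sup>+v. \<integral>\<^sup>+u. \<integral>\<^sup>+t. f v * f (u - t) * k u * k (v - t) \<partial>lborel \<partial>lborel \<partial>lborel)"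
    by (intro nn_integral_cong nn_integral_swap) measurable
  finally show ?thesis by (simp add: c_def)
qed

text \<open>The four equal parts cancel the square of 1/2 in the constant of
  \<open>stat_cov\<close>. The exponential in x + y + z splits between the kernel at
  \<open>y\<close> and the kernel at \<open>x - z\<close>, as in \<open>kern_diff\<close>.\<close>

lemma sigma_sq_eq_asym_var: "sigma_sq H \<theta> = asym_var"
proof -
  define f where "f x = ennreal (exp (- \<theta> * \<bar>x\<bar>))" for x
  define k where "k x = ennreal (kern x)" for x
  have [measurable]: "f \<in> borel_measurable borel" "k \<in> borel_measurable borel" by (auto simp: f_def[abs_def] k_def[abs_def])
  let ?G = "\<integral>\<^sup>+x. (\<integral>\<^sup>+y. (\<integral>\<^sup>+z. f x * f (y - z) * k y * k (x - z) * indicator {0..} z \<partial>lborel) * indicator {0..} y \<partial>lborel) * indicator {0..} x \<partial>lborel"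
  let ?h = "\<lambda>x y z. exp (- \<theta> * x - \<theta> * \<bar>y - z\<bar>) * exp ((1 - 1 / H) * (x + y + z)) *
           (1 - exp (- y / H)) powr (2 * H - 2) * \<bar>exp (- x / H) - exp (- z / H)\<bar> powr (2 * H - 2)"
  have kern_diff: "exp ((1 - 1 / H) * (x + z)) * \<bar>exp (- x / H) - exp (- z / H)\<bar> powr (2 * H - 2) = kern (x - z)" for x z
  proof -
    have *: "exp ((1 - 1 / H) * (x + z)) * \<bar>exp (- x / H) - exp (- z / H)\<bar> powr (2 * H - 2) = kern (x - z)" if "z \<le> x" for x z
    proof -
      have e: "exp (- z / H) - exp (- x / H) = exp (- z / H) * (1 - exp (- (x - z) / H))"
        by (simp add: right_diff_distrib exp_add[symmetric] diff_divide_distrib)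
      have nn: "0 \<le> 1 - exp (- (x - z) / H)" using that H_pos by (simp add: divide_nonpos_pos)
      have "\<bar>exp (- x / H) - exp (- z / H)\<bar> = exp (- z / H) * (1 - exp (- (x - z) / H))"
        unfolding abs_minus_commute[of "exp (- x / H)"] e using nn by (simp add: abs_mult)
      then have "\<bar>exp (- x / H) - exp (- z / H)\<bar> powr (2 * H - 2) = exp (- z / H) powr (2 * H - 2) * (1 - exp (- (x - z) / H)) powr (2 * H - 2)"
        using nn by (simp add: powr_mult)
      moreover have "exp ((1 - 1 / H) * (x + z)) * exp (- z / H) powr (2 * H - 2) = exp (- (1 / H - 1) * (x - z))"
        using H_pos by (simp add: powr_def exp_add[symmetric] field_simps)
      ultimately show ?thesis using that by (simp add: stat_kernel_def mult.assoc[symmetric])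
    qed
    show ?thesis
    proof (cases "z \<le> x")
      case False
      then show ?thesis using *[of x z] stat_kernel_minus[of H "x - z"] by (simp add: add.commute abs_minus_commute)
    qed (rule *)
  qed
  have h_eq: "ennreal (?h x y z) = f x * f (y - z) * k y * k (x - z)" if "0 \<le> x" "0 \<le> y" "0 \<le> z" for x y z
  proof -
    have ky: "exp ((1 - 1 / H) * y) * (1 - exp (- y / H)) powr (2 * H - 2) = kern y"
      using that by (simp add: stat_kernel_def left_diff_distrib)
    have "?h x y z = (exp (- \<theta> * x) * exp (- \<theta> * \<bar>y - z\<bar>)) * (exp ((1 - 1 / H) * y) * (1 - exp (- y / H)) powr (2 * H - 2)) *
        (exp ((1 - 1 / H) * (x + z)) * \<bar>exp (- x / H) - exp (- z / H)\<bar> powr (2 * H - 2))"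
    proof -
      have "exp (- \<theta> * x - \<theta> * \<bar>y - z\<bar>) = exp (- \<theta> * x) * exp (- \<theta> * \<bar>y - z\<bar>)"
        by (simp add: exp_add[symmetric])
      moreover have "exp ((1 - 1 / H) * (x + y + z)) = exp ((1 - 1 / H) * y) * exp ((1 - 1 / H) * (x + z))"
        by (simp add: exp_add[symmetric] algebra_simps add_divide_distrib)
      ultimately show ?thesis by (simp only: mult_ac)
    qed
    also have "\<dots> = exp (- \<theta> * \<bar>x\<bar>) * exp (- \<theta> * \<bar>y - z\<bar>) * kern y * kern (x - z)"
      unfolding kern_diff ky using that by simp
    finally show ?thesis unfolding f_def k_def
      by (simp only: ennreal_mult exp_ge_zero stat_kernel_nonneg mult_nonneg_nonneg)
  qed
  define F where "F w = indicator ({0..} \<times> {0..} \<times> {0..}) w *\<^sub>R (case w of (x, y, z) \<Rightarrow> ?h x y z)" for w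
  have "F \<in> borel_measurable (borel \<Otimes>\<^sub>M (borel \<Otimes>\<^sub>M borel))" unfolding F_def[abs_def] by measurable
  then have F_meas: "F \<in> borel_measurable (lborel \<Otimes>\<^sub>M (lborel \<Otimes>\<^sub>M lborel))"
    by (simp cong: measurable_cong_sets)
  then have F_meas': "(\<lambda>w. ennreal (F w)) \<in> borel_measurable (lborel \<Otimes>\<^sub>M (lborel \<Otimes>\<^sub>M lborel))"
    by (rule measurable_compose) simp
  have nnF: "(\<integral>\<^sup>+w. ennreal (F w) \<partial>lborel) = ?G"
  proof -
    have "(\<integral>\<^sup>+w. ennreal (F w) \<partial>lborel) = (\<integral>\<^sup>+w. ennreal (F w) \<partial>(lborel \<Otimes>\<^sub>M (lborel \<Otimes>\<^sub>M lborel)))"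
      by (simp only: lborel_prod)
    also have "\<dots> = (\<integral>\<^sup>+x. \<integral>\<^sup>+v. ennreal (F (x, v)) \<partial>(lborel \<Otimes>\<^sub>M lborel) \<partial>lborel)"
    proof -
      have sf: "sigma_finite_measure (lborel \<Otimes>\<^sub>M lborel :: (real \<times> real) measure)"
        unfolding lborel_prod by (rule sigma_finite_lborel)
      show ?thesis by (rule sigma_finite_measure.nn_integral_fst[OF sf F_meas', symmetric])
    qed
    also have "\<dots> = (\<integral>\<^sup>+x. \<integral>\<^sup>+y. \<integral>\<^sup>+z. ennreal (F (x, y, z)) \<partial>lborel \<partial>lborel \<partial>lborel)"
    proof (rule nn_integral_cong)
      fix x :: real
      have "(\<lambda>v. ennreal (F (x, v))) \<in> borel_measurable (lborel \<Otimes>\<^sub>M lborel)"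
        by (rule measurable_compose[OF measurable_Pair1' F_meas']) simp
      then show "(\<integral>\<^sup>+v. ennreal (F (x, v)) \<partial>(lborel \<Otimes>\<^sub>M lborel)) = (\<integral>\<^sup>+y. \<integral>\<^sup>+z. ennreal (F (x, y, z)) \<partial>lborel \<partial>lborel)"
        by (rule lborel.nn_integral_fst[symmetric])
    qed
    also have "\<dots> = (\<integral>\<^sup>+x. \<integral>\<^sup>+y. \<integral>\<^sup>+z. f x * f (y - z) * k y * k (x - z) * indicator {0..} z * indicator {0..} y * indicator {0..} x \<partial>lborel \<partial>lborel \<partial>lborel)"
    proof (intro nn_integral_cong)
      fix x y z :: real
      show "ennreal (F (x, y, z)) = f x * f (y - z) * k y * k (x - z) * indicator {0..} z * indicator {0..} y * indicator {0..} x"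
      proof (cases "0 \<le> x \<and> 0 \<le> y \<and> 0 \<le> z")
        case True
        then have "F (x, y, z) = ?h x y z" by (simp add: F_def)
        then show ?thesis using h_eq[of x y z] True by simp
      next
        case False
        then have "F (x, y, z) = 0" by (auto simp: F_def indicator_def)
        then show ?thesis using False by (auto simp: indicator_def)
      qed
    qed
    also have "\<dots> = ?G" by (simp add: nn_integral_multc)
    finally show ?thesis .
  qed
  have "(LINT w:({0..} \<times> {0..} \<times> {0..})|lborel. (case w of (x, y, z) \<Rightarrow> ?h x y z)) = enn2real (\<integral>\<^sup>+w. ennreal (F w) \<partial>lborel)"
    unfolding set_lebesgue_integral_def F_def[symmetric]
  proof (rule integral_eq_nn_integral)
    show "F \<in> borel_measurable lborel" using F_meas by (simp only: lborel_prod)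
    show "AE w in lborel. 0 \<le> F w" by (intro AE_I2) (auto simp: F_def indicator_def split: prod.split)
  qed
  then have int: "(LINT w:({0..} \<times> {0..} \<times> {0..})|lborel. (case w of (x, y, z) \<Rightarrow> ?h x y z)) = enn2real ?G"
    unfolding nnF .
  have "ennreal (LINT t|lborel. (stat_cov t)\<^sup>2) = (\<integral>\<^sup>+t. ennreal ((stat_cov t)\<^sup>2) \<partial>lborel)"
    by (rule nn_integral_eq_integral[OF integrable_stat_cov_sq, symmetric]) auto
  also have "\<dots> = ennreal ((kc / (2 * \<theta>))\<^sup>2) * (4 * ?G)"
  proof -
    have "f (- x) = f x" "k (- x) = k x" for x by (simp_all add: f_def k_def)
    then have "(\<integral>\<^sup>+x. \<integral>\<^sup>+y. \<integral>\<^sup>+z. f x * f (y - z) * k y * k (x - z) \<partial>lborel \<partial>lborel \<partial>lborel) = 4 * ?G"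
      by (intro four_point_symmetry) simp_all
    moreover have "(\<integral>\<^sup>+t. ennreal ((stat_cov t)\<^sup>2) \<partial>lborel) = ennreal ((kc / (2 * \<theta>))\<^sup>2) *
        (\<integral>\<^sup>+x. \<integral>\<^sup>+y. \<integral>\<^sup>+z. f x * f (y - z) * k y * k (x - z) \<partial>lborel \<partial>lborel \<partial>lborel)"
      unfolding f_def k_def by (rule nn_integral_stat_cov_sq)
    ultimately show ?thesis by (simp only:)
  qed
  finally have "(LINT t|lborel. (stat_cov t)\<^sup>2) = enn2real (ennreal ((kc / (2 * \<theta>))\<^sup>2) * (4 * ?G))"
    using enn2real_ennreal[of "LINT t|lborel. (stat_cov t)\<^sup>2"] by (simp only: integral_nonneg_AE AE_I2 zero_le_power2)
  also have "\<dots> = (kc / (2 * \<theta>))\<^sup>2 * (4 * enn2real ?G)"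
    by (simp add: enn2real_mult)
  finally have "asym_var = 2 * (kc\<^sup>2 / \<theta>\<^sup>2) * enn2real ?G"
    by (simp add: asym_var_def power_divide power_mult_distrib)
  moreover have "kc\<^sup>2 = (alpha_H H)\<^sup>2 * H powr (4 * H - 4)"
    by (simp add: kernel_const_def power_mult_distrib power2_eq_square powr_add[symmetric])
  ultimately show ?thesis unfolding sigma_sq_def int by simp
qed

end

section \<open>Path regularity\<close>

text \<open>Each point is approached by its dyadic floors. Consecutive floors are equal or
  neighbours on the finer level, which gives a geometric series for each of \<open>s\<close> and
  \<open>t\<close>, while at level \<open>k\<close> their own floors are equal or adjacent. This
  explains the constant 1 + 2 / (1 - q).\<close>

lemma dyadic_chaining:
  fixes f :: "real \<Rightarrow> real"
  assumes cont: "continuous_on {0..} f" and D: "0 \<le> D" and q: "0 < q" "q < 1"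
    and inc: "\<And>k j. real j \<le> T * 2 ^ k \<Longrightarrow> \<bar>f (real (Suc j) / 2 ^ k) - f (real j / 2 ^ k)\<bar> \<le> D * q ^ k"
    and s: "0 \<le> s" and st: "s \<le> t" and t: "t \<le> T" and close: "t - s \<le> 1 / 2 ^ k"
  shows "\<bar>f s - f t\<bar> \<le> D * q ^ k * (1 + 2 / (1 - q))"
proof -
  define fl where "fl x k = nat \<lfloor>x * 2 ^ k\<rfloor>" for x :: real and k :: nat
  have fl: "real (fl x k) \<le> x * 2 ^ k" "x * 2 ^ k < real (fl x k) + 1" if "0 \<le> x" for x k
  proof -
    have "0 \<le> x * 2 ^ k" using that by simp
    then show "real (fl x k) \<le> x * 2 ^ k" "x * 2 ^ k < real (fl x k) + 1" unfolding fl_def by linarith+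
  qed
  define p where "p x k = real (fl x k) / 2 ^ k" for x k
  have step: "\<bar>f (p x (Suc k)) - f (p x k)\<bar> \<le> D * q ^ Suc k" if x: "0 \<le> x" "x \<le> T" for x k
  proof -
    have a: "real (fl x k) \<le> x * 2 ^ k" "x * 2 ^ k < real (fl x k) + 1"
      "real (fl x (Suc k)) \<le> 2 * (x * 2 ^ k)" "2 * (x * 2 ^ k) < real (fl x (Suc k)) + 1"
      using fl[OF x(1), of k] fl[OF x(1), of "Suc k"] by simp_all
    then have "real (2 * fl x k) < real (fl x (Suc k) + 1)" "real (fl x (Suc k)) < real (2 * fl x k + 2)" by simp_all
    then have cases: "fl x (Suc k) = 2 * fl x k \<or> fl x (Suc k) = Suc (2 * fl x k)"
      unfolding of_nat_less_iff by linarith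
    have e: "p x k = real (2 * fl x k) / 2 ^ Suc k" by (simp add: p_def)
    show ?thesis
    proof (cases "fl x (Suc k) = 2 * fl x k")
      case True
      then have "p x (Suc k) = p x k" by (simp add: p_def)
      then show ?thesis using D q by simp
    next
      case False
      then have e': "p x (Suc k) = real (Suc (2 * fl x k)) / 2 ^ Suc k" using cases by (simp add: p_def)
      have "x * 2 ^ k \<le> T * 2 ^ k" using x by (intro mult_right_mono) auto
      moreover have "real (2 * fl x k) = 2 * real (fl x k)" "T * 2 ^ Suc k = 2 * (T * 2 ^ k)" by simp_all
      ultimately have "real (2 * fl x k) \<le> T * 2 ^ Suc k" using a(1) by linarith
      then show ?thesis unfolding e e' by (rule inc)
    qed
  qed
  have app: "\<bar>f x - f (p x k)\<bar> \<le> D * q ^ k / (1 - q)" if x: "0 \<le> x" "x \<le> T" for x k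
  proof -
    have bound: "\<bar>f (p x (k + m)) - f (p x k)\<bar> \<le> D * q ^ k / (1 - q) * (1 - q ^ m)" for m
    proof (induction m)
      case (Suc m)
      have "\<bar>f (p x (k + Suc m)) - f (p x k)\<bar> \<le> \<bar>f (p x (k + Suc m)) - f (p x (k + m))\<bar> + \<bar>f (p x (k + m)) - f (p x k)\<bar>" by simp
      also have "\<dots> \<le> D * q ^ Suc (k + m) + D * q ^ k / (1 - q) * (1 - q ^ m)"
        using step[OF x, of "k + m"] Suc by simp
      \<comment> \<open>The exponent is lowered by one so that the partial sum takes the closed form
        of a geometric series.\<close>
      also have "D * q ^ Suc (k + m) \<le> D * q ^ (k + m)"
        using q D by (intro mult_left_mono power_decreasing) auto
      also have "D * q ^ (k + m) + D * q ^ k / (1 - q) * (1 - q ^ m) = D * q ^ k / (1 - q) * (1 - q ^ Suc m)"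
        using q by (simp add: field_simps power_add)
      finally show ?case by simp
    qed simp
    have "(\<lambda>m. p x (k + m)) \<longlonglongrightarrow> x"
    proof (rule tendsto_sandwich)
      have pb: "x - (1 / 2) ^ m \<le> p x m \<and> p x m \<le> x" for m
      proof -
        have "x \<le> (real (fl x m) + 1) / 2 ^ m" using fl(2)[OF x(1), of m] by (simp add: le_divide_eq)
        then show ?thesis using fl(1)[OF x(1), of m]
          by (simp add: p_def divide_le_eq add_divide_distrib power_one_over)
      qed
      show "\<forall>\<^sub>F m in sequentially. x - (1 / 2) ^ (k + m) \<le> p x (k + m)" using pb by simp
      show "\<forall>\<^sub>F m in sequentially. p x (k + m) \<le> x" using pb by simp
      have "(\<lambda>m. x - (1 / 2) ^ k * (1 / 2) ^ m) \<longlonglongrightarrow> x - (1 / 2) ^ k * 0"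
        by (intro tendsto_intros LIMSEQ_power_zero) auto
      then show "(\<lambda>m. x - (1 / 2) ^ (k + m)) \<longlonglongrightarrow> x" by (simp add: power_add)
    qed simp
    then have "(\<lambda>m. f (p x (k + m))) \<longlonglongrightarrow> f x"
      by (rule continuous_on_tendsto_compose[OF cont]) (use x in \<open>auto simp: p_def\<close>)
    then have "(\<lambda>m. \<bar>f (p x (k + m)) - f (p x k)\<bar>) \<longlonglongrightarrow> \<bar>f x - f (p x k)\<bar>" by (intro tendsto_intros)
    then show ?thesis
    proof (rule LIMSEQ_le_const2)
      have "D * q ^ k / (1 - q) * (1 - q ^ m) \<le> D * q ^ k / (1 - q) * 1" for m
        using D q by (intro mult_left_mono) auto
      then show "\<exists>n0. \<forall>n\<ge>n0. \<bar>f (p x (k + n)) - f (p x k)\<bar> \<le> D * q ^ k / (1 - q)"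
        using bound order_trans by (metis mult.right_neutral)
    qed
  qed
  have t0: "0 \<le> t" "s \<le> T" using s st t by auto
  have mid: "\<bar>f (p s k) - f (p t k)\<bar> \<le> D * q ^ k"
  proof -
    have "t * 2 ^ k - s * 2 ^ k \<le> 1" using close by (simp add: field_simps)
    moreover have "s * 2 ^ k \<le> t * 2 ^ k" using st by simp
    ultimately have "real (fl t k) < real (fl s k + 2)" "real (fl s k) < real (fl t k + 1)"
      using fl[OF s, of k] fl[OF t0(1), of k] unfolding of_nat_add of_nat_numeral of_nat_1 by linarith+
    then have cases: "fl t k = fl s k \<or> fl t k = Suc (fl s k)" unfolding of_nat_less_iff by linarith
    show ?thesis
    proof (cases "fl t k = fl s k")
      case True
      then show ?thesis using D q by (simp add: p_def)
    next
      case False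
      then have e: "fl t k = Suc (fl s k)" using cases by simp
      have "s * 2 ^ k \<le> T * 2 ^ k" using t0 by (intro mult_right_mono) auto
      then have "\<bar>f (real (Suc (fl s k)) / 2 ^ k) - f (real (fl s k) / 2 ^ k)\<bar> \<le> D * q ^ k"
        using fl(1)[OF s, of k] by (intro inc) linarith
      then show ?thesis unfolding p_def e by (simp add: abs_minus_commute)
    qed
  qed
  have "\<bar>f s - f t\<bar> \<le> \<bar>f s - f (p s k)\<bar> + \<bar>f (p s k) - f (p t k)\<bar> + \<bar>f t - f (p t k)\<bar>" by arith
  also have "\<dots> \<le> D * q ^ k / (1 - q) + D * q ^ k + D * q ^ k / (1 - q)"
    by (intro add_mono app mid s t0 t)
  also have "\<dots> = D * q ^ k * (1 + 2 / (1 - q))" by (simp add: algebra_simps)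
  finally show ?thesis .
qed

lemma summable_inverse_Suc_sq: "summable (\<lambda>j. 1 / (real (Suc j))\<^sup>2)"
  using summable_Suc_iff[of "\<lambda>n. inverse (real n ^ 2)"] inverse_power_summable[of 2, where 'a=real]
  by (simp add: inverse_eq_divide)

lemma ennreal_suminf_ge: "f i \<le> (\<Sum>i. f i :: ennreal)"
  using sum_le_suminf[of f "{i}"] by simp

text \<open>The sum of all terms has finite expectation, so it is almost surely finite and bounds
  every single term. This replaces Borel-Cantelli and yields one random constant for all
  indices.\<close>

lemma (in prob_space) AE_double_series_bound:
  fixes Y :: "nat \<Rightarrow> nat \<Rightarrow> 'a \<Rightarrow> real"
  assumes int: "\<And>k j. integrable M (Y k j)" and nn: "\<And>k j \<omega>. 0 \<le> Y k j \<omega>"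
    and bnd: "\<And>k j. expectation (Y k j) \<le> a k * b j"
    and a: "summable a" "\<And>k. 0 \<le> a k" and b: "summable b" "\<And>j. 0 \<le> b j"
  shows "AE \<omega> in M. \<exists>S\<ge>0. \<forall>k j. Y k j \<omega> \<le> S"
proof -
  have [measurable]: "Y k j \<in> borel_measurable M" for k j using int by auto
  have "(\<integral>\<^sup>+\<omega>. (\<Sum>k. \<Sum>j. ennreal (Y k j \<omega>)) \<partial>M) = (\<Sum>k. \<Sum>j. \<integral>\<^sup>+\<omega>. ennreal (Y k j \<omega>) \<partial>M)"
    by (simp add: nn_integral_suminf)
  also have "\<dots> = (\<Sum>k. \<Sum>j. ennreal (expectation (Y k j)))"
    by (simp add: nn_integral_eq_integral int nn)
  also have "\<dots> \<le> (\<Sum>k. \<Sum>j. ennreal (a k * b j))"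
    by (intro suminf_le summableI ennreal_leI bnd)
  also have "\<dots> = (\<Sum>k. ennreal (a k * (\<Sum>j. b j)))"
    using a b by (intro suminf_cong) (subst suminf_ennreal2, auto intro: summable_mult simp: suminf_mult)
  also have "\<dots> = ennreal (\<Sum>k. a k * (\<Sum>j. b j))"
    using a b by (intro suminf_ennreal2) (auto intro: summable_mult2 suminf_nonneg mult_nonneg_nonneg)
  also have "\<dots> < \<infinity>" by simp
  finally have "AE \<omega> in M. (\<Sum>k. \<Sum>j. ennreal (Y k j \<omega>)) \<noteq> \<infinity>"
    by (intro nn_integral_noteq_infinite) auto
  then show ?thesis
  proof eventually_elim
    case (elim \<omega>)
    let ?S = "\<Sum>k. \<Sum>j. ennreal (Y k j \<omega>)"
    have "Y k j \<omega> \<le> enn2real ?S" for k j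
    proof -
      have "ennreal (Y k j \<omega>) \<le> (\<Sum>j. ennreal (Y k j \<omega>))" by (rule ennreal_suminf_ge)
      also have "\<dots> \<le> ?S" by (rule ennreal_suminf_ge)
      finally have "enn2real (ennreal (Y k j \<omega>)) \<le> enn2real ?S"
        using elim by (intro enn2real_mono) (auto simp: less_top)
      then show ?thesis using nn by simp
    qed
    then show ?case by (intro exI[of _ "enn2real ?S"]) auto
  qed
qed

lemma (in prob_space) AE_series_bound:
  fixes Y :: "nat \<Rightarrow> 'a \<Rightarrow> real"
  assumes int: "\<And>j. integrable M (Y j)" and nn: "\<And>j \<omega>. 0 \<le> Y j \<omega>"
    and bnd: "\<And>j. expectation (Y j) \<le> b j"
    and b: "summable b" "\<And>j. 0 \<le> b j"
  shows "AE \<omega> in M. \<exists>S\<ge>0. \<forall>j. Y j \<omega> \<le> S"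
proof -
  \<comment> \<open>A single series becomes a double one by geometric weights; the claim is its row
    \<open>k = 0\<close>.\<close>
  have "AE \<omega> in M. \<exists>S\<ge>0. \<forall>k j. (1 / 2) ^ k * Y j \<omega> \<le> S"
  proof (rule AE_double_series_bound[OF _ _ _ _ _ b])
    show "expectation (\<lambda>\<omega>. (1 / 2) ^ k * Y j \<omega>) \<le> (1 / 2) ^ k * b j" for k j
      using bnd by (simp add: divide_right_mono)
    show "summable (\<lambda>k::nat. (1 / 2 :: real) ^ k)" by (intro summable_geometric) simp
  qed (use int nn in auto)
  then show ?thesis
  proof eventually_elim
    case (elim \<omega>)
    then obtain S where S: "S \<ge> 0" "\<And>k j. (1 / 2) ^ k * Y j \<omega> \<le> S" by blast
    then show ?case using S(2)[of 0] by auto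
  qed
qed

section \<open>Growth and Hoelder bounds for the paths of the process\<close>

context fou
begin

lemma X_increment_moment:
  assumes s: "0 \<le> s" and st: "s \<le> t"
  shows "expectation (\<lambda>\<omega>. (X t \<omega> - X s \<omega>) ^ 32) \<le> normal_moment 32 * ((kc * kernel_norm + \<theta> * stat_cov 0) * (t - s)) ^ 16"
proof -
  have t: "0 \<le> t" using s st by simp
  have m: "all_moments (X s)" "all_moments (X t)" using s t X_span all_moments_V by auto
  have Z: "(\<lambda>\<omega>. X t \<omega> - X s \<omega>) \<in> lin_span {0..} X" by (intro lin_span_diff X_span s t)
  have "expectation (\<lambda>\<omega>. (X t \<omega> - X s \<omega>)\<^sup>2) = expectation (\<lambda>\<omega>. X t \<omega> * X t \<omega> + X s \<omega> * X s \<omega> - 2 * (X s \<omega> * X t \<omega>))"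
    by (simp add: power2_eq_square algebra_simps)
  also have "\<dots> = R t t + R s s - 2 * R s t"
    using m by (simp add: cov_X[OF s s, symmetric] cov_X[OF t t, symmetric] cov_X[OF s t, symmetric] cov_def all_moments_integrable all_moments_mult)
  also have "\<dots> \<le> (kc * kernel_norm + \<theta> * stat_cov 0) * (t - s)" by (rule R_increment[OF s st])
  finally have v: "expectation (\<lambda>\<omega>. (X t \<omega> - X s \<omega>)\<^sup>2) \<le> (kc * kernel_norm + \<theta> * stat_cov 0) * (t - s)" .
  have "expectation (\<lambda>\<omega>. (X t \<omega> - X s \<omega>) ^ 32) = normal_moment 32 * expectation (\<lambda>\<omega>. (X t \<omega> - X s \<omega>)\<^sup>2) ^ 16"
    using moment[OF Z, of 32] by simp
  also have "\<dots> \<le> normal_moment 32 * ((kc * kernel_norm + \<theta> * stat_cov 0) * (t - s)) ^ 16"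
    by (intro mult_left_mono power_mono v integral_nonneg_AE) (auto simp: normal_moment_def)
  finally show ?thesis .
qed

text \<open>The moment of order 32 is of order 2^(-16 k). The weight 256^k uses up half of this
  decay and leaves 2^(-8 k) for the sum over levels, while the inverse square makes the sum over
  positions converge.\<close>

lemma AE_dyadic_increments:
  "AE \<omega> in M. \<exists>S\<ge>0. \<forall>k j. (X (real (Suc j) / 2 ^ k) \<omega> - X (real j / 2 ^ k) \<omega>) ^ 32 * (256 ^ k / (real (Suc j))\<^sup>2) \<le> S"
proof (rule AE_double_series_bound)
  let ?C = "normal_moment 32 * (kc * kernel_norm + \<theta> * stat_cov 0) ^ 16"
  have C: "0 \<le> ?C" using kernel_const_pos kernel_norm_pos \<theta>_pos stat_cov_0_pos by (simp add: normal_moment_def)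
  show "integrable M (\<lambda>\<omega>. (X (real (Suc j) / 2 ^ k) \<omega> - X (real j / 2 ^ k) \<omega>) ^ 32 * (256 ^ k / (real (Suc j))\<^sup>2))" for k j
    by (intro all_moments_integrable all_moments_intros all_moments_V X_span) auto
  show "0 \<le> (X (real (Suc j) / 2 ^ k) \<omega> - X (real j / 2 ^ k) \<omega>) ^ 32 * (256 ^ k / (real (Suc j))\<^sup>2)" for k j \<omega>
    by (simp add: zero_le_even_power)
  show "expectation (\<lambda>\<omega>. (X (real (Suc j) / 2 ^ k) \<omega> - X (real j / 2 ^ k) \<omega>) ^ 32 * (256 ^ k / (real (Suc j))\<^sup>2)) \<le>
    ?C * (1 / 256) ^ k * (1 / (real (Suc j))\<^sup>2)" for k j
  proof -
    have d: "real (Suc j) / 2 ^ k - real j / 2 ^ k = 1 / 2 ^ k" by (simp add: diff_divide_distrib[symmetric])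
    have "expectation (\<lambda>\<omega>. (X (real (Suc j) / 2 ^ k) \<omega> - X (real j / 2 ^ k) \<omega>) ^ 32) \<le> normal_moment 32 * ((kc * kernel_norm + \<theta> * stat_cov 0) * (1 / 2 ^ k)) ^ 16"
      using X_increment_moment[of "real j / 2 ^ k" "real (Suc j) / 2 ^ k"] unfolding d
      by (simp add: divide_right_mono)
    also have "\<dots> = ?C * (1 / 65536) ^ k"
    proof -
      have "((1::real) / 2 ^ k) ^ 16 = (1 / 65536) ^ k"
        by (simp add: power_divide power_mult[symmetric] mult.commute[of k] power_mult[of 2 16 k])
      then show ?thesis by (simp only: power_mult_distrib mult.assoc)
    qed
    finally have "expectation (\<lambda>\<omega>. (X (real (Suc j) / 2 ^ k) \<omega> - X (real j / 2 ^ k) \<omega>) ^ 32) * (256 ^ k / (real (Suc j))\<^sup>2) \<le>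
        ?C * (1 / 65536) ^ k * (256 ^ k / (real (Suc j))\<^sup>2)" by (rule mult_right_mono) simp
    also have "\<dots> = ?C * ((1 / 65536) ^ k * 256 ^ k) * (1 / (real (Suc j))\<^sup>2)" by simp
    also have "(1 / 65536) ^ k * 256 ^ k = (1 / 256 :: real) ^ k" by (simp add: power_mult_distrib[symmetric])
    finally show ?thesis by simp
  qed
  show "summable (\<lambda>k. ?C * (1 / 256) ^ k)" by (intro summable_mult summable_geometric) simp
  show "summable (\<lambda>j. 1 / (real (Suc j))\<^sup>2)" by (rule summable_inverse_Suc_sq)
qed (use kernel_const_pos kernel_norm_pos \<theta>_pos stat_cov_0_pos in \<open>auto simp: normal_moment_def\<close>)

text \<open>Chaining controls differences only; the values at integers anchor the path.\<close>

lemma AE_integer_values: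
  "AE \<omega> in M. \<exists>S\<ge>0. \<forall>j. (X (real j) \<omega>) ^ 32 * (1 / (real (Suc j))\<^sup>2) \<le> S"
proof (rule AE_series_bound)
  let ?C = "normal_moment 32 * decay_const ^ 16"
  show "integrable M (\<lambda>\<omega>. (X (real j) \<omega>) ^ 32 * (1 / (real (Suc j))\<^sup>2))" for j
    by (intro all_moments_integrable all_moments_intros all_moments_V X_span) auto
  show "0 \<le> (X (real j) \<omega>) ^ 32 * (1 / (real (Suc j))\<^sup>2)" for j \<omega>
    by (simp add: zero_le_even_power)
  show "expectation (\<lambda>\<omega>. (X (real j) \<omega>) ^ 32 * (1 / (real (Suc j))\<^sup>2)) \<le> ?C * (1 / (real (Suc j))\<^sup>2)" for j
  proof -
    have "expectation (\<lambda>\<omega>. X (real j) \<omega> ^ 32) = normal_moment 32 * expectation (\<lambda>\<omega>. (X (real j) \<omega>)\<^sup>2) ^ 16"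
      using moment[OF X_span[of "real j"], of 32] by simp
    also have "expectation (\<lambda>\<omega>. (X (real j) \<omega>)\<^sup>2) = R (real j) (real j)"
      using cov_X[of "real j" "real j"] by (simp add: cov_def power2_eq_square)
    also have "normal_moment 32 * R (real j) (real j) ^ 16 \<le> ?C"
      using R_eq_cov_region(2)[of "real j" "real j"] R_le_decay_const[of "real j" "real j"]
      by (intro mult_left_mono power_mono) (auto simp: normal_moment_def)
    finally show ?thesis by (simp add: divide_right_mono mult_left_mono)
  qed
  show "summable (\<lambda>j. ?C * (1 / (real (Suc j))\<^sup>2))" by (intro summable_mult summable_inverse_Suc_sq)
qed (use decay_const_nonneg in \<open>auto simp: normal_moment_def\<close>)

end

lemma abs_le_root_of_even_power:
  fixes x y :: real
  assumes "x ^ n \<le> y" "even n" "0 < n"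
  shows "\<bar>x\<bar> \<le> root n y"
proof -
  have "root n (\<bar>x\<bar> ^ n) \<le> root n y" using assms by (simp add: power_even_abs)
  then show ?thesis using assms by (simp add: real_root_power_cancel)
qed

context fou
begin

text \<open>The dyadic bound gives $|X_{(j+1)2^{-k}} - X_{j2^{-k}}| = O((1+j)^{1/16}\, 2^{-k/4})$. For
  $j \le T 2^k$ this is $O((1+T)^{1/16}\, 2^{-3k/16})$, whence the exponents $3/16$ and, after
  multiplication by $|X_s + X_t|$, $1/8$.\<close>

definition holder_growth :: "'a \<Rightarrow> real \<Rightarrow> bool" where
  "holder_growth \<omega> C \<longleftrightarrow> 0 \<le> C \<and>
     (\<forall>T\<ge>1. \<forall>t. 0 \<le> t \<and> t \<le> T \<longrightarrow> (X t \<omega>)\<^sup>2 \<le> C * (1 + T) powr (1 / 8)) \<and>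
     (\<forall>T\<ge>1. \<forall>d s t. 0 < d \<and> d \<le> 1 \<and> 0 \<le> s \<and> s \<le> t \<and> t \<le> T \<and> t - s \<le> d \<longrightarrow>
        \<bar>(X s \<omega>)\<^sup>2 - (X t \<omega>)\<^sup>2\<bar> \<le> C * (1 + T) powr (1 / 8) * d powr (3 / 16))"

lemma AE_holder_growth: "AE \<omega> in M. \<exists>C. holder_growth \<omega> C"
  using AE_dyadic_increments AE_integer_values AE_space
proof eventually_elim
  case (elim \<omega>)
  obtain S where S: "S \<ge> 0" "\<And>k j. (X (real (Suc j) / 2 ^ k) \<omega> - X (real j / 2 ^ k) \<omega>) ^ 32 * (256 ^ k / (real (Suc j))\<^sup>2) \<le> S"
    using elim(1) by blast
  obtain S' where S': "S' \<ge> 0" "\<And>j. (X (real j) \<omega>) ^ 32 * (1 / (real (Suc j))\<^sup>2) \<le> S'"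
    using elim(2) by blast
  have cont: "continuous_on {0..} (\<lambda>t. X t \<omega>)" by (rule continuous_on_X[OF elim(3)])
  \<comment> \<open>For j <= T 2^k the weight gives (j+1)^2 / 256^k <= (1+T)^2 (4 / 256)^k, and 4 /
    256 is 1 / 64. Taking roots of order 32 produces \<open>q\<close> and the exponent 1/16 of 1 +
    T.\<close>
  define q where "q = root 32 (1 / 64 :: real)"
  have q: "0 < q" "q < 1" by (auto simp: q_def)
  have q_powr: "q = 2 powr (- 3 / 16)"
  proof -
    have "(64::real) = 2 powr 6" by (simp add: powr_numeral)
    then have "64 powr (1 / 32) = (2 powr (3 / 16) :: real)" by (simp only: powr_powr) simp
    then show ?thesis by (simp add: q_def root_powr_inverse powr_divide powr_minus_divide)
  qed
  define c where "c = 1 + 2 / (1 - q)"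
  have c: "1 \<le> c" using q by (simp add: c_def)
  define D where "D T = root 32 S * (1 + T) powr (1 / 16)" for T
  have root_sq: "root 32 (x * y\<^sup>2) = root 32 x * y powr (1 / 16)" if "0 < y" for x y
  proof -
    have "root 32 (y\<^sup>2) = (y powr 2) powr (1 / 32)"
      using that by (simp add: root_powr_inverse powr_numeral)
    also have "\<dots> = y powr (1 / 16)" by (simp add: powr_powr)
    finally show ?thesis by (simp add: real_root_mult)
  qed
  have D0: "0 \<le> D T" if "0 \<le> T" for T using S that by (simp add: D_def)
  have inc: "\<bar>X (real (Suc j) / 2 ^ k) \<omega> - X (real j / 2 ^ k) \<omega>\<bar> \<le> D T * q ^ k"
    if T: "0 \<le> T" and j: "real j \<le> T * 2 ^ k" for T k j
  proof -
    let ?x = "X (real (Suc j) / 2 ^ k) \<omega> - X (real j / 2 ^ k) \<omega>"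
    have "(1::real) \<le> 2 ^ k" by simp
    then have jj: "real (Suc j) \<le> (1 + T) * 2 ^ k" using j unfolding distrib_right mult_1 of_nat_Suc by linarith
    have "?x ^ 32 * 256 ^ k \<le> S * (real (Suc j))\<^sup>2" using S(2)[of j k] by (simp add: divide_le_eq del: of_nat_Suc)
    also have "\<dots> \<le> S * ((1 + T) * 2 ^ k)\<^sup>2" using jj S by (intro mult_left_mono power_mono) auto
    also have "\<dots> = S * (1 + T)\<^sup>2 * (1 / 64) ^ k * 256 ^ k"
    proof -
      have "((1 / 64) ^ k * 256 ^ k :: real) = 4 ^ k" by (simp add: power_mult_distrib[symmetric])
      moreover have "((2::real) ^ k)\<^sup>2 = 4 ^ k" by (simp add: power2_eq_square power_mult_distrib[symmetric])
      ultimately show ?thesis by (simp only: power_mult_distrib mult.assoc)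
    qed
    finally have "?x ^ 32 \<le> S * (1 + T)\<^sup>2 * (1 / 64) ^ k" by (simp only: mult_le_cancel_right) simp
    then have "\<bar>?x\<bar> \<le> root 32 (S * (1 + T)\<^sup>2 * (1 / 64) ^ k)" by (rule abs_le_root_of_even_power) auto
    also have "\<dots> = D T * q ^ k"
    proof -
      have "root 32 ((1 / 64) ^ k) = q ^ k" unfolding q_def by (rule real_root_power) simp
      then show ?thesis
        using T root_sq[of "1 + T" S] real_root_mult[of 32 "S * (1 + T)\<^sup>2" "(1 / 64) ^ k"] by (simp add: D_def)
    qed
    finally show ?thesis .
  qed
  have chain: "\<bar>X s \<omega> - X t \<omega>\<bar> \<le> D T * q ^ k * c"
    if "0 \<le> s" "s \<le> t" "t \<le> T" "t - s \<le> 1 / 2 ^ k" for s t T k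
    unfolding c_def using that by (intro dyadic_chaining[OF cont D0 q inc]) auto
  have intv: "\<bar>X (real j) \<omega>\<bar> \<le> root 32 S' * (1 + real j) powr (1 / 16)" for j
  proof -
    have "X (real j) \<omega> ^ 32 \<le> S' * (1 + real j)\<^sup>2" using S'(2)[of j] by (simp add: divide_le_eq)
    then have "\<bar>X (real j) \<omega>\<bar> \<le> root 32 (S' * (1 + real j)\<^sup>2)" by (rule abs_le_root_of_even_power) auto
    then show ?thesis using root_sq[of "1 + real j" S'] by simp
  qed
  define K where "K = root 32 S' + root 32 S * c"
  have K: "0 \<le> K" using S S' c by (simp add: K_def)
  have val: "\<bar>X t \<omega>\<bar> \<le> K * (1 + T) powr (1 / 16)" if t: "0 \<le> t" "t \<le> T" for t T
  proof -
    \<comment> \<open>The value at \<open>t\<close> is reached from the integer below it by chaining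
      at level 0.\<close>
    define j where "j = nat \<lfloor>t\<rfloor>"
    have j: "real j \<le> t" "t - real j \<le> 1" unfolding j_def using t by linarith+
    have "\<bar>X t \<omega>\<bar> \<le> \<bar>X (real j) \<omega>\<bar> + \<bar>X (real j) \<omega> - X t \<omega>\<bar>" by arith
    also have "\<bar>X (real j) \<omega>\<bar> \<le> root 32 S' * (1 + T) powr (1 / 16)"
      using j t S' by (intro order_trans[OF intv] mult_left_mono powr_mono2) auto
    also have "\<bar>X (real j) \<omega> - X t \<omega>\<bar> \<le> D T * q ^ 0 * c" by (rule chain) (use j t in auto)
    finally show ?thesis by (simp add: K_def D_def algebra_simps)
  qed
  have powr_sq: "(1 + T) powr (1 / 16) * (1 + T) powr (1 / 16) = (1 + T) powr (1 / 8)" for T :: real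
    by (simp add: powr_add[symmetric])
  have lip: "\<bar>X s \<omega> - X t \<omega>\<bar> \<le> 2 * c * root 32 S * (1 + T) powr (1 / 16) * d powr (3 / 16)"
    if d: "0 < d" "d \<le> 1" and st: "0 \<le> s" "s \<le> t" "t \<le> T" "t - s \<le> d" for d s t T
  proof -
    obtain n where n: "(1 / 2) ^ n < d" using d(1) real_arch_pow_inv[of d "1/2"] by auto
    \<comment> \<open>The dyadic scale just above \<open>d\<close>: with \<open>n0 = Suc k\<close>,
      \<open>1 / 2 ^ k\<close> lies between \<open>d\<close> and \<open>2 * d\<close>. As
      \<open>d\<close> is at most 1, \<open>n0\<close> is not 0.\<close>
    define n0 where "n0 = (LEAST n. (1 / 2) ^ n < d)"
    have n0: "(1 / 2) ^ n0 < d" unfolding n0_def by (rule LeastI[of "\<lambda>n. (1/2) ^ n < d", OF n])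
    have "n0 \<noteq> 0" using n0 d(2) by (cases n0) auto
    then obtain k where k: "n0 = Suc k" by (cases n0) auto
    have "\<not> (1 / 2) ^ k < d" using not_less_Least[of k "\<lambda>n. (1 / 2) ^ n < d"] k by (simp add: n0_def)
    then have dk: "d \<le> 1 / 2 ^ k" by (simp add: power_one_over)
    have "q ^ k = (1 / 2 ^ k) powr (3 / 16)"
    proof -
      have "q ^ k = 2 powr (- 3 / 16 * real k)" unfolding q_powr by (simp add: powr_realpow[symmetric] powr_powr)
      moreover have "(1 / 2 ^ k) powr (3 / 16) = (2 powr (- real k)) powr (3 / 16 :: real)"
        by (simp add: powr_minus_divide powr_realpow)
      ultimately show ?thesis by (simp add: powr_powr mult.commute)
    qed
    also have "1 / 2 ^ k \<le> 2 * d" using n0 unfolding k by (simp add: power_one_over)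
    then have "(1 / 2 ^ k) powr (3 / 16) \<le> (2 * d) powr (3 / 16)" by (intro powr_mono2) auto
    also have "(2 * d) powr (3 / 16) = 2 powr (3 / 16) * d powr (3 / 16)" using d by (simp add: powr_mult)
    also have "\<dots> \<le> 2 powr 1 * d powr (3 / 16)" by (intro mult_right_mono powr_mono) auto
    finally have qk: "q ^ k \<le> 2 * d powr (3 / 16)" by simp
    have T: "0 \<le> T" using st by simp
    have "\<bar>X s \<omega> - X t \<omega>\<bar> \<le> D T * q ^ k * c" by (rule chain) (use st dk in auto)
    also have "\<dots> \<le> D T * (2 * d powr (3 / 16)) * c"
      using qk c D0[OF T] by (intro mult_right_mono mult_left_mono) auto
    finally show ?thesis by (simp add: D_def mult_ac)
  qed
  \<comment> \<open>The first summand serves the bound on squares, the second the bound on their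
    differences; its 4 is the 2 of \<open>lip\<close> times the 2 from bounding the sum of two
    values.\<close>
  define C where "C = K\<^sup>2 + 4 * c * root 32 S * K"
  have C: "0 \<le> C" using K c S by (simp add: C_def)
  have "holder_growth \<omega> C" unfolding holder_growth_def
  proof (intro conjI allI impI C)
    fix T t :: real assume T: "1 \<le> T" and t: "0 \<le> t \<and> t \<le> T"
    have "(X t \<omega>)\<^sup>2 = \<bar>X t \<omega>\<bar> * \<bar>X t \<omega>\<bar>" by (simp add: power2_eq_square)
    also have "\<dots> \<le> (K * (1 + T) powr (1 / 16)) * (K * (1 + T) powr (1 / 16))"
      using val[of t T] t K by (intro mult_mono) auto
    also have "\<dots> = K\<^sup>2 * (1 + T) powr (1 / 8)" unfolding powr_sq[symmetric] by (simp add: power2_eq_square mult_ac)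
    also have "\<dots> \<le> C * (1 + T) powr (1 / 8)" using K c S by (intro mult_right_mono) (auto simp: C_def)
    finally show "(X t \<omega>)\<^sup>2 \<le> C * (1 + T) powr (1 / 8)" .
  next
    fix T d s t :: real assume T: "1 \<le> T" and a: "0 < d \<and> d \<le> 1 \<and> 0 \<le> s \<and> s \<le> t \<and> t \<le> T \<and> t - s \<le> d"
    have "\<bar>(X s \<omega>)\<^sup>2 - (X t \<omega>)\<^sup>2\<bar> = \<bar>X s \<omega> - X t \<omega>\<bar> * \<bar>X s \<omega> + X t \<omega>\<bar>"
      by (simp add: abs_mult[symmetric] power2_eq_square algebra_simps)
    also have "\<dots> \<le> (2 * c * root 32 S * (1 + T) powr (1 / 16) * d powr (3 / 16)) * (2 * (K * (1 + T) powr (1 / 16)))"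
    proof (rule mult_mono)
      show "\<bar>X s \<omega> - X t \<omega>\<bar> \<le> 2 * c * root 32 S * (1 + T) powr (1 / 16) * d powr (3 / 16)" by (rule lip) (use a in auto)
      have "\<bar>X s \<omega> + X t \<omega>\<bar> \<le> \<bar>X s \<omega>\<bar> + \<bar>X t \<omega>\<bar>" by (rule abs_triangle_ineq)
      also have "\<dots> \<le> K * (1 + T) powr (1 / 16) + K * (1 + T) powr (1 / 16)"
        using a by (intro add_mono val) auto
      finally show "\<bar>X s \<omega> + X t \<omega>\<bar> \<le> 2 * (K * (1 + T) powr (1 / 16))" by simp
    qed (use c S in auto)
    also have "\<dots> = (4 * c * root 32 S * K) * ((1 + T) powr (1 / 16) * (1 + T) powr (1 / 16)) * d powr (3 / 16)"
      by (simp add: mult_ac)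
    also have "\<dots> \<le> C * (1 + T) powr (1 / 8) * d powr (3 / 16)"
      unfolding powr_sq by (intro mult_right_mono) (auto simp: C_def)
    finally show "\<bar>(X s \<omega>)\<^sup>2 - (X t \<omega>)\<^sup>2\<bar> \<le> C * (1 + T) powr (1 / 8) * d powr (3 / 16)" .
  qed
  then show ?case by blast
qed

end

section \<open>Almost sure convergence of the empirical second moment\<close>

text \<open>Cell by cell, the integral is compared with the value at the right endpoint.\<close>

lemma riemann_sum_error:
  fixes g :: "real \<Rightarrow> real"
  assumes cont: "continuous_on {0..} g" and h: "0 < h"
    and osc: "\<And>s t. 0 \<le> s \<Longrightarrow> s \<le> t \<Longrightarrow> t \<le> real N * h \<Longrightarrow> t - s \<le> h \<Longrightarrow> \<bar>g s - g t\<bar> \<le> e"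
  shows "\<bar>h * (\<Sum>k=1..N. g (real k * h)) - integral {0..real N * h} g\<bar> \<le> real N * (h * e)"
proof -
  have int: "g integrable_on {a..b}" if "0 \<le> a" for a b
    by (intro integrable_continuous_interval continuous_on_subset[OF cont]) (use that in auto)
  have "n \<le> N \<Longrightarrow> \<bar>h * (\<Sum>k=1..n. g (real k * h)) - integral {0..real n * h} g\<bar> \<le> real n * (h * e)" for n
  proof (induction n)
    case (Suc n)
    let ?a = "real n * h" and ?b = "real (Suc n) * h"
    have ab: "0 \<le> ?a" "?a \<le> ?b" "?b - ?a = h" using h by (auto simp: algebra_simps)
    have bN: "?b \<le> real N * h" using Suc.prems h by (intro mult_right_mono) auto
    have "integral {0..?b} g = integral {0..?a} g + integral {?a..?b} g"
      using ab by (intro Henstock_Kurzweil_Integration.integral_combine[symmetric] int) auto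
    moreover have "\<bar>integral {?a..?b} g - h * g ?b\<bar> \<le> h * e"
    proof -
      have "((\<lambda>x. g x - g ?b) has_integral (integral {?a..?b} g - h * g ?b)) (cbox ?a ?b)"
        using has_integral_diff[OF integrable_integral[OF int[OF ab(1), of ?b]] has_integral_const_real[of "g ?b" ?a ?b]] ab
        by simp
      then have "norm (integral {?a..?b} g - h * g ?b) \<le> e * measure lborel (cbox ?a ?b)"
      proof (rule has_integral_bound[rotated])
        show "0 \<le> e" using osc[of 0 0] h by auto
        fix x assume "x \<in> cbox ?a ?b"
        then show "norm (g x - g ?b) \<le> e" using osc[of x ?b] ab bN by auto
      qed
      also have "measure lborel (cbox ?a ?b) = h" using ab by simp
      finally show ?thesis by (simp add: mult.commute)
    qed
    moreover have "h * (\<Sum>k=1..Suc n. g (real k * h)) = h * (\<Sum>k=1..n. g (real k * h)) + h * g ?b"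
      by (simp add: distrib_left)
    ultimately show ?case using Suc by (simp add: distrib_right del: of_nat_Suc) (simp add: algebra_simps)
  qed simp
  then show ?thesis by simp
qed

context fou
begin

lemma mu2_hat_fluct:
  assumes N: "N \<ge> 1" and h: "0 < h N"
  shows "\<bar>sqrt (real N * h N) * (mu2_hat X h N \<omega> - stat_cov 0) - fluct (h N) N \<omega>\<bar> \<le> 2 * kc * kernel_norm / \<theta>\<^sup>2 / sqrt (real N * h N)"
proof -
  define Q where "Q = (\<Sum>k=1..N. R (real k * h N) (real k * h N)) - real N * stat_cov 0"
  have s: "0 < sqrt (real N * h N)" using N h by simp
  have "sqrt (real N * h N) * (mu2_hat X h N \<omega> - stat_cov 0) - fluct (h N) N \<omega> = h N / sqrt (real N * h N) * Q"
    unfolding mu2_hat_decomp[OF N, of h, OF h] Q_def by simp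
  then have "\<bar>sqrt (real N * h N) * (mu2_hat X h N \<omega> - stat_cov 0) - fluct (h N) N \<omega>\<bar> = h N * \<bar>Q\<bar> / sqrt (real N * h N)"
    using h s by (simp add: abs_mult)
  also have "\<dots> \<le> 2 * kc * kernel_norm / \<theta>\<^sup>2 / sqrt (real N * h N)"
    using bias_bound[OF h, of N] s unfolding Q_def by (intro divide_right_mono) auto
  finally show ?thesis .
qed

lemma all_moments_fluct: "0 \<le> h \<Longrightarrow> all_moments (fluct h N)"
  unfolding fluct_def by (intro all_moments_quad X_span) auto

text \<open>Horizon \<open>m\<close> and mesh \<open>1 / m\<close>: the horizon grows fast enough
  for fourth moments to be summable, and integer horizons are close enough to each other to reach
  every real one.\<close>

definition ref_mean :: "nat \<Rightarrow> 'a \<Rightarrow> real" where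
  "ref_mean m = mu2_hat X (\<lambda>_. 1 / real m) (m\<^sup>2)"

text \<open>Fourth moments of the fluctuation are bounded, and m^(-3/2) is summable, so the
  fluctuation is almost surely of order m^(3/8), which sqrt m dominates.\<close>

lemma AE_ref_mean: "AE \<omega> in M. (\<lambda>m. ref_mean (Suc m) \<omega>) \<longlonglongrightarrow> stat_cov 0"
proof -
  \<comment> \<open>An interpolating sequence of meshes: at the squares \<open>N = m^2\<close> it
    equals \<open>1 / m\<close>, and \<open>fluct_moments\<close> applies to it as a whole.\<close>
  define h where "h N = 1 / sqrt (real N)" for N :: nat
  have "(\<lambda>N. expectation (\<lambda>\<omega>. fluct (h N) N \<omega> ^ 4)) \<longlonglongrightarrow> normal_moment 4 * asym_var ^ (4 div 2)"
  proof (rule fluct_moments)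
    show "N \<ge> 1 \<Longrightarrow> 0 < h N" for N by (simp add: h_def)
    show "h \<longlonglongrightarrow> 0" unfolding h_def by real_asymp
    show "filterlim (\<lambda>N. real N * h N) at_top sequentially" unfolding h_def by real_asymp
  qed
  then have "Bseq (\<lambda>N. expectation (\<lambda>\<omega>. fluct (h N) N \<omega> ^ 4))" by (rule convergent_imp_Bseq[OF convergentI])
  then obtain K where K: "0 < K" "\<And>N. norm (expectation (\<lambda>\<omega>. fluct (h N) N \<omega> ^ 4)) \<le> K"
    by (auto simp: Bseq_def)
  have hm: "h ((Suc m)\<^sup>2) = 1 / real (Suc m)" for m by (simp add: h_def del: of_nat_Suc)
  have "AE \<omega> in M. \<exists>S\<ge>0. \<forall>m. fluct (1 / real (Suc m)) ((Suc m)\<^sup>2) \<omega> ^ 4 * (1 / real (Suc m) powr (3 / 2)) \<le> S"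
  proof (rule AE_series_bound)
    show "integrable M (\<lambda>\<omega>. fluct (1 / real (Suc m)) ((Suc m)\<^sup>2) \<omega> ^ 4 * (1 / real (Suc m) powr (3 / 2)))" for m
      by (intro all_moments_integrable all_moments_intros all_moments_fluct) simp
    show "0 \<le> fluct (1 / real (Suc m)) ((Suc m)\<^sup>2) \<omega> ^ 4 * (1 / real (Suc m) powr (3 / 2))" for m \<omega>
      by (simp add: zero_le_even_power)
    show "expectation (\<lambda>\<omega>. fluct (1 / real (Suc m)) ((Suc m)\<^sup>2) \<omega> ^ 4 * (1 / real (Suc m) powr (3 / 2))) \<le> K * (1 / real (Suc m) powr (3 / 2))" for m
    proof -
      have "expectation (\<lambda>\<omega>. fluct (1 / real (Suc m)) ((Suc m)\<^sup>2) \<omega> ^ 4) \<le> K"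
        using K(2)[of "(Suc m)\<^sup>2"] unfolding hm by simp
      then show ?thesis unfolding integral_mult_left_zero by (rule mult_right_mono) simp
    qed
    have "summable (\<lambda>m. real m powr (- 3 / 2))" by (simp add: summable_real_powr_iff)
    then have "summable (\<lambda>m. real (Suc m) powr (- 3 / 2))" by (subst summable_Suc_iff)
    then show "summable (\<lambda>m. K * (1 / real (Suc m) powr (3 / 2)))"
      by (intro summable_mult) (simp add: powr_minus_divide)
  qed (use K in simp)
  then show ?thesis
  proof eventually_elim
    case (elim \<omega>)
    then obtain S where S: "S \<ge> 0" "\<And>m. fluct (1 / real (Suc m)) ((Suc m)\<^sup>2) \<omega> ^ 4 * (1 / real (Suc m) powr (3 / 2)) \<le> S" by blast
    let ?C = "2 * kc * kernel_norm / \<theta>\<^sup>2"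
    show ?case
    proof (rule LIM_zero_cancel, rule Lim_null_comparison)
      show "\<forall>\<^sub>F m in sequentially. norm (ref_mean (Suc m) \<omega> - stat_cov 0) \<le> root 4 S * real (Suc m) powr (3 / 8) / sqrt (real (Suc m)) + ?C / real (Suc m)"
      proof (intro always_eventually allI)
        fix m
        let ?n = "real (Suc m)"
        have Nh: "real ((Suc m)\<^sup>2) * (1 / ?n) = ?n"
          unfolding of_nat_power by (simp add: power2_eq_square del: of_nat_Suc)
        have n1: "(Suc m)\<^sup>2 \<ge> 1" by simp
        have "fluct (1 / ?n) ((Suc m)\<^sup>2) \<omega> ^ 4 \<le> S * ?n powr (3 / 2)"
          using S(2)[of m] by (simp add: divide_le_eq del: of_nat_Suc)
        then have "\<bar>fluct (1 / ?n) ((Suc m)\<^sup>2) \<omega>\<bar> \<le> root 4 (S * ?n powr (3 / 2))"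
          by (rule abs_le_root_of_even_power) auto
        also have "\<dots> = root 4 S * ?n powr (3 / 8)"
          by (simp add: real_root_mult root_powr_inverse powr_powr del: of_nat_Suc)
        finally have f: "\<bar>fluct (1 / ?n) ((Suc m)\<^sup>2) \<omega>\<bar> \<le> root 4 S * ?n powr (3 / 8)" .
        have near: "\<bar>sqrt ?n * (ref_mean (Suc m) \<omega> - stat_cov 0) - fluct (1 / ?n) ((Suc m)\<^sup>2) \<omega>\<bar> \<le> ?C / sqrt ?n"
          using mu2_hat_fluct[OF n1, of "\<lambda>_. 1 / ?n" \<omega>] unfolding Nh ref_mean_def by simp
        have "sqrt ?n * \<bar>ref_mean (Suc m) \<omega> - stat_cov 0\<bar> \<le> root 4 S * ?n powr (3 / 8) + ?C / sqrt ?n"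
        proof -
          have "sqrt ?n * \<bar>ref_mean (Suc m) \<omega> - stat_cov 0\<bar> = \<bar>sqrt ?n * (ref_mean (Suc m) \<omega> - stat_cov 0)\<bar>"
            by (simp add: abs_mult)
          then show ?thesis using f near by linarith
        qed
        then have "\<bar>ref_mean (Suc m) \<omega> - stat_cov 0\<bar> \<le> (root 4 S * ?n powr (3 / 8) + ?C / sqrt ?n) / sqrt ?n"
          by (simp add: le_divide_eq mult.commute del: of_nat_Suc)
        also have "\<dots> = root 4 S * ?n powr (3 / 8) / sqrt ?n + ?C / ?n"
          by (simp add: add_divide_distrib del: of_nat_Suc)
        finally show "norm (ref_mean (Suc m) \<omega> - stat_cov 0) \<le> root 4 S * ?n powr (3 / 8) / sqrt ?n + ?C / ?n" by simp
      qed
      show "(\<lambda>m. root 4 S * real (Suc m) powr (3 / 8) / sqrt (real (Suc m)) + ?C / real (Suc m)) \<longlonglongrightarrow> 0"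
      proof -
        have "(\<lambda>m. real (Suc m) powr (3 / 8) / sqrt (real (Suc m))) \<longlonglongrightarrow> 0" by real_asymp
        moreover have "(\<lambda>m. 1 / real (Suc m)) \<longlonglongrightarrow> 0" by real_asymp
        ultimately have "(\<lambda>m. root 4 S * (real (Suc m) powr (3 / 8) / sqrt (real (Suc m))) + ?C * (1 / real (Suc m))) \<longlonglongrightarrow> root 4 S * 0 + ?C * 0"
          by (intro tendsto_intros)
        then show ?thesis by simp
      qed
    qed
  qed
qed

lemma holder_growth_riemann:
  assumes \<omega>: "\<omega> \<in> space M" and C: "holder_growth \<omega> C"
    and N: "N \<ge> 1" and h: "0 < h N" "h N \<le> 1" and T: "1 \<le> real N * h N"
  shows "\<bar>mu2_hat X h N \<omega> - integral {0..real N * h N} (\<lambda>t. (X t \<omega>)\<^sup>2) / (real N * h N)\<bar> \<le> C * (1 + real N * h N) powr (1 / 8) * h N powr (3 / 16)"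
proof -
  let ?T = "real N * h N" and ?g = "\<lambda>t. (X t \<omega>)\<^sup>2"
  let ?e = "C * (1 + ?T) powr (1 / 8) * h N powr (3 / 16)"
  have cont: "continuous_on {0..} ?g" by (intro continuous_intros continuous_on_X \<omega>)
  have "\<bar>h N * (\<Sum>k=1..N. ?g (real k * h N)) - integral {0..?T} ?g\<bar> \<le> real N * (h N * ?e)"
    by (rule riemann_sum_error[OF cont h(1)]) (use C h T in \<open>auto simp: holder_growth_def\<close>)
  then have "\<bar>h N * (\<Sum>k=1..N. ?g (real k * h N)) - integral {0..?T} ?g\<bar> / ?T \<le> ?e"
    using T by (simp add: divide_le_eq mult_ac)
  moreover have "mu2_hat X h N \<omega> - integral {0..?T} ?g / ?T = (h N * (\<Sum>k=1..N. ?g (real k * h N)) - integral {0..?T} ?g) / ?T"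
    unfolding mu2_hat_def sum_distrib_right[symmetric] by (simp add: diff_divide_distrib mult.commute)
  ultimately show ?thesis using T by simp
qed

text \<open>From the integer below T up to T the integral grows by at most a multiple of
  (1+T)^(1/8), which is small compared with T.\<close>

lemma time_average_limit:
  assumes \<omega>: "\<omega> \<in> space M" and C: "holder_growth \<omega> C"
    and ref: "(\<lambda>m. ref_mean (Suc m) \<omega>) \<longlonglongrightarrow> stat_cov 0"
  shows "((\<lambda>T. integral {0..T} (\<lambda>t. (X t \<omega>)\<^sup>2) / T) \<longlongrightarrow> stat_cov 0) at_top"
proof -
  let ?g = "\<lambda>t. (X t \<omega>)\<^sup>2"
  define J where "J T = integral {0..T} ?g" for T
  have C0: "0 \<le> C" using C by (simp add: holder_growth_def)
  have cont: "continuous_on {0..} ?g" by (intro continuous_intros continuous_on_X \<omega>)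
  have int: "?g integrable_on {a..b}" if "0 \<le> a" for a b
    by (intro integrable_continuous_interval continuous_on_subset[OF cont]) (use that in auto)
  have Jm: "(\<lambda>m. J (real (Suc m)) / real (Suc m)) \<longlonglongrightarrow> stat_cov 0"
  proof -
    have "(\<lambda>m. ref_mean (Suc m) \<omega> - J (real (Suc m)) / real (Suc m)) \<longlonglongrightarrow> 0"
    proof (rule Lim_null_comparison)
      show "\<forall>\<^sub>F m in sequentially. norm (ref_mean (Suc m) \<omega> - J (real (Suc m)) / real (Suc m)) \<le> C * ((1 + real (Suc m)) powr (1 / 8) * (1 / real (Suc m)) powr (3 / 16))"
      proof (intro always_eventually allI)
        fix m
        have Nh: "real ((Suc m)\<^sup>2) * (1 / real (Suc m)) = real (Suc m)"
          unfolding of_nat_power by (simp add: power2_eq_square del: of_nat_Suc)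
        show "norm (ref_mean (Suc m) \<omega> - J (real (Suc m)) / real (Suc m)) \<le> C * ((1 + real (Suc m)) powr (1 / 8) * (1 / real (Suc m)) powr (3 / 16))"
          using holder_growth_riemann[OF \<omega> C, of "(Suc m)\<^sup>2" "\<lambda>_. 1 / real (Suc m)"]
          unfolding Nh by (simp add: ref_mean_def J_def mult.assoc)
      qed
      have "(\<lambda>m. (1 + real (Suc m)) powr (1 / 8) * (1 / real (Suc m)) powr (3 / 16)) \<longlonglongrightarrow> 0" by real_asymp
      then show "(\<lambda>m. C * ((1 + real (Suc m)) powr (1 / 8) * (1 / real (Suc m)) powr (3 / 16))) \<longlonglongrightarrow> 0"
        by (rule tendsto_mult_right_zero)
    qed
    from tendsto_diff[OF ref this] show ?thesis by simp
  qed
  \<comment> \<open>One is subtracted because the averages are indexed by \<open>Suc m\<close>: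
    \<open>Suc (fl T)\<close> is the floor of \<open>T\<close>.\<close>
  define fl where "fl T = nat \<lfloor>T\<rfloor> - 1" for T :: real
  have fl: "real (Suc (fl T)) \<le> T" "T \<le> real (Suc (fl T)) + 1" if "1 \<le> T" for T
  proof -
    have "1 \<le> \<lfloor>T\<rfloor>" using that by simp
    then have "Suc (fl T) = nat \<lfloor>T\<rfloor>" by (simp add: fl_def)
    then have "real (Suc (fl T)) = of_int \<lfloor>T\<rfloor>" using \<open>1 \<le> \<lfloor>T\<rfloor>\<close> by simp
    then show "real (Suc (fl T)) \<le> T" "T \<le> real (Suc (fl T)) + 1" by linarith+
  qed
  have "filterlim fl sequentially at_top" unfolding filterlim_at_top
  proof
    fix Z :: nat
    show "\<forall>\<^sub>F T in at_top. Z \<le> fl T"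
      using eventually_ge_at_top[of "real Z + 2"]
    proof eventually_elim
      case (elim T)
      then have "real (Suc Z) \<le> real (Suc (fl T))" using fl(2)[of T] by simp
      then show ?case by simp
    qed
  qed
  from filterlim_compose[OF Jm this]
  have Jfl: "((\<lambda>T. J (real (Suc (fl T))) / real (Suc (fl T))) \<longlongrightarrow> stat_cov 0) at_top" .
  have "((\<lambda>T. J T / T - stat_cov 0) \<longlongrightarrow> 0) at_top"
  proof (rule Lim_null_comparison)
    show "\<forall>\<^sub>F T in at_top. norm (J T / T - stat_cov 0) \<le> \<bar>J (real (Suc (fl T))) / real (Suc (fl T)) - stat_cov 0\<bar> + stat_cov 0 * (1 / T) + C * ((1 + T) powr (1 / 8) / T)"
      using eventually_ge_at_top[of 1]
    proof eventually_elim
      case (elim T)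
      define m where "m = real (Suc (fl T))"
      have m: "1 \<le> m" "m \<le> T" "T - m \<le> 1" using fl[OF elim] by (auto simp: m_def)
      have "J T = J m + integral {m..T} ?g" unfolding J_def
        using m by (intro Henstock_Kurzweil_Integration.integral_combine[symmetric] int) auto
      moreover have "\<bar>integral {m..T} ?g\<bar> \<le> C * (1 + T) powr (1 / 8)"
      proof -
        have "norm (integral {m..T} ?g) \<le> C * (1 + T) powr (1 / 8) * measure lborel (cbox m T)"
        proof (rule has_integral_bound)
          show "0 \<le> C * (1 + T) powr (1 / 8)" using C0 by simp
          show "(?g has_integral integral {m..T} ?g) (cbox m T)" using int[of m T] m by (auto intro: integrable_integral)
          fix x assume "x \<in> cbox m T"
          then show "norm (?g x) \<le> C * (1 + T) powr (1 / 8)" using C elim m by (auto simp: holder_growth_def)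
        qed
        also have "\<dots> \<le> C * (1 + T) powr (1 / 8) * 1" using m C0 by (intro mult_left_mono) auto
        finally show ?thesis by simp
      qed
      ultimately obtain i where i: "J T = J m + i" "\<bar>i\<bar> \<le> C * (1 + T) powr (1 / 8)" by blast
      have e: "J T / T - stat_cov 0 = (m / T) * (J m / m - stat_cov 0) - stat_cov 0 * ((T - m) / T) + i / T"
        using m i by (simp add: field_simps)
      have tri: "\<bar>a - b + c\<bar> \<le> a' + b' + c'" if "\<bar>a\<bar> \<le> a'" "\<bar>b\<bar> \<le> b'" "\<bar>c\<bar> \<le> c'" for a b c a' b' c' :: real
        using that by arith
      show ?case unfolding e m_def[symmetric] real_norm_def
      proof (rule tri)
        have "\<bar>(m / T) * (J m / m - stat_cov 0)\<bar> \<le> 1 * \<bar>J m / m - stat_cov 0\<bar>"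
          unfolding abs_mult using m by (intro mult_right_mono) auto
        then show "\<bar>(m / T) * (J m / m - stat_cov 0)\<bar> \<le> \<bar>J m / m - stat_cov 0\<bar>" by simp
        show "\<bar>stat_cov 0 * ((T - m) / T)\<bar> \<le> stat_cov 0 * (1 / T)"
          unfolding abs_mult using m stat_cov_nonneg[of 0] by (intro mult_mono) (auto intro: divide_right_mono)
        show "\<bar>i / T\<bar> \<le> C * ((1 + T) powr (1 / 8) / T)"
          using i(2) m by (simp add: divide_right_mono)
      qed
    qed
    have "((\<lambda>T. \<bar>J (real (Suc (fl T))) / real (Suc (fl T)) - stat_cov 0\<bar>) \<longlongrightarrow> 0) at_top"
      using tendsto_rabs[OF tendsto_diff[OF Jfl tendsto_const[of "stat_cov 0"]]] by simp
    moreover have "((\<lambda>T::real. 1 / T) \<longlongrightarrow> 0) at_top" by real_asymp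
    moreover have "((\<lambda>T::real. (1 + T) powr (1 / 8) / T) \<longlongrightarrow> 0) at_top" by real_asymp
    ultimately have "((\<lambda>T. \<bar>J (real (Suc (fl T))) / real (Suc (fl T)) - stat_cov 0\<bar> + stat_cov 0 * (1 / T) + C * ((1 + T) powr (1 / 8) / T)) \<longlongrightarrow> 0 + stat_cov 0 * 0 + C * 0) at_top"
      by (intro tendsto_intros)
    then show "((\<lambda>T. \<bar>J (real (Suc (fl T))) / real (Suc (fl T)) - stat_cov 0\<bar> + stat_cov 0 * (1 / T) + C * ((1 + T) powr (1 / 8) / T)) \<longlongrightarrow> 0) at_top"
      by simp
  qed
  from LIM_zero_cancel[OF this] show ?thesis by (simp add: J_def)
qed

lemma AE_mu2_hat:
  fixes \<Delta> :: "nat \<Rightarrow> real"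
  assumes pos: "\<And>N. N \<ge> 1 \<Longrightarrow> 0 < \<Delta> N" and \<Delta>0: "\<Delta> \<longlonglongrightarrow> 0"
    and T: "filterlim (\<lambda>N. real N * \<Delta> N) at_top sequentially"
    and N\<Delta>: "(\<lambda>N. real N * (\<Delta> N)\<^sup>2) \<longlonglongrightarrow> 0"
  shows "AE \<omega> in M. (\<lambda>N. mu2_hat X \<Delta> N \<omega>) \<longlonglongrightarrow> stat_cov 0"
  using AE_holder_growth AE_ref_mean AE_space
proof eventually_elim
  case (elim \<omega>)
  obtain C where C: "holder_growth \<omega> C" using elim(1) by blast
  have C0: "0 \<le> C" using C by (simp add: holder_growth_def)
  let ?A = "\<lambda>T. integral {0..T} (\<lambda>t. (X t \<omega>)\<^sup>2) / T"
  have A: "(\<lambda>N. ?A (real N * \<Delta> N)) \<longlonglongrightarrow> stat_cov 0"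
    by (rule filterlim_compose[OF time_average_limit[OF elim(3) C elim(2)] T])
  have "(\<lambda>N. mu2_hat X \<Delta> N \<omega> - ?A (real N * \<Delta> N)) \<longlonglongrightarrow> 0"
  proof (rule Lim_null_comparison)
    have ev: "\<forall>\<^sub>F N in sequentially. N \<ge> 1 \<and> \<Delta> N < 1 \<and> 1 \<le> real N * \<Delta> N \<and> real N * (\<Delta> N)\<^sup>2 < 1"
      using order_tendstoD(2)[OF \<Delta>0 zero_less_one] order_tendstoD(2)[OF N\<Delta> zero_less_one] eventually_ge_at_top[of 1]
        T[unfolded filterlim_at_top, rule_format, of 1] by eventually_elim auto
    show "\<forall>\<^sub>F N in sequentially. norm (mu2_hat X \<Delta> N \<omega> - ?A (real N * \<Delta> N)) \<le>
        C * ((1 + real N * \<Delta> N) powr (1 / 8) * (1 / (real N * \<Delta> N)) powr (3 / 16))"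
      using ev
    proof eventually_elim
      case N: (elim N)
      have d: "0 < \<Delta> N" using pos N by blast
      have "\<Delta> N * (real N * \<Delta> N) \<le> 1" using N by (simp add: power2_eq_square mult_ac)
      then have "\<Delta> N \<le> 1 / (real N * \<Delta> N)" using N by (simp add: le_divide_eq)
      then have p: "\<Delta> N powr (3 / 16) \<le> (1 / (real N * \<Delta> N)) powr (3 / 16)" using d by (intro powr_mono2) auto
      have "norm (mu2_hat X \<Delta> N \<omega> - ?A (real N * \<Delta> N)) \<le> C * (1 + real N * \<Delta> N) powr (1 / 8) * \<Delta> N powr (3 / 16)"
        using holder_growth_riemann[OF elim(3) C, of N \<Delta>] N d by simp
      also have "\<dots> \<le> C * (1 + real N * \<Delta> N) powr (1 / 8) * (1 / (real N * \<Delta> N)) powr (3 / 16)"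
        using p C0 by (intro mult_left_mono) auto
      finally show ?case by (simp only: mult.assoc)
    qed
    \<comment> \<open>The total exponent is 1/8 - 3/16 = -1/16.\<close>
    have "((\<lambda>T::real. (1 + T) powr (1 / 8) * (1 / T) powr (3 / 16)) \<longlongrightarrow> 0) at_top" by real_asymp
    from filterlim_compose[OF this T]
    show "(\<lambda>N. C * ((1 + real N * \<Delta> N) powr (1 / 8) * (1 / (real N * \<Delta> N)) powr (3 / 16))) \<longlonglongrightarrow> 0"
      by (rule tendsto_mult_right_zero)
  qed
  from tendsto_add[OF this A] show ?case by simp
qed

end

section \<open>Inverting the moment map\<close>

lemma isCont_cdf_normal:
  assumes "0 < v"
  shows "isCont (cdf (density lborel (normal_density 0 (sqrt v)))) x"
proof -
  interpret D: real_distribution "density lborel (\<lambda>x. ennreal (normal_density 0 (sqrt v) x))"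
    using real_distribution_normal[OF assms] .
  have "emeasure (density lborel (\<lambda>x. ennreal (normal_density 0 (sqrt v) x))) {x} =
     (\<integral>\<^sup>+y. ennreal (normal_density 0 (sqrt v) y) * indicator {x} y \<partial>lborel)"
    by (rule emeasure_density) auto
  also have "\<dots> = 0"
    by (rule nn_integral_null_set) (simp add: null_sets_def)
  finally show ?thesis by (simp add: D.isCont_cdf measure_def)
qed

text \<open>Distribution functions are monotone, so the value at the moving point is squeezed
  between the values at two fixed points near \<open>x\<close>, where convergence is known.\<close>

lemma weak_conv_m_cdf_moving:
  fixes D :: "nat \<Rightarrow> real measure"
  assumes D: "\<And>n. real_distribution (D n)" and wc: "weak_conv_m D L"
    and cont: "\<And>x. isCont (cdf L) x" and y: "y \<longlonglongrightarrow> x"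
  shows "(\<lambda>n. cdf (D n) (y n)) \<longlonglongrightarrow> cdf L x"
proof (rule metric_LIMSEQ_I)
  fix e :: real assume e: "0 < e"
  have mono: "cdf (D n) a \<le> cdf (D n) b" if "a \<le> b" for n a b
  proof -
    interpret real_distribution "D n" by (rule D)
    show ?thesis by (rule cdf_nondecreasing[OF that])
  qed
  have lim: "(\<lambda>n. cdf (D n) a) \<longlonglongrightarrow> cdf L a" for a
    using wc cont by (auto simp: weak_conv_m_def weak_conv_def)
  from cont[of x] e obtain d where d: "0 < d" "\<And>a. dist a x < d \<Longrightarrow> dist (cdf L a) (cdf L x) < e / 2"
    unfolding continuous_at_eps_delta by (metis half_gt_zero dist_real_def real_norm_def)
  have d2: "dist (cdf L (x - d / 2)) (cdf L x) < e / 2" "dist (cdf L (x + d / 2)) (cdf L x) < e / 2"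
    using d by (auto simp: dist_real_def)
  have "\<forall>\<^sub>F n in sequentially. dist (cdf (D n) (y n)) (cdf L x) < e"
  proof -
    have "\<forall>\<^sub>F n in sequentially. dist (cdf (D n) (x - d / 2)) (cdf L (x - d / 2)) < e / 2"
      using e by (intro tendstoD lim) simp
    moreover have "\<forall>\<^sub>F n in sequentially. dist (cdf (D n) (x + d / 2)) (cdf L (x + d / 2)) < e / 2"
      using e by (intro tendstoD lim) simp
    moreover have "\<forall>\<^sub>F n in sequentially. dist (y n) x < d / 2"
      using d by (intro tendstoD y) simp
    ultimately show ?thesis
    proof eventually_elim
    case (elim n)
    have "x - d / 2 \<le> y n" "y n \<le> x + d / 2" using elim(3) unfolding dist_real_def by arith+
    then have "cdf (D n) (x - d / 2) \<le> cdf (D n) (y n)" "cdf (D n) (y n) \<le> cdf (D n) (x + d / 2)"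
      by (auto intro: mono)
    then show ?case using elim(1,2) d2 unfolding dist_real_def by arith
    qed
  qed
  then show "\<exists>no. \<forall>n\<ge>no. dist (cdf (D n) (y n)) (cdf L x) < e" by (simp add: eventually_sequentially)
qed

context hurst
begin

definition Psi' :: "real \<Rightarrow> real" where
  "Psi' t = Psi H t * (H * (Digamma ((t - 1) * H + 1) - Digamma ((t - 1) * H + 1 + (2 * H - 1))) - 1 / t)"

lemma Beta_arg_pos: "0 < t \<Longrightarrow> 0 < (t - 1) * H + 1"
  using H_pos H_1 mult_pos_pos[of t H] unfolding left_diff_distrib mult_1 by linarith

lemma Psi_pos: "0 < t \<Longrightarrow> 0 < Psi H t"
  unfolding Psi_def using Beta_arg_pos[of t] H_half H_pos
  by (intro mult_pos_pos divide_pos_pos Beta_pos_real) auto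

lemma DERIV_Psi:
  assumes t: "0 < t"
  shows "(Psi H has_real_derivative Psi' t) (at t)"
proof -
  let ?a = "(t - 1) * H + 1" and ?b = "2 * H - 1"
  note a = Beta_arg_pos[OF t]
  have b: "0 < ?b" using H_half by simp
  have "((\<lambda>x. Beta x ?b) has_real_derivative Beta ?a ?b * (Digamma ?a - Digamma (?a + ?b))) (at ?a)"
    using a b by (intro has_field_derivative_Beta1) (auto elim!: nonpos_Ints_cases)
  moreover have "((\<lambda>t. (t - 1) * H + 1) has_real_derivative H) (at t)"
    by (auto intro!: derivative_eq_intros)
  ultimately have B: "((\<lambda>t. Beta ((t - 1) * H + 1) ?b) has_real_derivative Beta ?a ?b * (Digamma ?a - Digamma (?a + ?b)) * H) (at t)"
    by (rule DERIV_chain2)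
  have "((\<lambda>t. (2 * H - 1) * H powr (2 * H) / t) has_real_derivative - ((2 * H - 1) * H powr (2 * H)) / t\<^sup>2) (at t)"
    using t by (auto intro!: derivative_eq_intros simp: power2_eq_square)
  from DERIV_mult[OF this B] show ?thesis
    unfolding Psi_def[abs_def]
    by (rule DERIV_cong) (use t in \<open>simp add: Psi'_def Psi_def power2_eq_square field_simps\<close>)
qed

lemma Psi'_neg:
  assumes t: "0 < t"
  shows "Psi' t < 0"
proof -
  have "Digamma ((t - 1) * H + 1) < Digamma ((t - 1) * H + 1 + (2 * H - 1))"
    using Beta_arg_pos[OF t] H_half by (intro Digamma_real_strict_mono) auto
  then have "H * (Digamma ((t - 1) * H + 1) - Digamma ((t - 1) * H + 1 + (2 * H - 1))) < 0"
    using H_pos by (intro mult_pos_neg) auto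
  moreover have "0 < 1 / t" using t by simp
  ultimately have "H * (Digamma ((t - 1) * H + 1) - Digamma ((t - 1) * H + 1 + (2 * H - 1))) - 1 / t < 0" by linarith
  then show ?thesis unfolding Psi'_def using Psi_pos[OF t] by (intro mult_pos_neg)
qed

lemma Psi_strict_decreasing:
  assumes "0 < s" "s < t"
  shows "Psi H t < Psi H s"
proof (rule DERIV_neg_imp_decreasing[OF assms(2)])
  fix x assume "s \<le> x" "x \<le> t"
  then have "0 < x" using assms by simp
  then show "\<exists>y. (Psi H has_real_derivative y) (at x) \<and> y < 0" using DERIV_Psi Psi'_neg by blast
qed

lemma Psi_le_iff: "0 < s \<Longrightarrow> 0 < t \<Longrightarrow> Psi H s \<le> Psi H t \<longleftrightarrow> t \<le> s"
  using Psi_strict_decreasing[of s t] Psi_strict_decreasing[of t s] by (cases s t rule: linorder_cases) auto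

lemma inj_on_Psi: "inj_on (Psi H) {0<..}"
proof (rule inj_onI)
  fix s t assume "s \<in> {0<..}" "t \<in> {0<..}" "Psi H s = Psi H t"
  then show "s = t" using Psi_strict_decreasing[of s t] Psi_strict_decreasing[of t s]
    by (cases s t rule: linorder_cases) auto
qed

lemma continuous_on_Psi: "S \<subseteq> {0<..} \<Longrightarrow> continuous_on S (Psi H)"
  using DERIV_Psi DERIV_isCont by (intro continuous_at_imp_continuous_on) blast

definition Psi_inv :: "real \<Rightarrow> real" where "Psi_inv = inv_into {0<..} (Psi H)"

lemma Psi_inv_Psi: "0 < t \<Longrightarrow> Psi_inv (Psi H t) = t"
  unfolding Psi_inv_def using inj_on_Psi by (simp add: inv_into_f_f)

lemma Psi_inv_le_iff:
  assumes "y \<in> Psi H ` {0<..}" "0 < x"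
  shows "Psi_inv y \<le> x \<longleftrightarrow> Psi H x \<le> y"
  using assms Psi_inv_Psi Psi_le_iff by auto

text \<open>The half-line is a countable union of compact intervals, and so is its continuous image
  a countable union of compact sets. This yields measurability without identifying the
  range.\<close>

lemma Psi_range_sets: "Psi H ` {0<..} \<in> sets borel"
proof -
  have "{0<..} = (\<Union>n::nat. {1 / real (Suc n) .. real (Suc n)})"
  proof (intro equalityI subsetI)
    fix x :: real assume "x \<in> {0<..}"
    then have x: "0 < x" by simp
    obtain n :: nat where n: "max x (1 / x) < real n" using reals_Archimedean2 by blast
    then have "x \<le> real (Suc n)" "1 / x \<le> real (Suc n)" by auto
    then have "1 / real (Suc n) \<le> x" using x by (simp add: field_simps)
    then show "x \<in> (\<Union>n::nat. {1 / real (Suc n) .. real (Suc n)})" using \<open>x \<le> real (Suc n)\<close> by auto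
  next
    fix x :: real assume "x \<in> (\<Union>n::nat. {1 / real (Suc n) .. real (Suc n)})"
    then obtain n :: nat where "1 / real (Suc n) \<le> x" by auto
    moreover have "0 < 1 / real (Suc n)" by simp
    ultimately show "x \<in> {0<..}" by (simp only: greaterThan_iff)
  qed
  then have "Psi H ` {0<..} = (\<Union>n::nat. Psi H ` {1 / real (Suc n) .. real (Suc n)})" by (simp only: image_UN)
  also have "\<dots> \<in> sets borel"
  proof (rule sets.countable_UN)
    show "range (\<lambda>n. Psi H ` {1 / real (Suc n) .. real (Suc n)}) \<subseteq> sets borel"
    proof safe
      fix n :: nat
      have "{1 / real (Suc n) .. real (Suc n)} \<subseteq> {0<..}"
        by (auto intro: less_le_trans[of 0 "1 / real (Suc n)"])
      then have "compact (Psi H ` {1 / real (Suc n) .. real (Suc n)})"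
        by (intro compact_continuous_image continuous_on_Psi) auto
      then show "Psi H ` {1 / real (Suc n) .. real (Suc n)} \<in> sets borel" by (intro borel_compact)
    qed
  qed
  finally show ?thesis .
qed

text \<open>Outside the range of \<^term>\<open>Psi H\<close>, \<^const>\<open>inv_into\<close> is the choice from an empty predicate,
  hence constant.\<close>

lemma Psi_inv_measurable: "Psi_inv \<in> borel_measurable borel"
proof (subst borel_measurable_iff_le, intro allI)
  fix x :: real
  let ?P = "Psi H ` {0<..}"
  define c where "c = (SOME y::real. False)"
  have out: "Psi_inv y = c" if "y \<notin> ?P" for y
    using that unfolding Psi_inv_def inv_into_def c_def by (intro arg_cong[where f=Eps]) auto
  have pos: "0 < Psi_inv y" if "y \<in> ?P" for y using that Psi_inv_Psi by auto
  have "{y \<in> space borel. Psi_inv y \<le> x} = (if 0 < x then ?P \<inter> {Psi H x..} else {}) \<union> (if c \<le> x then - ?P else {})"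
  proof (intro set_eqI)
    fix y
    show "y \<in> {y \<in> space borel. Psi_inv y \<le> x} \<longleftrightarrow> y \<in> (if 0 < x then ?P \<inter> {Psi H x..} else {}) \<union> (if c \<le> x then - ?P else {})"
    proof (cases "y \<in> ?P")
      case True
      then show ?thesis using pos[OF True] Psi_inv_le_iff[OF True, of x] by auto
    next
      case False
      then show ?thesis using out[OF False] by auto
    qed
  qed
  also have "\<dots> \<in> sets borel" using Psi_range_sets by auto
  finally show "{y \<in> space borel. Psi_inv y \<le> x} \<in> sets borel" .
qed

lemma Psi_interval_subset:
  assumes "0 < s" "s \<le> t" "Psi H t \<le> y" "y \<le> Psi H s"
  shows "\<exists>u. s \<le> u \<and> u \<le> t \<and> Psi H u = y"
  using assms by (intro IVT2') (auto intro: continuous_on_Psi)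

text \<open>Eventually \<open>y n\<close> lies strictly between the values at \<open>t + d\<close>
  and \<open>t - d\<close>. The intermediate value theorem then gives a preimage within
  \<open>d\<close> of \<open>t\<close>, which settles both claims.\<close>

lemma Psi_inv_tendsto:
  assumes t: "0 < t" and y: "y \<longlonglongrightarrow> Psi H t"
  shows "(\<lambda>n. Psi_inv (y n)) \<longlonglongrightarrow> t" and "\<forall>\<^sub>F n in sequentially. y n \<in> Psi H ` {0<..}"
proof -
  have ev: "\<forall>\<^sub>F n in sequentially. \<exists>u>0. \<bar>u - t\<bar> \<le> d \<and> Psi H u = y n" if d: "0 < d" "d < t" for d
  proof -
    have "\<forall>\<^sub>F n in sequentially. Psi H (t + d) < y n"
      by (rule order_tendstoD(1)[OF y]) (use d t in \<open>auto intro: Psi_strict_decreasing\<close>)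
    moreover have "\<forall>\<^sub>F n in sequentially. y n < Psi H (t - d)"
      by (rule order_tendstoD(2)[OF y]) (use d t in \<open>auto intro: Psi_strict_decreasing\<close>)
    ultimately show ?thesis
    proof eventually_elim
      case (elim n)
      then obtain u where "t - d \<le> u" "u \<le> t + d" "Psi H u = y n"
        using Psi_interval_subset[of "t - d" "t + d" "y n"] d by auto
      then show ?case using d by (intro exI[of _ u]) auto
    qed
  qed
  show "\<forall>\<^sub>F n in sequentially. y n \<in> Psi H ` {0<..}"
    using ev[of "t / 2"] t by (auto elim!: eventually_mono) (metis greaterThan_iff imageI)
  show "(\<lambda>n. Psi_inv (y n)) \<longlonglongrightarrow> t"
  proof (rule metric_LIMSEQ_I)
    fix e :: real assume "0 < e"
    then have "\<forall>\<^sub>F n in sequentially. \<exists>u>0. \<bar>u - t\<bar> \<le> min e t / 2 \<and> Psi H u = y n"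
      using t by (intro ev) auto
    then have "\<forall>\<^sub>F n in sequentially. dist (Psi_inv (y n)) t < e"
    proof eventually_elim
      case (elim n)
      then obtain u where u: "0 < u" "\<bar>u - t\<bar> \<le> min e t / 2" "Psi H u = y n" by blast
      then have "Psi_inv (y n) = u" using Psi_inv_Psi by metis
      then show ?case using u \<open>0 < e\<close> by (auto simp: dist_real_def min_def split: if_splits)
    qed
    then show "\<exists>no. \<forall>n\<ge>no. dist (Psi_inv (y n)) t < e" by (simp add: eventually_sequentially)
  qed
qed

end

section \<open>Consistency and the delta method\<close>

context fou
begin

lemma theta_hat_eq: "theta_hat H X \<Delta> N \<omega> = Psi_inv (mu2_hat X \<Delta> N \<omega>)"
  by (simp add: theta_hat_def Psi_inv_def)

lemma estimator_limits:
  fixes \<Delta> :: "nat \<Rightarrow> real"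
  assumes pos: "\<And>N. N \<ge> 1 \<Longrightarrow> 0 < \<Delta> N" and \<Delta>0: "\<Delta> \<longlonglongrightarrow> 0"
    and T: "filterlim (\<lambda>N. real N * \<Delta> N) at_top sequentially"
    and N\<Delta>: "(\<lambda>N. real N * (\<Delta> N)\<^sup>2) \<longlonglongrightarrow> 0"
  shows "AE \<omega> in M. (\<lambda>N. theta_hat H X \<Delta> N \<omega>) \<longlonglongrightarrow> \<theta>"
    and "weak_conv_m (\<lambda>N. distr M borel (\<lambda>\<omega>. sqrt (real N * \<Delta> N) * (theta_hat H X \<Delta> N \<omega> - \<theta>)))
      (density lborel (normal_density 0 (sqrt (sigma_theta_sq H \<theta>))))"
proof -
  have AEmu: "AE \<omega> in M. (\<lambda>N. mu2_hat X \<Delta> N \<omega>) \<longlonglongrightarrow> Psi H \<theta>"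
    using AE_mu2_hat[OF assms] unfolding stat_cov_0 .
  show "AE \<omega> in M. (\<lambda>N. theta_hat H X \<Delta> N \<omega>) \<longlonglongrightarrow> \<theta>"
    using AEmu by eventually_elim (unfold theta_hat_eq, rule Psi_inv_tendsto(1)[OF \<theta>_pos])
  define D where "D = Psi' \<theta>"
  have D: "D < 0" unfolding D_def by (rule Psi'_neg[OF \<theta>_pos])
  have derivPsi: "deriv (Psi H) \<theta> = D" unfolding D_def by (rule DERIV_imp_deriv[OF DERIV_Psi[OF \<theta>_pos]])
  define v where "v = sigma_theta_sq H \<theta>"
  have v_eq: "v = asym_var / D\<^sup>2" by (simp add: v_def sigma_theta_sq_def sigma_sq_eq_asym_var derivPsi)
  have v: "0 < v" using asym_var_pos D by (simp add: v_eq)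
  let ?L = "density lborel (normal_density 0 (sqrt v))"
  \<comment> \<open>Dividing by the negative \<open>D\<close> undoes the reversal of inequalities by
    the decreasing \<open>Psi H\<close>, so that lower events correspond to lower events. Odd normal
    moments vanish, so the sign of \<open>D\<close> does not affect the limit.\<close>
  define W where "W N \<omega> = 1 / D * fluct (\<Delta> N) N \<omega>" for N \<omega>
  have \<Delta>nn: "all_moments (fluct (\<Delta> N) N)" for N
  proof (cases "N \<ge> 1")
    case True
    then show ?thesis using pos[OF True] by (intro all_moments_fluct) auto
  next
    \<comment> \<open>Only \<open>N = 0\<close> is left. The sign of \<open>\<Delta> 0\<close> is
      unknown, but the index set is empty and the fluctuation is constant.\<close>
    case False
    then show ?thesis by (simp add: fluct_def quad_def)
  qed
  have W_mom: "all_moments (W N)" for N unfolding W_def[abs_def] by (intro all_moments_cmult \<Delta>nn)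
  have W_meas [measurable]: "W N \<in> borel_measurable M" for N using W_mom by (rule all_moments_measurable)
  have W_lim: "(\<lambda>N. expectation (\<lambda>\<omega>. W N \<omega> ^ n)) \<longlonglongrightarrow> normal_moment n * v ^ (n div 2)" for n
  proof -
    have "(\<lambda>N. (1 / D) ^ n * expectation (\<lambda>\<omega>. fluct (\<Delta> N) N \<omega> ^ n)) \<longlonglongrightarrow> (1 / D) ^ n * (normal_moment n * asym_var ^ (n div 2))"
      by (intro tendsto_intros fluct_moments pos \<Delta>0 T)
    also have "(1 / D) ^ n * (normal_moment n * asym_var ^ (n div 2)) = normal_moment n * v ^ (n div 2)"
    proof (cases "even n")
      case True
      then obtain k where "n = 2 * k" by (auto elim: evenE)
      then show ?thesis by (simp add: v_eq power_divide power_mult[symmetric])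
    qed (simp add: normal_moment_def)
    finally show ?thesis by (simp add: W_def power_mult_distrib power_divide)
  qed
  have wcW: "weak_conv_m (\<lambda>N. distr M borel (W N)) ?L"
    by (rule weak_conv_normal_of_moments[OF W_mom v W_lim])
  have X_meas [measurable]: "X (real k * \<Delta> N) \<in> borel_measurable M" if "k \<in> {1..N}" for k N
    using pos[of N] that by (intro X_measurable) auto
  have mu_meas [measurable]: "mu2_hat X \<Delta> N \<in> borel_measurable M" for N
    unfolding mu2_hat_def[abs_def] by measurable
  define E where "E N \<omega> = sqrt (real N * \<Delta> N) * (theta_hat H X \<Delta> N \<omega> - \<theta>)" for N \<omega>
  have E_meas [measurable]: "E N \<in> borel_measurable M" for N
    unfolding E_def[abs_def] theta_hat_eq using Psi_inv_measurable[measurable] by measurable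
  have cdf_distr: "cdf (distr M borel Y) x = expectation (indicator {\<omega>. Y \<omega> \<le> x})" if [measurable]: "Y \<in> borel_measurable M" for Y x
  proof -
    have "cdf (distr M borel Y) x = measure M (Y -` {..x} \<inter> space M)" unfolding cdf_def by (rule measure_distr) auto
    also have "Y -` {..x} \<inter> space M = {\<omega>. Y \<omega> \<le> x} \<inter> space M" by auto
    finally show ?thesis by simp
  qed
  define u where "u N = 1 / sqrt (real N * \<Delta> N)" for N
  have u0: "u \<longlonglongrightarrow> 0"
  proof -
    have "filterlim (\<lambda>N. sqrt (real N * \<Delta> N)) at_top sequentially" by (rule filterlim_compose[OF sqrt_at_top T])
    then show ?thesis unfolding u_def by (intro tendsto_divide_0[OF tendsto_const] filterlim_at_top_imp_at_infinity)
  qed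
  define b where "b N \<omega> = sqrt (real N * \<Delta> N) * (mu2_hat X \<Delta> N \<omega> - Psi H \<theta>) - fluct (\<Delta> N) N \<omega>" for N \<omega>
  \<comment> \<open>The bias does not depend on the path, so it can be moved into the threshold
    \<open>z N\<close> below.\<close>
  define \<beta> where "\<beta> N = \<Delta> N / sqrt (real N * \<Delta> N) * ((\<Sum>k=1..N. R (real k * \<Delta> N) (real k * \<Delta> N)) - real N * stat_cov 0)" for N
  have b\<beta>: "b N \<omega> = \<beta> N" if "N \<ge> 1" for N \<omega>
    using mu2_hat_decomp[OF that, of \<Delta>, OF pos[OF that]] by (simp add: b_def \<beta>_def stat_cov_0)
  have \<beta>0: "\<beta> \<longlonglongrightarrow> 0"
  proof (rule Lim_null_comparison)
    show "\<forall>\<^sub>F N in sequentially. norm (\<beta> N) \<le> 2 * kc * kernel_norm / \<theta>\<^sup>2 * u N"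
      using eventually_ge_at_top[of 1]
    proof eventually_elim
      case (elim N)
      \<comment> \<open>Since \<open>b N\<close> is the same for every path, any argument
        serves.\<close>
      have "norm (\<beta> N) = \<bar>b N undefined\<bar>" using b\<beta>[OF elim] by simp
      also have "\<dots> \<le> 2 * kc * kernel_norm / \<theta>\<^sup>2 / sqrt (real N * \<Delta> N)"
        unfolding b_def stat_cov_0[symmetric] by (rule mu2_hat_fluct[of N \<Delta>, OF elim pos[OF elim]])
      finally show ?case by (simp add: u_def)
    qed
    show "(\<lambda>N. 2 * kc * kernel_norm / \<theta>\<^sup>2 * u N) \<longlonglongrightarrow> 0" by (rule tendsto_mult_right_zero[OF u0])
  qed
  show "weak_conv_m (\<lambda>N. distr M borel (\<lambda>\<omega>. sqrt (real N * \<Delta> N) * (theta_hat H X \<Delta> N \<omega> - \<theta>)))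
      (density lborel (normal_density 0 (sqrt (sigma_theta_sq H \<theta>))))"
    unfolding v_def[symmetric] E_def[symmetric] weak_conv_m_def weak_conv_def
  proof (intro allI impI)
    fix x :: real
    \<comment> \<open>The threshold for \<open>W N\<close> that is equivalent to \<open>E N\<close>
      being at most \<open>x\<close>. It tends to \<open>x\<close> by differentiability of
      \<open>Psi H\<close> at \<open>\<theta>\<close>, the only place where the derivative enters
      the delta method.\<close>
    define z where "z N = (sqrt (real N * \<Delta> N) * (Psi H (\<theta> + x * u N) - Psi H \<theta>) - \<beta> N) / D" for N
    have evpos: "\<forall>\<^sub>F N in sequentially. N \<ge> 1 \<and> 0 < sqrt (real N * \<Delta> N) \<and> 0 < \<theta> + x * u N"
    proof -
      have "(\<lambda>N. \<theta> + x * u N) \<longlonglongrightarrow> \<theta> + x * 0" by (intro tendsto_intros u0)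
      then have "\<forall>\<^sub>F N in sequentially. 0 < \<theta> + x * u N" using \<theta>_pos by (intro order_tendstoD(1)) auto
      then show ?thesis using eventually_ge_at_top[of 1] by eventually_elim (use pos in auto)
    qed
    have z: "z \<longlonglongrightarrow> x"
    proof -
      have "((\<lambda>w. Psi H (\<theta> + x * w)) has_real_derivative D * x) (at 0)"
      proof (rule DERIV_chain2[where f="Psi H" and g="\<lambda>w. \<theta> + x * w"])
        show "(Psi H has_real_derivative D) (at (\<theta> + x * 0))" unfolding D_def using DERIV_Psi[OF \<theta>_pos] by simp
        show "((\<lambda>w. \<theta> + x * w) has_real_derivative x) (at 0)" by (auto intro!: derivative_eq_intros)
      qed
      then have d: "((\<lambda>w. (Psi H (\<theta> + x * w) - Psi H \<theta>) / w) \<longlongrightarrow> D * x) (at 0)"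
        by (simp add: has_field_derivative_iff)
      have "\<forall>\<^sub>F N in sequentially. u N \<noteq> 0" using evpos by eventually_elim (auto simp: u_def)
      then have "filterlim u (at 0) sequentially" using u0 by (simp add: filterlim_at)
      from filterlim_compose[OF d this]
      have "(\<lambda>N. ((Psi H (\<theta> + x * u N) - Psi H \<theta>) / u N - \<beta> N) / D) \<longlonglongrightarrow> (D * x - 0) / D"
        using D by (intro tendsto_intros \<beta>0) auto
      then show ?thesis using D by (simp add: z_def[abs_def] u_def mult.commute)
    qed
    have iff: "E N \<omega> \<le> x \<longleftrightarrow> W N \<omega> \<le> z N"
      if N: "N \<ge> 1 \<and> 0 < sqrt (real N * \<Delta> N) \<and> 0 < \<theta> + x * u N" and mu: "mu2_hat X \<Delta> N \<omega> \<in> Psi H ` {0<..}" for N \<omega>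
    proof -
      let ?s = "sqrt (real N * \<Delta> N)"
      have "E N \<omega> \<le> x \<longleftrightarrow> Psi_inv (mu2_hat X \<Delta> N \<omega>) \<le> \<theta> + x * u N"
      proof -
        have "E N \<omega> \<le> x \<longleftrightarrow> Psi_inv (mu2_hat X \<Delta> N \<omega>) - \<theta> \<le> x / ?s"
          unfolding E_def theta_hat_eq using N by (simp only: pos_le_divide_eq mult.commute)
        then show ?thesis by (auto simp: u_def)
      qed
      also have "\<dots> \<longleftrightarrow> Psi H (\<theta> + x * u N) \<le> mu2_hat X \<Delta> N \<omega>" using mu N by (intro Psi_inv_le_iff) auto
      also have "\<dots> \<longleftrightarrow> ?s * (Psi H (\<theta> + x * u N) - Psi H \<theta>) \<le> ?s * (mu2_hat X \<Delta> N \<omega> - Psi H \<theta>)"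
        using N by (simp only: mult_le_cancel_left_pos diff_le_mono) simp
      also have "?s * (mu2_hat X \<Delta> N \<omega> - Psi H \<theta>) = fluct (\<Delta> N) N \<omega> + \<beta> N" using b\<beta>[of N \<omega>] N by (simp add: b_def)
      also have "?s * (Psi H (\<theta> + x * u N) - Psi H \<theta>) \<le> fluct (\<Delta> N) N \<omega> + \<beta> N \<longleftrightarrow> W N \<omega> \<le> z N"
        unfolding W_def z_def using D by (auto simp: field_simps)
      finally show ?thesis .
    qed
    \<comment> \<open>The equivalence \<open>iff\<close> holds only where the empirical moment lies
      in the range of \<open>Psi H\<close>. Almost surely this is eventually the case, so the two
      events differ by a probability that tends to 0.\<close>
    have "(\<lambda>N. expectation (\<lambda>\<omega>. indicator {\<omega>. E N \<omega> \<le> x} \<omega> - indicator {\<omega>. W N \<omega> \<le> z N} \<omega> :: real)) \<longlonglongrightarrow> expectation (\<lambda>\<omega>. 0)"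
    proof (rule integral_dominated_convergence[where w="\<lambda>_. 1"])
      show "AE \<omega> in M. (\<lambda>N. indicator {\<omega>. E N \<omega> \<le> x} \<omega> - indicator {\<omega>. W N \<omega> \<le> z N} \<omega> :: real) \<longlonglongrightarrow> 0"
        using AEmu
      proof eventually_elim
        case (elim \<omega>)
        have "\<forall>\<^sub>F N in sequentially. (indicator {\<omega>. E N \<omega> \<le> x} \<omega> - indicator {\<omega>. W N \<omega> \<le> z N} \<omega> :: real) = 0"
          using Psi_inv_tendsto(2)[OF \<theta>_pos elim] evpos
          by eventually_elim (use iff in \<open>auto simp: indicator_def\<close>)
        then show ?case by (rule tendsto_eventually)
      qed
      show "AE \<omega> in M. norm (indicator {\<omega>. E N \<omega> \<le> x} \<omega> - indicator {\<omega>. W N \<omega> \<le> z N} \<omega> :: real) \<le> 1" for N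
        by (intro AE_I2) (auto simp: indicator_def)
    qed (auto simp: indicator_def)
    moreover have "expectation (\<lambda>\<omega>. indicator {\<omega>. E N \<omega> \<le> x} \<omega> - indicator {\<omega>. W N \<omega> \<le> z N} \<omega> :: real) =
       cdf (distr M borel (E N)) x - cdf (distr M borel (W N)) (z N)" for N
    proof -
      have i: "integrable M (indicator {\<omega>. Y \<omega> \<le> y} :: 'a \<Rightarrow> real)" if [measurable]: "Y \<in> borel_measurable M" for Y :: "'a \<Rightarrow> real" and y
      proof -
        have "(indicator {\<omega>. Y \<omega> \<le> y} :: 'a \<Rightarrow> real) = (\<lambda>\<omega>. indicator {..y} (Y \<omega>))"
          by (auto simp: indicator_def fun_eq_iff)
        moreover have "integrable M (\<lambda>\<omega>. indicator {..y} (Y \<omega>) :: real)"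
        proof (rule integrable_const_bound[where B=1])
          show "(\<lambda>\<omega>. indicator {..y} (Y \<omega>) :: real) \<in> borel_measurable M"
            by (rule measurable_compose[OF that]) simp
        qed (auto simp: indicator_def)
        ultimately show ?thesis by simp
      qed
      show ?thesis unfolding cdf_distr[OF E_meas] cdf_distr[OF W_meas]
        by (rule Bochner_Integration.integral_diff) (intro i E_meas W_meas)+
    qed
    ultimately have "(\<lambda>N. cdf (distr M borel (E N)) x - cdf (distr M borel (W N)) (z N)) \<longlonglongrightarrow> 0" by simp
    moreover have "(\<lambda>N. cdf (distr M borel (W N)) (z N)) \<longlonglongrightarrow> cdf ?L x"
      by (rule weak_conv_m_cdf_moving[OF _ wcW isCont_cdf_normal[OF v] z]) (rule real_distribution_distr, simp)
    ultimately show "(\<lambda>N. cdf (distr M borel (E N)) x) \<longlonglongrightarrow> cdf ?L x"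
      using tendsto_add[of "\<lambda>N. cdf (distr M borel (E N)) x - cdf (distr M borel (W N)) (z N)" 0 sequentially "\<lambda>N. cdf (distr M borel (W N)) (z N)"]
      by simp
  qed
qed

end

theorem theorem3p2:
  fixes M :: "'a measure" and B :: "real \<Rightarrow> 'a \<Rightarrow> real"
    and H \<theta> :: real and \<Delta> :: "nat \<Rightarrow> real"
  assumes "1 / 2 < H" and "H < 1" and "0 < \<theta>"
    and "fractional_brownian_motion M H B"
    and "\<And>N. N \<ge> 1 \<Longrightarrow> 0 < \<Delta> N"
    and "\<Delta> \<longlonglongrightarrow> 0"
    and "filterlim (\<lambda>N. real N * \<Delta> N) at_top sequentially"
    and "(\<lambda>N. real N * (\<Delta> N)\<^sup>2) \<longlonglongrightarrow> 0"
  shows "(AE \<omega> in M. (\<lambda>N. theta_hat H (fou2 H \<theta> B) \<Delta> N \<omega>) \<longlonglongrightarrow> \<theta>) \<and>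
    weak_conv_m
      (\<lambda>N. distr M borel
        (\<lambda>\<omega>. sqrt (real N * \<Delta> N) * (theta_hat H (fou2 H \<theta> B) \<Delta> N \<omega> - \<theta>)))
      (density lborel (normal_density 0 (sqrt (sigma_theta_sq H \<theta>))))"
proof -
  have "prob_space M" using assms(4) by (simp add: fractional_brownian_motion_def)
  then have "fou H \<theta> M B"
    using assms(1-4) by (simp add: fou_def fou_axioms_def fou_param_def fou_param_axioms_def hurst_def)
  then interpret fou H \<theta> M B .
  show ?thesis using estimator_limits[OF assms(5-8)] unfolding X_def by blast
qed

end
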